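(* Let $\varepsilon$ be sufficiently small, let $(v,c)$ be the two-rarefaction-wave solution on $[0,t^*]\times\mathbb R\times\mathbb R/2\pi\mathbb Z$ constructed from given $\varepsilon$-perturbed Riemann data as described in the context, and let $(v',c')$ be an entropy solution to the Euler equations on $[0,t^*]\times\mathbb R\times\mathbb R/2\pi\mathbb Z$ with the same initial data. Then $(v',c')\equiv(v,c)$.
   Context: **Euler system.** Fix $\gamma\in(1,3)$, $k_0>0$, $p(\rho)=k_0\rho^\gamma$, $c=\sqrt{p'(\rho)}$, $h=\frac{c^2}{\gamma-1}$, $e=\int\frac{p(\rho)}{\rho^2}d\rho=\frac{p(\rho)}{(\gamma-1)\rho}$. Space is $\mathbb{R}\times\mathbb{R}/2\pi\mathbb{Z}\ni(x_1,x_2)$, $\Sigma_t$ the time-$t$ slice, $t^*=1$. The isentropic Euler equations are $(\partial_t+v\cdot\nabla)\rho=-\rho\nabla\cdot v$, $(\partial_t+v\cdot\nabla)v=-\rho^{-1}\nabla p$, conservative form $\partial_t\rho+\nabla\cdot(\rho v)=0$, $\partial_t(\rho v)+\nabla\cdot(\rho v\otimes v)+\nabla p=0$. Put $\psi_2=-v^2$, $\underline{w}=\frac12(\frac{2}{\gamma-1}c+v^1)$, $w=\frac12(\frac{2}{\gamma-1}c-v^1)$, acoustical metric $g=-c^2dt^2+\sum_i(dx^i-v^idt)^2$. **Entropy solution.** With $\eta=\frac12\rho|v|^2+\rho e$ and $q=\rho(\frac{|v|^2}2+h)v$, an entropy solution is a pair of measurable bounded functions $(\rho,v)$ satisfying the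 conservative Euler equations in the sense of distributions together with $\partial_t\eta+\nabla\cdot q\le0$ in the sense of distributions; the initial data are attained in the usual weak sense (the equations and the inequality are tested up to $t=0$ including the initial data). $(v',c')$ is identified with $(\rho',v')$ through $c'=\sqrt{p'(\rho')}$, where on the right-hand side $p'(\cdot)$ denotes the derivative of the pressure law. **Data.** Fix constant states $(\mathring v_l,\mathring c_l)$, $(\mathring v_r,\mathring c_r)$ (velocities in the $x_1$ direction, positive sound speeds) with $\mathring{\underline w}_r>\mathring{\underline w}_l$, $\mathring w_l>\mathring w_r$, $\mathring{\underline w}_l+\mathring w_r>0$. An $\varepsilon$-perturbed Riemann data equals $(v_l,c_l)$ for $x_1\le 0$ and $(v_r,c_r)$ for $x_1\ge 0$, each smooth up to $x_1=0$, with $\|v^1_l-\mathring v_l\|_{H^{N_0}}+\|v_l^2\|_{H^{N_0}}+\|c_l-\mathring c_l\|_{H^{N_0}}<\varepsilon$ on $\{x_1\le0\}$, similarly for $r$ on $\{x_1\ge 0\}$, and $\mathrm{curl}\,v=0$ in distributions on $\Sigma_0$; $N_0$ is a sufficiently large fixed integer. **The constructed solution $(v,c)$.** It is continuous away from $\mathbf S_*=\{t=0,x_1=0\}$, and is obtained by gluing along four $g$-null hypersurfaces emanating from $\mathbf S_*$, in order of increasing $x_1$: $\underline C_0,\underline H,H,C_0$. Left of $\underline C_0$ and right of $C_0$ it is the smooth solution developed from $(v_l,c_l)$ and $(v_r,c_r)$ in their future domains of dependence. Between $H$ and $C_0$ it is a centered front rarefaction wave: the region is part of a region foliated by $g$-null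 hypersurfaces $C_u$, $u\ge0$, all emanating from $\mathbf S_*$, with $C_0$ the leaf $u=0$; the solution is smooth (class $C^N$ for a large $N$) up to $t=0$ in acoustical coordinates $(t,u,\vartheta)$ ($\vartheta$ constant along the null generators, $\vartheta=x_2$ at $\mathbf S_*$), with limits at $t=0$: $\underline w=\underline w_r(0,\vartheta)-\frac{2}{\gamma+1}u$, $w=w_r(0,\vartheta)$, $\psi_2=-v_r^2(0,\vartheta)$ (here $f(0,\vartheta)$ denotes the trace at $x_1=0,x_2=\vartheta$ of the initial data), and satisfies $|\partial_{x_2}(\underline w,w,\psi_2)|\lesssim\varepsilon$, $|\partial_{x_1}(w,\psi_2)|\lesssim\varepsilon$, $|-t\partial_{x_1}\underline w+\frac{2}{\gamma+1}|\lesssim\varepsilon t$. $H$ is the null hypersurface emanating from the curve $u=\frac{\gamma+1}{2}(\underline w_r(0,\vartheta)-\underline w_l(0,\vartheta))$ in $\{t=0\}$ in these coordinates. The region between $\underline C_0$ and $\underline H$ is constructed symmetrically (centered back rarefaction wave, with the roles of $w$ and $\underline w$ and of $l$ and $r$ exchanged). Between $\underline H$ and $H$ the solution is the smooth solution of the Goursat problem with the resulting characteristic data on $H\cup\underline H$. *)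

theory Defs
  imports "HOL-Analysis.Analysis"
begin

text \<open>
  Space-time points are triples \<open>(t, x\<^sub>1, x\<^sub>2)\<close>; functions on
  \<open>\<real> \<times> \<real>/2\<pi>\<int>\<close> are functions on the plane that are \<open>2\<pi>\<close>-periodic in \<open>x\<^sub>2\<close>,
  and integrals over the circle are taken over the fundamental domain \<open>{0..<2\<pi>}\<close>.
  Velocities are pairs \<open>(v\<^sup>1, v\<^sup>2)\<close>.
\<close>

type_synonym spt = "real \<times> real \<times> real"
type_synonym vel = "real \<times> real"

subsection \<open>Derivatives and classes of differentiability\<close>

definition dird :: "'a::euclidean_space \<Rightarrow> ('a \<Rightarrow> 'b::real_normed_vector) \<Rightarrow> 'a \<Rightarrow> 'b" where
  "dird b f x = frechet_derivative f (at x) b"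

abbreviation dt :: "(spt \<Rightarrow> 'b::real_normed_vector) \<Rightarrow> spt \<Rightarrow> 'b" where
  "dt \<equiv> dird (1, 0, 0)"
abbreviation dx1 :: "(spt \<Rightarrow> 'b::real_normed_vector) \<Rightarrow> spt \<Rightarrow> 'b" where
  "dx1 \<equiv> dird (0, 1, 0)"
abbreviation dx2 :: "(spt \<Rightarrow> 'b::real_normed_vector) \<Rightarrow> spt \<Rightarrow> 'b" where
  "dx2 \<equiv> dird (0, 0, 1)"

definition grad :: "(spt \<Rightarrow> real) \<Rightarrow> spt \<Rightarrow> vel" where
  "grad f p = (dx1 f p, dx2 f p)"

definition dvg :: "(spt \<Rightarrow> vel) \<Rightarrow> spt \<Rightarrow> real" where
  "dvg v p = dx1 (\<lambda>q. fst (v q)) p + dx2 (\<lambda>q. snd (v q)) p"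

text \<open>Class \<open>C\<^sup>k\<close> on an arbitrary set: derivatives are taken within the set, so that for a
  closed region this is regularity up to the boundary.\<close>

primrec Ck_on :: "nat \<Rightarrow> 'a::euclidean_space set \<Rightarrow> ('a \<Rightarrow> 'b::real_normed_vector) \<Rightarrow> bool" where
  "Ck_on 0 S f = continuous_on S f"
| "Ck_on (Suc k) S f = (\<exists>D. (\<forall>b\<in>Basis. Ck_on k S (D b)) \<and>
     (\<forall>x\<in>S. (f has_derivative (\<lambda>h. \<Sum>b\<in>Basis. (h \<bullet> b) *\<^sub>R D b x)) (at x within S)))"

definition smooth_on :: "'a::euclidean_space set \<Rightarrow> ('a \<Rightarrow> 'b::real_normed_vector) \<Rightarrow> bool" where
  "smooth_on S f \<longleftrightarrow> (\<forall>k. Ck_on k S f)"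

definition periodic :: "(spt \<Rightarrow> 'b) \<Rightarrow> bool" where
  "periodic f \<longleftrightarrow> (\<forall>t x1 x2. f (t, x1, x2 + 2 * pi) = f (t, x1, x2))"

text \<open>Periodicity in the second variable, for functions of \<open>(x\<^sub>1, x\<^sub>2)\<close> or of \<open>(t, x\<^sub>2)\<close>.\<close>

definition periodic2 :: "(real \<times> real \<Rightarrow> 'b) \<Rightarrow> bool" where
  "periodic2 f \<longleftrightarrow> (\<forall>a x2. f (a, x2 + 2 * pi) = f (a, x2))"

text \<open>The time slab uses the final time \<open>t\<^sup>* = 1\<close>; the edge is \<open>S\<^sub>* = {t = 0, x\<^sub>1 = 0}\<close>.\<close>

definition slab :: "spt set" where
  "slab = {0..1} \<times> UNIV"

definition slab_cell :: "spt set" where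
  "slab_cell = {0<..<1} \<times> UNIV \<times> {0..<2 * pi}"

definition slice_cell :: "(real \<times> real) set" where
  "slice_cell = UNIV \<times> {0..<2 * pi}"

definition edge :: "spt set" where
  "edge = {(t, x1, x2). t = 0 \<and> x1 = 0}"

subsection \<open>Equation of state and Riemann invariants\<close>

definition pressure :: "real \<Rightarrow> real \<Rightarrow> real \<Rightarrow> real" where
  "pressure \<gamma> k0 r = k0 * r powr \<gamma>"

text \<open>The derivative of the pressure law on \<open>{0..}\<close> (one-sided at the vacuum).\<close>

definition dpressure :: "real \<Rightarrow> real \<Rightarrow> real \<Rightarrow> real" where
  "dpressure \<gamma> k0 r = k0 * \<gamma> * r powr (\<gamma> - 1)"

definition sound_speed :: "real \<Rightarrow> real \<Rightarrow> real \<Rightarrow> real" where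
  "sound_speed \<gamma> k0 r = sqrt (dpressure \<gamma> k0 r)"

text \<open>Inverse of \<open>sound_speed\<close> on \<open>{0..}\<close>.\<close>

definition density_of :: "real \<Rightarrow> real \<Rightarrow> real \<Rightarrow> real" where
  "density_of \<gamma> k0 c = (c\<^sup>2 / (k0 * \<gamma>)) powr (1 / (\<gamma> - 1))"

definition wbar :: "real \<Rightarrow> real \<Rightarrow> vel \<Rightarrow> real" where
  "wbar \<gamma> c v = (2 / (\<gamma> - 1) * c + fst v) / 2"

definition wup :: "real \<Rightarrow> real \<Rightarrow> vel \<Rightarrow> real" where
  "wup \<gamma> c v = (2 / (\<gamma> - 1) * c - fst v) / 2"

definition psi2 :: "vel \<Rightarrow> real" where
  "psi2 v = - snd v"

subsection \<open>Classical solutions, acoustical metric, null hypersurfaces\<close>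

definition euler_at :: "real \<Rightarrow> real \<Rightarrow> (spt \<Rightarrow> vel) \<Rightarrow> (spt \<Rightarrow> real) \<Rightarrow> spt \<Rightarrow> bool" where
  "euler_at \<gamma> k0 v c p \<longleftrightarrow>
    (let \<rho> = (\<lambda>q. density_of \<gamma> k0 (c q)) in
      v differentiable (at p) \<and> \<rho> differentiable (at p) \<and>
      dt \<rho> p + v p \<bullet> grad \<rho> p = - \<rho> p * dvg v p \<and>
      dt v p + fst (v p) *\<^sub>R dx1 v p + snd (v p) *\<^sub>R dx2 v p
        = - (inverse (\<rho> p) *\<^sub>R grad (\<lambda>q. pressure \<gamma> k0 (\<rho> q)) p))"

definition acoustic_metric :: "vel \<Rightarrow> real \<Rightarrow> spt \<Rightarrow> spt \<Rightarrow> real" where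
  "acoustic_metric v c X Y = - c\<^sup>2 * fst X * fst Y
     + (snd X - fst X *\<^sub>R v) \<bullet> (snd Y - fst Y *\<^sub>R v)"

text \<open>The hypersurface \<open>x\<^sub>1 = \<phi>(t, x\<^sub>2)\<close> is null: the metric degenerates on its tangent plane,
  which is spanned by \<open>Et\<close> and \<open>E2\<close>.\<close>

definition null_graph :: "(spt \<Rightarrow> vel) \<Rightarrow> (spt \<Rightarrow> real) \<Rightarrow> (real \<times> real \<Rightarrow> real) \<Rightarrow> bool" where
  "null_graph v c \<phi> \<longleftrightarrow> (\<forall>t x2. 0 < t \<and> t < 1 \<longrightarrow>
    (let p = (t, \<phi> (t, x2), x2);
         Et = (1, dird (1, 0) \<phi> (t, x2), 0);
         E2 = (0, dird (0, 1) \<phi> (t, x2), 1)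
     in \<exists>a b. (a, b) \<noteq> (0, 0) \<and>
          acoustic_metric (v p) (c p) (a *\<^sub>R Et + b *\<^sub>R E2) Et = 0 \<and>
          acoustic_metric (v p) (c p) (a *\<^sub>R Et + b *\<^sub>R E2) E2 = 0))"

definition graph_of :: "(real \<times> real \<Rightarrow> real) \<Rightarrow> spt set" where
  "graph_of \<phi> = {(t, x1, x2). 0 < t \<and> t \<le> 1 \<and> x1 = \<phi> (t, x2)}"

definition null_from_edge ::
  "nat \<Rightarrow> (spt \<Rightarrow> vel) \<Rightarrow> (spt \<Rightarrow> real) \<Rightarrow> (real \<times> real \<Rightarrow> real) \<Rightarrow> bool" where
  "null_from_edge N v c \<phi> \<longleftrightarrow> Ck_on N ({0..1} \<times> UNIV) \<phi> \<and> periodic2 \<phi> \<and>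
     (\<forall>x2. \<phi> (0, x2) = 0) \<and> null_graph v c \<phi>"

subsection \<open>Perturbed Riemann data\<close>

definition mixed_deriv :: "nat \<Rightarrow> nat \<Rightarrow> (real \<times> real \<Rightarrow> real) \<Rightarrow> real \<times> real \<Rightarrow> real" where
  "mixed_deriv i j f = (dird (1, 0) ^^ i) ((dird (0, 1) ^^ j) f)"

text \<open>The \<open>H\<^sup>N\<close> norm of a (smooth, periodic) function on an open set \<open>\<Omega>\<close> of the slice.\<close>

definition sobolev_norm :: "nat \<Rightarrow> (real \<times> real) set \<Rightarrow> (real \<times> real \<Rightarrow> real) \<Rightarrow> ennreal" where
  "sobolev_norm N \<Omega> f =
    (let s = (\<Sum>(i, j) \<in> {(i, j). i + j \<le> N}.
                \<integral>\<^sup>+x. ennreal ((mixed_deriv i j f x)\<^sup>2) * indicator (\<Omega> \<inter> slice_cell) x \<partial>lebesgue)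
     in if s = \<infinity> then \<infinity> else ennreal (sqrt (enn2real s)))"

definition close_to_state ::
  "nat \<Rightarrow> (real \<times> real) set \<Rightarrow> real \<Rightarrow> real \<Rightarrow> real \<Rightarrow>
     (real \<times> real \<Rightarrow> vel) \<Rightarrow> (real \<times> real \<Rightarrow> real) \<Rightarrow> bool" where
  "close_to_state N \<Omega> \<epsilon> v0 c0 v c \<longleftrightarrow>
     sobolev_norm N \<Omega> (\<lambda>x. fst (v x) - v0) + sobolev_norm N \<Omega> (\<lambda>x. snd (v x))
       + sobolev_norm N \<Omega> (\<lambda>x. c x - c0) < ennreal \<epsilon>"

definition glue :: "(real \<times> real \<Rightarrow> 'b) \<Rightarrow> (real \<times> real \<Rightarrow> 'b) \<Rightarrow> real \<times> real \<Rightarrow> 'b" where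
  "glue fl fr x = (if fst x \<le> 0 then fl x else fr x)"

definition curl_free :: "(real \<times> real \<Rightarrow> vel) \<Rightarrow> bool" where
  "curl_free v \<longleftrightarrow> (\<forall>\<zeta> :: real \<times> real \<Rightarrow> real.
     smooth_on UNIV \<zeta> \<and> periodic2 \<zeta> \<and> (\<exists>R. \<forall>x. \<bar>fst x\<bar> > R \<longrightarrow> \<zeta> x = 0) \<longrightarrow>
     (LINT x:slice_cell|lebesgue.
        snd (v x) * dird (1, 0) \<zeta> x - fst (v x) * dird (0, 1) \<zeta> x) = 0)"

definition riemann_data ::
  "nat \<Rightarrow> real \<Rightarrow> real \<Rightarrow> real \<Rightarrow> real \<Rightarrow> real \<Rightarrow>
     (real \<times> real \<Rightarrow> vel) \<Rightarrow> (real \<times> real \<Rightarrow> real) \<Rightarrow>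
     (real \<times> real \<Rightarrow> vel) \<Rightarrow> (real \<times> real \<Rightarrow> real) \<Rightarrow> bool" where
  "riemann_data N0 \<epsilon> vl0 cl0 vr0 cr0 vl cl vr cr \<longleftrightarrow>
     smooth_on {x. fst x \<le> 0} vl \<and> smooth_on {x. fst x \<le> 0} cl \<and>
     smooth_on {x. fst x \<ge> 0} vr \<and> smooth_on {x. fst x \<ge> 0} cr \<and>
     periodic2 vl \<and> periodic2 cl \<and> periodic2 vr \<and> periodic2 cr \<and>
     close_to_state N0 {x. fst x < 0} \<epsilon> vl0 cl0 vl cl \<and>
     close_to_state N0 {x. fst x > 0} \<epsilon> vr0 cr0 vr cr \<and>
     curl_free (glue vl vr)"

subsection \<open>Centered rarefaction waves\<close>

definition acoustic_box :: "real \<Rightarrow> spt set" where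
  "acoustic_box us = {0..1} \<times> {0..us} \<times> UNIV"

definition foliated_region :: "real \<Rightarrow> (spt \<Rightarrow> spt) \<Rightarrow> spt set" where
  "foliated_region us X = X ` ({0<..1} \<times> {0..us} \<times> UNIV)"

text \<open>
  \<open>X\<close> expresses \<open>(t, x\<^sub>1, x\<^sub>2)\<close> through the acoustical coordinates \<open>(t, u, \<theta>)\<close>, and \<open>U\<close>, \<open>\<Theta>\<close> are
  the coordinates as functions on space-time.  All leaves emanate from the edge, where
  \<open>\<theta> = x\<^sub>2\<close>.  The leaf \<open>C\<^sub>u\<close> has tangent plane spanned by \<open>\<partial>\<^sub>tX\<close> and \<open>\<partial>\<^sub>\<theta>X\<close>; it is null with
  generators \<open>\<theta> = const\<close>, i.e. \<open>\<partial>\<^sub>tX\<close> is orthogonal to both.  The last inequality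
  selects the front family (generators moving to the right relative to the fluid).
\<close>

definition acoustical_coords ::
  "nat \<Rightarrow> real \<Rightarrow> (spt \<Rightarrow> vel) \<Rightarrow> (spt \<Rightarrow> real) \<Rightarrow> (spt \<Rightarrow> spt) \<Rightarrow> bool" where
  "acoustical_coords N us v c X \<longleftrightarrow>
     Ck_on N (acoustic_box us) X \<and>
     (\<forall>(t, u, \<theta>) \<in> acoustic_box us. fst (X (t, u, \<theta>)) = t \<and>
        X (t, u, \<theta> + 2 * pi) = X (t, u, \<theta>) + (0, 0, 2 * pi)) \<and>
     (\<forall>u\<in>{0..us}. \<forall>\<theta>. X (0, u, \<theta>) = (0, 0, \<theta>)) \<and>
     (\<exists>U \<Theta> :: spt \<Rightarrow> real. Ck_on N (foliated_region us X) U \<and> Ck_on N (foliated_region us X) \<Theta> \<and>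
        (\<forall>t u \<theta>. 0 < t \<and> t \<le> 1 \<and> 0 \<le> u \<and> u \<le> us \<longrightarrow>
           U (X (t, u, \<theta>)) = u \<and> \<Theta> (X (t, u, \<theta>)) = \<theta>)) \<and>
     (\<forall>t u \<theta>. 0 < t \<and> t < 1 \<and> 0 < u \<and> u < us \<longrightarrow>
        (let p = X (t, u, \<theta>); L = dt X (t, u, \<theta>); E = dx2 X (t, u, \<theta>) in
           acoustic_metric (v p) (c p) L L = 0 \<and>
           acoustic_metric (v p) (c p) L E = 0 \<and>
           fst (snd L) > fst (v p)))"

text \<open>The space-time function \<open>F\<close> is \<open>C\<^sup>N\<close> up to \<open>t = 0\<close> in acoustical coordinates, with
  limit \<open>f0\<close> there.\<close>

definition smooth_with_limit ::
  "nat \<Rightarrow> real \<Rightarrow> (spt \<Rightarrow> spt) \<Rightarrow> (spt \<Rightarrow> real) \<Rightarrow> (real \<Rightarrow> real \<Rightarrow> real) \<Rightarrow> bool" where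
  "smooth_with_limit N us X F f0 \<longleftrightarrow> (\<exists>f. Ck_on N (acoustic_box us) f \<and>
     (\<forall>t u \<theta>. 0 < t \<and> t \<le> 1 \<and> 0 \<le> u \<and> u \<le> us \<longrightarrow> f (t, u, \<theta>) = F (X (t, u, \<theta>))) \<and>
     (\<forall>u \<theta>. 0 \<le> u \<and> u \<le> us \<longrightarrow> f (0, u, \<theta>) = f0 u \<theta>))"

text \<open>
  \<open>(v, c)\<close> is a centered front rarefaction wave between \<open>H\<close>: \<open>x\<^sub>1 = \<phi>H(t, x\<^sub>2)\<close> and
  \<open>C\<^sub>0\<close>: \<open>x\<^sub>1 = \<phi>C(t, x\<^sub>2)\<close>.  There it coincides with a wave \<open>(vF, cF)\<close> that lives on the
  possibly larger region foliated by the leaves \<open>0 \<le> u \<le> us\<close>.  In acoustical coordinates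
  \<open>H\<close> is the graph of \<open>UH\<close> over \<open>(t, \<theta>)\<close>.  The implicit constant of all estimates is \<open>A\<close>.
\<close>

definition front_rarefaction ::
  "real \<Rightarrow> real \<Rightarrow> nat \<Rightarrow> real \<Rightarrow> real \<Rightarrow>
     (real \<times> real \<Rightarrow> vel) \<Rightarrow> (real \<times> real \<Rightarrow> real) \<Rightarrow>
     (real \<times> real \<Rightarrow> vel) \<Rightarrow> (real \<times> real \<Rightarrow> real) \<Rightarrow>
     (real \<times> real \<Rightarrow> real) \<Rightarrow> (real \<times> real \<Rightarrow> real) \<Rightarrow>
     (spt \<Rightarrow> vel) \<Rightarrow> (spt \<Rightarrow> real) \<Rightarrow> bool" where
  "front_rarefaction \<gamma> k0 N A \<epsilon> vl cl vr cr \<phi>H \<phi>C v c \<longleftrightarrow>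
    (\<exists>us vF cF X UH.
       let wbF = (\<lambda>p. wbar \<gamma> (cF p) (vF p));
           wF = (\<lambda>p. wup \<gamma> (cF p) (vF p));
           psiF = (\<lambda>p. psi2 (vF p));
           wb_l = (\<lambda>\<theta>. wbar \<gamma> (cl (0, \<theta>)) (vl (0, \<theta>)));
           wb_r = (\<lambda>\<theta>. wbar \<gamma> (cr (0, \<theta>)) (vr (0, \<theta>)));
           w_r = (\<lambda>\<theta>. wup \<gamma> (cr (0, \<theta>)) (vr (0, \<theta>)));
           R = foliated_region us X
       in
       us > 0 \<and> periodic vF \<and> periodic cF \<and>
       (\<forall>p\<in>R. cF p > 0) \<and>
       (\<forall>p\<in>interior R. euler_at \<gamma> k0 vF cF p) \<and>
       acoustical_coords N us vF cF X \<and>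
       smooth_with_limit N us X wbF (\<lambda>u \<theta>. wb_r \<theta> - 2 / (\<gamma> + 1) * u) \<and>
       smooth_with_limit N us X wF (\<lambda>u \<theta>. w_r \<theta>) \<and>
       smooth_with_limit N us X psiF (\<lambda>u \<theta>. psi2 (vr (0, \<theta>))) \<and>
       (\<forall>p\<in>interior R.
          \<bar>dx2 wbF p\<bar> \<le> A * \<epsilon> \<and> \<bar>dx2 wF p\<bar> \<le> A * \<epsilon> \<and> \<bar>dx2 psiF p\<bar> \<le> A * \<epsilon> \<and>
          \<bar>dx1 wF p\<bar> \<le> A * \<epsilon> \<and> \<bar>dx1 psiF p\<bar> \<le> A * \<epsilon> \<and>
          \<bar>- fst p * dx1 wbF p + 2 / (\<gamma> + 1)\<bar> \<le> A * \<epsilon> * fst p) \<and>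
       graph_of \<phi>C = {X (t, 0, \<theta>) | t \<theta>. 0 < t \<and> t \<le> 1} \<and>
       Ck_on N ({0..1} \<times> UNIV) UH \<and> periodic2 UH \<and>
       (\<forall>t\<in>{0..1}. \<forall>\<theta>. UH (t, \<theta>) \<in> {0..us}) \<and>
       (\<forall>\<theta>. UH (0, \<theta>) = (\<gamma> + 1) / 2 * (wb_r \<theta> - wb_l \<theta>)) \<and>
       graph_of \<phi>H = {X (t, UH (t, \<theta>), \<theta>) | t \<theta>. 0 < t \<and> t \<le> 1} \<and>
       (\<forall>t x1 x2. 0 < t \<and> t \<le> 1 \<and> \<phi>H (t, x2) \<le> x1 \<and> x1 \<le> \<phi>C (t, x2) \<longrightarrow>
          (t, x1, x2) \<in> R \<and> v (t, x1, x2) = vF (t, x1, x2) \<and> c (t, x1, x2) = cF (t, x1, x2)))"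

text \<open>The reflection \<open>x\<^sub>1 \<mapsto> -x\<^sub>1\<close> exchanges left and right, and \<open>wbar\<close> and \<open>wup\<close>; it
  turns front into back rarefaction waves.\<close>

definition flip :: "vel \<Rightarrow> vel" where
  "flip v = (- fst v, snd v)"

definition reflect :: "spt \<Rightarrow> spt" where
  "reflect p = (fst p, flip (snd p))"

definition back_rarefaction ::
  "real \<Rightarrow> real \<Rightarrow> nat \<Rightarrow> real \<Rightarrow> real \<Rightarrow>
     (real \<times> real \<Rightarrow> vel) \<Rightarrow> (real \<times> real \<Rightarrow> real) \<Rightarrow>
     (real \<times> real \<Rightarrow> vel) \<Rightarrow> (real \<times> real \<Rightarrow> real) \<Rightarrow>
     (real \<times> real \<Rightarrow> real) \<Rightarrow> (real \<times> real \<Rightarrow> real) \<Rightarrow>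
     (spt \<Rightarrow> vel) \<Rightarrow> (spt \<Rightarrow> real) \<Rightarrow> bool" where
  "back_rarefaction \<gamma> k0 N A \<epsilon> vl cl vr cr \<phi>C \<phi>H v c \<longleftrightarrow>
     front_rarefaction \<gamma> k0 N A \<epsilon>
       (flip \<circ> vr \<circ> flip) (cr \<circ> flip) (flip \<circ> vl \<circ> flip) (cl \<circ> flip)
       (\<lambda>s. - \<phi>H s) (\<lambda>s. - \<phi>C s) (flip \<circ> v \<circ> reflect) (c \<circ> reflect)"

subsection \<open>The two-rarefaction-wave solution\<close>

text \<open>A classical solution in the region \<open>S\<close>, of class \<open>C\<^sup>N\<close> up to the boundary.  Since the
  glued solution is discontinuous at the edge, its values on \<open>S \<inter> edge\<close> are
  replaced by the limits from within \<open>S\<close>.\<close>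

definition classical_solution_on ::
  "real \<Rightarrow> real \<Rightarrow> nat \<Rightarrow> spt set \<Rightarrow> (spt \<Rightarrow> vel) \<Rightarrow> (spt \<Rightarrow> real) \<Rightarrow> bool" where
  "classical_solution_on \<gamma> k0 N S v c \<longleftrightarrow>
     (\<exists>v' c'. Ck_on N S v' \<and> Ck_on N S c' \<and> (\<forall>p\<in>S - edge. v' p = v p \<and> c' p = c p)) \<and>
     (\<forall>p\<in>interior S. euler_at \<gamma> k0 v c p)"

text \<open>\<open>\<phi>1\<close>, \<open>\<phi>2\<close>, \<open>\<phi>3\<close>, \<open>\<phi>4\<close> describe the hypersurfaces bounding the back wave
  (\<open>\<phi>1\<close>, \<open>\<phi>2\<close>) and the front wave (\<open>\<phi>3\<close>, \<open>\<phi>4\<close>).  Boundedness and positivity of \<open>c\<close>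
  matter in the outer regions, unbounded in \<open>x\<^sub>1\<close>, where the solution develops from data that
  are Sobolev-close to a constant state.  The middle solution takes its characteristic data
  on \<open>\<phi>2\<close>, \<open>\<phi>3\<close> from the two waves by continuity.\<close>

definition two_rarefaction_solution ::
  "real \<Rightarrow> real \<Rightarrow> nat \<Rightarrow> real \<Rightarrow> real \<Rightarrow>
     (real \<times> real \<Rightarrow> vel) \<Rightarrow> (real \<times> real \<Rightarrow> real) \<Rightarrow>
     (real \<times> real \<Rightarrow> vel) \<Rightarrow> (real \<times> real \<Rightarrow> real) \<Rightarrow>
     (spt \<Rightarrow> vel) \<Rightarrow> (spt \<Rightarrow> real) \<Rightarrow> bool" where
  "two_rarefaction_solution \<gamma> k0 N A \<epsilon> vl cl vr cr v c \<longleftrightarrow>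
     periodic v \<and> periodic c \<and>
     bounded (v ` slab) \<and> bounded (c ` slab) \<and> (\<forall>p\<in>slab - edge. c p > 0) \<and>
     continuous_on (slab - edge) v \<and> continuous_on (slab - edge) c \<and>
     (\<forall>x. fst x \<noteq> 0 \<longrightarrow> v (0, x) = glue vl vr x \<and> c (0, x) = glue cl cr x) \<and>
     (\<exists>\<phi>1 \<phi>2 \<phi>3 \<phi>4.
        null_from_edge N v c \<phi>1 \<and> null_from_edge N v c \<phi>2 \<and>
        null_from_edge N v c \<phi>3 \<and> null_from_edge N v c \<phi>4 \<and>
        (\<forall>t x2. 0 < t \<and> t \<le> 1 \<longrightarrow>
           \<phi>1 (t, x2) < \<phi>2 (t, x2) \<and> \<phi>2 (t, x2) < \<phi>3 (t, x2) \<and> \<phi>3 (t, x2) < \<phi>4 (t, x2)) \<and>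
        classical_solution_on \<gamma> k0 N
          {(t, x1, x2). 0 \<le> t \<and> t \<le> 1 \<and> x1 \<le> \<phi>1 (t, x2)} v c \<and>
        back_rarefaction \<gamma> k0 N A \<epsilon> vl cl vr cr \<phi>1 \<phi>2 v c \<and>
        classical_solution_on \<gamma> k0 N
          {(t, x1, x2). 0 \<le> t \<and> t \<le> 1 \<and> \<phi>2 (t, x2) \<le> x1 \<and> x1 \<le> \<phi>3 (t, x2)} v c \<and>
        front_rarefaction \<gamma> k0 N A \<epsilon> vl cl vr cr \<phi>3 \<phi>4 v c \<and>
        classical_solution_on \<gamma> k0 N
          {(t, x1, x2). 0 \<le> t \<and> t \<le> 1 \<and> \<phi>4 (t, x2) \<le> x1} v c)"

subsection \<open>Entropy solutions\<close>

definition phys_entropy :: "real \<Rightarrow> real \<Rightarrow> real \<Rightarrow> vel \<Rightarrow> real" where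
  "phys_entropy \<gamma> k0 r v = r * (v \<bullet> v) / 2 + r * (pressure \<gamma> k0 r / ((\<gamma> - 1) * r))"

definition entropy_flux :: "real \<Rightarrow> real \<Rightarrow> real \<Rightarrow> vel \<Rightarrow> vel" where
  "entropy_flux \<gamma> k0 r v = (r * ((v \<bullet> v) / 2 + (sound_speed \<gamma> k0 r)\<^sup>2 / (\<gamma> - 1))) *\<^sub>R v"

text \<open>Test functions are (restrictions to \<open>t \<ge> 0\<close> of) smooth functions whose support is compact
  in \<open>[0, 1) \<times> \<real> \<times> \<real>/2\<pi>\<int>\<close>; they need not vanish at \<open>t = 0\<close>.\<close>

definition test_function :: "(spt \<Rightarrow> real) \<Rightarrow> bool" where
  "test_function \<zeta> \<longleftrightarrow> smooth_on UNIV \<zeta> \<and> periodic \<zeta> \<and>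
     (\<exists>T R. T < 1 \<and> (\<forall>t x1 x2. t > T \<or> \<bar>x1\<bar> > R \<longrightarrow> \<zeta> (t, x1, x2) = 0))"

definition entropy_solution ::
  "real \<Rightarrow> real \<Rightarrow> (real \<times> real \<Rightarrow> real) \<Rightarrow> (real \<times> real \<Rightarrow> vel) \<Rightarrow>
     (spt \<Rightarrow> real) \<Rightarrow> (spt \<Rightarrow> vel) \<Rightarrow> bool" where
  "entropy_solution \<gamma> k0 \<rho>0 v0 \<rho> v \<longleftrightarrow>
     \<rho> \<in> borel_measurable (lebesgue_on slab) \<and> v \<in> borel_measurable (lebesgue_on slab) \<and>
     periodic \<rho> \<and> periodic v \<and>
     bounded (\<rho> ` slab) \<and> bounded (v ` slab) \<and> (\<forall>p\<in>slab. \<rho> p \<ge> 0) \<and>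
     (\<forall>\<zeta>. test_function \<zeta> \<longrightarrow>
        (LINT p:slab_cell|lebesgue. \<rho> p * dt \<zeta> p + \<rho> p * (v p \<bullet> grad \<zeta> p))
          + (LINT x:slice_cell|lebesgue. \<rho>0 x * \<zeta> (0, x)) = 0 \<and>
        (LINT p:slab_cell|lebesgue.
            (\<rho> p * dt \<zeta> p) *\<^sub>R v p + (\<rho> p * (v p \<bullet> grad \<zeta> p)) *\<^sub>R v p
              + pressure \<gamma> k0 (\<rho> p) *\<^sub>R grad \<zeta> p)
          + (LINT x:slice_cell|lebesgue. (\<rho>0 x * \<zeta> (0, x)) *\<^sub>R v0 x) = 0 \<and>
        ((\<forall>p. \<zeta> p \<ge> 0) \<longrightarrow>
          (LINT p:slab_cell|lebesgue.
              phys_entropy \<gamma> k0 (\<rho> p) (v p) * dt \<zeta> p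
                + entropy_flux \<gamma> k0 (\<rho> p) (v p) \<bullet> grad \<zeta> p)
            + (LINT x:slice_cell|lebesgue. phys_entropy \<gamma> k0 (\<rho>0 x) (v0 x) * \<zeta> (0, x)) \<ge> 0))"

end

theory Submission
  imports Defs
begin

text \<open>
  The proof is the relative entropy method of Dafermos and DiPerna. The constructed solution is described by
  its velocity \<open>v\<close> and its specific enthalpy \<open>h = c\<^sup>2 / (\<gamma> - 1)\<close>, in which the Euler equations are polynomial;
  the entropy solution is described by its density \<open>r\<close> and velocity \<open>u\<close>. The relative entropy
  \<open>E = r \<bar>u - v\<bar>\<^sup>2 / 2 + H(r) - r h + P(h)\<close>, with the energy density \<open>H(r) = p(r) / (\<gamma> - 1)\<close> and the pressure \<open>P\<close>
  as a function of enthalpy, is nonnegative because \<open>H\<close> is convex with Legendre dual \<open>P\<close>, and it vanishes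
  only where the two states agree (\<open>rel_energy_lower\<close>, \<open>rel_entropy_zero\<close>).

  For a nonnegative weight \<open>W\<close> the entropy inequality is tested with \<open>W\<close>, the mass equation with
  \<open>W (h - \<bar>v\<bar>\<^sup>2 / 2)\<close> and the momentum equations with the components of \<open>W v\<close>. By the equations for \<open>(v, h)\<close>
  everything combines (\<open>rel_entropy_identity\<close>) into
  \<open>0 \<le> \<integral> (\<partial>\<^sub>t W) E + (\<partial>\<^sub>1 W) Q - W \<sigma>\<close>, without an initial term since the data agree
  (\<open>relative_entropy_inequality\<close>). The source \<open>\<sigma>\<close> is quadratic in the difference of the states, with the first
  derivatives of \<open>v\<close> as coefficients.

  Two features of the solution make this useful although its gradient is unbounded. In a rarefaction wave the only
  singular derivative of the velocity is \<open>\<partial>\<^sub>1 v\<^sup>1\<close>, which is about \<open>2 / ((\<gamma> + 1) t)\<close> and hence positive: an expansion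
  has a favourable sign, so that \<open>\<sigma> \<ge> - 8 C E\<close> with \<open>C\<close> independent of time (\<open>source_lower\<close>,
  \<open>jets_front_rarefaction\<close>, \<open>jets_back_rarefaction\<close>). Moreover \<open>\<bar>Q\<bar> \<le> S E\<close> with a speed \<open>S\<close> that depends only on bounds
  for the two solutions (\<open>rel_flux_bound\<close>); the quantitative convexity of \<open>H\<close> behind this uses \<open>\<gamma> < 3\<close>. A weight that decreases exponentially in time and is
  supported in a shrinking cone of slope \<open>S\<close> then absorbs both the source and the flux, and the weighted
  integral of \<open>E\<close> is zero (\<open>rel_entropy_vanishes_in_cone\<close>).

  The test functions above are only Lipschitz, and only if \<open>W\<close> vanishes near the edge \<open>t = 0, x\<^sub>1 = 0\<close>. Three facts
  bridge the gap. Weak formulations extend from smooth to Lipschitz test functions by mollification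
  (\<open>weak_form_lipschitz\<close>). A continuous function with bounded gradient off finitely many graphs
  \<open>x\<^sub>1 = \<phi> (t, x\<^sub>2)\<close> is Lipschitz (\<open>lipschitz_off_graphs\<close>), so the solution may be tested across the null hypersurfaces
  along which it is glued. Finally the edge has codimension two: a cut-off at scale \<open>\<delta>\<close> has gradient of order
  \<open>1 / \<delta>\<close> on a set of measure of order \<open>\<delta>\<^sup>2\<close>, and contributes nothing in the limit.
\<close>

(* Quantifiers over points of space-time stay quantifiers over points. *)
declare split_paired_All [simp del] split_paired_Ex [simp del]

section \<open>A smooth bump function and its derivatives\<close>

text \<open>Differentiating \<open>P(x) exp (- 1 / y) / y\<^bsup>2 i\<^esup>\<close> with \<open>y = 1 - x\<^sup>2\<close> gives an expression of the same form with
  \<open>i + 1\<close> in place of \<open>i\<close> and the numerator \<open>P' y\<^sup>2 + 4 i x P y - 2 x P\<close>; this is the recursion below, and \<open>bump i\<close> is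
  the \<open>i\<close>-th derivative of the standard bump function.\<close>

primrec bump_poly :: "nat \<Rightarrow> real poly" where
  "bump_poly 0 = 1"
| "bump_poly (Suc i) = pderiv (bump_poly i) * [:1, 0, -1:]\<^sup>2
     + smult (4 * real i) ([:0, 1:] * bump_poly i * [:1, 0, -1:]) - smult 2 ([:0, 1:] * bump_poly i)"

definition bump :: "nat \<Rightarrow> real \<Rightarrow> real" where
  "bump i x = (if \<bar>x\<bar> < 1 then poly (bump_poly i) x * exp (- 1 / (1 - x\<^sup>2)) / (1 - x\<^sup>2) ^ (2 * i) else 0)"

lemma bump_eq_0: "1 \<le> \<bar>x\<bar> \<Longrightarrow> bump i x = 0"
  by (simp add: bump_def)

lemma one_minus_square_pos: "\<bar>x\<bar> < 1 \<Longrightarrow> 0 < 1 - (x::real)\<^sup>2"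
  by (simp add: abs_square_less_1)

text \<open>The exponential beats every power of \<open>1 - x\<^sup>2\<close>; quadratic decay at \<open>\<plusminus>1\<close> is what makes the extension by zero
  differentiable there.\<close>

lemma bump_decay: "\<exists>C>0. \<forall>x. \<bar>x\<bar> < 1 \<longrightarrow> \<bar>bump i x\<bar> \<le> C * (1 - x\<^sup>2)\<^sup>2"
proof -
  have "compact (poly (bump_poly i) ` {-1..1})"
    by (intro compact_continuous_image continuous_intros) auto
  then obtain B where B: "B > 0" "\<And>x. x \<in> {-1..1} \<Longrightarrow> \<bar>poly (bump_poly i) x\<bar> \<le> B"
    by (metis bounded_pos compact_imp_bounded image_eqI real_norm_def)
  define n where "n = 2 * i + 2"
  have n: "n > 0" by (simp add: n_def)
  have "\<bar>bump i x\<bar> \<le> B * real n ^ n * (1 - x\<^sup>2)\<^sup>2" if x: "\<bar>x\<bar> < 1" for x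
  proof -
    define y where "y = 1 - x\<^sup>2"
    have y: "y > 0" using one_minus_square_pos[OF x] by (simp add: y_def)
    have "(1 / y / real n) ^ n \<le> (1 + 1 / y / real n) ^ n"
      using y n by (intro power_mono) auto
    also have "\<dots> \<le> exp (1 / y)"
      using y n by (intro exp_ge_one_plus_x_over_n_power_n) (auto intro: order_trans[of _ 0])
    finally have "exp (- (1 / y)) \<le> real n ^ n * y ^ n"
      using y n by (simp add: exp_minus power_divide field_simps)
    also have "\<dots> = real n ^ n * y\<^sup>2 * y ^ (2 * i)"
      by (simp add: n_def power_add power2_eq_square)
    finally have e: "exp (- (1 / y)) / y ^ (2 * i) \<le> real n ^ n * y\<^sup>2"
      using y by (simp add: field_simps)
    have "\<bar>bump i x\<bar> = \<bar>poly (bump_poly i) x\<bar> * (exp (- (1 / y)) / y ^ (2 * i))"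
      using x y by (simp add: bump_def y_def[symmetric] abs_mult)
    also have "\<dots> \<le> B * (real n ^ n * y\<^sup>2)"
      using B(1) B(2)[of x] x y by (intro mult_mono e) (auto simp: abs_less_iff)
    finally show ?thesis by (simp add: y_def)
  qed
  then show ?thesis using B n by (intro exI[of _ "B * real n ^ n"]) auto
qed

lemma bump_bounded: "\<exists>C>0. \<forall>x. \<bar>bump i x\<bar> \<le> C"
proof -
  obtain C where C: "C > 0" "\<And>x. \<bar>x\<bar> < 1 \<Longrightarrow> \<bar>bump i x\<bar> \<le> C * (1 - x\<^sup>2)\<^sup>2"
    using bump_decay by blast
  have "\<bar>bump i x\<bar> \<le> C" for x
  proof (cases "\<bar>x\<bar> < 1")
    case True
    have "(1 - x\<^sup>2)\<^sup>2 \<le> 1"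
      using one_minus_square_pos[OF True] by (simp add: power_le_one)
    then show ?thesis using C(1) C(2)[OF True]
      by (meson mult_left_le less_imp_le order_trans)
  qed (use C bump_eq_0 in auto)
  then show ?thesis using C by blast
qed

lemma bump_deriv: "(bump i has_real_derivative bump (Suc i) x) (at x)"
proof (cases "\<bar>x\<bar> < 1")
  case True
  define y where "y = 1 - x\<^sup>2"
  have y: "y > 0" using one_minus_square_pos[OF True] by (simp add: y_def)
  let ?P = "bump_poly i"
  have "((\<lambda>x. poly ?P x * exp (- 1 / (1 - x\<^sup>2)) / (1 - x\<^sup>2) ^ (2 * i)) has_real_derivative
     bump (Suc i) x) (at x)"
  proof (rule DERIV_cong)
    show "((\<lambda>x. poly ?P x * exp (- 1 / (1 - x\<^sup>2)) / (1 - x\<^sup>2) ^ (2 * i)) has_real_derivative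
      ((poly (pderiv ?P) x * exp (- 1 / y) + poly ?P x * (exp (- 1 / y) * (- 2 * x / y\<^sup>2))) * y ^ (2 * i)
        - poly ?P x * exp (- 1 / y) * (real (2 * i) * y ^ (2 * i - 1) * (- 2 * x))) / (y ^ (2 * i))\<^sup>2) (at x)"
      using y unfolding y_def
      by (auto intro!: derivative_eq_intros simp: power2_eq_square) (simp add: algebra_simps)?
    have "(real (2 * i) * y ^ (2 * i - 1)) * y = real (2 * i) * y ^ (2 * i)"
      by (cases i) (auto simp: algebra_simps)
    then have p: "real (2 * i) * y ^ (2 * i - 1) = real (2 * i) * y ^ (2 * i) / y"
      using y by (simp add: field_simps)
    have q: "y ^ (2 * Suc i) = y ^ (2 * i) * y\<^sup>2" by (simp add: power2_eq_square)
    have r: "poly (bump_poly (Suc i)) x = poly (pderiv ?P) x * y\<^sup>2 + 4 * real i * x * poly ?P x * y - 2 * x * poly ?P x"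
      by (simp add: y_def power2_eq_square algebra_simps)
    show "((poly (pderiv ?P) x * exp (- 1 / y) + poly ?P x * (exp (- 1 / y) * (- 2 * x / y\<^sup>2))) * y ^ (2 * i)
        - poly ?P x * exp (- 1 / y) * (real (2 * i) * y ^ (2 * i - 1) * (- 2 * x))) / (y ^ (2 * i))\<^sup>2
        = bump (Suc i) x"
      unfolding p bump_def r using True y
      by (simp only: y_def[symmetric] q if_True)
         (simp add: divide_simps power2_eq_square algebra_simps)
  qed
  moreover have "\<forall>\<^sub>F z in nhds x. z \<in> {-1<..<1}"
    using True by (intro eventually_nhds_in_open) auto
  ultimately show ?thesis
    by (subst DERIV_cong_ev[OF refl _ refl])
       (auto elim!: eventually_mono simp: bump_def abs_less_iff)
next
  case False
  obtain C where C: "C > 0" "\<And>x. \<bar>x\<bar> < 1 \<Longrightarrow> \<bar>bump i x\<bar> \<le> C * (1 - x\<^sup>2)\<^sup>2"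
    using bump_decay by blast
  have *: "\<bar>bump i z\<bar> \<le> 4 * C * (z - x)\<^sup>2" for z
  proof (cases "\<bar>z\<bar> < 1")
    case True
    have "1 - z\<^sup>2 = (1 - \<bar>z\<bar>) * (1 + \<bar>z\<bar>)" by (simp add: power2_eq_square algebra_simps)
    also have "\<dots> \<le> \<bar>z - x\<bar> * 2"
      using True False by (intro mult_mono) auto
    finally have "(1 - z\<^sup>2)\<^sup>2 \<le> (\<bar>z - x\<bar> * 2)\<^sup>2"
      using one_minus_square_pos[OF True] by (intro power_mono) auto
    then have "C * (1 - z\<^sup>2)\<^sup>2 \<le> C * (\<bar>z - x\<bar> * 2)\<^sup>2" using C by simp
    then show ?thesis using C(2)[OF True] by (simp add: power_mult_distrib)
  qed (use C bump_eq_0 in auto)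
  have "((\<lambda>z. (bump i z - bump i x) / (z - x)) \<longlongrightarrow> 0) (at x)"
  proof (rule Lim_null_comparison)
    show "((\<lambda>z. 4 * C * \<bar>z - x\<bar>) \<longlongrightarrow> 0) (at x)"
      by (auto intro!: tendsto_eq_intros)
    show "\<forall>\<^sub>F z in at x. norm ((bump i z - bump i x) / (z - x)) \<le> 4 * C * \<bar>z - x\<bar>"
      unfolding eventually_at_filter
    proof (intro always_eventually allI impI)
      fix z assume "z \<noteq> x"
      then show "norm ((bump i z - bump i x) / (z - x)) \<le> 4 * C * \<bar>z - x\<bar>"
        using *[of z] False
        by (simp add: bump_eq_0 divide_simps power2_eq_square abs_mult mult.assoc)
    qed
  qed
  then show ?thesis using False by (simp add: has_field_derivative_iff bump_eq_0)
qed

lemma bump_nonneg: "0 \<le> bump 0 x"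
  by (simp add: bump_def)

lemma bump_lower: "\<bar>x\<bar> \<le> 1/2 \<Longrightarrow> exp (- 2) \<le> bump 0 x"
proof -
  assume x: "\<bar>x\<bar> \<le> 1/2"
  then have "x\<^sup>2 \<le> (1/2)\<^sup>2" by (metis abs_ge_zero power2_abs power_mono)
  then have "1 / (1 - x\<^sup>2) \<le> 2" by (simp add: divide_simps power2_eq_square)
  then show ?thesis using x by (simp add: bump_def)
qed

lemma continuous_bump: "continuous_on UNIV (bump i)"
  using bump_deriv by (intro DERIV_continuous_on) (auto intro: has_field_derivative_at_within)

section \<open>Convolution and mollification\<close>

text \<open>The partial derivative of order \<open>(i, j, k)\<close> of the product kernel at scale \<open>\<delta>\<close>. Carrying the orders as
  parameters makes differentiation under the integral a statement about the family \<open>conv\<close> itself, so that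
  smoothness follows by induction.\<close>

definition kern :: "real \<Rightarrow> nat \<Rightarrow> nat \<Rightarrow> nat \<Rightarrow> spt \<Rightarrow> real" where
  "kern \<delta> i j k z =
     bump i (fst z / \<delta>) * bump j (fst (snd z) / \<delta>) * bump k (snd (snd z) / \<delta>) / \<delta> ^ (i + j + k)"

definition conv :: "real \<Rightarrow> nat \<Rightarrow> nat \<Rightarrow> nat \<Rightarrow> (spt \<Rightarrow> real) \<Rightarrow> spt \<Rightarrow> real" where
  "conv \<delta> i j k f p = (\<integral>q. kern \<delta> i j k (p - q) * f q \<partial>lborel)"

abbreviation cube :: "spt \<Rightarrow> real \<Rightarrow> spt set" where
  "cube p r \<equiv> cbox (p - (r, r, r)) (p + (r, r, r))"

lemma Basis_spt: "(Basis :: spt set) = {(1, 0, 0), (0, 1, 0), (0, 0, 1)}"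
  by (auto simp: Basis_prod_def zero_prod_def)

lemma abs_component_le_norm:
  fixes z :: spt
  shows "\<bar>fst z\<bar> \<le> norm z" "\<bar>fst (snd z)\<bar> \<le> norm z" "\<bar>snd (snd z)\<bar> \<le> norm z"
proof -
  obtain a b c where z: "z = (a, b, c)" by (cases z)
  have "norm a \<le> norm (a, b, c)" "norm (b, c) \<le> norm (a, b, c)" "norm b \<le> norm (b, c)" "norm c \<le> norm (b, c)"
    by (rule norm_fst_le norm_snd_le)+
  then show "\<bar>fst z\<bar> \<le> norm z" "\<bar>fst (snd z)\<bar> \<le> norm z" "\<bar>snd (snd z)\<bar> \<le> norm z"
    unfolding z by auto
qed

lemma mem_cube: "q \<in> cube p r \<longleftrightarrow> \<bar>fst (p - q)\<bar> \<le> r \<and> \<bar>fst (snd (p - q))\<bar> \<le> r \<and> \<bar>snd (snd (p - q))\<bar> \<le> r"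
  by (cases p; cases q) (auto simp: cbox_Pair_eq abs_le_iff)

lemma kern_outside: "\<delta> > 0 \<Longrightarrow> q \<notin> cube p \<delta> \<Longrightarrow> kern \<delta> i j k (p - q) = 0"
  unfolding mem_cube kern_def by (auto simp: bump_eq_0 not_le)

lemma continuous_kern [continuous_intros]:
  assumes "continuous_on S g" shows "continuous_on S (\<lambda>x. kern \<delta> i j k (g x))"
  unfolding kern_def divide_inverse
  by (intro continuous_intros continuous_on_compose2[OF continuous_bump] assms) auto

lemma kern_bound: "\<exists>C>0. \<forall>\<delta>>0. \<forall>z. \<bar>kern \<delta> i j k z\<bar> \<le> C / \<delta> ^ (i + j + k)"
proof -
  obtain A where A: "A > 0" "\<And>x. \<bar>bump i x\<bar> \<le> A" using bump_bounded by blast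
  obtain B where B: "B > 0" "\<And>x. \<bar>bump j x\<bar> \<le> B" using bump_bounded by blast
  obtain C where C: "C > 0" "\<And>x. \<bar>bump k x\<bar> \<le> C" using bump_bounded by blast
  have "\<bar>kern \<delta> i j k z\<bar> \<le> A * B * C / \<delta> ^ (i + j + k)" if "\<delta> > 0" for \<delta> z
    unfolding kern_def abs_divide abs_mult
    using that A B C by (intro frac_le mult_mono) (auto intro!: mult_nonneg_nonneg)
  then show ?thesis using A B C by (intro exI[of _ "A * B * C"]) auto
qed

lemma kern_nonneg: "\<delta> > 0 \<Longrightarrow> 0 \<le> kern \<delta> 0 0 0 z"
  by (simp add: kern_def bump_nonneg)

lemma kern_deriv:
  assumes "\<delta> > 0"
  shows "(kern \<delta> i j k has_derivative (\<lambda>h. fst h * kern \<delta> (Suc i) j k z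
     + fst (snd h) * kern \<delta> i (Suc j) k z + snd (snd h) * kern \<delta> i j (Suc k) z)) (at z)"
proof -
  have b: "((\<lambda>z. bump n (f z / \<delta>)) has_derivative (\<lambda>h. f h * (bump (Suc n) (f z / \<delta>) / \<delta>))) (at z)"
    if "bounded_linear f" for n and f :: "spt \<Rightarrow> real"
  proof -
    have "((\<lambda>z. f z / \<delta>) has_derivative (\<lambda>h. f h / \<delta>)) (at z)"
      using has_derivative_mult_left[OF bounded_linear_imp_has_derivative[OF that], where y = "inverse \<delta>"]
      by (simp add: divide_inverse)
    from has_derivative_compose[OF this bump_deriv[of n "f z / \<delta>", unfolded has_field_derivative_def]]
    show ?thesis by (simp add: mult.commute)
  qed
  have 1: "bounded_linear (fst :: spt \<Rightarrow> real)" "bounded_linear (\<lambda>z::spt. fst (snd z))"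
    "bounded_linear (\<lambda>z::spt. snd (snd z))"
    by (intro bounded_linear_fst bounded_linear_fst_comp bounded_linear_snd_comp bounded_linear_snd)+
  show ?thesis
    unfolding kern_def divide_inverse[of _ "\<delta> ^ _"]
    by (rule has_derivative_eq_rhs[OF has_derivative_mult_left[OF
            has_derivative_mult[OF has_derivative_mult[OF b[OF 1(1)] b[OF 1(2)]] b[OF 1(3)]]]])
       (use assms in \<open>simp add: fun_eq_iff divide_simps; simp add: algebra_simps\<close>)
qed

lemma cube_integrable:
  fixes g :: "spt \<Rightarrow> real"
  assumes "continuous_on UNIV g" "\<And>q. q \<notin> cube p r \<Longrightarrow> g q = 0"
  shows "integrable lborel g"
proof -
  have "integrable lborel (\<lambda>x. indicator (cube p r) x *\<^sub>R g x)"
    by (intro borel_integrable_compact compact_cbox continuous_on_subset[OF assms(1)] subset_UNIV)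
  also have "(\<lambda>x. indicator (cube p r) x *\<^sub>R g x) = g" using assms(2) by (auto simp: indicator_def fun_eq_iff)
  finally show ?thesis .
qed

lemma conv_integrable:
  assumes "\<delta> > 0" "continuous_on UNIV f"
  shows "integrable lborel (\<lambda>q. kern \<delta> i j k (p - q) * f q)"
  using assms(2) by (intro cube_integrable[of _ p \<delta>] continuous_intros) (auto simp: kern_outside assms(1))

lemma cube_HK_integral:
  fixes g :: "spt \<Rightarrow> real"
  assumes "continuous_on UNIV g" "\<And>q. q \<notin> cube p r \<Longrightarrow> g q = 0"
  shows "integral\<^sup>L lborel g = integral (cube p r) g" "g integrable_on cube p r"
proof -
  have *: "(\<lambda>x. indicator (cube p r) x *\<^sub>R g x) = g" using assms(2) by (auto simp: indicator_def fun_eq_iff)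
  have "set_integrable lborel (cube p r) g"
    unfolding set_integrable_def * by (rule cube_integrable[OF assms])
  from set_borel_integral_eq_integral[OF this]
  show "integral\<^sup>L lborel g = integral (cube p r) g" "g integrable_on cube p r"
    unfolding set_lebesgue_integral_def * by auto
qed

text \<open>Near \<open>p\<close> all integrands live in one fixed box, where the Leibniz rule for integrals applies.\<close>

lemma conv_deriv:
  assumes d: "\<delta> > 0" and f: "continuous_on UNIV f"
  shows "(conv \<delta> i j k f has_derivative (\<lambda>h. fst h * conv \<delta> (Suc i) j k f p
     + fst (snd h) * conv \<delta> i (Suc j) k f p + snd (snd h) * conv \<delta> i j (Suc k) f p)) (at p)"
proof -
  define U where "U = ball p 1"
  define a b where "a = p - (1 + \<delta>, 1 + \<delta>, 1 + \<delta>)" and "b = p + (1 + \<delta>, 1 + \<delta>, 1 + \<delta>)"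
  have out: "kern \<delta> i j k (x - q) * f q = 0" if x: "x \<in> U" and q: "q \<notin> cube p (1 + \<delta>)" for x q i j k
  proof -
    have "norm (p - x) < 1" using x by (simp add: U_def dist_norm)
    then have "\<bar>fst (p - x)\<bar> < 1" "\<bar>fst (snd (p - x))\<bar> < 1" "\<bar>snd (snd (p - x))\<bar> < 1"
      using abs_component_le_norm[of "p - x"] by linarith+
    then have "q \<notin> cube x \<delta>" using q unfolding mem_cube by auto
    then show ?thesis using kern_outside[OF d] by simp
  qed
  have eq: "conv \<delta> i j k f x = integral (cbox a b) (\<lambda>q. kern \<delta> i j k (x - q) * f q)"
    and int: "(\<lambda>q. kern \<delta> i j k (x - q) * f q) integrable_on cbox a b"
    if "x \<in> U" for x i j k
  proof -
    have "continuous_on UNIV (\<lambda>q. kern \<delta> i j k (x - q) * f q)"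
      by (intro continuous_intros f)
    from cube_HK_integral[OF this out[OF that]]
    show "conv \<delta> i j k f x = integral (cbox a b) (\<lambda>q. kern \<delta> i j k (x - q) * f q)"
      "(\<lambda>q. kern \<delta> i j k (x - q) * f q) integrable_on cbox a b"
      unfolding conv_def a_def b_def by blast+
  qed
  define e1 e2 e3 where "e1 = blinfun_inner_left ((1,0,0)::spt)" and "e2 = blinfun_inner_left ((0,1,0)::spt)"
    and "e3 = blinfun_inner_left ((0,0,1)::spt)"
  define D where "D x q = (kern \<delta> (Suc i) j k (x - q) * f q) *\<^sub>R e1 + (kern \<delta> i (Suc j) k (x - q) * f q) *\<^sub>R e2
     + (kern \<delta> i j (Suc k) (x - q) * f q) *\<^sub>R e3" for x q
  have D: "blinfun_apply (D x q) h = fst h * (kern \<delta> (Suc i) j k (x - q) * f q)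
     + fst (snd h) * (kern \<delta> i (Suc j) k (x - q) * f q) + snd (snd h) * (kern \<delta> i j (Suc k) (x - q) * f q)" for x q h
    by (cases h) (simp add: D_def e1_def e2_def e3_def blinfun.bilinear_simps blinfun_inner_left.rep_eq)
  have p: "p \<in> U" by (simp add: U_def)
  have *: "((\<lambda>x. integral (cbox a b) (\<lambda>q. kern \<delta> i j k (x - q) * f q)) has_derivative
      blinfun_apply (integral (cbox a b) (D p))) (at p within U)"
  proof (rule leibniz_rule[OF _ _ _ p])
    fix x t :: spt assume "x \<in> U"
    have "((\<lambda>x. x - t) has_derivative (\<lambda>h. h)) (at x within U)"
      by (auto intro!: derivative_eq_intros)
    from has_derivative_mult_left[OF has_derivative_compose[OF this kern_deriv[OF d, of i j k]], where y = "f t"]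
    show "((\<lambda>x. kern \<delta> i j k (x - t) * f t) has_derivative blinfun_apply (D x t)) (at x within U)"
      by (rule has_derivative_eq_rhs) (simp add: fun_eq_iff D algebra_simps)
  next
    have "continuous_on (U \<times> cbox a b) (\<lambda>z. f (snd z))"
      by (rule continuous_on_compose2[OF f]) (auto intro!: continuous_intros)
    then show "continuous_on (U \<times> cbox a b) (\<lambda>(x, t). D x t)"
      unfolding D_def case_prod_beta by (intro continuous_intros)
  qed (use int in \<open>auto simp: U_def\<close>)
  have Di: "D p integrable_on cbox a b"
    unfolding D_def
    by (intro integrable_continuous continuous_intros continuous_on_subset[OF f]) auto
  have "blinfun_apply (integral (cbox a b) (D p)) h = fst h * conv \<delta> (Suc i) j k f p
     + fst (snd h) * conv \<delta> i (Suc j) k f p + snd (snd h) * conv \<delta> i j (Suc k) f p" for h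
  proof -
    have "blinfun_apply (integral (cbox a b) (D p)) h = integral (cbox a b) (\<lambda>q. blinfun_apply (D p q) h)"
      using integral_linear[OF Di, of "\<lambda>F. blinfun_apply F h"] blinfun.bounded_linear_left
      by (simp add: o_def)
    also have "\<dots> = fst h * conv \<delta> (Suc i) j k f p
     + fst (snd h) * conv \<delta> i (Suc j) k f p + snd (snd h) * conv \<delta> i j (Suc k) f p"
      unfolding D eq[OF p] using int[OF p]
      by (subst integral_add, (auto intro!: integrable_add integrable_on_mult_right)[2])+ (simp add: integral_mult_right)
    finally show ?thesis .
  qed
  then have "blinfun_apply (integral (cbox a b) (D p)) = (\<lambda>h. fst h * conv \<delta> (Suc i) j k f p
     + fst (snd h) * conv \<delta> i (Suc j) k f p + snd (snd h) * conv \<delta> i j (Suc k) f p)" by auto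
  with * have "((\<lambda>x. integral (cbox a b) (\<lambda>q. kern \<delta> i j k (x - q) * f q)) has_derivative
      (\<lambda>h. fst h * conv \<delta> (Suc i) j k f p
     + fst (snd h) * conv \<delta> i (Suc j) k f p + snd (snd h) * conv \<delta> i j (Suc k) f p)) (at p)"
    using at_within_open[OF p] by (simp add: U_def)
  then show ?thesis
    by (rule has_derivative_transform_within_open[of _ _ _ _ U]) (use p eq in \<open>auto simp: U_def\<close>)
qed

lemma continuous_conv:
  assumes "\<delta> > 0" "continuous_on UNIV f" shows "continuous_on UNIV (conv \<delta> i j k f)"
  by (rule differentiable_imp_continuous_on)
     (meson conv_deriv[OF assms] differentiable_on_def has_derivative_at_withinI differentiable_def)

lemma Ck_on_conv:
  assumes "\<delta> > 0" "continuous_on UNIV f" shows "Ck_on m UNIV (conv \<delta> i j k f)"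
proof (induction m arbitrary: i j k)
  case 0 show ?case by (simp add: continuous_conv assms)
next
  case (Suc m)
  show ?case
    unfolding Ck_on.simps
  proof (intro exI conjI ballI)
    let ?D = "\<lambda>b::spt. if b = (1,0,0) then conv \<delta> (Suc i) j k f else if b = (0,1,0) then conv \<delta> i (Suc j) k f
        else conv \<delta> i j (Suc k) f"
    show "Ck_on m UNIV (?D b)" for b using Suc.IH by auto
    show "(conv \<delta> i j k f has_derivative (\<lambda>h. \<Sum>b\<in>Basis. (h \<bullet> b) *\<^sub>R ?D b x)) (at x within UNIV)" for x
      by (rule has_derivative_eq_rhs[OF conv_deriv[OF assms]]) (auto simp: Basis_spt fun_eq_iff)
  qed
qed

definition kmass :: "real \<Rightarrow> real" where
  "kmass \<delta> = (\<integral>q. kern \<delta> 0 0 0 q \<partial>lborel)"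

text \<open>Dividing by the mass of the kernel makes mollification preserve constants.\<close>

definition mollify :: "real \<Rightarrow> (spt \<Rightarrow> real) \<Rightarrow> spt \<Rightarrow> real" where
  "mollify \<delta> f = conv \<delta> 0 0 0 (\<lambda>q. f q / kmass \<delta>)"

lemma conv_reflected:
  assumes "continuous_on UNIV f"
  shows "conv \<delta> i j k f p = (\<integral>q. kern \<delta> i j k q * f (p - q) \<partial>lborel)"
proof -
  let ?g = "\<lambda>q. kern \<delta> i j k q * f (p - q)"
  have "continuous_on UNIV (\<lambda>q. f (p - q))"
    by (rule continuous_on_compose2[OF assms]) (auto intro!: continuous_intros)
  then have g: "?g \<in> borel_measurable borel"
    by (intro borel_measurable_continuous_onI continuous_intros) auto
  have "distr lborel borel (\<lambda>x. p + (-1) *\<^sub>R x) = (lborel :: spt measure)"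
    using lborel_affine[of "-1" p] by (simp add: density_1)
  then have "integral\<^sup>L lborel ?g = integral\<^sup>L (distr lborel borel (\<lambda>x. p + (-1) *\<^sub>R x)) ?g"
    by simp
  also have "\<dots> = (\<integral>x. ?g (p + (-1) *\<^sub>R x) \<partial>lborel)"
    using g by (intro integral_distr) auto
  finally show ?thesis by (simp add: conv_def)
qed

text \<open>The kernel has size \<open>\<delta>\<^bsup>- (i + j + k)\<^esup>\<close> on a cube of volume \<open>8 \<delta>\<^sup>3\<close>.\<close>

lemma conv_bound:
  "\<exists>C>0. \<forall>\<delta> f p M. \<delta> > 0 \<longrightarrow> continuous_on UNIV f \<longrightarrow> (\<forall>q\<in>cube p \<delta>. \<bar>f q\<bar> \<le> M) \<longrightarrow>
     \<bar>conv \<delta> i j k f p\<bar> \<le> C * \<delta> ^ 3 * M / \<delta> ^ (i + j + k)"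
proof -
  obtain C where C: "C > 0" "\<And>\<delta> z. \<delta> > 0 \<Longrightarrow> \<bar>kern \<delta> i j k z\<bar> \<le> C / \<delta> ^ (i + j + k)"
    using kern_bound by blast
  have *: "\<bar>conv \<delta> i j k f p\<bar> \<le> (8 * C) * \<delta> ^ 3 * M / \<delta> ^ (i + j + k)"
    if d: "\<delta> > 0" and f: "continuous_on UNIV f" and M: "\<forall>q\<in>cube p \<delta>. \<bar>f q\<bar> \<le> M" for \<delta> f p M
  proof -
    let ?K = "C / \<delta> ^ (i + j + k) * M"
    have m: "measure lborel (cube p \<delta>) = 8 * \<delta> ^ 3"
      using d by (cases p) (simp add: content_Pair power3_eq_cube)
    have fin: "emeasure lborel (cube p \<delta>) < \<infinity>" by (rule emeasure_compact_finite) auto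
    have "\<bar>conv \<delta> i j k f p\<bar> \<le> (\<integral>q. ?K * indicator (cube p \<delta>) q \<partial>lborel)"
      unfolding conv_def
    proof (rule integral_abs_bound[THEN order_trans], rule integral_mono)
      show "integrable lborel (\<lambda>q. \<bar>kern \<delta> i j k (p - q) * f q\<bar>)"
        using conv_integrable[OF d f] by (intro integrable_abs)
      show "integrable lborel (\<lambda>q. ?K * indicator (cube p \<delta>) q)"
        using fin by (intro integrable_mult_right) (auto intro!: integrable_real_indicator)
      show "\<bar>kern \<delta> i j k (p - q) * f q\<bar> \<le> ?K * indicator (cube p \<delta>) q" for q
      proof (cases "q \<in> cube p \<delta>")
        case True
        have "\<bar>kern \<delta> i j k (p - q)\<bar> * \<bar>f q\<bar> \<le> ?K"
          using C(1) C(2)[OF d, of "p - q"] bspec[OF M True] d by (intro mult_mono) simp_all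
        then show ?thesis using True by (simp add: abs_mult)
      qed (simp add: kern_outside[OF d])
    qed
    also have "\<dots> = ?K * (8 * \<delta> ^ 3)" using m by simp
    finally show ?thesis by (simp add: mult_ac)
  qed
  have "8 * C > 0" using C by simp
  with * show ?thesis by (intro exI[of _ "8 * C"] conjI allI impI)
qed

lemma kern_outside_origin: "\<delta> > 0 \<Longrightarrow> q \<notin> cube 0 \<delta> \<Longrightarrow> kern \<delta> i j k q = 0"
  unfolding mem_cube kern_def by (auto simp: bump_eq_0 not_le)

text \<open>On the cube of half the size each of the three factors of the kernel is at least \<open>exp (- 2)\<close>.\<close>

lemma kmass_lower: 
  assumes d: "\<delta> > 0" shows "exp (- 6) * \<delta> ^ 3 \<le> kmass \<delta>"
proof -
  let ?Q = "cube 0 (\<delta> / 2)"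
  have m: "measure lborel ?Q = \<delta> ^ 3"
    using d by (simp add: content_Pair power3_eq_cube zero_prod_def)
  have fin: "emeasure lborel ?Q < \<infinity>" by (rule emeasure_compact_finite) auto
  have "(\<integral>q. exp (- 6) * indicator ?Q q \<partial>lborel) \<le> kmass \<delta>"
    unfolding kmass_def
  proof (rule integral_mono)
    show "integrable lborel (\<lambda>q::spt. exp (- 6) * indicator ?Q q :: real)"
      using fin by (intro integrable_mult_right) (auto intro!: integrable_real_indicator)
    show "integrable lborel (kern \<delta> 0 0 0)"
      by (intro cube_integrable[of _ 0 \<delta>] continuous_intros continuous_on_id kern_outside_origin[OF d])
    show "exp (- 6) * indicator ?Q q \<le> kern \<delta> 0 0 0 q" for q
    proof (cases "q \<in> ?Q")
      case True
      then have "\<bar>fst q / \<delta>\<bar> \<le> 1/2" "\<bar>fst (snd q) / \<delta>\<bar> \<le> 1/2" "\<bar>snd (snd q) / \<delta>\<bar> \<le> 1/2"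
        unfolding mem_cube using d by (simp_all add: pos_divide_le_eq)
      note h = bump_lower[OF this(1)] bump_lower[OF this(2)] bump_lower[OF this(3)]
      have "exp (-2) * exp (-2) * exp (-2) \<le> kern \<delta> 0 0 0 q"
        unfolding kern_def add_0 power_0 div_by_1
        by (rule mult_mono[OF mult_mono[OF h(1,2)] h(3)]) (simp_all add: bump_nonneg)
      then show ?thesis using True by (simp add: mult_exp_exp)
    qed (simp add: kern_nonneg[OF d])
  qed
  then show ?thesis using m by simp
qed

lemma kmass_pos: "\<delta> > 0 \<Longrightarrow> 0 < kmass \<delta>"
  by (rule less_le_trans[OF _ kmass_lower]) simp_all

text \<open>The mass of the kernel compensates the volume factor \<open>\<delta>\<^sup>3\<close>, leaving one factor \<open>1 / \<delta>\<close> for each derivative.\<close>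

lemma conv_normalized_bound:
  "\<exists>C>0. \<forall>\<delta> f p M. \<delta> > 0 \<longrightarrow> continuous_on UNIV f \<longrightarrow> (\<forall>q\<in>cube p \<delta>. \<bar>f q\<bar> \<le> M) \<longrightarrow>
     \<bar>conv \<delta> i j k f p\<bar> / kmass \<delta> \<le> C * M / \<delta> ^ (i + j + k)"
proof -
  obtain C where C: "C > 0" and b: "\<forall>\<delta> f p M. \<delta> > 0 \<longrightarrow> continuous_on UNIV f \<longrightarrow> (\<forall>q\<in>cube p \<delta>. \<bar>f q\<bar> \<le> M) \<longrightarrow>
     \<bar>conv \<delta> i j k f p\<bar> \<le> C * \<delta> ^ 3 * M / \<delta> ^ (i + j + k)"
    using conv_bound[of i j k] by (elim exE conjE) (rule that)
  have *: "\<bar>conv \<delta> i j k f p\<bar> / kmass \<delta> \<le> (C * exp 6) * M / \<delta> ^ (i + j + k)"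
    if d: "\<delta> > 0" and f: "continuous_on UNIV f" and M: "\<forall>q\<in>cube p \<delta>. \<bar>f q\<bar> \<le> M" for \<delta> f p M
  proof -
    have "p \<in> cube p \<delta>" using d by (simp only: mem_cube) simp
    from bspec[OF M this] have M0: "0 \<le> M" by linarith
    have "\<bar>conv \<delta> i j k f p\<bar> / kmass \<delta> \<le> (C * \<delta> ^ 3 * M / \<delta> ^ (i + j + k)) / (exp (- 6) * \<delta> ^ 3)"
    proof (rule frac_le)
      show "0 \<le> C * \<delta> ^ 3 * M / \<delta> ^ (i + j + k)" using d C M0 by simp
    qed (use b[rule_format, OF d f bspec[OF M]] kmass_lower[OF d] d in simp_all)
    also have "\<dots> = (C * exp 6) * M / \<delta> ^ (i + j + k)"
      using d by (simp add: exp_minus divide_simps)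
    finally show ?thesis .
  qed
  have "C * exp 6 > 0" using C by simp
  with * show ?thesis by (intro exI[of _ "C * exp 6"] conjI allI impI)
qed

lemma continuous_div_kmass: "continuous_on UNIV f \<Longrightarrow> continuous_on UNIV (\<lambda>q. f q / kmass \<delta>)" for f :: "spt \<Rightarrow> real"
  unfolding divide_inverse by (intro continuous_intros)

lemma conv_divide: "conv \<delta> i j k (\<lambda>q. f q / c) p = conv \<delta> i j k f p / c"
  by (simp add: conv_def)

lemma conv_diff:
  assumes "\<delta> > 0" "continuous_on UNIV f" "continuous_on UNIV g"
  shows "conv \<delta> i j k (\<lambda>q. f q - g q) p = conv \<delta> i j k f p - conv \<delta> i j k g p"
  unfolding conv_def right_diff_distrib
  by (intro Bochner_Integration.integral_diff conv_integrable assms)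

lemma mollify_smooth: "\<delta> > 0 \<Longrightarrow> continuous_on UNIV f \<Longrightarrow> smooth_on UNIV (mollify \<delta> f)"
  by (simp add: smooth_on_def mollify_def Ck_on_conv continuous_div_kmass)

lemma mollify_nonneg: "\<delta> > 0 \<Longrightarrow> (\<And>q. 0 \<le> f q) \<Longrightarrow> 0 \<le> mollify \<delta> f p"
  unfolding mollify_def conv_def
  by (intro integral_nonneg_AE) (auto intro!: mult_nonneg_nonneg divide_nonneg_pos kern_nonneg kmass_pos)

lemma mollify_zero:
  assumes "\<delta> > 0" "\<And>q. q \<in> cube p \<delta> \<Longrightarrow> f q = 0" shows "mollify \<delta> f p = 0"
proof -
  have "kern \<delta> 0 0 0 (p - q) * (f q / kmass \<delta>) = 0" for q
    using kern_outside[OF assms(1), of q p] assms(2)[of q] by (cases "q \<in> cube p \<delta>") auto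
  then show ?thesis unfolding mollify_def conv_def by (simp only: integral_zero)
qed

text \<open>Averaging a linear function against a translated kernel only adds a constant, so the gradient of an affine
  function survives mollification exactly. This is what allows gradients of mollifications to be compared with
  gradients of the original function.\<close>

lemma mollify_affine:
  assumes d: "\<delta> > 0" and D: "bounded_linear D"
  shows "\<exists>a. \<forall>q. mollify \<delta> (\<lambda>q. c + D q) q = a + D q"
proof -
  have cD: "continuous_on UNIV D" using D by (simp add: linear_continuous_on)
  then have c: "continuous_on UNIV (\<lambda>q. c + D q)" by (intro continuous_intros)
  have k: "integrable lborel (kern \<delta> 0 0 0)" 
    by (intro cube_integrable[of _ 0 \<delta>] continuous_intros continuous_on_id kern_outside_origin[OF d])
  have kD: "integrable lborel (\<lambda>q. kern \<delta> 0 0 0 q * D q)"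
    using cD by (intro cube_integrable[of _ 0 \<delta>] continuous_intros continuous_on_id) (simp_all add: kern_outside_origin[OF d])
  have "mollify \<delta> (\<lambda>q. c + D q) p = (c - (\<integral>q. kern \<delta> 0 0 0 q * D q \<partial>lborel) / kmass \<delta>) + D p" for p
  proof -
    have "conv \<delta> 0 0 0 (\<lambda>q. c + D q) p = (\<integral>q. (c + D p) * kern \<delta> 0 0 0 q - kern \<delta> 0 0 0 q * D q \<partial>lborel)"
      unfolding conv_reflected[OF c] linear_diff[OF bounded_linear.linear[OF D]]
      by (intro Bochner_Integration.integral_cong refl) (simp add: algebra_simps)
    also have "\<dots> = (c + D p) * kmass \<delta> - (\<integral>q. kern \<delta> 0 0 0 q * D q \<partial>lborel)"
      using k kD by (subst Bochner_Integration.integral_diff) (auto simp: kmass_def)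
    finally show ?thesis
      using kmass_pos[OF d] by (simp add: mollify_def conv_divide diff_divide_distrib)
  qed
  then show ?thesis by blast
qed

lemma mollify_deriv:
  assumes "\<delta> > 0" "continuous_on UNIV f"
  shows "(mollify \<delta> f has_derivative (\<lambda>h. (fst h * conv \<delta> 1 0 0 f p
     + fst (snd h) * conv \<delta> 0 1 0 f p + snd (snd h) * conv \<delta> 0 0 1 f p) / kmass \<delta>)) (at p)"
  using conv_deriv[OF assms(1) continuous_div_kmass[OF assms(2)], where i = 0 and j = 0 and k = 0]
  by (simp add: mollify_def conv_divide add_divide_distrib)

text \<open>After subtraction of the affine function with slope \<open>D\<close>, which is reproduced exactly, the derivative of the
  kernel costs one factor \<open>1 / \<delta>\<close>. With \<open>D = 0\<close> this bounds the gradients of mollified Lipschitz functions uniformly; with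
  \<open>D\<close> the derivative at a point, where the error is \<open>o(\<delta>)\<close>, it gives convergence of the gradients.\<close>

lemma mollify_gradient_error:
  "\<exists>C>0. \<forall>\<delta> f p D M b. \<delta> > 0 \<longrightarrow> b \<in> Basis \<longrightarrow> continuous_on UNIV f \<longrightarrow> bounded_linear D \<longrightarrow>
     (\<forall>q\<in>cube p \<delta>. \<bar>f q - f p - D (q - p)\<bar> \<le> M) \<longrightarrow> \<bar>dird b (mollify \<delta> f) p - D b\<bar> \<le> C * M / \<delta>"
proof -
  obtain C1 where C1: "C1 > 0" "\<forall>\<delta> f p M. \<delta> > 0 \<longrightarrow> continuous_on UNIV f \<longrightarrow> (\<forall>q\<in>cube p \<delta>. \<bar>f q\<bar> \<le> M) \<longrightarrow>
     \<bar>conv \<delta> 1 0 0 f p\<bar> / kmass \<delta> \<le> C1 * M / \<delta> ^ (1 + 0 + 0)"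
    using conv_normalized_bound[of 1 0 0] by (elim exE conjE) (rule that)
  obtain C2 where C2: "C2 > 0" "\<forall>\<delta> f p M. \<delta> > 0 \<longrightarrow> continuous_on UNIV f \<longrightarrow> (\<forall>q\<in>cube p \<delta>. \<bar>f q\<bar> \<le> M) \<longrightarrow>
     \<bar>conv \<delta> 0 1 0 f p\<bar> / kmass \<delta> \<le> C2 * M / \<delta> ^ (0 + 1 + 0)"
    using conv_normalized_bound[of 0 1 0] by (elim exE conjE) (rule that)
  obtain C3 where C3: "C3 > 0" "\<forall>\<delta> f p M. \<delta> > 0 \<longrightarrow> continuous_on UNIV f \<longrightarrow> (\<forall>q\<in>cube p \<delta>. \<bar>f q\<bar> \<le> M) \<longrightarrow>
     \<bar>conv \<delta> 0 0 1 f p\<bar> / kmass \<delta> \<le> C3 * M / \<delta> ^ (0 + 0 + 1)"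
    using conv_normalized_bound[of 0 0 1] by (elim exE conjE) (rule that)
  define C where "C = C1 + C2 + C3"
  have *: "\<bar>dird b (mollify \<delta> f) p - D b\<bar> \<le> C * M / \<delta>"
    if d: "\<delta> > 0" and b: "b \<in> Basis" and f: "continuous_on UNIV f" and D: "bounded_linear D"
      and M: "\<forall>q\<in>cube p \<delta>. \<bar>f q - f p - D (q - p)\<bar> \<le> M" for \<delta> f p D M and b :: spt
  proof -
    define l where "l q = f p + D (q - p)" for q
    have l: "l = (\<lambda>q. (f p - D p) + D q)"
      unfolding l_def linear_diff[OF bounded_linear.linear[OF D]] by (simp only: diff_conv_add_uminus add_ac)
    have cl: "continuous_on UNIV l" unfolding l using D by (intro continuous_intros linear_continuous_on)
    define g where "g q = f q - l q" for q
    have g: "continuous_on UNIV g" unfolding g_def by (intro continuous_intros f cl)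
    have gM: "\<bar>g q\<bar> \<le> M" if "q \<in> cube p \<delta>" for q using bspec[OF M that] by (simp only: g_def l_def diff_diff_eq)
    have "p \<in> cube p \<delta>" using d by (simp only: mem_cube) simp
    from bspec[OF M this] have M0: "0 \<le> M" by linarith
    let ?d = "\<lambda>f h. (fst h * conv \<delta> 1 0 0 f p + fst (snd h) * conv \<delta> 0 1 0 f p + snd (snd h) * conv \<delta> 0 0 1 f p) / kmass \<delta>"
    obtain a where "mollify \<delta> l = (\<lambda>q. a + D q)"
      using mollify_affine[OF d D, of "f p - D p"] unfolding l by auto
    then have "(mollify \<delta> l has_derivative D) (at p)"
      using has_derivative_add[OF has_derivative_const bounded_linear_imp_has_derivative[OF D]] by simp
    from has_derivative_unique[OF this mollify_deriv[OF d cl]]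
    have "D b = ?d l b" by simp
    moreover have "dird b (mollify \<delta> f) p = ?d f b"
      unfolding dird_def using frechet_derivative_at[OF mollify_deriv[OF d f], symmetric] by simp
    ultimately have "dird b (mollify \<delta> f) p - D b = ?d g b"
      unfolding g_def conv_diff[OF d f cl] by (simp add: diff_divide_distrib algebra_simps add_divide_distrib)
    also have "\<bar>\<dots>\<bar> \<le> C * M / \<delta>"
    proof -
      have "C1 * M / \<delta> \<le> C * M / \<delta>" "C2 * M / \<delta> \<le> C * M / \<delta>" "C3 * M / \<delta> \<le> C * M / \<delta>"
        using C1(1) C2(1) C3(1) M0 d unfolding C_def by (intro divide_right_mono mult_right_mono; simp)+
      moreover have c: "\<bar>conv \<delta> 1 0 0 g p\<bar> / kmass \<delta> \<le> C1 * M / \<delta>"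
        "\<bar>conv \<delta> 0 1 0 g p\<bar> / kmass \<delta> \<le> C2 * M / \<delta>" "\<bar>conv \<delta> 0 0 1 g p\<bar> / kmass \<delta> \<le> C3 * M / \<delta>"
        using C1(2)[rule_format, OF d g, of p M] C2(2)[rule_format, OF d g, of p M] C3(2)[rule_format, OF d g, of p M] gM
        by simp_all
      moreover have "\<bar>?d g b\<bar> \<in> {\<bar>conv \<delta> 1 0 0 g p\<bar> / kmass \<delta>, \<bar>conv \<delta> 0 1 0 g p\<bar> / kmass \<delta>, \<bar>conv \<delta> 0 0 1 g p\<bar> / kmass \<delta>}"
        using b kmass_pos[OF d] unfolding Basis_spt by (auto simp: abs_divide)
      ultimately show ?thesis
        by auto
    qed
    finally show ?thesis .
  qed
  have "C > 0" using C1(1) C2(1) C3(1) by (simp add: C_def)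
  with * show ?thesis by (intro exI[of _ C] conjI allI impI)
qed

section \<open>Approximation of Lipschitz test functions\<close>

text \<open>The class that contains the product of a cut-off weight with a continuous, piecewise differentiable solution.\<close>

definition lipschitz_test :: "(spt \<Rightarrow> real) \<Rightarrow> bool" where
  "lipschitz_test f \<longleftrightarrow> periodic f \<and>
     (\<exists>T R. T < 1 \<and> (\<forall>t x1 x2. t > T \<or> \<bar>x1\<bar> > R \<longrightarrow> f (t, x1, x2) = 0)) \<and>
     (\<exists>L. \<forall>p q. \<bar>f p - f q\<bar> \<le> L * norm (p - q))"

lemma cube_norm: "q \<in> cube p \<delta> \<Longrightarrow> norm (q - p) \<le> 3 * \<delta>"
proof -
  assume "q \<in> cube p \<delta>"
  then have "\<bar>fst (p - q)\<bar> \<le> \<delta>" "\<bar>fst (snd (p - q))\<bar> \<le> \<delta>" "\<bar>snd (snd (p - q))\<bar> \<le> \<delta>"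
    unfolding mem_cube by auto
  moreover have "norm (p - q) \<le> norm (fst (p - q)) + norm (snd (p - q))"
    by (metis norm_Pair_le prod.collapse)
  moreover have "norm (snd (p - q)) \<le> norm (fst (snd (p - q))) + norm (snd (snd (p - q)))"
    by (metis norm_Pair_le prod.collapse)
  ultimately show ?thesis unfolding norm_minus_commute[of q p] real_norm_def by linarith
qed

lemma mollify_bound:
  "\<exists>C>0. \<forall>\<delta> f p M. \<delta> > 0 \<longrightarrow> continuous_on UNIV f \<longrightarrow> (\<forall>q\<in>cube p \<delta>. \<bar>f q\<bar> \<le> M) \<longrightarrow> \<bar>mollify \<delta> f p\<bar> \<le> C * M"
proof -
  obtain C where C: "C > 0" and b: "\<forall>\<delta> f p M. \<delta> > 0 \<longrightarrow> continuous_on UNIV f \<longrightarrow> (\<forall>q\<in>cube p \<delta>. \<bar>f q\<bar> \<le> M) \<longrightarrow>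
     \<bar>conv \<delta> 0 0 0 f p\<bar> / kmass \<delta> \<le> C * M / \<delta> ^ (0 + 0 + 0)"
    using conv_normalized_bound[of 0 0 0] by (elim exE conjE) (rule that)
  have "\<bar>mollify \<delta> f p\<bar> \<le> C * M" if d: "\<delta> > 0" and f: "continuous_on UNIV f" and M: "\<forall>q\<in>cube p \<delta>. \<bar>f q\<bar> \<le> M" for \<delta> f p M
    using b[rule_format, OF d f bspec[OF M]] kmass_pos[OF d] by (simp add: mollify_def conv_divide abs_divide)
  with C show ?thesis by (intro exI[of _ C] conjI allI impI)
qed

lemma mollify_const: 
  assumes "\<delta> > 0" shows "mollify \<delta> (\<lambda>q. c) p = c"
  using kmass_pos[OF assms] by (simp add: mollify_def conv_divide conv_reflected kmass_def)

lemma mollify_diff: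
  assumes "\<delta> > 0" "continuous_on UNIV f" "continuous_on UNIV g"
  shows "mollify \<delta> (\<lambda>q. f q - g q) p = mollify \<delta> f p - mollify \<delta> g p"
  unfolding mollify_def conv_divide conv_diff[OF assms] by (rule diff_divide_distrib)

lemma mollify_periodic:
  assumes "periodic f" "continuous_on UNIV f" shows "periodic (mollify \<delta> f)"
  unfolding periodic_def mollify_def conv_divide conv_reflected[OF assms(2)]
proof (intro allI)
  fix t x1 x2 :: real
  have "f ((t, x1, x2 + 2 * pi) - q) = f ((t, x1, x2) - q)" for q
  proof -
    obtain a b c where q: "q = (a, b, c)" by (cases q)
    have "f (t - a, x1 - b, (x2 - c) + 2 * pi) = f (t - a, x1 - b, x2 - c)"
      using assms(1) unfolding periodic_def by blast
    then show ?thesis by (simp add: q diff_add_eq)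
  qed
  then show "(LBINT q. kern \<delta> 0 0 0 q * f ((t, x1, x2 + 2 * pi) - q)) / kmass \<delta>
     = (LBINT q. kern \<delta> 0 0 0 q * f ((t, x1, x2) - q)) / kmass \<delta>" by simp
qed

lemma lipschitz_test_continuous:
  fixes f :: "spt \<Rightarrow> real"
  assumes "\<And>p q. \<bar>f p - f q\<bar> \<le> L * norm (p - q)"
  shows "continuous_on UNIV f"
proof (rule continuous_at_imp_continuous_on, intro ballI)
  fix p :: spt
  have "((\<lambda>q. f q - f p) \<longlongrightarrow> 0) (at p)"
  proof (rule Lim_null_comparison)
    show "\<forall>\<^sub>F q in at p. norm (f q - f p) \<le> L * norm (q - p)"
      by (intro always_eventually allI) (simp add: assms)
    have "isCont (\<lambda>q. L * norm (q - p)) p" by (intro continuous_intros)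
    then show "((\<lambda>q. L * norm (q - p)) \<longlongrightarrow> 0) (at p)" by (simp add: isCont_def)
  qed
  then show "isCont f p" by (simp add: isCont_def LIM_zero_iff)
qed

text \<open>Bounded convergence of values everywhere and of first derivatives at all points of differentiability, with
  supports in a common strip: the conditions needed to pass to the limit in a weak formulation by dominated
  convergence. Signs are preserved so that inequalities survive as well.\<close>

definition test_approximation ::
  "(spt \<Rightarrow> real) \<Rightarrow> (nat \<Rightarrow> spt \<Rightarrow> real) \<Rightarrow> real \<Rightarrow> real \<Rightarrow> bool" where
  "test_approximation f F R B \<longleftrightarrow> (\<forall>n. test_function (F n)) \<and>
    (\<forall>n t x1 x2. \<bar>x1\<bar> > R \<longrightarrow> F n (t, x1, x2) = 0) \<and>
    (\<forall>n p. \<bar>F n p\<bar> \<le> B) \<and> (\<forall>n p. \<forall>b\<in>Basis. \<bar>dird b (F n) p\<bar> \<le> B) \<and>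
    (\<forall>p. (\<lambda>n. F n p) \<longlonglongrightarrow> f p) \<and>
    (\<forall>p. \<forall>b\<in>Basis. f differentiable (at p) \<longrightarrow> (\<lambda>n. dird b (F n) p) \<longlonglongrightarrow> dird b f p) \<and>
    ((\<forall>p. 0 \<le> f p) \<longrightarrow> (\<forall>n p. 0 \<le> F n p))"

lemma lipschitz_test_approx:
  assumes "lipschitz_test f" shows "\<exists>F R B. test_approximation f F R B"
proof -
  obtain T R L where per: "periodic f" and T: "T < 1" and
    supp: "\<And>t x1 x2. t > T \<or> \<bar>x1\<bar> > R \<Longrightarrow> f (t, x1, x2) = 0" and
    L: "\<And>p q. \<bar>f p - f q\<bar> \<le> L * norm (p - q)"
    using assms unfolding lipschitz_test_def by blast
  have cont: "continuous_on UNIV f" by (rule lipschitz_test_continuous[OF L])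
  have L0: "0 \<le> L"
  proof -
    have "0 \<le> L * norm ((1,0,0) - (0,0,0) :: spt)" by (rule order_trans[OF abs_ge_zero L])
    then show ?thesis by (simp add: zero_le_mult_iff)
  qed
  have fB: "\<bar>f p\<bar> \<le> L * (2 * \<bar>R\<bar> + 1)" for p
  proof -
    obtain t x1 x2 where p: "p = (t, x1, x2)" by (cases p)
    show ?thesis
    proof (cases "\<bar>x1\<bar> > R")
      case True
      then show ?thesis using supp[of t x1 x2] L0 unfolding p by simp
    next
      case False
      have "\<bar>f (t, x1, x2) - f (t, \<bar>R\<bar> + 1, x2)\<bar> \<le> L * norm ((t, x1, x2) - (t, \<bar>R\<bar> + 1, x2))" by (rule L)
      also have "norm ((t, x1, x2) - (t, \<bar>R\<bar> + 1, x2)) = \<bar>x1 - (\<bar>R\<bar> + 1)\<bar>" by (simp add: norm_Pair)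
      also have "L * \<dots> \<le> L * (2 * \<bar>R\<bar> + 1)" using False L0 by (intro mult_left_mono) auto
      moreover have "f (t, \<bar>R\<bar> + 1, x2) = 0" by (rule supp) linarith
      ultimately show ?thesis unfolding p by simp
    qed
  qed
  \<comment> \<open>At most half the distance of the support from the final time, so that the mollified functions still vanish near it.\<close>
  define \<delta> where "\<delta> n = (1 - T) / 2 / real (Suc n)" for n
  have d: "\<delta> n > 0" and dT: "\<delta> n \<le> (1 - T) / 2" for n
    using T frac_le[of "(1 - T) / 2" "(1 - T) / 2" 1 "real (Suc n)"] by (auto simp: \<delta>_def)
  have dlim: "\<delta> \<longlonglongrightarrow> 0"
    unfolding \<delta>_def by (rule LIMSEQ_Suc[OF lim_const_over_n])
  obtain Cb where Cb: "Cb > 0" and Cb': "\<forall>\<delta> f p M. \<delta> > 0 \<longrightarrow> continuous_on UNIV f \<longrightarrow> (\<forall>q\<in>cube p \<delta>. \<bar>f q\<bar> \<le> M) \<longrightarrow> \<bar>mollify \<delta> f p\<bar> \<le> Cb * M"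
    using mollify_bound by (elim exE conjE) (rule that)
  obtain Cg where Cg: "Cg > 0" and Cg': "\<forall>\<delta> f p D M b. \<delta> > 0 \<longrightarrow> b \<in> Basis \<longrightarrow> continuous_on UNIV f \<longrightarrow> bounded_linear D \<longrightarrow>
     (\<forall>q\<in>cube p \<delta>. \<bar>f q - f p - D (q - p)\<bar> \<le> M) \<longrightarrow> \<bar>dird b (mollify \<delta> f) p - D b\<bar> \<le> Cg * M / \<delta>"
    using mollify_gradient_error by (elim exE conjE) (rule that)
  define F where "F n = mollify (\<delta> n) f" for n
  define T' R' where "T' = (1 + T) / 2" and "R' = R + (1 - T) / 2"
  define B where "B = Cb * (L * (2 * \<bar>R\<bar> + 1)) + Cg * (3 * L)"
  have B1: "0 \<le> Cb * (L * (2 * \<bar>R\<bar> + 1))" "0 \<le> Cg * (3 * L)" using Cb Cg L0 by auto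
  have F0: "F n (t, x1, x2) = 0" if "t > T' \<or> \<bar>x1\<bar> > R'" for n t x1 x2
    unfolding F_def
  proof (rule mollify_zero[OF d])
    fix q assume "q \<in> cube (t, x1, x2) (\<delta> n)"
    then have "\<bar>t - fst q\<bar> \<le> \<delta> n" "\<bar>x1 - fst (snd q)\<bar> \<le> \<delta> n" unfolding mem_cube by auto
    then have "fst q > T \<or> \<bar>fst (snd q)\<bar> > R" using that dT[of n] unfolding T'_def R'_def by (auto simp: field_simps abs_if split: if_splits)
    then show "f q = 0" using supp[of "fst q" "fst (snd q)" "snd (snd q)"] by simp
  qed
  have "test_approximation f F R' B"
    unfolding test_approximation_def
  proof (intro conjI allI ballI impI)
    show "F n (t, x1, x2) = 0" if "\<bar>x1\<bar> > R'" for n t x1 x2 using F0 that by blast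
    show "test_function (F n)" for n
      unfolding test_function_def
    proof (intro conjI exI allI impI)
      show "smooth_on UNIV (F n)" unfolding F_def by (rule mollify_smooth[OF d cont])
      show "periodic (F n)" unfolding F_def by (rule mollify_periodic[OF per cont])
      show "T' < 1" using T by (simp add: T'_def)
    qed (rule F0)
    show "\<bar>F n p\<bar> \<le> B" for n p
      using Cb'[rule_format, OF d cont fB, of n p] B1 unfolding F_def B_def by linarith
    show "\<bar>dird b (F n) p\<bar> \<le> B" if b: "b \<in> Basis" for n p b
    proof -
      \<comment> \<open>Comparison with a constant function bounds the gradients uniformly.\<close>
      have 1: "\<bar>f q - f p - 0\<bar> \<le> L * (3 * \<delta> n)" if "q \<in> cube p (\<delta> n)" for q
      proof -
        have "\<bar>f q - f p\<bar> \<le> L * norm (q - p)" by (rule L)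
        also have "\<dots> \<le> L * (3 * \<delta> n)" by (rule mult_left_mono[OF cube_norm[OF that] L0])
        finally show ?thesis by simp
      qed
      have "\<bar>dird b (F n) p - 0\<bar> \<le> Cg * (L * (3 * \<delta> n)) / \<delta> n"
        unfolding F_def
        by (rule Cg'[rule_format, OF d b cont, where D = "\<lambda>_. 0"]) (use 1 in \<open>auto simp: bounded_linear_zero\<close>)
      then show ?thesis using B1 d[of n] unfolding B_def by (simp add: mult_ac)
    qed
    show "(\<lambda>n. F n p) \<longlonglongrightarrow> f p" for p
    proof (rule LIM_zero_cancel, rule Lim_null_comparison)
      show "\<forall>\<^sub>F n in sequentially. norm (F n p - f p) \<le> Cb * (L * (3 * \<delta> n))"
      proof (intro always_eventually allI)
        fix n
        have c: "continuous_on UNIV (\<lambda>q. f q - f p)" by (intro continuous_intros cont)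
        have 1: "\<bar>f q - f p\<bar> \<le> L * (3 * \<delta> n)" if "q \<in> cube p (\<delta> n)" for q
          by (rule order_trans[OF L mult_left_mono[OF cube_norm[OF that] L0]])
        have "\<bar>mollify (\<delta> n) (\<lambda>q. f q - f p) p\<bar> \<le> Cb * (L * (3 * \<delta> n))"
          by (rule Cb'[rule_format, OF d c 1])
        moreover have "mollify (\<delta> n) (\<lambda>q. f q - f p) p = F n p - f p"
          using mollify_diff[OF d cont continuous_on_const] mollify_const[OF d] by (simp add: F_def)
        ultimately show "norm (F n p - f p) \<le> Cb * (L * (3 * \<delta> n))" by simp
      qed
      show "(\<lambda>n. Cb * (L * (3 * \<delta> n))) \<longlonglongrightarrow> 0"
        using dlim by (auto intro!: tendsto_eq_intros)
    qed
    show "(\<lambda>n. dird b (F n) p) \<longlonglongrightarrow> dird b f p" if b: "b \<in> Basis" and df: "f differentiable (at p)" for p b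
    proof (rule LIMSEQ_I)
      fix r :: real assume r: "0 < r"
      define D where "D = frechet_derivative f (at p)"
      have D: "(f has_derivative D) (at p)"
        using df unfolding D_def by (simp add: frechet_derivative_works)
      define e where "e = r / (6 * Cg)"
      have e: "e > 0" using r Cg by (simp add: e_def)
      obtain s where s: "s > 0" "\<And>q. norm (q - p) < s \<Longrightarrow> norm (f q - f p - D (q - p)) \<le> e * norm (q - p)"
        using D e unfolding has_derivative_at_alt by blast
      have "\<forall>\<^sub>F n in sequentially. \<delta> n < s / 3"
        using order_tendstoD(2)[OF dlim, of "s / 3"] s by simp
      then obtain N where N: "\<And>n. n \<ge> N \<Longrightarrow> \<delta> n < s / 3"
        unfolding eventually_sequentially by blast
      have "norm (dird b (F n) p - dird b f p) < r" if n: "n \<ge> N" for n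
      proof -
        have 1: "\<bar>f q - f p - D (q - p)\<bar> \<le> e * (3 * \<delta> n)" if "q \<in> cube p (\<delta> n)" for q
        proof -
          have "norm (q - p) < s" using cube_norm[OF that] N[OF n] by simp
          from s(2)[OF this] have "\<bar>f q - f p - D (q - p)\<bar> \<le> e * norm (q - p)" by simp
          also have "\<dots> \<le> e * (3 * \<delta> n)" using cube_norm[OF that] e by (intro mult_left_mono) auto
          finally show ?thesis .
        qed
        have "\<bar>dird b (F n) p - D b\<bar> \<le> Cg * (e * (3 * \<delta> n)) / \<delta> n"
          unfolding F_def by (rule Cg'[rule_format, OF d b cont has_derivative_bounded_linear[OF D] 1])
        also have "\<dots> = r / 2" using d[of n] Cg by (simp add: e_def)
        finally show ?thesis using r by (simp add: D_def dird_def)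
      qed
      then show "\<exists>no. \<forall>n\<ge>no. norm (dird b (F n) p - dird b f p) < r" by blast
    qed
    show "0 \<le> F n p" if "\<forall>p. 0 \<le> f p" for n p
      unfolding F_def by (rule mollify_nonneg[OF d spec[OF that]])
  qed
  then show ?thesis by blast
qed

section \<open>Weak formulations tested with Lipschitz functions\<close>

abbreviation "cell_measure \<equiv> lebesgue_on slab_cell"
abbreviation "slice_measure \<equiv> lebesgue_on slice_cell"

text \<open>The weak form, on one period, of \<open>\<partial>\<^sub>t F\<^sub>0 + \<partial>\<^sub>1 F\<^sub>1 + \<partial>\<^sub>2 F\<^sub>2\<close> with initial value \<open>G\<close> of \<open>F\<^sub>0\<close>; it vanishes for all
  test functions when the equation holds, and is nonnegative for nonnegative ones when the divergence is \<open>\<le> 0\<close>.\<close>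

definition weak_form ::
  "(spt \<Rightarrow> real) \<Rightarrow> (spt \<Rightarrow> real) \<Rightarrow> (spt \<Rightarrow> real) \<Rightarrow> (real \<times> real \<Rightarrow> real) \<Rightarrow> (spt \<Rightarrow> real) \<Rightarrow> real" where
  "weak_form F0 F1 F2 G \<zeta> = (LINT p:slab_cell|lebesgue. F0 p * dt \<zeta> p + F1 p * dx1 \<zeta> p + F2 p * dx2 \<zeta> p)
     + (LINT x:slice_cell|lebesgue. G x * \<zeta> (0, x))"

lemma slab_cell_sets: "slab_cell \<in> sets lebesgue"
proof -
  have "slab_cell \<in> sets borel" unfolding slab_cell_def by (intro borel_Times) auto
  then show ?thesis by simp
qed

lemma slice_cell_sets: "slice_cell \<in> sets lebesgue"
proof -
  have "slice_cell \<in> sets borel" unfolding slice_cell_def by (intro borel_Times) auto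
  then show ?thesis by simp
qed

lemma continuous_measurable_lebesgue_on:
  fixes f :: "'a::euclidean_space \<Rightarrow> 'b::{second_countable_topology, real_normed_vector}"
  assumes "continuous_on UNIV f"
  shows "f \<in> borel_measurable (lebesgue_on S)"
  by (intro measurable_restrict_space1 measurable_completion) (simp add: borel_measurable_continuous_onI assms)

lemma cell_integrable:
  fixes f :: "spt \<Rightarrow> 'b::{second_countable_topology, banach}"
  assumes f: "f \<in> borel_measurable cell_measure" and B: "\<And>p. p \<in> slab_cell \<Longrightarrow> norm (f p) \<le> B"
    and R: "\<And>t x1 x2. \<bar>x1\<bar> > R \<Longrightarrow> f (t, x1, x2) = 0"
  shows "integrable cell_measure f"
proof (rule integrableI_bounded_set[where A = "cbox (0, -R, 0) (1, R, 2 * pi) \<inter> slab_cell" and B = B])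
  show "cbox (0, -R, 0) (1, R, 2 * pi) \<inter> slab_cell \<in> sets cell_measure"
    using slab_cell_sets by (intro sets_restrict_space_iff[THEN iffD2]) auto
  have "emeasure cell_measure (cbox (0, -R, 0) (1, R, 2 * pi) \<inter> slab_cell)
     = emeasure lebesgue (cbox (0, -R, 0) (1, R, 2 * pi) \<inter> slab_cell)"
    using slab_cell_sets by (intro emeasure_restrict_space) auto
  also have "\<dots> \<le> emeasure lebesgue (cbox (0, -R, 0) (1, R, 2 * pi) :: spt set)"
    by (intro emeasure_mono) auto
  also have "\<dots> < \<infinity>" using emeasure_compact_finite[of "cbox (0, -R, 0) (1, R, 2 * pi) :: spt set"] by simp
  finally show "emeasure cell_measure (cbox (0, -R, 0) (1, R, 2 * pi) \<inter> slab_cell) < \<infinity>" .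
  show "AE p in cell_measure. p \<in> cbox (0, -R, 0) (1, R, 2 * pi) \<inter> slab_cell \<longrightarrow> norm (f p) \<le> B" using B by auto
  show "AE p in cell_measure. p \<notin> cbox (0, -R, 0) (1, R, 2 * pi) \<inter> slab_cell \<longrightarrow> f p = 0"
  proof (intro AE_I2 impI)
    fix p assume p: "p \<in> space cell_measure" "p \<notin> cbox (0, -R, 0) (1, R, 2 * pi) \<inter> slab_cell"
    obtain t x1 x2 where [simp]: "p = (t, x1, x2)" by (cases p)
    have "\<bar>x1\<bar> > R" using p by (auto simp: slab_cell_def)
    then show "f p = 0" using R by simp
  qed
qed (use f in auto)

lemma slice_integrable:
  fixes f :: "real \<times> real \<Rightarrow> 'b::{second_countable_topology, banach}"
  assumes f: "f \<in> borel_measurable slice_measure" and B: "\<And>p. p \<in> slice_cell \<Longrightarrow> norm (f p) \<le> B"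
    and R: "\<And>x1 x2. \<bar>x1\<bar> > R \<Longrightarrow> f (x1, x2) = 0"
  shows "integrable slice_measure f"
proof (rule integrableI_bounded_set[where A = "cbox (-R, 0) (R, 2 * pi) \<inter> slice_cell" and B = B])
  show "cbox (-R, 0) (R, 2 * pi) \<inter> slice_cell \<in> sets slice_measure"
    using slice_cell_sets by (intro sets_restrict_space_iff[THEN iffD2]) auto
  have "emeasure slice_measure (cbox (-R, 0) (R, 2 * pi) \<inter> slice_cell)
     = emeasure lebesgue (cbox (-R, 0) (R, 2 * pi) \<inter> slice_cell)"
    using slice_cell_sets by (intro emeasure_restrict_space) auto
  also have "\<dots> \<le> emeasure lebesgue (cbox (-R, 0) (R, 2 * pi))"
    by (intro emeasure_mono) auto
  also have "\<dots> < \<infinity>" using emeasure_compact_finite[of "cbox (-R, 0) (R, 2 * pi) :: (real \<times> real) set"] by simp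
  finally show "emeasure slice_measure (cbox (-R, 0) (R, 2 * pi) \<inter> slice_cell) < \<infinity>" .
  show "AE p in slice_measure. p \<in> cbox (-R, 0) (R, 2 * pi) \<inter> slice_cell \<longrightarrow> norm (f p) \<le> B" using B by auto
  show "AE p in slice_measure. p \<notin> cbox (-R, 0) (R, 2 * pi) \<inter> slice_cell \<longrightarrow> f p = 0"
  proof (intro AE_I2 impI)
    fix p assume p: "p \<in> space slice_measure" "p \<notin> cbox (-R, 0) (R, 2 * pi) \<inter> slice_cell"
    obtain x1 x2 where [simp]: "p = (x1, x2)" by (cases p)
    have "\<bar>x1\<bar> > R" using p by (auto simp: slice_cell_def)
    then show "f p = 0" using R by simp
  qed
qed (use f in auto)

lemma cell_set_integral:
  fixes f :: "spt \<Rightarrow> 'b::{second_countable_topology, banach}"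
  shows "(LINT p:slab_cell|lebesgue. f p) = integral\<^sup>L cell_measure f"
  unfolding set_lebesgue_integral_def using slab_cell_sets by (simp add: integral_restrict_space)

lemma slice_set_integral:
  fixes f :: "real \<times> real \<Rightarrow> 'b::{second_countable_topology, banach}"
  shows "(LINT p:slice_cell|lebesgue. f p) = integral\<^sup>L slice_measure f"
  unfolding set_lebesgue_integral_def using slice_cell_sets by (simp add: integral_restrict_space)

lemma Ck_on_Suc_dird:
  assumes "Ck_on (Suc m) UNIV f" "b \<in> Basis"
  shows "f differentiable (at p)" "Ck_on m UNIV (dird b f)"
proof -
  obtain D where D: "\<And>b. b \<in> Basis \<Longrightarrow> Ck_on m UNIV (D b)"
    "\<And>x. (f has_derivative (\<lambda>h. \<Sum>b\<in>Basis. (h \<bullet> b) *\<^sub>R D b x)) (at x)"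
    using assms(1) by auto
  then show "f differentiable (at p)" by (auto simp: differentiable_def)
  have "dird b f x = D b x" for x
  proof -
    have "dird b f x = (\<Sum>c\<in>Basis. (b \<bullet> c) *\<^sub>R D c x)"
      unfolding dird_def using frechet_derivative_at[OF D(2)[of x]] by metis
    also have "\<dots> = (\<Sum>c\<in>Basis. if c = b then D b x else 0)"
      using assms(2) by (intro sum.cong) (auto simp: inner_Basis)
    also have "\<dots> = D b x" using assms(2) by simp
    finally show ?thesis .
  qed
  then have "dird b f = D b" by auto
  then show "Ck_on m UNIV (dird b f)" using D assms(2) by simp
qed

lemma smooth_dird_continuous: "smooth_on UNIV f \<Longrightarrow> b \<in> Basis \<Longrightarrow> continuous_on UNIV (dird b f)"
  using Ck_on_Suc_dird(2)[of 0 f b] by (simp add: smooth_on_def del: Ck_on.simps(2))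

lemma AE_cell_iff: "(AE p in cell_measure. P p) \<longleftrightarrow> (AE p in lebesgue. p \<in> slab_cell \<longrightarrow> P p)"
  using slab_cell_sets by (subst AE_restrict_space_iff) auto

lemma cell_measurable_AE:
  fixes f g :: "spt \<Rightarrow> real"
  assumes "f \<in> borel_measurable cell_measure" "AE p in cell_measure. f p = g p"
  shows "g \<in> borel_measurable cell_measure"
proof -
  have "(\<lambda>x. if x \<in> slab_cell then f x else 0) \<in> borel_measurable lebesgue"
    using assms(1) slab_cell_sets by (simp add: borel_measurable_if)
  moreover have "AE x in lebesgue. (if x \<in> slab_cell then f x else 0) = (if x \<in> slab_cell then g x else 0)"
    using assms(2) unfolding AE_cell_iff by eventually_elim auto
  ultimately have "(\<lambda>x. if x \<in> slab_cell then g x else 0) \<in> borel_measurable lebesgue"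
    by (rule borel_measurable_AE)
  then show ?thesis using slab_cell_sets by (simp add: borel_measurable_if)
qed

text \<open>A derivative is an almost everywhere limit of continuous derivatives, hence measurable.\<close>

lemma lipschitz_test_dird:
  assumes "lipschitz_test f" "AE p in cell_measure. f differentiable (at p)" "b \<in> Basis"
  shows "dird b f \<in> borel_measurable cell_measure"
proof -
  obtain F R B where F: "test_approximation f F R B" using lipschitz_test_approx[OF assms(1)] by blast
  have sm: "smooth_on UNIV (F n)" for n using F by (simp add: test_approximation_def test_function_def)
  have lim: "(\<lambda>n. dird b (F n) p) \<longlonglongrightarrow> dird b f p" if "f differentiable (at p)" for p
    using F that assms(3) by (simp add: test_approximation_def)
  have "(\<lambda>p. lim (\<lambda>n. dird b (F n) p)) \<in> borel_measurable cell_measure"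
    by (intro borel_measurable_lim_metric continuous_measurable_lebesgue_on smooth_dird_continuous sm assms(3))
  then show ?thesis
  proof (rule cell_measurable_AE)
    show "AE p in cell_measure. lim (\<lambda>n. dird b (F n) p) = dird b f p"
      using assms(2) by eventually_elim (intro limI lim)
  qed
qed

text \<open>Dominated convergence along the mollifications, whose gradients converge almost everywhere because \<open>f\<close> is
  differentiable almost everywhere.\<close>

lemma weak_form_limit:
  assumes f: "lipschitz_test f" "AE p in cell_measure. f differentiable (at p)"
    and meas: "F0 \<in> borel_measurable cell_measure" "F1 \<in> borel_measurable cell_measure"
      "F2 \<in> borel_measurable cell_measure" "G \<in> borel_measurable slice_measure"
    and bd: "\<And>p. p \<in> slab_cell \<Longrightarrow> \<bar>F0 p\<bar> \<le> M" "\<And>p. p \<in> slab_cell \<Longrightarrow> \<bar>F1 p\<bar> \<le> M"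
      "\<And>p. p \<in> slab_cell \<Longrightarrow> \<bar>F2 p\<bar> \<le> M" "AE x in slice_measure. \<bar>G x\<bar> \<le> M"
  shows "\<exists>F. (\<forall>n. test_function (F n)) \<and> ((\<forall>p. 0 \<le> f p) \<longrightarrow> (\<forall>n p. 0 \<le> F n p)) \<and>
     (\<lambda>n. weak_form F0 F1 F2 G (F n)) \<longlonglongrightarrow> weak_form F0 F1 F2 G f"
proof -
  obtain F R B where apx: "test_approximation f F R B" using lipschitz_test_approx[OF f(1)] by blast
  have tF: "test_function (F n)" and F0: "\<bar>x1\<bar> > R \<Longrightarrow> F n (t, x1, x2) = 0" and FB: "\<bar>F n p\<bar> \<le> B"
    and dFB: "b \<in> Basis \<Longrightarrow> \<bar>dird b (F n) p\<bar> \<le> B" and Flim: "(\<lambda>n. F n p) \<longlonglongrightarrow> f p"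
    and dFlim: "b \<in> Basis \<Longrightarrow> f differentiable (at p) \<Longrightarrow> (\<lambda>n. dird b (F n) p) \<longlonglongrightarrow> dird b f p"
    for n p b t x1 x2
    using apx by (simp_all add: test_approximation_def)
  have sm: "smooth_on UNIV (F n)" for n using tF by (simp add: test_function_def)
  have B0: "0 \<le> B" using order_trans[OF abs_ge_zero FB] .
  have bas: "(1,0,0) \<in> (Basis :: spt set)" "(0,1,0) \<in> (Basis :: spt set)" "(0,0,1) \<in> (Basis :: spt set)"
    by (auto simp: Basis_spt)
  have dF0: "dird b (F n) (t, x1, x2) = 0" if x: "\<bar>x1\<bar> > R" and b: "b \<in> Basis" for n t x1 x2 b
  proof -
    let ?U = "{p::spt. \<bar>fst (snd p)\<bar> > R}"
    have "open ?U" by (intro open_Collect_less continuous_intros)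
    then have "(F n has_derivative (\<lambda>h. 0)) (at (t, x1, x2))"
      by (rule has_derivative_transform_within_open[OF has_derivative_const]) (use x F0 in auto)
    then show ?thesis unfolding dird_def using frechet_derivative_at by metis
  qed
  let ?h = "\<lambda>\<zeta> p. F0 p * dt \<zeta> p + F1 p * dx1 \<zeta> p + F2 p * dx2 \<zeta> p"
  let ?w = "\<lambda>p::spt. if \<bar>fst (snd p)\<bar> > R then 0 else 3 * \<bar>M\<bar> * B"
  let ?w' = "\<lambda>x::real \<times> real. if \<bar>fst x\<bar> > R then 0 else \<bar>M\<bar> * B"
  have dm: "dird b f \<in> borel_measurable cell_measure" if "b \<in> Basis" for b by (rule lipschitz_test_dird[OF f that])
  have dFm: "dird b (F n) \<in> borel_measurable cell_measure" if "b \<in> Basis" for n b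
    by (intro continuous_measurable_lebesgue_on smooth_dird_continuous sm that)
  have 1: "(\<lambda>n. integral\<^sup>L cell_measure (?h (F n))) \<longlonglongrightarrow> integral\<^sup>L cell_measure (?h f)"
  proof (rule integral_dominated_convergence[where w = ?w])
    show "?h f \<in> borel_measurable cell_measure" using meas dm bas by measurable
    show "?h (F n) \<in> borel_measurable cell_measure" for n using meas dFm bas by measurable
    show "integrable cell_measure ?w"
    proof (rule cell_integrable[where R = R and B = "3 * \<bar>M\<bar> * B"])
      have "{p::spt. \<bar>fst (snd p)\<bar> > R} \<in> sets borel"
        by (intro borel_open open_Collect_less continuous_intros)
      then have "?w \<in> borel_measurable borel" by (intro measurable_If) auto
      then show "?w \<in> borel_measurable cell_measure"
        by (intro measurable_restrict_space1 measurable_completion) simp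
    qed (use B0 in auto)
    show "AE p in cell_measure. (\<lambda>n. ?h (F n) p) \<longlonglongrightarrow> ?h f p"
      using f(2) by eventually_elim (intro tendsto_intros dFlim bas)
    show "AE p in cell_measure. norm (?h (F n) p) \<le> ?w p" for n
    proof (intro AE_I2)
      fix p assume "p \<in> space cell_measure"
      then have p: "p \<in> slab_cell" by simp
      obtain t x1 x2 where [simp]: "p = (t, x1, x2)" by (cases p)
      have m: "\<bar>F0 p\<bar> \<le> \<bar>M\<bar>" "\<bar>F1 p\<bar> \<le> \<bar>M\<bar>" "\<bar>F2 p\<bar> \<le> \<bar>M\<bar>" using bd(1-3)[OF p] by auto
      have "\<bar>F0 p * dt (F n) p\<bar> \<le> \<bar>M\<bar> * B" "\<bar>F1 p * dx1 (F n) p\<bar> \<le> \<bar>M\<bar> * B" "\<bar>F2 p * dx2 (F n) p\<bar> \<le> \<bar>M\<bar> * B"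
        unfolding abs_mult by (intro mult_mono m dFB bas; simp)+
      then show "norm (?h (F n) p) \<le> ?w p"
        using dF0[of x1 _ n t x2] bas by auto
    qed
  qed
  have 2: "(\<lambda>n. \<integral>x. G x * F n (0, x) \<partial>slice_measure) \<longlonglongrightarrow> (\<integral>x. G x * f (0, x) \<partial>slice_measure)"
  proof (rule integral_dominated_convergence[where w = ?w'])
    have c: "continuous_on UNIV (\<lambda>x. g (0, x))" if "continuous_on UNIV g" for g :: "spt \<Rightarrow> real"
      by (rule continuous_on_compose2[OF that]) (auto intro!: continuous_intros)
    have "continuous_on UNIV f" using f(1) lipschitz_test_continuous unfolding lipschitz_test_def by blast
    then have "(\<lambda>x. f (0, x)) \<in> borel_measurable slice_measure"
      by (intro continuous_measurable_lebesgue_on c)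
    then show "(\<lambda>x. G x * f (0, x)) \<in> borel_measurable slice_measure" using meas by measurable
    have "Ck_on 0 UNIV (F n)" for n using sm unfolding smooth_on_def by blast
    then have "(\<lambda>x. F n (0, x)) \<in> borel_measurable slice_measure" for n
      by (intro continuous_measurable_lebesgue_on c) simp
    then show "(\<lambda>x. G x * F n (0, x)) \<in> borel_measurable slice_measure" for n using meas by measurable
    show "integrable slice_measure ?w'"
    proof (rule slice_integrable[where R = R and B = "\<bar>M\<bar> * B"])
      have "{p::real \<times> real. \<bar>fst p\<bar> > R} \<in> sets borel"
        by (intro borel_open open_Collect_less continuous_intros)
      then have "?w' \<in> borel_measurable borel" by (intro measurable_If) auto
      then show "?w' \<in> borel_measurable slice_measure"
        by (intro measurable_restrict_space1 measurable_completion) simp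
    qed (use B0 in auto)
    show "AE x in slice_measure. (\<lambda>n. G x * F n (0, x)) \<longlonglongrightarrow> G x * f (0, x)"
      by (intro AE_I2 tendsto_intros Flim)
    show "AE x in slice_measure. norm (G x * F n (0, x)) \<le> ?w' x" for n
      using bd(4)
    proof eventually_elim
      fix x :: "real \<times> real" assume g: "\<bar>G x\<bar> \<le> M"
      obtain x1 x2 where [simp]: "x = (x1, x2)" by (cases x)
      have "\<bar>G x * F n (0, x)\<bar> \<le> \<bar>M\<bar> * B" unfolding abs_mult using g by (intro mult_mono FB) auto
      then show "norm (G x * F n (0, x)) \<le> ?w' x" using F0[of x1 n 0 x2] by auto
    qed
  qed
  have "(\<lambda>n. weak_form F0 F1 F2 G (F n)) \<longlonglongrightarrow> weak_form F0 F1 F2 G f"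
    unfolding weak_form_def cell_set_integral slice_set_integral by (intro tendsto_add 1 2)
  then show ?thesis using tF apx unfolding test_approximation_def by blast
qed

lemma dird_curve:
  fixes f :: "'a::euclidean_space \<Rightarrow> 'b::real_normed_vector"
  assumes "f differentiable (at (g s))" "(g has_vector_derivative b) (at s within S)"
  shows "((\<lambda>s. f (g s)) has_vector_derivative dird b f (g s)) (at s within S)"
proof -
  have "(f has_derivative frechet_derivative f (at (g s))) (at (g s) within g ` S)"
    using assms(1) frechet_derivative_works has_derivative_at_withinI by blast
  from vector_derivative_diff_chain_within[OF assms(2) this]
  show ?thesis by (simp add: dird_def o_def)
qed

lemma cell_HK_integral:
  fixes g :: "spt \<Rightarrow> real"
  assumes g: "continuous_on UNIV g" and R: "\<And>t x1 x2. \<bar>x1\<bar> > R \<Longrightarrow> g (t, x1, x2) = 0"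
  shows "(LINT p:slab_cell|lebesgue. g p) = integral (cbox (0, (-R, 0)) (1, (R, 2 * pi))) g"
proof -
  let ?K = "cbox (0, (-R, 0)) (1, (R, 2 * pi)) :: spt set"
  have "bounded (g ` ?K)"
    by (intro compact_imp_bounded compact_continuous_image continuous_on_subset[OF g]) auto
  then obtain B where B: "\<And>p. p \<in> ?K \<Longrightarrow> \<bar>g p\<bar> \<le> B" unfolding bounded_iff by auto
  have K: "p \<in> ?K" if "p \<in> slab_cell" "g p \<noteq> 0" for p
  proof -
    have "\<bar>fst (snd p)\<bar> \<le> R"
      using that R[of "fst (snd p)" "fst p" "snd (snd p)"] by (intro leI notI) auto
    then show ?thesis using that by (cases p) (auto simp: slab_cell_def abs_le_iff)
  qed
  have "integrable cell_measure g"
  proof (rule cell_integrable[where B = "max B 0" and R = R])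
    show "norm (g p) \<le> max B 0" if "p \<in> slab_cell" for p
      using K[OF that] B[of p] by (cases "g p = 0") (auto simp: max_def)
  qed (use g R in \<open>auto intro: continuous_measurable_lebesgue_on\<close>)
  then have "set_integrable lebesgue slab_cell g"
    using slab_cell_sets unfolding set_integrable_def by (simp add: integrable_restrict_space)
  then have "(LINT p:slab_cell|lebesgue. g p) = integral slab_cell g"
    by (rule set_lebesgue_integral_eq_integral)
  also have "\<dots> = integral ?K g"
  proof (rule integral_spike_set)
    have "{p \<in> slab_cell - ?K. g p \<noteq> 0} = {}" using K by auto
    then show "negligible {p \<in> slab_cell - ?K. g p \<noteq> 0}" by (simp only: negligible_empty)
    have "{p \<in> ?K - slab_cell. g p \<noteq> 0} \<subseteq> {p. p \<bullet> (1,0,0) = 0} \<union> {p. p \<bullet> (1,0,0) = 1} \<union> {p. p \<bullet> (0,0,1) = 2 * pi}"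
      by (auto simp: slab_cell_def)
    moreover have "negligible ({p::spt. p \<bullet> (1,0,0) = 0} \<union> {p. p \<bullet> (1,0,0) = 1} \<union> {p. p \<bullet> (0,0,1) = 2 * pi})"
      by (intro negligible_Un negligible_standard_hyperplane) (auto simp: Basis_spt)
    ultimately show "negligible {p \<in> ?K - slab_cell. g p \<noteq> 0}" using negligible_subset by blast
  qed
  finally show ?thesis .
qed

lemma slice_HK_integral:
  fixes g :: "real \<times> real \<Rightarrow> real"
  assumes g: "continuous_on UNIV g" and R: "\<And>x1 x2. \<bar>x1\<bar> > R \<Longrightarrow> g (x1, x2) = 0"
  shows "(LINT p:slice_cell|lebesgue. g p) = integral (cbox (-R, 0) (R, 2 * pi)) g"
proof -
  let ?K = "cbox (-R, 0) (R, 2 * pi) :: (real \<times> real) set"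
  have "bounded (g ` ?K)"
    by (intro compact_imp_bounded compact_continuous_image continuous_on_subset[OF g]) auto
  then obtain B where B: "\<And>p. p \<in> ?K \<Longrightarrow> \<bar>g p\<bar> \<le> B" unfolding bounded_iff by auto
  have K: "p \<in> ?K" if "p \<in> slice_cell" "g p \<noteq> 0" for p
  proof -
    have "\<bar>fst p\<bar> \<le> R"
      using that R[of "fst p" "snd p"] by (intro leI notI) auto
    then show ?thesis using that by (cases p) (auto simp: slice_cell_def abs_le_iff)
  qed
  have "integrable slice_measure g"
  proof (rule slice_integrable[where B = "max B 0" and R = R])
    show "norm (g p) \<le> max B 0" if "p \<in> slice_cell" for p
      using K[OF that] B[of p] by (cases "g p = 0") (auto simp: max_def)
  qed (use g R in \<open>auto intro: continuous_measurable_lebesgue_on\<close>)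
  then have "set_integrable lebesgue slice_cell g"
    using slice_cell_sets unfolding set_integrable_def by (simp add: integrable_restrict_space)
  then have "(LINT p:slice_cell|lebesgue. g p) = integral slice_cell g"
    by (rule set_lebesgue_integral_eq_integral)
  also have "\<dots> = integral ?K g"
  proof (rule integral_spike_set)
    have "{p \<in> slice_cell - ?K. g p \<noteq> 0} = {}" using K by auto
    then show "negligible {p \<in> slice_cell - ?K. g p \<noteq> 0}" by (simp only: negligible_empty)
    have "{p \<in> ?K - slice_cell. g p \<noteq> 0} \<subseteq> {p. p \<bullet> (0,1) = 2 * pi}"
      by (auto simp: slice_cell_def)
    moreover have "negligible {p::real \<times> real. p \<bullet> (0,1) = 2 * pi}"
      by (intro negligible_standard_hyperplane) (auto simp: Basis_prod_def)
    ultimately show "negligible {p \<in> ?K - slice_cell. g p \<noteq> 0}" using negligible_subset by blast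
  qed
  finally show ?thesis .
qed

text \<open>Constants solve the equation. The three identities are the fundamental theorem of calculus in one variable and
  Fubini; boundary terms vanish by the support in \<open>t\<close> and \<open>x\<^sub>1\<close> and cancel by periodicity in \<open>x\<^sub>2\<close>. They are stated as weak
  forms so that they extend to Lipschitz functions in the same way as the Euler equations do.\<close>

lemma smooth_divergence:
  assumes \<zeta>: "test_function \<zeta>"
  shows "weak_form (\<lambda>_. 1) (\<lambda>_. 0) (\<lambda>_. 0) (\<lambda>_. 1) \<zeta> = 0"
    "weak_form (\<lambda>_. 0) (\<lambda>_. 1) (\<lambda>_. 0) (\<lambda>_. 0) \<zeta> = 0"
    "weak_form (\<lambda>_. 0) (\<lambda>_. 0) (\<lambda>_. 1) (\<lambda>_. 0) \<zeta> = 0"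
proof -
  obtain T R0 where sm: "smooth_on UNIV \<zeta>" and per: "periodic \<zeta>" and T: "T < 1" and
    supp0: "\<And>t x1 x2. t > T \<or> \<bar>x1\<bar> > R0 \<Longrightarrow> \<zeta> (t, x1, x2) = 0"
    using \<zeta> unfolding test_function_def by blast
  define R where "R = \<bar>R0\<bar> + 1"
  have R: "R > 0" by (simp add: R_def)
  have supp: "\<zeta> (t, x1, x2) = 0" if "t > T \<or> \<bar>x1\<bar> \<ge> R" for t x1 x2
  proof -
    have "t > T \<or> \<bar>x1\<bar> > R0" using that unfolding R_def by linarith
    then show ?thesis by (rule supp0)
  qed
  have bas: "(1,0,0) \<in> (Basis :: spt set)" "(0,1,0) \<in> (Basis :: spt set)" "(0,0,1) \<in> (Basis :: spt set)"
    by (auto simp: Basis_spt)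
  have diff: "\<zeta> differentiable (at p)" for p
    using Ck_on_Suc_dird(1)[of 0 \<zeta> _ p] sm bas unfolding smooth_on_def by blast
  have cont: "continuous_on UNIV \<zeta>" using sm unfolding smooth_on_def by (metis Ck_on.simps(1))
  note dc = smooth_dird_continuous[OF sm]
  have d0: "dird b \<zeta> (t, x1, x2) = 0" if x: "\<bar>x1\<bar> > R" for b t x1 x2
  proof -
    let ?U = "{p::spt. \<bar>fst (snd p)\<bar> > R}"
    have "open ?U" by (intro open_Collect_less continuous_intros)
    then have "(\<zeta> has_derivative (\<lambda>h. 0)) (at (t, x1, x2))"
      by (rule has_derivative_transform_within_open[OF has_derivative_const]) (use x supp in auto)
    then show ?thesis unfolding dird_def using frechet_derivative_at by metis
  qed
  let ?c = "(-R, 0) :: real \<times> real" and ?d = "(R, 2 * pi) :: real \<times> real"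
  have ftc_t: "integral {0..1} (\<lambda>t. dt \<zeta> (t, x)) = - \<zeta> (0, x)" for x
  proof -
    have "((\<lambda>t. dt \<zeta> (t, x)) has_integral \<zeta> (1, x) - \<zeta> (0, x)) {0..1}"
    proof (rule fundamental_theorem_of_calculus)
      fix t :: real
      have "((\<lambda>t. (t, x)) has_vector_derivative (1, 0, 0)) (at t within {0..1})"
        by (auto intro!: derivative_eq_intros has_vector_derivative_Pair simp: zero_prod_def)
      from dird_curve[OF diff this]
      show "((\<lambda>t. \<zeta> (t, x)) has_vector_derivative dt \<zeta> (t, x)) (at t within {0..1})" .
    qed simp
    moreover have "\<zeta> (1, x) = 0" using supp[of 1] T by (cases x) auto
    ultimately show ?thesis by (simp add: integral_unique)
  qed
  have ftc_1: "integral {-R..R} (\<lambda>x1. dx1 \<zeta> (t, x1, x2)) = 0" for t x2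
  proof -
    have "((\<lambda>x1. dx1 \<zeta> (t, x1, x2)) has_integral \<zeta> (t, R, x2) - \<zeta> (t, - R, x2)) {-R..R}"
    proof (rule fundamental_theorem_of_calculus)
      fix x :: real
      have "((\<lambda>x. (t, x, x2)) has_vector_derivative (0, 1, 0)) (at x within {-R..R})"
        by (auto intro!: derivative_eq_intros has_vector_derivative_Pair simp: zero_prod_def)
      from dird_curve[OF diff this]
      show "((\<lambda>x. \<zeta> (t, x, x2)) has_vector_derivative dx1 \<zeta> (t, x, x2)) (at x within {-R..R})" .
    qed (use R in simp)
    then show ?thesis using R supp[of t R x2] supp[of t "-R" x2] by (simp add: integral_unique)
  qed
  have ftc_2: "integral {0..2 * pi} (\<lambda>x2. dx2 \<zeta> (t, x1, x2)) = 0" for t x1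
  proof -
    have "((\<lambda>x2. dx2 \<zeta> (t, x1, x2)) has_integral \<zeta> (t, x1, 2 * pi) - \<zeta> (t, x1, 0)) {0..2 * pi}"
    proof (rule fundamental_theorem_of_calculus)
      fix x :: real
      have "((\<lambda>x. (t, x1, x)) has_vector_derivative (0, 0, 1)) (at x within {0..2 * pi})"
        by (auto intro!: derivative_eq_intros has_vector_derivative_Pair simp: zero_prod_def)
      from dird_curve[OF diff this]
      show "((\<lambda>x. \<zeta> (t, x1, x)) has_vector_derivative dx2 \<zeta> (t, x1, x)) (at x within {0..2 * pi})" .
    qed simp
    moreover have "\<zeta> (t, x1, 2 * pi) = \<zeta> (t, x1, 0)"
      using per[unfolded periodic_def, rule_format, of t x1 0] by simp
    ultimately show ?thesis by (simp add: integral_unique)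
  qed
  have cell: "(LINT p:slab_cell|lebesgue. dird b \<zeta> p) = integral {0..1} (\<lambda>t. integral (cbox ?c ?d) (\<lambda>x. dird b \<zeta> (t, x)))"
    if b: "b \<in> Basis" for b
  proof -
    have "(LINT p:slab_cell|lebesgue. dird b \<zeta> p) = integral (cbox (0, ?c) (1, ?d)) (dird b \<zeta>)"
      by (rule cell_HK_integral[OF dc[OF b] d0])
    also have "\<dots> = integral (cbox 0 1) (\<lambda>t. integral (cbox ?c ?d) (\<lambda>x. dird b \<zeta> (t, x)))"
      by (intro integral_prod_continuous continuous_on_subset[OF dc[OF b]]) auto
    finally show ?thesis by simp
  qed
  have ct: "continuous_on UNIV (\<lambda>x. dird b \<zeta> (t, x))" if "b \<in> Basis" for b t
    by (rule continuous_on_compose2[OF dc[OF that]]) (auto intro!: continuous_intros)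
  have "(LINT p:slab_cell|lebesgue. dt \<zeta> p) = integral (cbox ?c ?d) (\<lambda>x. integral (cbox 0 1) (\<lambda>t. dt \<zeta> (t, x)))"
    unfolding cell[OF bas(1)] cbox_interval[symmetric]
    by (rule integral_swap_continuous) (auto intro!: continuous_on_subset[OF dc[OF bas(1)]] simp: case_prod_beta)
  also have "\<dots> = - integral (cbox ?c ?d) (\<lambda>x. \<zeta> (0, x))"
    by (simp add: ftc_t)
  also have "integral (cbox ?c ?d) (\<lambda>x. \<zeta> (0, x)) = (LINT x:slice_cell|lebesgue. \<zeta> (0, x))"
  proof (rule slice_HK_integral[symmetric])
    show "continuous_on UNIV (\<lambda>x. \<zeta> (0, x))"
      by (rule continuous_on_compose2[OF cont]) (auto intro!: continuous_intros)
  qed (use supp in auto)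
  finally show "weak_form (\<lambda>_. 1) (\<lambda>_. 0) (\<lambda>_. 0) (\<lambda>_. 1) \<zeta> = 0" by (simp add: weak_form_def)
  have "integral (cbox ?c ?d) (\<lambda>x. dx1 \<zeta> (t, x)) = 0" for t
  proof -
    have "integral (cbox ?c ?d) (\<lambda>x. dx1 \<zeta> (t, x)) = integral (cbox (-R) R) (\<lambda>x1. integral (cbox 0 (2 * pi)) (\<lambda>x2. dx1 \<zeta> (t, x1, x2)))"
      by (intro integral_prod_continuous continuous_on_subset[OF ct] bas) auto
    also have "\<dots> = integral (cbox 0 (2 * pi)) (\<lambda>x2. integral (cbox (-R) R) (\<lambda>x1. dx1 \<zeta> (t, x1, x2)))"
      by (rule integral_swap_continuous) (auto intro!: continuous_on_subset[OF ct] bas simp: case_prod_beta)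
    finally show ?thesis by (simp add: ftc_1)
  qed
  then show "weak_form (\<lambda>_. 0) (\<lambda>_. 1) (\<lambda>_. 0) (\<lambda>_. 0) \<zeta> = 0"
    using cell[OF bas(2)] by (simp add: weak_form_def)
  have "integral (cbox ?c ?d) (\<lambda>x. dx2 \<zeta> (t, x)) = 0" for t
  proof -
    have "integral (cbox ?c ?d) (\<lambda>x. dx2 \<zeta> (t, x)) = integral (cbox (-R) R) (\<lambda>x1. integral (cbox 0 (2 * pi)) (\<lambda>x2. dx2 \<zeta> (t, x1, x2)))"
      by (intro integral_prod_continuous continuous_on_subset[OF ct] bas) auto
    then show ?thesis by (simp add: ftc_2)
  qed
  then show "weak_form (\<lambda>_. 0) (\<lambda>_. 0) (\<lambda>_. 1) (\<lambda>_. 0) \<zeta> = 0"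
    using cell[OF bas(3)] by (simp add: weak_form_def)
qed

lemma weak_form_lipschitz:
  assumes "lipschitz_test f" "AE p in cell_measure. f differentiable (at p)"
    "F0 \<in> borel_measurable cell_measure" "F1 \<in> borel_measurable cell_measure"
    "F2 \<in> borel_measurable cell_measure" "G \<in> borel_measurable slice_measure"
    "\<And>p. p \<in> slab_cell \<Longrightarrow> \<bar>F0 p\<bar> \<le> M" "\<And>p. p \<in> slab_cell \<Longrightarrow> \<bar>F1 p\<bar> \<le> M"
      "\<And>p. p \<in> slab_cell \<Longrightarrow> \<bar>F2 p\<bar> \<le> M" "AE x in slice_measure. \<bar>G x\<bar> \<le> M"
  shows "(\<And>\<zeta>. test_function \<zeta> \<Longrightarrow> weak_form F0 F1 F2 G \<zeta> = 0) \<Longrightarrow> weak_form F0 F1 F2 G f = 0"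
    "(\<forall>\<zeta>. test_function \<zeta> \<longrightarrow> (\<forall>p. 0 \<le> \<zeta> p) \<longrightarrow> 0 \<le> weak_form F0 F1 F2 G \<zeta>) \<Longrightarrow> (\<forall>p. 0 \<le> f p) \<Longrightarrow>
      0 \<le> weak_form F0 F1 F2 G f"
proof -
  obtain F where F: "\<And>n. test_function (F n)" "(\<forall>p. 0 \<le> f p) \<Longrightarrow> (\<forall>n p. 0 \<le> F n p)"
    "(\<lambda>n. weak_form F0 F1 F2 G (F n)) \<longlonglongrightarrow> weak_form F0 F1 F2 G f"
    using weak_form_limit[OF assms] by blast
  show "weak_form F0 F1 F2 G f = 0" if "\<And>\<zeta>. test_function \<zeta> \<Longrightarrow> weak_form F0 F1 F2 G \<zeta> = 0"
    using F(3) LIMSEQ_unique[OF _ tendsto_const] by (simp add: that[OF F(1)])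
  show "0 \<le> weak_form F0 F1 F2 G f" if "\<forall>\<zeta>. test_function \<zeta> \<longrightarrow> (\<forall>p. 0 \<le> \<zeta> p) \<longrightarrow> 0 \<le> weak_form F0 F1 F2 G \<zeta>"
    "\<forall>p. 0 \<le> f p"
    by (rule LIMSEQ_le_const[OF F(3)]) (use that F(1,2) in blast)
qed

section \<open>Lipschitz bounds across finitely many graphs\<close>

text \<open>Sard's theorem on the line, from its version for Euclidean spaces of equal dimension, where the real line is the
  space of vectors with one entry.\<close>

lemma critical_values_negligible:
  fixes g :: "real \<Rightarrow> real"
  assumes "\<And>s. s \<in> S \<Longrightarrow> (g has_real_derivative 0) (at s within S)"
  shows "negligible (g ` S)"
proof -
  define S' :: "(real^1) set" where "S' = vec ` S"
  define G :: "real^1 \<Rightarrow> real^1" where "G x = vec (g (x $ 1))" for x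
  have "negligible (G ` S')"
  proof (rule baby_Sard)
    fix x assume x: "x \<in> S'"
    then have xs: "x $ 1 \<in> S" by (auto simp: S'_def)
    have "(\<lambda>x. x $ 1) ` S' = S" by (auto simp: S'_def image_image)
    moreover have "((\<lambda>x::real^1. x $ 1) has_derivative (\<lambda>h. h $ 1)) (at x within S')"
      by (intro bounded_linear_imp_has_derivative bounded_linear_vec_nth)
    moreover have "(g has_derivative (\<lambda>h. 0)) (at (x $ 1) within S)"
      using assms[OF xs] unfolding has_field_derivative_def by (rule has_derivative_eq_rhs) auto
    ultimately have "((\<lambda>x. g (x $ 1)) has_derivative (\<lambda>h. 0)) (at x within S')"
      using diff_chain_within[of "\<lambda>x. x $ 1" "\<lambda>h. h $ 1" x S' g "\<lambda>h. 0"] by (simp add: o_def)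
    then have "((\<lambda>x. g (x $ 1) *\<^sub>R (1::real^1)) has_derivative (\<lambda>h. 0 *\<^sub>R 1)) (at x within S')"
      by (rule has_derivative_scaleR_left)
    moreover have "g (x $ 1) *\<^sub>R (1::real^1) = G x" for x by (simp add: G_def vec_eq_iff)
    ultimately show "(G has_derivative (\<lambda>h. 0)) (at x within S')" by simp
    show "rank (matrix (\<lambda>h::real^1. 0::real^1)) < CARD(1)"
    proof -
      have "matrix (\<lambda>h::real^1. 0::real^1) = 0" by (simp add: matrix_def vec_eq_iff)
      then show ?thesis by simp
    qed
  qed simp
  then have "negligible ((\<lambda>x. x $ 1) ` G ` S')"
    by (rule negligible_differentiable_image_negligible[rotated])
       (auto intro!: linear_imp_differentiable_on linearI)
  also have "(\<lambda>x. x $ 1) ` G ` S' = g ` S" by (auto simp: S'_def G_def image_image)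
  finally show ?thesis .
qed

text \<open>An accumulation point of the level set would be a point of the level set with derivative zero.\<close>

lemma regular_level_finite:
  fixes g g' :: "real \<Rightarrow> real"
  assumes d: "\<And>s. s \<in> {0..1} \<Longrightarrow> (g has_real_derivative g' s) (at s within {0..1})"
    and r: "\<And>s. s \<in> {0..1} \<Longrightarrow> g s = a \<Longrightarrow> g' s \<noteq> 0"
  shows "finite {s \<in> {0..1}. g s = a}"
proof (rule ccontr)
  let ?K = "{s \<in> {0..1}. g s = a}"
  assume "infinite ?K"
  then obtain l where l: "l \<in> {0..1}" "l islimpt ?K"
    using compact_eq_Bolzano_Weierstrass[of "{0..1::real}"] by auto
  have c: "continuous_on {0..1} g" using d DERIV_continuous_on by blast
  have "closed ({0..1} \<inter> g -` {a})" using c by (rule continuous_closed_preimage) auto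
  moreover have "{0..1} \<inter> g -` {a} = ?K" by auto
  ultimately have "l \<in> ?K" using l(2) closed_limpt by metis
  then have gl: "g l = a" by simp
  have "((\<lambda>s. (g s - g l) / (s - l)) \<longlongrightarrow> g' l) (at l within {0..1})"
    using d[OF l(1)] by (simp add: has_field_derivative_iff)
  then have "\<forall>\<^sub>F s in at l within {0..1}. (g s - g l) / (s - l) \<noteq> 0"
    using r[OF l(1) gl] by (rule tendsto_imp_eventually_ne)
  then have "\<forall>\<^sub>F s in at l. s \<notin> ?K"
    unfolding eventually_at_filter by eventually_elim (use gl in auto)
  then show False using l(2) by (simp add: islimpt_iff_eventually)
qed

definition off_graphs :: "(real \<times> real \<Rightarrow> real) set \<Rightarrow> spt set" where
  "off_graphs \<Phi> = {(t, x1, x2). 0 < t \<and> t < 1 \<and> (\<forall>\<phi>\<in>\<Phi>. x1 \<noteq> \<phi> (t, x2))}"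

text \<open>A segment may run along one of the graphs or meet it infinitely often. By Sard's theorem this does not happen after
  a suitable arbitrarily small shift in the \<open>x\<^sub>1\<close>-direction: the shifted segment meets each graph finitely often, the
  fundamental theorem of calculus with finitely many exceptional points bounds the increment along it, and continuity of
  \<open>f\<close> removes the shift.\<close>

lemma lipschitz_off_graphs:
  fixes f :: "spt \<Rightarrow> real"
  assumes fin: "finite \<Phi>" and \<Phi>: "\<And>\<phi>. \<phi> \<in> \<Phi> \<Longrightarrow> \<phi> differentiable_on ({0..1} \<times> UNIV)"
    and f: "continuous_on {p. 0 < fst p \<and> fst p < 1} f"
    and L: "\<And>p. p \<in> off_graphs \<Phi> \<Longrightarrow> f differentiable (at p)"
      "\<And>p h. p \<in> off_graphs \<Phi> \<Longrightarrow> \<bar>frechet_derivative f (at p) h\<bar> \<le> L * norm h" "0 \<le> L"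
    and p: "0 < fst p" "fst p < 1" and q: "0 < fst q" "fst q < 1"
  shows "\<bar>f q - f p\<bar> \<le> L * norm (q - p)"
proof -
  obtain t x1 x2 where p': "p = (t, x1, x2)" by (cases p)
  obtain u y1 y2 where q': "q = (u, y1, y2)" by (cases q)
  define T X Y where "T s = t + s * (u - t)" and "X s = x1 + s * (y1 - x1)" and "Y s = x2 + s * (y2 - x2)" for s
  have T: "0 < T s" "T s < 1" if "s \<in> {0..1}" for s
  proof -
    have "T s = (1 - s) * t + s * u" by (simp add: T_def algebra_simps)
    moreover have "0 < (1 - s) * t + s * u" "(1 - s) * t + s * u < 1"
      using that p q convex_bound_lt[of t 1 u "1 - s" s] convex_bound_lt[of "- t" 0 "- u" "1 - s" s]
      by (auto simp: p' q')
    ultimately show "0 < T s" "T s < 1" by auto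
  qed
  \<comment> \<open>The signed height of each graph over the segment; a shift by \<open>a\<close> meets the graph where this height is \<open>a\<close>.\<close>
  define g where "g \<phi> s = \<phi> (T s, Y s) - X s" for \<phi> s
  have "\<exists>g'. \<forall>s\<in>{0..1}. (g \<phi> has_real_derivative g' s) (at s within {0..1})" if "\<phi> \<in> \<Phi>" for \<phi>
  proof (rule bchoice, rule ballI)
    fix s :: real assume s: "s \<in> {0..1}"
    have "\<phi> differentiable (at (T s, Y s) within {0..1} \<times> UNIV)"
      using \<Phi>[OF that] T[OF s] unfolding differentiable_on_def by auto
    then obtain D where "(\<phi> has_derivative D) (at (T s, Y s) within {0..1} \<times> UNIV)"
      by (auto simp: differentiable_def)
    then have D: "(\<phi> has_derivative D) (at (T s, Y s) within (\<lambda>s. (T s, Y s)) ` {0..1})"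
      by (rule has_derivative_subset) (use less_imp_le[OF T(1)] less_imp_le[OF T(2)] in \<open>clarsimp\<close>)
    have "((\<lambda>s. (T s, Y s)) has_vector_derivative (u - t, y2 - x2)) (at s within {0..1})"
      unfolding T_def Y_def by (auto intro!: derivative_eq_intros has_vector_derivative_Pair)
    from vector_derivative_diff_chain_within[OF this D]
    have "((\<lambda>s. \<phi> (T s, Y s)) has_real_derivative D (u - t, y2 - x2)) (at s within {0..1})"
      by (simp add: o_def has_real_derivative_iff_has_vector_derivative)
    moreover have "(X has_real_derivative (y1 - x1)) (at s within {0..1})"
      unfolding X_def by (auto intro!: derivative_eq_intros)
    ultimately show "\<exists>d. (g \<phi> has_real_derivative d) (at s within {0..1})"
      unfolding g_def using DERIV_diff by blast
  qed
  then obtain g' where g': "\<And>\<phi> s. \<phi> \<in> \<Phi> \<Longrightarrow> s \<in> {0..1} \<Longrightarrow> (g \<phi> has_real_derivative g' \<phi> s) (at s within {0..1})"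
    by metis
  \<comment> \<open>Shifts for which the segment may touch a graph instead of crossing it.\<close>
  define Bad where "Bad = (\<Union>\<phi>\<in>\<Phi>. g \<phi> ` {s \<in> {0..1}. g' \<phi> s = 0})"
  have "negligible Bad"
    unfolding Bad_def
  proof (intro negligible_Union ballI finite_imageI fin, clarify)
    fix \<phi> assume "\<phi> \<in> \<Phi>"
    then show "negligible (g \<phi> ` {s \<in> {0..1}. g' \<phi> s = 0})"
      by (intro critical_values_negligible) (metis (mono_tags, lifting) DERIV_subset g' mem_Collect_eq subsetI)
  qed
  then have "\<exists>a\<in>ball 0 (1 / real (Suc n)). a \<notin> Bad" for n
    using open_not_negligible[of "ball (0::real) (1 / real (Suc n))"] negligible_subset[of Bad "ball 0 (1 / real (Suc n))"]
    by auto
  then obtain a where a: "\<And>n. \<bar>a n\<bar> < 1 / real (Suc n)" "\<And>n. a n \<notin> Bad"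
    by (metis dist_0_norm mem_ball real_norm_def)
  have alim: "a \<longlonglongrightarrow> 0"
    by (rule Lim_null_comparison[OF _ LIMSEQ_Suc[OF lim_const_over_n[of 1]]])
       (use a(1) in \<open>auto intro!: always_eventually less_imp_le\<close>)
  have shifted: "\<bar>f (u, y1 + a n, y2) - f (t, x1 + a n, x2)\<bar> \<le> L * norm (q - p)" for n
  proof -
    define c where "c s = (T s, X s + a n, Y s)" for s
    define K where "K = (\<Union>\<phi>\<in>\<Phi>. {s \<in> {0..1}. g \<phi> s = a n})"
    have "finite K"
      unfolding K_def
    proof (intro finite_UN_I fin)
      fix \<phi> assume \<phi>: "\<phi> \<in> \<Phi>"
      show "finite {s \<in> {0..1}. g \<phi> s = a n}"
      proof (rule regular_level_finite[OF g'[OF \<phi>]])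
        fix s :: real assume s: "s \<in> {0..1}" "g \<phi> s = a n"
        show "g' \<phi> s \<noteq> 0"
        proof
          assume "g' \<phi> s = 0"
          then have "g \<phi> s \<in> Bad" using s(1) \<phi> unfolding Bad_def by blast
          then show False using a(2)[of n] s(2) by simp
        qed
      qed
    qed
    have off: "c s \<in> off_graphs \<Phi>" if "s \<in> {0..1} - K" for s
      using that T by (auto simp: off_graphs_def c_def K_def g_def)
    \<comment> \<open>The value at the finitely many crossings is immaterial; zero keeps the bound.\<close>
    define F' where "F' s = (if s \<in> {0..1} - K then dird (q - p) f (c s) else 0)" for s
    have "(F' has_integral f (c 1) - f (c 0)) {0..1}"
    proof (rule fundamental_theorem_of_calculus_interior_strong[OF \<open>finite K\<close>])
      fix s assume s: "s \<in> {0<..<1} - K"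
      have "(c has_vector_derivative (q - p)) (at s)"
        unfolding c_def T_def X_def Y_def p' q' by (auto intro!: derivative_eq_intros has_vector_derivative_Pair)
      moreover have "f differentiable (at (c s))" by (rule L(1)[OF off]) (use s in auto)
      ultimately have "((\<lambda>s. f (c s)) has_vector_derivative dird (q - p) f (c s)) (at s)"
        by (intro dird_curve)
      then show "((\<lambda>s. f (c s)) has_vector_derivative F' s) (at s)" using s by (simp add: F'_def)
    next
      have "continuous_on {0..1} c" unfolding c_def T_def X_def Y_def by (intro continuous_intros)
      then show "continuous_on {0..1} (\<lambda>s. f (c s))"
        by (rule continuous_on_compose2[OF f]) (use T in \<open>auto simp: c_def\<close>)
    qed simp
    moreover have "norm (F' s) \<le> L * norm (q - p)" for s
      using L(2)[OF off, of s "q - p"] L(3) by (auto simp: F'_def dird_def)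
    ultimately have "norm (f (c 1) - f (c 0)) \<le> L * norm (q - p) * measure lborel (cbox 0 (1::real))"
      using L(3) by (intro has_integral_bound[where f = F']) auto
    then show ?thesis by (simp add: c_def T_def X_def Y_def)
  qed
  have V: "open {p::spt. 0 < fst p \<and> fst p < 1}"
    by (intro open_Collect_conj open_Collect_less continuous_intros)
  have lim: "(\<lambda>n. f (t, x1 + a n, x2)) \<longlonglongrightarrow> f (t, x1, x2)" if "0 < t" "t < 1" for t x1 x2
  proof (rule isCont_tendsto_compose[of "(t, x1, x2)"])
    show "isCont f (t, x1, x2)" using f V that by (simp add: continuous_on_eq_continuous_at)
    have "(\<lambda>n. (t, x1 + a n, x2)) \<longlonglongrightarrow> (t, x1 + 0, x2)" by (intro tendsto_intros alim)
    then show "(\<lambda>n. (t, x1 + a n, x2)) \<longlonglongrightarrow> (t, x1, x2)" by simp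
  qed
  have "(\<lambda>n. \<bar>f (u, y1 + a n, y2) - f (t, x1 + a n, x2)\<bar>) \<longlonglongrightarrow> \<bar>f q - f p\<bar>"
    using p q unfolding p' q' by (intro tendsto_intros lim) auto
  then show ?thesis by (rule LIMSEQ_le_const2) (use shifted in blast)
qed

text \<open>Test functions live on all of space-time, solutions only for times in \<open>{0..1}\<close>. Freezing the time outside this
  interval extends a function and keeps its Lipschitz constant.\<close>

definition clamp_time :: "spt \<Rightarrow> spt" where
  "clamp_time p = (max 0 (min 1 (fst p)), snd p)"

lemma clamp_lipschitz:
  assumes f: "continuous_on slab f"
    and L: "\<And>p q. 0 < fst p \<Longrightarrow> fst p < 1 \<Longrightarrow> 0 < fst q \<Longrightarrow> fst q < 1 \<Longrightarrow> \<bar>f q - f p\<bar> \<le> L * norm (q - p)"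
    and L0: "0 \<le> (L::real)"
  shows "\<bar>f (clamp_time q) - f (clamp_time p)\<bar> \<le> L * norm (q - p)"
proof -
  define r where "r n p = ((1 - 1 / real (Suc (Suc n))) * fst (clamp_time p) + 1 / real (Suc (Suc n)) * (1/2), snd p)" for n and p :: spt
  have k: "fst (clamp_time p) \<ge> 0" "fst (clamp_time p) \<le> 1" for p by (auto simp: clamp_time_def)
  have r01: "0 < fst (r n p) \<and> fst (r n p) < 1" for n p
  proof -
    define s where "s = 1 / real (Suc (Suc n))"
    have s: "0 < s" "s < 1" by (auto simp: s_def)
    define y where "y = (1 - s) * fst (clamp_time p)"
    have "0 \<le> y" "y \<le> (1 - s) * 1"
      using k[of p] s unfolding y_def by (auto intro!: mult_left_mono)
    then show ?thesis using s unfolding r_def s_def[symmetric] fst_conv y_def[symmetric] by auto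
  qed
  have rn: "norm (r n q - r n p) \<le> norm (q - p)" for n
  proof -
    define s where "s = 1 / real (Suc (Suc n))"
    have s: "0 < s" "s < 1" by (auto simp: s_def)
    have "fst (r n q - r n p) = (1 - s) * (fst (clamp_time q) - fst (clamp_time p))"
      unfolding r_def s_def[symmetric] by (simp add: algebra_simps)
    then have "\<bar>fst (r n q - r n p)\<bar> = (1 - s) * \<bar>fst (clamp_time q) - fst (clamp_time p)\<bar>"
      using s by (simp add: abs_mult)
    also have "\<dots> \<le> 1 * \<bar>fst q - fst p\<bar>"
    proof (rule mult_mono)
      show "\<bar>fst (clamp_time q) - fst (clamp_time p)\<bar> \<le> \<bar>fst q - fst p\<bar>"
        unfolding clamp_time_def fst_conv by linarith
    qed (use s in auto)
    finally have "\<bar>fst (r n q - r n p)\<bar> \<le> \<bar>fst (q - p)\<bar>" by simp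
    then have "(fst (r n q - r n p))\<^sup>2 \<le> (fst (q - p))\<^sup>2" by (simp only: abs_le_square_iff)
    moreover have "snd (r n q - r n p) = snd (q - p)" by (simp add: r_def)
    ultimately show ?thesis
      by (simp add: norm_prod_def)
  qed
  have rlim: "(\<lambda>n. r n p) \<longlonglongrightarrow> clamp_time p" for p
  proof -
    have "(\<lambda>n. 1 / real (Suc (Suc n))) \<longlonglongrightarrow> 0"
      by (rule LIMSEQ_Suc, rule LIMSEQ_Suc, rule lim_const_over_n)
    then have "(\<lambda>n. r n p) \<longlonglongrightarrow> ((1 - 0) * fst (clamp_time p) + 0 * (1/2), snd p)"
      unfolding r_def by (intro tendsto_intros)
    then show ?thesis by (simp add: clamp_time_def)
  qed
  have flim: "(\<lambda>n. f (r n p)) \<longlonglongrightarrow> f (clamp_time p)" for p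
    by (rule continuous_on_tendsto_compose[OF f rlim])
       (use r01 k in \<open>auto simp: slab_def mem_Times_iff less_imp_le\<close>)
  have "(\<lambda>n. \<bar>f (r n q) - f (r n p)\<bar>) \<longlonglongrightarrow> \<bar>f (clamp_time q) - f (clamp_time p)\<bar>"
    by (intro tendsto_intros flim)
  then show ?thesis
  proof (rule LIMSEQ_le_const2, intro exI allI impI)
    fix n
    have "\<bar>f (r n q) - f (r n p)\<bar> \<le> L * norm (r n q - r n p)" using r01 by (intro L) auto
    also have "\<dots> \<le> L * norm (q - p)" by (intro mult_left_mono rn L0)
    finally show "\<bar>f (r n q) - f (r n p)\<bar> \<le> L * norm (q - p)" .
  qed
qed

section \<open>Functions singular at the edge\<close>

lemma dird_eq: "(f has_derivative D) (at p) \<Longrightarrow> dird b f p = D b"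
  unfolding dird_def using frechet_derivative_at by metis

lemma dird_mult:
  fixes f g :: "'a::euclidean_space \<Rightarrow> real"
  assumes "f differentiable (at p)" "g differentiable (at p)"
  shows "dird b (\<lambda>q. f q * g q) p = dird b f p * g p + f p * dird b g p"
proof -
  have "(f has_derivative frechet_derivative f (at p)) (at p)" "(g has_derivative frechet_derivative g (at p)) (at p)"
    using assms frechet_derivative_works by auto
  from dird_eq[OF has_derivative_mult[OF this]] show ?thesis by (simp add: dird_def)
qed

lemma dird_add:
  fixes f g :: "'a::euclidean_space \<Rightarrow> real"
  assumes "f differentiable (at p)" "g differentiable (at p)"
  shows "dird b (\<lambda>q. f q + g q) p = dird b f p + dird b g p"
proof -
  have "(f has_derivative frechet_derivative f (at p)) (at p)" "(g has_derivative frechet_derivative g (at p)) (at p)"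
    using assms frechet_derivative_works by auto
  from dird_eq[OF has_derivative_add[OF this]] show ?thesis by (simp add: dird_def)
qed

lemma dird_const: "dird b (\<lambda>q. c) p = 0"
  by (rule dird_eq[OF has_derivative_const])

lemma dird_chain:
  fixes f :: "'a::euclidean_space \<Rightarrow> real"
  assumes "f differentiable (at p)" "(g has_real_derivative d) (at (f p))"
  shows "(\<lambda>q. g (f q)) differentiable (at p)" "dird b (\<lambda>q. g (f q)) p = d * dird b f p"
proof -
  have "(f has_derivative frechet_derivative f (at p)) (at p)"
    using assms frechet_derivative_works by auto
  from has_derivative_compose[OF this assms(2)[unfolded has_field_derivative_def]]
  have *: "((\<lambda>q. g (f q)) has_derivative (\<lambda>h. d * frechet_derivative f (at p) h)) (at p)" .
  show "(\<lambda>q. g (f q)) differentiable (at p)" using * by (auto simp: differentiable_def)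
  show "dird b (\<lambda>q. g (f q)) p = d * dird b f p" using dird_eq[OF *] by (simp add: dird_def)
qed

lemma dird_cong_open:
  assumes "open U" "p \<in> U" "\<And>q. q \<in> U \<Longrightarrow> f q = g q"
  shows "f differentiable (at p) \<longleftrightarrow> g differentiable (at p)" "dird b f p = dird b g p"
proof -
  have *: "(f has_derivative D) (at p) \<longleftrightarrow> (g has_derivative D) (at p)" for D
  proof
    show "(g has_derivative D) (at p)" if "(f has_derivative D) (at p)"
      by (rule has_derivative_transform_within_open[OF that assms])
    show "(f has_derivative D) (at p)" if "(g has_derivative D) (at p)"
      by (rule has_derivative_transform_within_open[OF that assms(1,2) assms(3)[symmetric]])
  qed
  show "f differentiable (at p) \<longleftrightarrow> g differentiable (at p)" by (simp add: differentiable_def *)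
  show "dird b f p = dird b g p" by (simp add: dird_def frechet_derivative_def *)
qed

lemma frechet_le_components:
  fixes f :: "spt \<Rightarrow> real"
  assumes "f differentiable (at p)" "\<And>b. b \<in> Basis \<Longrightarrow> \<bar>dird b f p\<bar> \<le> M"
  shows "\<bar>frechet_derivative f (at p) h\<bar> \<le> 3 * M * norm h"
proof -
  let ?D = "frechet_derivative f (at p)"
  have lin: "linear ?D" using assms(1) by (rule linear_frechet_derivative)
  obtain a b c where h: "h = (a, b, c)" by (cases h)
  have "h = a *\<^sub>R (1,0,0) + b *\<^sub>R (0,1,0) + c *\<^sub>R (0,0,1)" by (simp add: h)
  then have "?D h = ?D (a *\<^sub>R (1,0,0) + b *\<^sub>R (0,1,0) + c *\<^sub>R (0,0,1))" by (rule arg_cong)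
  also have "\<dots> = a * dt f p + b * dx1 f p + c * dx2 f p"
    unfolding linear_add[OF lin] linear_scale[OF lin] by (simp add: dird_def)
  finally have "?D h = a * dt f p + b * dx1 f p + c * dx2 f p" .
  moreover have "\<bar>a * dt f p\<bar> \<le> norm h * M" "\<bar>b * dx1 f p\<bar> \<le> norm h * M" "\<bar>c * dx2 f p\<bar> \<le> norm h * M"
    unfolding abs_mult using abs_component_le_norm[of h]
    by (intro mult_mono assms(2); simp add: Basis_spt h)+
  moreover have "3 * M * norm h = norm h * M + norm h * M + norm h * M" by simp
  ultimately show ?thesis by linarith
qed

text \<open>Comparable to the distance from the edge for points with \<open>t \<ge> 0\<close>.\<close>

definition rad :: "spt \<Rightarrow> real" where
  "rad p = \<bar>fst p\<bar> + \<bar>fst (snd p)\<bar>"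

text \<open>Regularity of a rarefaction wave: locally bounded, continuous off the edge, differentiable off the graphs, with
  gradients of the size of the reciprocal distance from the edge. The class is closed under products, sums
  and smooth functions of a positive argument, and so contains all multipliers used below.\<close>

definition tame :: "(real \<times> real \<Rightarrow> real) set \<Rightarrow> (spt \<Rightarrow> real) \<Rightarrow> bool" where
  "tame \<Phi> f \<longleftrightarrow> periodic f \<and> continuous_on (slab - edge) f \<and>
     (\<forall>R. \<exists>C. \<forall>p \<in> slab - edge. \<bar>fst (snd p)\<bar> \<le> R \<longrightarrow> \<bar>f p\<bar> \<le> C) \<and>
     (\<forall>p \<in> off_graphs \<Phi>. f differentiable (at p)) \<and>
     (\<forall>R. \<exists>C. \<forall>p \<in> off_graphs \<Phi>. \<bar>fst (snd p)\<bar> \<le> R \<longrightarrow> (\<forall>b\<in>Basis. \<bar>dird b f p\<bar> * rad p \<le> C))"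

lemma off_graphs_slab: "p \<in> off_graphs \<Phi> \<Longrightarrow> p \<in> slab - edge"
  by (auto simp: off_graphs_def slab_def edge_def)

lemma rad_pos: "p \<in> off_graphs \<Phi> \<Longrightarrow> 0 < rad p"
  by (auto simp: off_graphs_def rad_def)

lemma tame_bound: 
  assumes "tame \<Phi> f" 
  obtains C where "0 \<le> C" "\<And>p. p \<in> slab - edge \<Longrightarrow> \<bar>fst (snd p)\<bar> \<le> R \<Longrightarrow> \<bar>f p\<bar> \<le> C"
    "\<And>p b. p \<in> off_graphs \<Phi> \<Longrightarrow> \<bar>fst (snd p)\<bar> \<le> R \<Longrightarrow> b \<in> Basis \<Longrightarrow> \<bar>dird b f p\<bar> * rad p \<le> C"
proof -
  have "\<exists>C. \<forall>p \<in> slab - edge. \<bar>fst (snd p)\<bar> \<le> R \<longrightarrow> \<bar>f p\<bar> \<le> C"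
    "\<exists>C. \<forall>p \<in> off_graphs \<Phi>. \<bar>fst (snd p)\<bar> \<le> R \<longrightarrow> (\<forall>b\<in>Basis. \<bar>dird b f p\<bar> * rad p \<le> C)"
    using assms by (simp_all add: tame_def)
  then obtain C1 C2 where 1: "\<forall>p \<in> slab - edge. \<bar>fst (snd p)\<bar> \<le> R \<longrightarrow> \<bar>f p\<bar> \<le> C1"
    and 2: "\<forall>p \<in> off_graphs \<Phi>. \<bar>fst (snd p)\<bar> \<le> R \<longrightarrow> (\<forall>b\<in>Basis. \<bar>dird b f p\<bar> * rad p \<le> C2)"
    by (elim exE) (rule that)
  show ?thesis
  proof (rule that[of "max 0 (max C1 C2)"])
    show "\<bar>f p\<bar> \<le> max 0 (max C1 C2)" if "p \<in> slab - edge" "\<bar>fst (snd p)\<bar> \<le> R" for p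
      using bspec[OF 1 that(1)] that(2) by linarith
    show "\<bar>dird b f p\<bar> * rad p \<le> max 0 (max C1 C2)" if "p \<in> off_graphs \<Phi>" "\<bar>fst (snd p)\<bar> \<le> R" "b \<in> Basis" for p b
    proof -
      have "\<bar>dird b f p\<bar> * rad p \<le> C2" using bspec[OF 2 that(1)] that(2,3) by simp
      then show ?thesis by linarith
    qed
  qed simp
qed

lemma tame_differentiable: "tame \<Phi> f \<Longrightarrow> p \<in> off_graphs \<Phi> \<Longrightarrow> f differentiable (at p)"
  by (simp add: tame_def)

lemma tameI:
  assumes "periodic f" "continuous_on (slab - edge) f"
    and "\<And>R. \<exists>C. \<forall>p \<in> slab - edge. \<bar>fst (snd p)\<bar> \<le> R \<longrightarrow> \<bar>f p\<bar> \<le> C"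
    and "\<And>p. p \<in> off_graphs \<Phi> \<Longrightarrow> f differentiable (at p)"
    and "\<And>R. \<exists>C. \<forall>p \<in> off_graphs \<Phi>. \<bar>fst (snd p)\<bar> \<le> R \<longrightarrow> (\<forall>b\<in>Basis. \<bar>dird b f p\<bar> * rad p \<le> C)"
  shows "tame \<Phi> f"
  unfolding tame_def by (intro conjI allI ballI assms)

lemma tame_const: "tame \<Phi> (\<lambda>p. c)"
  by (rule tameI) (auto simp: periodic_def dird_const)

lemma tame_mult:
  assumes f: "tame \<Phi> f" and g: "tame \<Phi> g" shows "tame \<Phi> (\<lambda>p. f p * g p)"
proof (rule tameI)
  show "periodic (\<lambda>p. f p * g p)" using f g by (simp add: tame_def periodic_def)
  show "continuous_on (slab - edge) (\<lambda>p. f p * g p)" using f g by (simp add: tame_def continuous_on_mult)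
  show "(\<lambda>p. f p * g p) differentiable (at p)" if "p \<in> off_graphs \<Phi>" for p
    using tame_differentiable[OF f that] tame_differentiable[OF g that] by simp
  fix R
  obtain C where C: "0 \<le> C" "\<And>p. p \<in> slab - edge \<Longrightarrow> \<bar>fst (snd p)\<bar> \<le> R \<Longrightarrow> \<bar>f p\<bar> \<le> C"
    "\<And>p b. p \<in> off_graphs \<Phi> \<Longrightarrow> \<bar>fst (snd p)\<bar> \<le> R \<Longrightarrow> b \<in> Basis \<Longrightarrow> \<bar>dird b f p\<bar> * rad p \<le> C" by (rule tame_bound[OF f, of R]) (rule that)
  obtain D where D: "0 \<le> D" "\<And>p. p \<in> slab - edge \<Longrightarrow> \<bar>fst (snd p)\<bar> \<le> R \<Longrightarrow> \<bar>g p\<bar> \<le> D"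
    "\<And>p b. p \<in> off_graphs \<Phi> \<Longrightarrow> \<bar>fst (snd p)\<bar> \<le> R \<Longrightarrow> b \<in> Basis \<Longrightarrow> \<bar>dird b g p\<bar> * rad p \<le> D" by (rule tame_bound[OF g, of R]) (rule that)
  have "\<bar>f p * g p\<bar> \<le> C * D" if "p \<in> slab - edge" "\<bar>fst (snd p)\<bar> \<le> R" for p
    unfolding abs_mult using C(1,2) D(1,2) that by (intro mult_mono) auto
  then show "\<exists>C. \<forall>p \<in> slab - edge. \<bar>fst (snd p)\<bar> \<le> R \<longrightarrow> \<bar>f p * g p\<bar> \<le> C" by blast
  have "\<bar>dird b (\<lambda>p. f p * g p) p\<bar> * rad p \<le> C * D + C * D"
    if p: "p \<in> off_graphs \<Phi>" "\<bar>fst (snd p)\<bar> \<le> R" and b: "b \<in> Basis" for p b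
  proof -
    have r: "0 < rad p" by (rule rad_pos[OF p(1)])
    have "\<bar>dird b (\<lambda>p. f p * g p) p\<bar> * rad p \<le> (\<bar>dird b f p\<bar> * rad p) * \<bar>g p\<bar> + \<bar>f p\<bar> * (\<bar>dird b g p\<bar> * rad p)"
      unfolding dird_mult[OF tame_differentiable[OF f p(1)] tame_differentiable[OF g p(1)]]
      using mult_right_mono[OF abs_triangle_ineq[of "dird b f p * g p" "f p * dird b g p"], of "rad p"] r
      by (simp add: abs_mult algebra_simps)
    also have "\<dots> \<le> C * D + C * D"
      using C(1) C(2)[OF off_graphs_slab[OF p(1)] p(2)] C(3)[OF p b] D(1) D(2)[OF off_graphs_slab[OF p(1)] p(2)] D(3)[OF p b] r
      by (intro add_mono mult_mono) auto
    finally show ?thesis .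
  qed
  then show "\<exists>C. \<forall>p \<in> off_graphs \<Phi>. \<bar>fst (snd p)\<bar> \<le> R \<longrightarrow> (\<forall>b\<in>Basis. \<bar>dird b (\<lambda>p. f p * g p) p\<bar> * rad p \<le> C)"
    by blast
qed

lemma tame_add:
  assumes f: "tame \<Phi> f" and g: "tame \<Phi> g" shows "tame \<Phi> (\<lambda>p. f p + g p)"
proof (rule tameI)
  show "periodic (\<lambda>p. f p + g p)" using f g by (simp add: tame_def periodic_def)
  show "continuous_on (slab - edge) (\<lambda>p. f p + g p)" using f g by (simp add: tame_def continuous_on_add)
  show "(\<lambda>p. f p + g p) differentiable (at p)" if "p \<in> off_graphs \<Phi>" for p
    using tame_differentiable[OF f that] tame_differentiable[OF g that] by simp
  fix R
  obtain C where C: "0 \<le> C" "\<And>p. p \<in> slab - edge \<Longrightarrow> \<bar>fst (snd p)\<bar> \<le> R \<Longrightarrow> \<bar>f p\<bar> \<le> C"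
    "\<And>p b. p \<in> off_graphs \<Phi> \<Longrightarrow> \<bar>fst (snd p)\<bar> \<le> R \<Longrightarrow> b \<in> Basis \<Longrightarrow> \<bar>dird b f p\<bar> * rad p \<le> C" by (rule tame_bound[OF f, of R]) (rule that)
  obtain D where D: "0 \<le> D" "\<And>p. p \<in> slab - edge \<Longrightarrow> \<bar>fst (snd p)\<bar> \<le> R \<Longrightarrow> \<bar>g p\<bar> \<le> D"
    "\<And>p b. p \<in> off_graphs \<Phi> \<Longrightarrow> \<bar>fst (snd p)\<bar> \<le> R \<Longrightarrow> b \<in> Basis \<Longrightarrow> \<bar>dird b g p\<bar> * rad p \<le> D" by (rule tame_bound[OF g, of R]) (rule that)
  have "\<bar>f p + g p\<bar> \<le> C + D" if "p \<in> slab - edge" "\<bar>fst (snd p)\<bar> \<le> R" for p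
    using C(2)[OF that] D(2)[OF that] by linarith
  then show "\<exists>C. \<forall>p \<in> slab - edge. \<bar>fst (snd p)\<bar> \<le> R \<longrightarrow> \<bar>f p + g p\<bar> \<le> C" by blast
  have "\<bar>dird b (\<lambda>p. f p + g p) p\<bar> * rad p \<le> C + D"
    if p: "p \<in> off_graphs \<Phi>" "\<bar>fst (snd p)\<bar> \<le> R" and b: "b \<in> Basis" for p b
  proof -
    have "\<bar>dird b (\<lambda>p. f p + g p) p\<bar> * rad p \<le> \<bar>dird b f p\<bar> * rad p + \<bar>dird b g p\<bar> * rad p"
      unfolding dird_add[OF tame_differentiable[OF f p(1)] tame_differentiable[OF g p(1)]]
      using mult_right_mono[OF abs_triangle_ineq[of "dird b f p" "dird b g p"], of "rad p"] rad_pos[OF p(1)]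
      by (simp add: algebra_simps)
    then show ?thesis using C(3)[OF p b] D(3)[OF p b] by linarith
  qed
  then show "\<exists>C. \<forall>p \<in> off_graphs \<Phi>. \<bar>fst (snd p)\<bar> \<le> R \<longrightarrow> (\<forall>b\<in>Basis. \<bar>dird b (\<lambda>p. f p + g p) p\<bar> * rad p \<le> C)"
    by blast
qed

lemma tame_compose:
  assumes f: "tame \<Phi> f" and pos: "\<And>p. p \<in> slab - edge \<Longrightarrow> 0 < f p"
    and g: "\<And>y. 0 < y \<Longrightarrow> (g has_real_derivative g' y) (at y)"
    and bd: "\<And>M. \<exists>C. \<forall>y. 0 < y \<and> y \<le> M \<longrightarrow> \<bar>g y\<bar> \<le> C \<and> \<bar>g' y\<bar> \<le> C"
  shows "tame \<Phi> (\<lambda>p. g (f p))"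
proof (rule tameI)
  show "periodic (\<lambda>p. g (f p))" using f by (simp add: tame_def periodic_def)
  have "continuous_on {0<..} g" 
    by (rule DERIV_continuous_on[of _ _ g']) (rule has_field_derivative_at_within, rule g, simp)
  then show "continuous_on (slab - edge) (\<lambda>p. g (f p))"
  proof (rule continuous_on_compose2[of "{0<..}" g])
    show "continuous_on (slab - edge) f" using f by (simp add: tame_def)
    show "f ` (slab - edge) \<subseteq> {0<..}" using pos by (intro image_subsetI) simp
  qed
  show "(\<lambda>p. g (f p)) differentiable (at p)" if "p \<in> off_graphs \<Phi>" for p
    by (rule dird_chain(1)[OF tame_differentiable[OF f that] g[OF pos[OF off_graphs_slab[OF that]]]])
  fix R
  obtain C where C: "0 \<le> C" "\<And>p. p \<in> slab - edge \<Longrightarrow> \<bar>fst (snd p)\<bar> \<le> R \<Longrightarrow> \<bar>f p\<bar> \<le> C"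
    "\<And>p b. p \<in> off_graphs \<Phi> \<Longrightarrow> \<bar>fst (snd p)\<bar> \<le> R \<Longrightarrow> b \<in> Basis \<Longrightarrow> \<bar>dird b f p\<bar> * rad p \<le> C" by (rule tame_bound[OF f, of R]) (rule that)
  from bd[of C] obtain D where D: "\<forall>y. 0 < y \<and> y \<le> C \<longrightarrow> \<bar>g y\<bar> \<le> D \<and> \<bar>g' y\<bar> \<le> D" by (elim exE) (rule that)
  have D': "\<bar>g (f p)\<bar> \<le> D \<and> \<bar>g' (f p)\<bar> \<le> D" if "p \<in> slab - edge" "\<bar>fst (snd p)\<bar> \<le> R" for p
    using spec[OF D, of "f p"] pos[OF that(1)] C(2)[OF that] by simp
  have "\<bar>g (f p)\<bar> \<le> D" if "p \<in> slab - edge" "\<bar>fst (snd p)\<bar> \<le> R" for p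
    using D'[OF that] by simp
  then show "\<exists>C. \<forall>p \<in> slab - edge. \<bar>fst (snd p)\<bar> \<le> R \<longrightarrow> \<bar>g (f p)\<bar> \<le> C" by blast
  have "\<bar>dird b (\<lambda>p. g (f p)) p\<bar> * rad p \<le> D * C"
    if p: "p \<in> off_graphs \<Phi>" "\<bar>fst (snd p)\<bar> \<le> R" and b: "b \<in> Basis" for p b
  proof -
    note s = off_graphs_slab[OF p(1)]
    have "\<bar>dird b (\<lambda>p. g (f p)) p\<bar> * rad p = \<bar>g' (f p)\<bar> * (\<bar>dird b f p\<bar> * rad p)"
      unfolding dird_chain(2)[OF tame_differentiable[OF f p(1)] g[OF pos[OF s]]] by (simp add: abs_mult)
    also have "\<dots> \<le> D * C"
    proof (rule mult_mono)
      show "0 \<le> D" using D'[OF s p(2)] by linarith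
      show "0 \<le> \<bar>dird b f p\<bar> * rad p" using rad_pos[OF p(1)] by simp
      show "\<bar>g' (f p)\<bar> \<le> D" using D'[OF s p(2)] by simp
      show "\<bar>dird b f p\<bar> * rad p \<le> C" by (rule C(3)[OF p b])
    qed
    finally show ?thesis .
  qed
  then show "\<exists>C. \<forall>p \<in> off_graphs \<Phi>. \<bar>fst (snd p)\<bar> \<le> R \<longrightarrow> (\<forall>b\<in>Basis. \<bar>dird b (\<lambda>p. g (f p)) p\<bar> * rad p \<le> C)"
    by blast
qed

text \<open>Weights vanish near the edge, where the gradients of the solution blow up, and, like every test function, for late
  times and for large \<open>x\<^sub>1\<close>. They depend on \<open>t\<close> and \<open>x\<^sub>1\<close> only, so that a cone in these two variables controls the flux.\<close>

definition edge_weight :: "real \<Rightarrow> real \<Rightarrow> real \<Rightarrow> real \<Rightarrow> (spt \<Rightarrow> real) \<Rightarrow> (spt \<Rightarrow> real) \<Rightarrow> (spt \<Rightarrow> real) \<Rightarrow> bool" where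
  "edge_weight T R r B W W0 W1 \<longleftrightarrow> T < 1 \<and> 0 < r \<and> periodic W \<and>
     (\<forall>t x1 x2. 0 \<le> t \<longrightarrow> t > T \<or> \<bar>x1\<bar> > R \<longrightarrow> W (t, x1, x2) = 0) \<and> (\<forall>p. rad p < r \<longrightarrow> W p = 0) \<and>
     (\<forall>p. (W has_derivative (\<lambda>h. fst h * W0 p + fst (snd h) * W1 p)) (at p)) \<and>
     (\<forall>p\<in>slab. 0 \<le> W p \<and> W p \<le> B \<and> \<bar>W0 p\<bar> \<le> B \<and> \<bar>W1 p\<bar> \<le> B)"

lemma edge_closed: "closed edge"
proof -
  have "edge = {p. fst p = 0} \<inter> {p. fst (snd p) = 0}" by (auto simp: edge_def)
  moreover have "closed ({p::spt. fst p = 0} \<inter> {p. fst (snd p) = 0})"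
    by (intro closed_Int closed_Collect_eq continuous_intros)
  ultimately show ?thesis by simp
qed

text \<open>Multiplication by the weight removes the neighbourhood of the edge where gradients blow up, and turns a
  tame function into a Lipschitz test function.\<close>

definition weighted :: "(spt \<Rightarrow> real) \<Rightarrow> (spt \<Rightarrow> real) \<Rightarrow> spt \<Rightarrow> real" where
  "weighted W f p = W (clamp_time p) * f (clamp_time p)"

lemma weighted_dird:
  assumes W: "edge_weight T R r B W W0 W1" and f: "tame \<Phi> f" and p: "p \<in> off_graphs \<Phi>"
  shows "weighted W f differentiable (at p)" "(\<lambda>p. W p * f p) differentiable (at p)"
    "dird b (weighted W f) p = dird b (\<lambda>p. W p * f p) p"
    "dt (weighted W f) p = W0 p * f p + W p * dt f p"
    "dx1 (weighted W f) p = W1 p * f p + W p * dx1 f p"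
    "dx2 (weighted W f) p = W p * dx2 f p"
proof -
  have Wd: "(W has_derivative (\<lambda>h. fst h * W0 p + fst (snd h) * W1 p)) (at p)"
    using W by (simp add: edge_weight_def)
  then have Wdiff: "W differentiable (at p)" by (auto simp: differentiable_def)
  let ?U = "{p::spt. 0 < fst p \<and> fst p < 1}"
  have U: "open ?U" by (intro open_Collect_conj open_Collect_less continuous_intros)
  have pU: "p \<in> ?U" using p by (auto simp: off_graphs_def)
  have eq: "weighted W f q = W q * f q" if "q \<in> ?U" for q
    using that by (cases q) (simp add: weighted_def clamp_time_def)
  show d: "(\<lambda>p. W p * f p) differentiable (at p)"
    using Wdiff tame_differentiable[OF f p] by simp
  show "weighted W f differentiable (at p)" using dird_cong_open(1)[OF U pU eq] d by simp
  show e: "dird b (weighted W f) p = dird b (\<lambda>p. W p * f p) p" for b by (rule dird_cong_open(2)[OF U pU eq])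
  show "dt (weighted W f) p = W0 p * f p + W p * dt f p"
    "dx1 (weighted W f) p = W1 p * f p + W p * dx1 f p"
    "dx2 (weighted W f) p = W p * dx2 f p"
    unfolding e dird_mult[OF Wdiff tame_differentiable[OF f p]] dird_eq[OF Wd] by simp_all
qed

lemma weighted_lipschitz_test:
  assumes fin: "finite \<Phi>" and \<Phi>: "\<And>\<phi>. \<phi> \<in> \<Phi> \<Longrightarrow> \<phi> differentiable_on ({0..1} \<times> UNIV)"
    and W: "edge_weight T R r B W W0 W1" and f: "tame \<Phi> f"
  shows "lipschitz_test (weighted W f)"
proof -
  have T: "T < 1" and r: "0 < r" and perW: "periodic W" and supp: "\<And>t x1 x2. 0 \<le> t \<Longrightarrow> t > T \<or> \<bar>x1\<bar> > R \<Longrightarrow> W (t, x1, x2) = 0"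
    and Wr: "\<And>p. rad p < r \<Longrightarrow> W p = 0" and Wd: "\<And>p. (W has_derivative (\<lambda>h. fst h * W0 p + fst (snd h) * W1 p)) (at p)"
    and WB: "\<And>p. p \<in> slab \<Longrightarrow> 0 \<le> W p \<and> W p \<le> B \<and> \<bar>W0 p\<bar> \<le> B \<and> \<bar>W1 p\<bar> \<le> B"
    using W by (simp_all add: edge_weight_def) blast
  have "(0,0,0) \<in> slab" by (simp add: slab_def)
  from WB[OF this] have B0: "0 \<le> B" by linarith
  have Wdiff: "W differentiable (at p)" for p using Wd[of p] by (auto simp: differentiable_def)
  have Wcont: "continuous_on S W" for S
    by (intro continuous_at_imp_continuous_on ballI has_derivative_continuous[OF Wd])
  have W0: "W0 p = 0 \<and> W1 p = 0" if "p \<in> U" "open U" "\<And>q. q \<in> U \<Longrightarrow> W q = 0" for p U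
  proof -
    have "(W has_derivative (\<lambda>h. 0)) (at p)"
      by (rule has_derivative_transform_within_open[OF has_derivative_const that(2,1)]) (use that(3) in auto)
    from fun_cong[OF has_derivative_unique[OF Wd this], of "(1,0,0)"] fun_cong[OF has_derivative_unique[OF Wd this], of "(0,1,0)"]
    show ?thesis by simp
  qed
  have W0R: "W0 p = 0 \<and> W1 p = 0 \<and> W p = 0" if "0 < fst p" "\<bar>fst (snd p)\<bar> > R" for p
  proof -
    let ?U = "{p::spt. 0 < fst p \<and> \<bar>fst (snd p)\<bar> > R}"
    have U: "open ?U" by (intro open_Collect_conj open_Collect_less continuous_intros)
    have z: "W q = 0" if "q \<in> ?U" for q using that supp[of "fst q" "fst (snd q)" "snd (snd q)"] by simp
    have "p \<in> ?U" using that by simp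
    then show ?thesis using W0[OF _ U z] z by blast
  qed
  have opr: "open {p::spt. rad p < r}" unfolding rad_def by (intro open_Collect_less continuous_intros)
  have W0r: "W0 p = 0 \<and> W1 p = 0 \<and> W p = 0" if "rad p < r" for p
    using W0[OF _ opr, of p] that Wr by auto
  obtain C where C: "0 \<le> C" "\<And>p. p \<in> slab - edge \<Longrightarrow> \<bar>fst (snd p)\<bar> \<le> R \<Longrightarrow> \<bar>f p\<bar> \<le> C"
    "\<And>p b. p \<in> off_graphs \<Phi> \<Longrightarrow> \<bar>fst (snd p)\<bar> \<le> R \<Longrightarrow> b \<in> Basis \<Longrightarrow> \<bar>dird b f p\<bar> * rad p \<le> C" by (rule tame_bound[OF f, of R]) (rule that)
  define g where "g p = W p * f p" for p
  have cont: "continuous_on slab g"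
  proof -
    let ?S = "slab \<inter> {p. rad p < r}" and ?T = "slab \<inter> (- edge)"
    have ST: "slab = ?S \<union> ?T" using r by (auto simp: edge_def rad_def)
    have "continuous_on (?S \<union> ?T) g"
    proof (rule continuous_on_Un_local_open)
      show "openin (top_of_set (?S \<union> ?T)) ?S" unfolding ST[symmetric] using opr by (rule openin_open_Int)
      show "openin (top_of_set (?S \<union> ?T)) ?T" unfolding ST[symmetric] using edge_closed by (intro openin_open_Int) auto
      show "continuous_on ?S g" by (rule continuous_on_eq[OF continuous_on_const[of _ 0]]) (auto simp: g_def Wr)
      have "continuous_on ?T f" using f by (simp add: tame_def Diff_eq)
      then show "continuous_on ?T g" unfolding g_def by (intro continuous_intros Wcont)
    qed
    then show ?thesis using ST by simp
  qed
  \<comment> \<open>Product rule: away from the edge \<open>rad \<ge> r\<close>, so the derivative of \<open>f\<close> is at most \<open>C / r\<close>.\<close>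
  define M where "M = B * C + B * (C / r)"
  have M0: "0 \<le> M" using B0 C(1) r by (simp add: M_def)
  have gd: "g differentiable (at p)" if "p \<in> off_graphs \<Phi>" for p
    using weighted_dird(2)[OF W f that] unfolding g_def[abs_def] .
  have gb: "\<bar>dird b g p\<bar> \<le> M" if p: "p \<in> off_graphs \<Phi>" and b: "b \<in> Basis" for p b
  proof (cases "\<bar>fst (snd p)\<bar> > R \<or> rad p < r")
    case True
    moreover have "0 < fst p" using p by (auto simp: off_graphs_def)
    ultimately have "W0 p = 0 \<and> W1 p = 0 \<and> W p = 0" using W0R W0r by blast
    then have "dird b g p = 0"
      unfolding g_def dird_mult[OF Wdiff tame_differentiable[OF f p]] dird_eq[OF Wd] by simp
    then show ?thesis using M0 by simp
  next
    case False
    have s: "p \<in> slab - edge" by (rule off_graphs_slab[OF p])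
    have "\<bar>dird b f p\<bar> * r \<le> \<bar>dird b f p\<bar> * rad p" using False by (intro mult_left_mono) auto
    also have "\<dots> \<le> C" by (rule C(3)[OF p _ b]) (use False in auto)
    finally have df: "\<bar>dird b f p\<bar> \<le> C / r" using r by (simp add: pos_le_divide_eq)
    have dW: "\<bar>dird b W p\<bar> \<le> B" unfolding dird_eq[OF Wd] using b WB[of p] s B0 by (auto simp: Basis_spt)
    have "\<bar>dird b g p\<bar> \<le> \<bar>dird b W p\<bar> * \<bar>f p\<bar> + \<bar>W p\<bar> * \<bar>dird b f p\<bar>"
      unfolding g_def dird_mult[OF Wdiff tame_differentiable[OF f p]] abs_mult[symmetric] by (rule abs_triangle_ineq)
    also have "\<dots> \<le> M"
      unfolding M_def using dW df C(2)[OF s] False WB[of p] s B0 by (intro add_mono mult_mono) auto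
    finally show ?thesis .
  qed
  have Lip: "\<bar>g q - g p\<bar> \<le> (3 * M) * norm (q - p)"
    if "0 < fst p" "fst p < 1" "0 < fst q" "fst q < 1" for p q
  proof (rule lipschitz_off_graphs[OF fin \<Phi> _ gd _ _ that])
    show "continuous_on {p. 0 < fst p \<and> fst p < 1} g"
      by (rule continuous_on_subset[OF cont]) (auto simp: slab_def)
    show "\<bar>frechet_derivative g (at p) h\<bar> \<le> 3 * M * norm h" if "p \<in> off_graphs \<Phi>" for p h
      by (rule frechet_le_components[OF gd[OF that] gb[OF that]])
  qed (use M0 in auto)
  have wg: "weighted W f p = g (clamp_time p)" for p by (simp add: weighted_def g_def)
  show ?thesis
    unfolding lipschitz_test_def
  proof (intro conjI exI allI impI)
    have "f (t, x1, x2 + 2 * pi) = f (t, x1, x2)" "W (t, x1, x2 + 2 * pi) = W (t, x1, x2)" for t x1 x2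
      using f perW by (auto simp: tame_def periodic_def)
    then show "periodic (weighted W f)" by (simp add: periodic_def weighted_def clamp_time_def)
    show "T < 1" by (rule T)
    show "weighted W f (t, x1, x2) = 0" if "t > T \<or> \<bar>x1\<bar> > R" for t x1 x2
    proof -
      have "max 0 (min 1 t) > T \<or> \<bar>x1\<bar> > R" using that T by linarith
      from supp[OF _ this] show ?thesis by (simp add: weighted_def clamp_time_def)
    qed
    show "\<bar>weighted W f p - weighted W f q\<bar> \<le> 3 * M * norm (p - q)" for p q
      unfolding wg using M0 by (intro clamp_lipschitz[OF cont Lip]) auto
  qed
qed

lemma graphs_negligible:
  assumes "finite \<Phi>" "\<And>\<phi>. \<phi> \<in> \<Phi> \<Longrightarrow> \<phi> differentiable_on ({0..1} \<times> UNIV)"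
  shows "AE p in cell_measure. p \<in> off_graphs \<Phi>"
proof -
  have "negligible (\<Union>\<phi>\<in>\<Phi>. (\<lambda>x. (fst x, \<phi> x, snd x)) ` ({0..1} \<times> UNIV))"
  proof (intro negligible_Union finite_imageI assms(1), clarify)
    fix \<phi> assume \<phi>: "\<phi> \<in> \<Phi>"
    have "(\<lambda>x. (fst x, \<phi> x, snd x)) differentiable_on ({0..1} \<times> UNIV)"
      unfolding differentiable_on_def
    proof (intro ballI differentiable_Pair)
      fix x :: "real \<times> real" assume "x \<in> {0..1} \<times> UNIV"
      then show "\<phi> differentiable (at x within {0..1} \<times> UNIV)"
        by (rule bspec[OF assms(2)[OF \<phi>, unfolded differentiable_on_def]])
    qed (intro bounded_linear_imp_differentiable bounded_linear_fst bounded_linear_snd)+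
    then show "negligible ((\<lambda>x. (fst x, \<phi> x, snd x)) ` ({0..1} \<times> UNIV))"
      by (rule negligible_differentiable_image_lowdim[rotated]) simp
  qed
  then have "AE p in lebesgue. p \<notin> (\<Union>\<phi>\<in>\<Phi>. (\<lambda>x. (fst x, \<phi> x, snd x)) ` ({0..1} \<times> UNIV))"
    by (intro AE_not_in) (simp add: negligible_iff_null_sets)
  then show ?thesis
    unfolding AE_cell_iff
  proof eventually_elim
    fix p :: spt assume p: "p \<notin> (\<Union>\<phi>\<in>\<Phi>. (\<lambda>x. (fst x, \<phi> x, snd x)) ` ({0..1} \<times> UNIV))"
    show "p \<in> slab_cell \<longrightarrow> p \<in> off_graphs \<Phi>"
    proof
      assume s: "p \<in> slab_cell"
      obtain t x1 x2 where [simp]: "p = (t, x1, x2)" by (cases p)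
      have t: "0 < t" "t < 1" using s by (auto simp: slab_cell_def)
      have "x1 \<noteq> \<phi> (t, x2)" if "\<phi> \<in> \<Phi>" for \<phi>
      proof
        assume "x1 = \<phi> (t, x2)"
        then have "p = (\<lambda>x. (fst x, \<phi> x, snd x)) (t, x2)" by simp
        moreover have "(t, x2) \<in> {0..1} \<times> UNIV" using t by simp
        ultimately show False using p that by blast
      qed
      then show "p \<in> off_graphs \<Phi>" using t by (simp add: off_graphs_def)
    qed
  qed
qed

section \<open>Relative entropy of an isentropic gas\<close>

text \<open>Density as a function of the specific enthalpy \<open>h = c\<^sup>2 / (\<gamma> - 1)\<close>; the inverse of \<open>enth\<close>.\<close>

definition dens :: "real \<Rightarrow> real \<Rightarrow> real \<Rightarrow> real" where
  "dens \<gamma> k0 h = ((\<gamma> - 1) * h / (k0 * \<gamma>)) powr (1 / (\<gamma> - 1))"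

text \<open>Pressure as a function of the specific enthalpy; its derivative is the density.\<close>

definition press :: "real \<Rightarrow> real \<Rightarrow> real \<Rightarrow> real" where
  "press \<gamma> k0 h = (\<gamma> - 1) / \<gamma> * h * dens \<gamma> k0 h"

definition enth :: "real \<Rightarrow> real \<Rightarrow> real \<Rightarrow> real" where
  "enth \<gamma> k0 r = k0 * \<gamma> * r powr (\<gamma> - 1) / (\<gamma> - 1)"

text \<open>With \<open>H(r) = p(r) / (\<gamma> - 1)\<close> one has \<open>H' = enth\<close>, and \<open>press\<close> is the Legendre transform of \<open>H\<close>. Hence this is
  \<open>H(r) - H(\<rho>) - H'(\<rho>) (r - \<rho>)\<close> at \<open>\<rho> = dens h\<close>, the quadratic remainder of \<open>H\<close>.\<close>

definition rel_energy :: "real \<Rightarrow> real \<Rightarrow> real \<Rightarrow> real \<Rightarrow> real" where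
  "rel_energy \<gamma> k0 r h = pressure \<gamma> k0 r / (\<gamma> - 1) - r * h + press \<gamma> k0 h"

definition rel_entropy :: "real \<Rightarrow> real \<Rightarrow> real \<Rightarrow> real \<Rightarrow> real \<Rightarrow> real \<Rightarrow> real \<Rightarrow> real \<Rightarrow> real" where
  "rel_entropy \<gamma> k0 r u1 u2 h v1 v2 = r * ((u1 - v1)\<^sup>2 + (u2 - v2)\<^sup>2) / 2 + rel_energy \<gamma> k0 r h"

text \<open>The \<open>x\<^sub>1\<close>-component of the flux of the relative entropy, which is paired with the \<open>x\<^sub>1\<close>-derivative of a weight.\<close>

definition rel_flux :: "real \<Rightarrow> real \<Rightarrow> real \<Rightarrow> real \<Rightarrow> real \<Rightarrow> real \<Rightarrow> real \<Rightarrow> real \<Rightarrow> real" where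
  "rel_flux \<gamma> k0 r u1 u2 h v1 v2 =
     rel_entropy \<gamma> k0 r u1 u2 h v1 v2 * u1 + (pressure \<gamma> k0 r - press \<gamma> k0 h) * (u1 - v1)"

lemma dens_pos: "1 < \<gamma> \<Longrightarrow> 0 < k0 \<Longrightarrow> 0 < h \<Longrightarrow> 0 < dens \<gamma> k0 h"
  by (simp add: dens_def)

lemma press_pos: "1 < \<gamma> \<Longrightarrow> 0 < k0 \<Longrightarrow> 0 < h \<Longrightarrow> 0 < press \<gamma> k0 h"
  by (simp add: press_def dens_pos)

lemma density_of_dens: "1 < \<gamma> \<Longrightarrow> density_of \<gamma> k0 c = dens \<gamma> k0 (c\<^sup>2 / (\<gamma> - 1))"
  by (simp add: density_of_def dens_def)

lemma pressure_dens:
  assumes "1 < \<gamma>" "0 < k0" "0 < h" shows "pressure \<gamma> k0 (dens \<gamma> k0 h) = press \<gamma> k0 h"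
proof -
  have "dens \<gamma> k0 h powr \<gamma> = dens \<gamma> k0 h powr (\<gamma> - 1) * dens \<gamma> k0 h"
    using dens_pos[OF assms] powr_add[of "dens \<gamma> k0 h" "\<gamma> - 1" 1] by simp
  also have "dens \<gamma> k0 h powr (\<gamma> - 1) = (\<gamma> - 1) * h / (k0 * \<gamma>)"
    using assms by (simp add: dens_def powr_powr)
  finally show ?thesis using assms by (simp add: pressure_def press_def field_simps)
qed

lemma press_deriv:
  assumes "1 < \<gamma>" "0 < k0" "0 < h"
  shows "(press \<gamma> k0 has_real_derivative dens \<gamma> k0 h) (at h)"
proof -
  let ?b = "1 / (\<gamma> - 1)" and ?x = "(\<gamma> - 1) * h / (k0 * \<gamma>)"
  have x: "0 < ?x" using assms by simp
  have "(dens \<gamma> k0 has_real_derivative (?b * ?x powr (?b - 1) * ((\<gamma> - 1) / (k0 * \<gamma>)))) (at h)"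
    unfolding dens_def[abs_def] using x assms by (auto intro!: derivative_eq_intros)
  moreover have "?b * ?x powr (?b - 1) * ((\<gamma> - 1) / (k0 * \<gamma>)) = dens \<gamma> k0 h * ?b / h"
  proof -
    have "?x powr (?b - 1) = ?x powr ?b / ?x powr 1" by (rule powr_diff)
    also have "?x powr 1 = ?x" using x by (intro powr_one) simp
    finally have "?x powr (?b - 1) = dens \<gamma> k0 h / ?x" by (simp only: dens_def)
    then show ?thesis using assms by (simp add: field_simps)
  qed
  ultimately have d: "(dens \<gamma> k0 has_real_derivative (dens \<gamma> k0 h * ?b / h)) (at h)" by simp
  have "((\<lambda>h. (\<gamma> - 1) / \<gamma> * h * dens \<gamma> k0 h) has_real_derivative
     ((\<gamma> - 1) / \<gamma> * dens \<gamma> k0 h + (\<gamma> - 1) / \<gamma> * h * (dens \<gamma> k0 h * ?b / h))) (at h)"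
    by (rule DERIV_cong[OF DERIV_mult[OF _ d, of "\<lambda>h. (\<gamma> - 1) / \<gamma> * h" "(\<gamma> - 1) / \<gamma>"]])
       (use assms in \<open>auto intro!: derivative_eq_intros\<close>)
  moreover have "(\<gamma> - 1) / \<gamma> * dens \<gamma> k0 h + (\<gamma> - 1) / \<gamma> * h * (dens \<gamma> k0 h * ?b / h) = dens \<gamma> k0 h"
    using assms by (simp add: field_simps)
  ultimately show ?thesis unfolding press_def[abs_def] by simp
qed

lemma dens_mono:
  assumes "1 < \<gamma>" "0 < k0" "0 < y" "y \<le> M" shows "dens \<gamma> k0 y \<le> dens \<gamma> k0 M"
  unfolding dens_def using assms by (intro powr_mono2 divide_right_mono mult_left_mono) auto

text \<open>Bounds down to the vacuum \<open>h = 0\<close>, since the exponents in \<open>dens\<close> and \<open>press\<close> are positive.\<close>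

lemma press_bounded:
  assumes "1 < \<gamma>" "0 < k0"
  shows "\<exists>C. \<forall>y. 0 < y \<and> y \<le> M \<longrightarrow> \<bar>press \<gamma> k0 y\<bar> \<le> C \<and> \<bar>dens \<gamma> k0 y\<bar> \<le> C"
proof (intro exI allI impI)
  fix y assume y: "0 < y \<and> y \<le> M"
  have d: "0 < dens \<gamma> k0 y" "dens \<gamma> k0 y \<le> dens \<gamma> k0 M"
    using dens_pos[OF assms, of y] dens_mono[OF assms, of y M] y by auto
  have "(\<gamma> - 1) / \<gamma> * y \<le> 1 * M" using assms y by (intro mult_mono) (auto simp: divide_simps)
  then have "press \<gamma> k0 y \<le> M * dens \<gamma> k0 M"
    unfolding press_def using d y by (intro mult_mono) auto
  moreover have "0 \<le> press \<gamma> k0 y" using press_pos[OF assms, of y] y by simp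
  moreover have "0 \<le> M * dens \<gamma> k0 M" using d y by simp
  ultimately show "\<bar>press \<gamma> k0 y\<bar> \<le> M * dens \<gamma> k0 M + dens \<gamma> k0 M \<and> \<bar>dens \<gamma> k0 y\<bar> \<le> M * dens \<gamma> k0 M + dens \<gamma> k0 M"
    using d by linarith
qed

lemma enth_dens:
  assumes "1 < \<gamma>" "0 < k0" "0 < r"
  shows "0 < enth \<gamma> k0 r" "dens \<gamma> k0 (enth \<gamma> k0 r) = r"
proof -
  show "0 < enth \<gamma> k0 r" using assms by (simp add: enth_def)
  have "(\<gamma> - 1) * enth \<gamma> k0 r / (k0 * \<gamma>) = r powr (\<gamma> - 1)" using assms by (simp add: enth_def)
  then show "dens \<gamma> k0 (enth \<gamma> k0 r) = r" using assms by (simp add: dens_def powr_powr)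
qed

text \<open>The right-hand side increases with \<open>\<beta>\<close>, so the extreme case \<open>\<beta> = 1/2\<close>, that is \<open>\<gamma> = 3\<close>, decides. There the
  expression is a polynomial in \<open>sqrt x\<close>.\<close>

lemma bregman_power_lower:
  fixes \<beta> x :: real
  assumes b: "1/2 < \<beta>" and x: "0 < x"
  shows "(x - 1)\<^sup>2 / (4 * (1 + x)) \<le> x powr (\<beta> + 1) / (\<beta> + 1) - x + \<beta> / (\<beta> + 1)"
proof -
  \<comment> \<open>The difference of the powers for \<open>\<beta>\<close> and for \<open>1/2\<close>, minimal at one.\<close>
  define g where "g x = x powr (\<beta> + 1) / (\<beta> + 1) - x powr (3/2) / (3/2)" for x :: real
  have g: "(g has_real_derivative (y powr \<beta> - y powr (1/2))) (at y)" if "0 < y" for y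
    unfolding g_def[abs_def] using that b by (auto intro!: derivative_eq_intros)
  have "g 1 \<le> g x"
  proof (cases "1 \<le> x")
    case True
    show ?thesis
    proof (rule DERIV_nonneg_imp_nondecreasing[OF True])
      fix y assume "1 \<le> y" "y \<le> x"
      then show "\<exists>d. (g has_real_derivative d) (at y) \<and> 0 \<le> d"
        using g[of y] b by (intro exI[of _ "y powr \<beta> - y powr (1/2)"]) (auto intro: powr_mono)
    qed
  next
    case False
    have "g x \<ge> g 1"
    proof (rule DERIV_nonpos_imp_nonincreasing[where a = x and b = 1 and f = g])
      show "x \<le> 1" using False by simp
      fix y assume "x \<le> y" "y \<le> 1"
      then show "\<exists>d. (g has_real_derivative d) (at y) \<and> d \<le> 0"
        using g[of y] b x by (intro exI[of _ "y powr \<beta> - y powr (1/2)"]) (auto intro!: powr_mono')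
    qed
    then show ?thesis by simp
  qed
  then have *: "x powr (3/2) / (3/2) - x + 1/3 \<le> x powr (\<beta> + 1) / (\<beta> + 1) - x + \<beta> / (\<beta> + 1)"
  proof -
    have "\<beta> / (\<beta> + 1) = 1 - 1 / (\<beta> + 1)" using b by (simp add: field_simps)
    then show ?thesis using \<open>g 1 \<le> g x\<close> by (simp add: g_def)
  qed
  \<comment> \<open>For \<open>\<beta> = 1/2\<close> everything is polynomial in the square root.\<close>
  define y where "y = sqrt x"
  have y: "0 < y" "x = y\<^sup>2" using x by (auto simp: y_def)
  have "x = y powr 2" using y by (simp add: powr_numeral)
  then have "x powr (3/2) = y powr 3" by (simp add: powr_powr)
  then have "x powr (3/2) = y ^ 3" using y(1) by (simp add: powr_numeral)
  then have eq: "x powr (3/2) / (3/2) - x + 1/3 = (y - 1)\<^sup>2 * (2 * y + 1) / 3"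
    using y by (simp add: power2_eq_square power3_eq_cube field_simps)
  have "(x - 1)\<^sup>2 / (4 * (1 + x)) \<le> (y - 1)\<^sup>2 * (2 * y + 1) / 3"
  proof -
    have "3 * (y + 1)\<^sup>2 \<le> 4 * (2 * y + 1) * (1 + y\<^sup>2)"
    proof -
      have "4 * (2 * y + 1) * (1 + y\<^sup>2) - 3 * (y + 1)\<^sup>2 = 8 * y ^ 3 + y\<^sup>2 + 2 * y + 1"
        by (simp add: power2_eq_square power3_eq_cube algebra_simps)
      moreover have "0 \<le> 8 * y ^ 3 + y\<^sup>2 + 2 * y + 1" using y by simp
      ultimately show ?thesis by linarith
    qed
    then have "(y - 1)\<^sup>2 * (3 * (y + 1)\<^sup>2) \<le> (y - 1)\<^sup>2 * (4 * (2 * y + 1) * (1 + y\<^sup>2))"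
      by (intro mult_left_mono) auto
    moreover have "(x - 1)\<^sup>2 = (y - 1)\<^sup>2 * (y + 1)\<^sup>2"
      by (simp add: y(2) power2_eq_square algebra_simps)
    ultimately have "(x - 1)\<^sup>2 * 3 \<le> ((y - 1)\<^sup>2 * (2 * y + 1)) * (4 * (1 + y\<^sup>2))"
      by (simp only: mult_ac)
    moreover have "0 < 4 * (1 + y\<^sup>2)" by (simp add: add_pos_nonneg)
    ultimately have "(x - 1)\<^sup>2 \<le> ((y - 1)\<^sup>2 * (2 * y + 1)) / 3 * (4 * (1 + y\<^sup>2))"
    proof -
      have "a \<le> b / 3 * c" if "a * 3 \<le> b * c" for a b c :: real using that by simp
      then show ?thesis using \<open>(x - 1)\<^sup>2 * 3 \<le> ((y - 1)\<^sup>2 * (2 * y + 1)) * (4 * (1 + y\<^sup>2))\<close> .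
    qed
    with \<open>0 < 4 * (1 + y\<^sup>2)\<close> show ?thesis by (simp only: y(2)[symmetric] pos_divide_le_eq)
  qed
  also note eq[symmetric]
  also note *
  finally show ?thesis .
qed

text \<open>The previous inequality with \<open>\<beta> = 1 / (\<gamma> - 1)\<close> and the ratio \<open>x\<close> of the two enthalpies, scaled by the pressure. The
  left-hand side is the form in which the pressure difference enters the flux.\<close>

lemma rel_energy_lower:
  assumes \<gamma>: "1 < \<gamma>" "\<gamma> < 3" and k: "0 < k0" and r: "0 \<le> r" and h: "0 < h"
  shows "r * (enth \<gamma> k0 r - h)\<^sup>2 \<le> 4 * (enth \<gamma> k0 r + h) * rel_energy \<gamma> k0 r h"
proof (cases "r = 0")
  case True
  then show ?thesis using press_pos[OF \<gamma>(1) k h] h \<gamma> k by (simp add: rel_energy_def pressure_def enth_def)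
next
  case False
  then have r: "0 < r" using assms by simp
  define h' where "h' = enth \<gamma> k0 r"
  have h': "0 < h'" "dens \<gamma> k0 h' = r" using enth_dens[OF \<gamma>(1) k r] by (auto simp: h'_def)
  define \<beta> x where "\<beta> = 1 / (\<gamma> - 1)" and "x = h / h'"
  have b: "1/2 < \<beta>" using \<gamma> by (simp add: \<beta>_def field_simps)
  have x: "0 < x" using h h' by (simp add: x_def)
  have hx: "h = h' * x" using h' by (simp add: x_def)
  have b1: "\<beta> + 1 = \<gamma> / (\<gamma> - 1)" and b2: "\<beta> / (\<beta> + 1) = 1 / \<gamma>"
    using \<gamma> by (auto simp: \<beta>_def field_simps)
  have dh: "dens \<gamma> k0 h = r * x powr \<beta>"
  proof -
    define z where "z = (\<gamma> - 1) * h' / (k0 * \<gamma>)"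
    have "0 \<le> z" using h' \<gamma> k by (simp add: z_def)
    moreover have "(\<gamma> - 1) * h / (k0 * \<gamma>) = z * x" by (simp add: hx z_def)
    ultimately have "dens \<gamma> k0 h = z powr \<beta> * x powr \<beta>"
      unfolding dens_def \<beta>_def[symmetric] using x by (simp add: powr_mult)
    then show ?thesis using h'(2) unfolding dens_def \<beta>_def[symmetric] z_def by simp
  qed
  have "press \<gamma> k0 h = r * h' * (x powr (\<beta> + 1) / (\<beta> + 1))"
  proof -
    have "(\<gamma> - 1) / \<gamma> = 1 / (\<beta> + 1)" unfolding b1 using \<gamma> by simp
    then show ?thesis unfolding press_def dh using x by (simp add: hx powr_add)
  qed
  moreover have "pressure \<gamma> k0 r / (\<gamma> - 1) = r * h' * (\<beta> / (\<beta> + 1))"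
  proof -
    have "r powr \<gamma> = r powr (\<gamma> - 1) * r" using r powr_add[of r "\<gamma> - 1" 1] by simp
    then show ?thesis unfolding b2 using \<gamma> by (simp add: pressure_def h'_def enth_def)
  qed
  ultimately have "rel_energy \<gamma> k0 r h = r * h' * (x powr (\<beta> + 1) / (\<beta> + 1) - x + \<beta> / (\<beta> + 1))"
    unfolding rel_energy_def hx by (simp add: algebra_simps)
  also have "\<dots> \<ge> r * h' * ((x - 1)\<^sup>2 / (4 * (1 + x)))"
    using r h' by (intro mult_left_mono bregman_power_lower[OF b x]) auto
  finally have "4 * (h' + h) * (r * h' * ((x - 1)\<^sup>2 / (4 * (1 + x)))) \<le> 4 * (h' + h) * rel_energy \<gamma> k0 r h"
    using h h' by (intro mult_left_mono) auto
  moreover have "4 * (h' + h) * (r * h' * ((x - 1)\<^sup>2 / (4 * (1 + x)))) = r * (h' - h)\<^sup>2"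
  proof -
    have "h' + h = h' * (1 + x)" "h' - h = h' * (1 - x)" by (simp_all add: hx algebra_simps)
    then show ?thesis using x by (simp add: power_mult_distrib power2_eq_square field_simps) 
  qed
  ultimately show ?thesis by (simp add: h'_def)
qed

lemma enth_nonneg: "1 < \<gamma> \<Longrightarrow> 0 < k0 \<Longrightarrow> 0 \<le> enth \<gamma> k0 r"
  by (simp add: enth_def)

lemma rel_energy_nonneg:
  assumes "1 < \<gamma>" "\<gamma> < 3" "0 < k0" "0 \<le> r" "0 < h"
  shows "0 \<le> rel_energy \<gamma> k0 r h"
proof -
  have "0 \<le> r * (enth \<gamma> k0 r - h)\<^sup>2" using assms by simp
  also note rel_energy_lower[OF assms]
  finally have "0 \<le> 4 * (enth \<gamma> k0 r + h) * rel_energy \<gamma> k0 r h" .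
  moreover have "0 < 4 * (enth \<gamma> k0 r + h)" using assms enth_nonneg[of \<gamma> k0 r] by simp
  ultimately show ?thesis using mult_pos_neg[of "4 * (enth \<gamma> k0 r + h)" "rel_energy \<gamma> k0 r h"] by linarith
qed

lemma rel_entropy_nonneg:
  assumes "1 < \<gamma>" "\<gamma> < 3" "0 < k0" "0 \<le> r" "0 < h"
  shows "0 \<le> rel_entropy \<gamma> k0 r u1 u2 h v1 v2"
  using rel_energy_nonneg[OF assms] assms(4) by (simp add: rel_entropy_def)

text \<open>The pressure of the reference state is positive, so the vacuum \<open>r = 0\<close> has positive relative entropy.\<close>

lemma rel_entropy_zero:
  assumes A: "1 < \<gamma>" "\<gamma> < 3" "0 < k0" "0 \<le> r" "0 < h" and z: "rel_entropy \<gamma> k0 r u1 u2 h v1 v2 = 0"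
  shows "u1 = v1 \<and> u2 = v2 \<and> enth \<gamma> k0 r = h"
proof -
  have e: "rel_energy \<gamma> k0 r h = 0" and k: "r * ((u1 - v1)\<^sup>2 + (u2 - v2)\<^sup>2) = 0"
  proof -
    have "0 \<le> r * ((u1 - v1)\<^sup>2 + (u2 - v2)\<^sup>2)" using A(4) by simp
    with z rel_energy_nonneg[OF A] show "rel_energy \<gamma> k0 r h = 0" "r * ((u1 - v1)\<^sup>2 + (u2 - v2)\<^sup>2) = 0"
      unfolding rel_entropy_def by linarith+
  qed
  have "r \<noteq> 0"
    using e press_pos[OF A(1,3,5)] by (auto simp: rel_energy_def pressure_def)
  moreover have "r * (enth \<gamma> k0 r - h)\<^sup>2 \<le> 0" using rel_energy_lower[OF A] e by simp
  ultimately show ?thesis using k A(4) by (auto simp: mult_le_0_iff sum_power2_eq_zero_iff)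
qed

text \<open>Expresses the pressure difference by quantities that the relative entropy controls.\<close>

lemma pressure_difference:
  assumes "1 < \<gamma>" "0 \<le> r"
  shows "pressure \<gamma> k0 r - press \<gamma> k0 h = r * (enth \<gamma> k0 r - h) - rel_energy \<gamma> k0 r h"
proof -
  have "r * enth \<gamma> k0 r = \<gamma> / (\<gamma> - 1) * pressure \<gamma> k0 r"
  proof (cases "r = 0")
    case False
    then have "r powr \<gamma> = r powr (\<gamma> - 1) * r" using assms powr_add[of r "\<gamma> - 1" 1] by simp
    then show ?thesis using assms by (simp add: enth_def pressure_def)
  qed (use assms in \<open>simp add: pressure_def\<close>)
  moreover have "\<gamma> / (\<gamma> - 1) * pressure \<gamma> k0 r = pressure \<gamma> k0 r + pressure \<gamma> k0 r / (\<gamma> - 1)"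
    using assms by (simp add: field_simps)
  ultimately show ?thesis by (simp add: rel_energy_def algebra_simps)
qed

text \<open>The mixed term \<open>r (enth r - h) (u1 - v1)\<close> is split by the inequality between arithmetic and geometric mean; both
  squares are controlled by the relative entropy, with constants \<open>2\<close> and \<open>8 M\<close>. The convected and the remaining pressure
  part contribute \<open>M\<close> and \<open>2 M\<close>, which gives the speed \<open>7 M + 1\<close>.\<close>

lemma rel_flux_bound:
  assumes A: "1 < \<gamma>" "\<gamma> < 3" "0 < k0" "0 \<le> r" "0 < h"
    and M: "\<bar>u1\<bar> \<le> M" "\<bar>v1\<bar> \<le> M" "h \<le> M" "enth \<gamma> k0 r \<le> M"
  shows "\<bar>rel_flux \<gamma> k0 r u1 u2 h v1 v2\<bar> \<le> (7 * M + 1) * rel_entropy \<gamma> k0 r u1 u2 h v1 v2"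
proof -
  let ?E = "rel_entropy \<gamma> k0 r u1 u2 h v1 v2" and ?H = "rel_energy \<gamma> k0 r h" and ?d = "enth \<gamma> k0 r - h"
  have E0: "0 \<le> ?E" by (rule rel_entropy_nonneg[OF A])
  have H0: "0 \<le> ?H" by (rule rel_energy_nonneg[OF A])
  have HE: "?H \<le> ?E" using A(4) by (simp add: rel_entropy_def)
  have M0: "0 \<le> M" using M by linarith
  have UE: "r * (u1 - v1)\<^sup>2 \<le> 2 * ?E"
  proof -
    have "0 \<le> r * (u2 - v2)\<^sup>2" using A(4) by simp
    moreover have "2 * ?E = r * (u1 - v1)\<^sup>2 + r * (u2 - v2)\<^sup>2 + 2 * ?H"
      by (simp add: rel_entropy_def field_simps)
    ultimately show ?thesis using H0 by linarith
  qed
  have 1: "\<bar>?E * u1\<bar> \<le> M * ?E" using M(1) E0 by (simp add: abs_mult mult.commute[of "rel_entropy _ _ _ _ _ _ _ _"] mult_right_mono)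
  have 2: "\<bar>?H * (u1 - v1)\<bar> \<le> 2 * M * ?E"
  proof -
    have "\<bar>?H * (u1 - v1)\<bar> \<le> ?E * (2 * M)"
      unfolding abs_mult using H0 HE E0 M by (intro mult_mono) auto
    then show ?thesis by (simp add: mult_ac)
  qed
  \<comment> \<open>Twice the product is at most the sum of the squares, and \<open>r (enth r - h)\<^sup>2 \<le> 8 M E\<close>, \<open>r (u1 - v1)\<^sup>2 \<le> 2 E\<close>.\<close>
  have 3: "\<bar>r * ?d * (u1 - v1)\<bar> \<le> (4 * M + 1) * ?E"
  proof -
    have "2 * (\<bar>?d\<bar> * \<bar>u1 - v1\<bar>) \<le> ?d\<^sup>2 + (u1 - v1)\<^sup>2"
      using sum_squares_bound[of "\<bar>?d\<bar>" "\<bar>u1 - v1\<bar>"] by (simp add: mult.assoc)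
    then have "r * (2 * (\<bar>?d\<bar> * \<bar>u1 - v1\<bar>)) \<le> r * (?d\<^sup>2 + (u1 - v1)\<^sup>2)" using A(4) by (rule mult_left_mono)
    then have "2 * \<bar>r * ?d * (u1 - v1)\<bar> \<le> r * ?d\<^sup>2 + r * (u1 - v1)\<^sup>2"
    proof -
      assume "r * (2 * (\<bar>?d\<bar> * \<bar>u1 - v1\<bar>)) \<le> r * (?d\<^sup>2 + (u1 - v1)\<^sup>2)"
      moreover have "\<bar>r * ?d * (u1 - v1)\<bar> = r * (\<bar>?d\<bar> * \<bar>u1 - v1\<bar>)"
        by (simp only: abs_mult abs_of_nonneg[OF A(4)] mult.assoc)
      ultimately show ?thesis by (simp add: distrib_left)
    qed
    also have "r * ?d\<^sup>2 \<le> 4 * (enth \<gamma> k0 r + h) * ?H" by (rule rel_energy_lower[OF A])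
    also have "\<dots> \<le> (8 * M) * ?E"
      using M HE H0 E0 enth_nonneg[OF A(1,3), of r] A(5) by (intro mult_mono[of "4 * (enth \<gamma> k0 r + h)"]) auto
    finally show ?thesis using UE by (simp add: algebra_simps)
  qed
  have "rel_flux \<gamma> k0 r u1 u2 h v1 v2 = ?E * u1 + r * ?d * (u1 - v1) - ?H * (u1 - v1)"
    unfolding rel_flux_def pressure_difference[OF A(1,4)] by (simp add: algebra_simps)
  then have "\<bar>rel_flux \<gamma> k0 r u1 u2 h v1 v2\<bar> \<le> M * ?E + (4 * M + 1) * ?E + 2 * M * ?E"
    using 1 2 3 by linarith
  then show ?thesis by (simp add: algebra_simps)
qed

text \<open>A polynomial identity in which \<open>h0, h1, h2\<close>, \<open>a0, a1, a2\<close> and \<open>b0, b1, b2\<close> stand for the first derivatives of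
  \<open>h\<close>, \<open>v1\<close>, \<open>v2\<close> at a point. The left-hand side is the integrand of the entropy inequality minus those of the mass and
  momentum equations, tested with \<open>W\<close>, \<open>W (h - \<bar>v\<bar>\<^sup>2 / 2)\<close> and \<open>W v\<close>, plus the space-time divergence of
  \<open>W P (1, v1, v2)\<close>, which integrates to an initial term. All terms linear in the difference of the states cancel by the
  equations satisfied by \<open>(h, v)\<close>.\<close>

lemma rel_entropy_identity:
  fixes \<gamma> r u1 u2 h v1 v2 :: real
  assumes \<gamma>: "1 < \<gamma>"
    and p: "p = pressure \<gamma> k0 r" and P: "P = press \<gamma> k0 h" and \<rho>: "\<rho> = dens \<gamma> k0 h"
    and h0: "h0 + v1 * h1 + v2 * h2 = - (\<gamma> - 1) * h * (a1 + b2)"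
    and a0: "a0 + v1 * a1 + v2 * a2 = - h1" and b0: "b0 + v1 * b1 + v2 * b2 = - h2"
  shows "(r * (u1\<^sup>2 + u2\<^sup>2) / 2 + p / (\<gamma> - 1)) * W0 + ((r * (u1\<^sup>2 + u2\<^sup>2) / 2 + \<gamma> / (\<gamma> - 1) * p) * u1) * W1
    - (r * (W0 * (h - (v1\<^sup>2 + v2\<^sup>2) / 2) + W * (h0 - v1 * a0 - v2 * b0))
       + r * u1 * (W1 * (h - (v1\<^sup>2 + v2\<^sup>2) / 2) + W * (h1 - v1 * a1 - v2 * b1))
       + r * u2 * (W * (h2 - v1 * a2 - v2 * b2)))
    - (r * u1 * (W0 * v1 + W * a0) + (r * u1\<^sup>2 + p) * (W1 * v1 + W * a1) + r * u1 * u2 * (W * a2))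
    - (r * u2 * (W0 * v2 + W * b0) + r * u1 * u2 * (W1 * v2 + W * b1) + (r * u2\<^sup>2 + p) * (W * b2))
    + (W0 * P + W * (\<rho> * h0)) + (W1 * (P * v1) + W * (\<rho> * h1 * v1 + P * a1)) + W * (\<rho> * h2 * v2 + P * b2)
    = W0 * rel_entropy \<gamma> k0 r u1 u2 h v1 v2 + W1 * rel_flux \<gamma> k0 r u1 u2 h v1 v2
      - W * (r * (a1 * (u1 - v1)\<^sup>2 + (a2 + b1) * ((u1 - v1) * (u2 - v2)) + b2 * (u2 - v2)\<^sup>2)
          + (\<gamma> - 1) * rel_energy \<gamma> k0 r h * (a1 + b2))"
proof -
  define e where "e = p / (\<gamma> - 1)"
  have e: "p = (\<gamma> - 1) * e" "\<gamma> / (\<gamma> - 1) * p = \<gamma> * e" using \<gamma> by (auto simp: e_def)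
  have HR: "rel_energy \<gamma> k0 r h = e - r * h + P" by (simp add: rel_energy_def e_def p P)
  have PR: "\<gamma> * P = (\<gamma> - 1) * h * \<rho>" using \<gamma> by (simp add: P press_def \<rho>)
  have H0': "h0 = (1 - \<gamma>) * h * (a1 + b2) - v1 * h1 - v2 * h2" using h0 by simp
  have A0': "a0 = - h1 - v1 * a1 - v2 * a2" using a0 by simp
  have B0': "b0 = - h2 - v1 * b1 - v2 * b2" using b0 by simp
  have RF: "rel_flux \<gamma> k0 r u1 u2 h v1 v2 = rel_entropy \<gamma> k0 r u1 u2 h v1 v2 * u1 + (p - P) * (u1 - v1)"
    by (simp add: rel_flux_def p P)
  let ?D = "W * (a1 + b2) * (\<gamma> * P - (\<gamma> - 1) * h * \<rho>)"
  have D: "?D = 0" using PR by simp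
  show ?thesis
    unfolding RF rel_entropy_def HR e_def[symmetric] e(2) H0' A0' B0' unfolding e(1)
    using D by (simp only: algebra_simps power2_eq_square add_divide_distrib diff_divide_distrib
        mult_minus_left mult_minus_right times_divide_eq_left times_divide_eq_right mult_1_left mult_1_right)
qed

section \<open>The relative entropy inequality\<close>

definition bounded_coefficient :: "(spt \<Rightarrow> real) \<Rightarrow> bool" where
  "bounded_coefficient F \<longleftrightarrow> F \<in> borel_measurable cell_measure \<and> (\<exists>M. \<forall>p\<in>slab_cell. \<bar>F p\<bar> \<le> M)"

definition bounded_datum :: "(real \<times> real \<Rightarrow> real) \<Rightarrow> bool" where
  "bounded_datum G \<longleftrightarrow> G \<in> borel_measurable slice_measure \<and> (\<exists>M. \<forall>x\<in>slice_cell. \<bar>G x\<bar> \<le> M)"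

lemma bounded_coefficient_const: "bounded_coefficient (\<lambda>p. c)"
  by (auto simp: bounded_coefficient_def)

lemma bounded_coefficient_mult:
  assumes "bounded_coefficient F" "bounded_coefficient G" shows "bounded_coefficient (\<lambda>p. F p * G p)"
proof -
  obtain M N where "\<forall>p\<in>slab_cell. \<bar>F p\<bar> \<le> M" "\<forall>p\<in>slab_cell. \<bar>G p\<bar> \<le> N"
    using assms by (auto simp: bounded_coefficient_def)
  then have "\<bar>F p * G p\<bar> \<le> \<bar>M\<bar> * \<bar>N\<bar>" if "p \<in> slab_cell" for p
    unfolding abs_mult using that by (intro mult_mono) (auto intro: order_trans[OF _ abs_ge_self])
  then have "\<exists>M. \<forall>p\<in>slab_cell. \<bar>F p * G p\<bar> \<le> M" by blast
  then show ?thesis using assms unfolding bounded_coefficient_def by (intro conjI borel_measurable_times) blast+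
qed

lemma bounded_coefficient_add:
  assumes "bounded_coefficient F" "bounded_coefficient G" shows "bounded_coefficient (\<lambda>p. F p + G p)"
proof -
  obtain M N where "\<forall>p\<in>slab_cell. \<bar>F p\<bar> \<le> M" "\<forall>p\<in>slab_cell. \<bar>G p\<bar> \<le> N"
    using assms by (auto simp: bounded_coefficient_def)
  then have "\<bar>F p + G p\<bar> \<le> M + N" if "p \<in> slab_cell" for p
    using that abs_triangle_ineq[of "F p" "G p"] by force
  then have "\<exists>M. \<forall>p\<in>slab_cell. \<bar>F p + G p\<bar> \<le> M" by blast
  then show ?thesis using assms unfolding bounded_coefficient_def by (intro conjI borel_measurable_add) blast+
qed

lemma bounded_datum_const: "bounded_datum (\<lambda>x. c)"
  by (auto simp: bounded_datum_def)

lemma bounded_datum_mult: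
  assumes "bounded_datum F" "bounded_datum G" shows "bounded_datum (\<lambda>p. F p * G p)"
proof -
  obtain M N where "\<forall>p\<in>slice_cell. \<bar>F p\<bar> \<le> M" "\<forall>p\<in>slice_cell. \<bar>G p\<bar> \<le> N"
    using assms by (auto simp: bounded_datum_def)
  then have "\<bar>F p * G p\<bar> \<le> \<bar>M\<bar> * \<bar>N\<bar>" if "p \<in> slice_cell" for p
    unfolding abs_mult using that by (intro mult_mono) (auto intro: order_trans[OF _ abs_ge_self])
  then have "\<exists>M. \<forall>p\<in>slice_cell. \<bar>F p * G p\<bar> \<le> M" by blast
  then show ?thesis using assms unfolding bounded_datum_def by (intro conjI borel_measurable_times) blast+
qed

lemma bounded_datum_add:
  assumes "bounded_datum F" "bounded_datum G" shows "bounded_datum (\<lambda>p. F p + G p)"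
proof -
  obtain M N where "\<forall>p\<in>slice_cell. \<bar>F p\<bar> \<le> M" "\<forall>p\<in>slice_cell. \<bar>G p\<bar> \<le> N"
    using assms by (auto simp: bounded_datum_def)
  then have "\<bar>F p + G p\<bar> \<le> M + N" if "p \<in> slice_cell" for p
    using that abs_triangle_ineq[of "F p" "G p"] by force
  then have "\<exists>M. \<forall>p\<in>slice_cell. \<bar>F p + G p\<bar> \<le> M" by blast
  then show ?thesis using assms unfolding bounded_datum_def by (intro conjI borel_measurable_add) blast+
qed

lemma pressure_bound: "0 < k0 \<Longrightarrow> 0 < \<gamma> \<Longrightarrow> 0 \<le> r \<Longrightarrow> r \<le> M \<Longrightarrow> \<bar>pressure \<gamma> k0 r\<bar> \<le> k0 * M powr \<gamma>"
  by (simp add: pressure_def abs_mult powr_mono2)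

lemma bounded_coefficient_pressure:
  assumes "bounded_coefficient F" "\<And>p. p \<in> slab_cell \<Longrightarrow> 0 \<le> F p" "0 < k0" "0 < \<gamma>"
  shows "bounded_coefficient (\<lambda>p. pressure \<gamma> k0 (F p))"
proof -
  obtain M where M: "\<forall>p\<in>slab_cell. \<bar>F p\<bar> \<le> M" using assms(1) by (auto simp: bounded_coefficient_def)
  have F: "F \<in> borel_measurable cell_measure" using assms(1) by (simp add: bounded_coefficient_def)
  have "\<bar>pressure \<gamma> k0 (F p)\<bar> \<le> k0 * M powr \<gamma>" if p: "p \<in> slab_cell" for p
    using pressure_bound[OF assms(3,4) assms(2)[OF p], of M] bspec[OF M p] assms(2)[OF p] by simp
  moreover have "(\<lambda>p. pressure \<gamma> k0 (F p)) \<in> borel_measurable cell_measure"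
    unfolding pressure_def using F by measurable
  ultimately show ?thesis unfolding bounded_coefficient_def by blast
qed

lemma bounded_datum_pressure:
  assumes "bounded_datum F" "\<And>p. p \<in> slice_cell \<Longrightarrow> 0 \<le> F p" "0 < k0" "0 < \<gamma>"
  shows "bounded_datum (\<lambda>p. pressure \<gamma> k0 (F p))"
proof -
  obtain M where M: "\<forall>p\<in>slice_cell. \<bar>F p\<bar> \<le> M" using assms(1) by (auto simp: bounded_datum_def)
  have F: "F \<in> borel_measurable slice_measure" using assms(1) by (simp add: bounded_datum_def)
  have "\<bar>pressure \<gamma> k0 (F p)\<bar> \<le> k0 * M powr \<gamma>" if p: "p \<in> slice_cell" for p
    using pressure_bound[OF assms(3,4) assms(2)[OF p], of M] bspec[OF M p] assms(2)[OF p] by simp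
  moreover have "(\<lambda>p. pressure \<gamma> k0 (F p)) \<in> borel_measurable slice_measure"
    unfolding pressure_def using F by measurable
  ultimately show ?thesis unfolding bounded_datum_def by blast
qed

definition cell_part :: "(spt \<Rightarrow> real) \<Rightarrow> (spt \<Rightarrow> real) \<Rightarrow> (spt \<Rightarrow> real) \<Rightarrow> (spt \<Rightarrow> real) \<Rightarrow> spt \<Rightarrow> real" where
  "cell_part F0 F1 F2 f p = F0 p * dt f p + F1 p * dx1 f p + F2 p * dx2 f p"

lemma weak_form_split:
  "weak_form F0 F1 F2 G f = integral\<^sup>L cell_measure (cell_part F0 F1 F2 f) + (\<integral>x. G x * f (0, x) \<partial>slice_measure)"
  unfolding weak_form_def cell_set_integral slice_set_integral cell_part_def[abs_def] ..

lemma weak_pairing_integrable: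
  assumes f: "lipschitz_test f" "AE p in cell_measure. f differentiable (at p)"
    and F: "bounded_coefficient F0" "bounded_coefficient F1" "bounded_coefficient F2" and G: "bounded_datum G"
  shows "integrable cell_measure (cell_part F0 F1 F2 f)" "integrable slice_measure (\<lambda>x. G x * f (0, x))"
proof -
  obtain A R B where apx: "test_approximation f A R B" using lipschitz_test_approx[OF f(1)] by blast
  have fB: "\<bar>f p\<bar> \<le> B" for p
  proof (rule LIMSEQ_le_const2)
    show "(\<lambda>n. \<bar>A n p\<bar>) \<longlonglongrightarrow> \<bar>f p\<bar>" using apx by (intro tendsto_intros) (simp add: test_approximation_def)
    show "\<exists>N. \<forall>n\<ge>N. \<bar>A n p\<bar> \<le> B" using apx by (simp add: test_approximation_def)
  qed
  have dB: "\<bar>dird b f p\<bar> \<le> B" if "f differentiable (at p)" "b \<in> Basis" for p b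
  proof (rule LIMSEQ_le_const2)
    show "(\<lambda>n. \<bar>dird b (A n) p\<bar>) \<longlonglongrightarrow> \<bar>dird b f p\<bar>"
      using apx that by (intro tendsto_intros) (simp add: test_approximation_def)
    show "\<exists>N. \<forall>n\<ge>N. \<bar>dird b (A n) p\<bar> \<le> B" using apx that by (simp add: test_approximation_def)
  qed
  have f0: "f (t, x1, x2) = 0" if "\<bar>x1\<bar> > R" for t x1 x2
  proof (rule LIMSEQ_unique)
    show "(\<lambda>n. A n (t, x1, x2)) \<longlonglongrightarrow> f (t, x1, x2)" using apx by (simp add: test_approximation_def)
    show "(\<lambda>n. A n (t, x1, x2)) \<longlonglongrightarrow> 0" using apx that by (simp add: test_approximation_def)
  qed
  have d0: "dird b f (t, x1, x2) = 0" if x: "\<bar>x1\<bar> > R" for b t x1 x2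
  proof -
    have "open {p::spt. \<bar>fst (snd p)\<bar> > R}" by (intro open_Collect_less continuous_intros)
    from dird_cong_open(2)[OF this, of "(t, x1, x2)" f "\<lambda>_. 0" b] show ?thesis
      using x f0 by (auto simp: dird_const)
  qed
  have B0: "0 \<le> B" by (rule order_trans[OF abs_ge_zero fB])
  have bas: "(1,0,0) \<in> (Basis :: spt set)" "(0,1,0) \<in> (Basis :: spt set)" "(0,0,1) \<in> (Basis :: spt set)"
    by (auto simp: Basis_spt)
  have 1: "integrable cell_measure (\<lambda>p. F p * dird b f p)" if F: "bounded_coefficient F" and b: "b \<in> Basis" for F b
  proof -
    obtain M where M: "\<forall>p\<in>slab_cell. \<bar>F p\<bar> \<le> M" using F by (auto simp: bounded_coefficient_def)
    have m: "(\<lambda>p. F p * dird b f p) \<in> borel_measurable cell_measure"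
      using F lipschitz_test_dird[OF f b] by (simp add: bounded_coefficient_def borel_measurable_times)
    let ?g = "\<lambda>p. if \<bar>dird b f p\<bar> \<le> B then F p * dird b f p else 0"
    have ae: "AE p in cell_measure. F p * dird b f p = ?g p"
      using f(2) by eventually_elim (simp add: dB b)
    have gm: "?g \<in> borel_measurable cell_measure" by (rule cell_measurable_AE[OF m ae])
    have "integrable cell_measure ?g"
    proof (rule cell_integrable[where B = "\<bar>M\<bar> * B" and R = R, OF gm])
      fix p assume p: "p \<in> slab_cell"
      have "\<bar>F p\<bar> \<le> \<bar>M\<bar>" using bspec[OF M p] by simp
      then have "\<bar>F p * dird b f p\<bar> \<le> \<bar>M\<bar> * B" if "\<bar>dird b f p\<bar> \<le> B"
        unfolding abs_mult using that by (intro mult_mono) auto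
      then show "norm (?g p) \<le> \<bar>M\<bar> * B" using B0 by simp
    qed (simp add: d0)
    then show ?thesis using integrable_cong_AE[OF m gm ae] by simp
  qed
  show "integrable cell_measure (cell_part F0 F1 F2 f)"
    unfolding cell_part_def[abs_def] by (intro Bochner_Integration.integrable_add 1 F bas)
  obtain M where M: "\<forall>x\<in>slice_cell. \<bar>G x\<bar> \<le> M" using G by (auto simp: bounded_datum_def)
  show "integrable slice_measure (\<lambda>x. G x * f (0, x))"
  proof (rule slice_integrable[where B = "\<bar>M\<bar> * B" and R = R])
    have "\<exists>L. \<forall>p q. \<bar>f p - f q\<bar> \<le> L * norm (p - q)" using f(1) by (simp add: lipschitz_test_def)
    then obtain L where "\<And>p q. \<bar>f p - f q\<bar> \<le> L * norm (p - q)" by auto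
    then have c: "continuous_on UNIV f" by (rule lipschitz_test_continuous)
    have "continuous_on UNIV (\<lambda>x. f (0, x))"
      by (rule continuous_on_compose2[OF c]) (auto intro!: continuous_intros)
    then have "(\<lambda>x. f (0, x)) \<in> borel_measurable slice_measure" by (rule continuous_measurable_lebesgue_on)
    then show "(\<lambda>x. G x * f (0, x)) \<in> borel_measurable slice_measure" using G by (simp add: bounded_datum_def borel_measurable_times)
    show "norm (G x * f (0, x)) \<le> \<bar>M\<bar> * B" if x: "x \<in> slice_cell" for x
      unfolding real_norm_def abs_mult using bspec[OF M x] by (intro mult_mono fB) auto
  qed (simp add: f0)
qed

lemma weak_form_tested:
  assumes f: "lipschitz_test f" "AE p in cell_measure. f differentiable (at p)"
    and F: "bounded_coefficient F0" "bounded_coefficient F1" "bounded_coefficient F2" and G: "bounded_datum G"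
  shows "(\<And>\<zeta>. test_function \<zeta> \<Longrightarrow> weak_form F0 F1 F2 G \<zeta> = 0) \<Longrightarrow> weak_form F0 F1 F2 G f = 0"
    "(\<forall>\<zeta>. test_function \<zeta> \<longrightarrow> (\<forall>p. 0 \<le> \<zeta> p) \<longrightarrow> 0 \<le> weak_form F0 F1 F2 G \<zeta>) \<Longrightarrow> (\<forall>p. 0 \<le> f p) \<Longrightarrow>
      0 \<le> weak_form F0 F1 F2 G f"
proof -
  obtain M0 M1 M2 M3 where M: "\<forall>p\<in>slab_cell. \<bar>F0 p\<bar> \<le> M0" "\<forall>p\<in>slab_cell. \<bar>F1 p\<bar> \<le> M1" "\<forall>p\<in>slab_cell. \<bar>F2 p\<bar> \<le> M2"
    "\<forall>x\<in>slice_cell. \<bar>G x\<bar> \<le> M3"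
    using F G unfolding bounded_coefficient_def bounded_datum_def by auto
  define M where "M = \<bar>M0\<bar> + \<bar>M1\<bar> + \<bar>M2\<bar> + \<bar>M3\<bar>"
  have b: "\<bar>F0 p\<bar> \<le> M" "\<bar>F1 p\<bar> \<le> M" "\<bar>F2 p\<bar> \<le> M" if "p \<in> slab_cell" for p
    using bspec[OF M(1) that] bspec[OF M(2) that] bspec[OF M(3) that] unfolding M_def by linarith+
  have "\<bar>G x\<bar> \<le> M" if "x \<in> slice_cell" for x using bspec[OF M(4) that] unfolding M_def by linarith
  then have g: "AE x in slice_measure. \<bar>G x\<bar> \<le> M" by (intro AE_I2) simp
  have m: "F0 \<in> borel_measurable cell_measure" "F1 \<in> borel_measurable cell_measure"
    "F2 \<in> borel_measurable cell_measure" "G \<in> borel_measurable slice_measure"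
    using F G by (auto simp: bounded_coefficient_def bounded_datum_def)
  show "(\<And>\<zeta>. test_function \<zeta> \<Longrightarrow> weak_form F0 F1 F2 G \<zeta> = 0) \<Longrightarrow> weak_form F0 F1 F2 G f = 0"
    by (rule weak_form_lipschitz(1)[OF f m b g])
  show "(\<forall>\<zeta>. test_function \<zeta> \<longrightarrow> (\<forall>p. 0 \<le> \<zeta> p) \<longrightarrow> 0 \<le> weak_form F0 F1 F2 G \<zeta>) \<Longrightarrow> (\<forall>p. 0 \<le> f p) \<Longrightarrow>
      0 \<le> weak_form F0 F1 F2 G f"
    by (rule weak_form_lipschitz(2)[OF f m b g])
qed

text \<open>Written for enthalpy and velocity the Euler equations contain no fractional powers, and their solutions are the
  multipliers with which the weak formulation is tested.\<close>

definition classical_pair ::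
  "real \<Rightarrow> (real \<times> real \<Rightarrow> real) set \<Rightarrow> (spt \<Rightarrow> real) \<Rightarrow> (spt \<Rightarrow> real) \<Rightarrow> (spt \<Rightarrow> real) \<Rightarrow> bool" where
  "classical_pair \<gamma> \<Phi> h v1 v2 \<longleftrightarrow> tame \<Phi> h \<and> tame \<Phi> v1 \<and> tame \<Phi> v2 \<and> (\<forall>p\<in>slab - edge. 0 < h p) \<and>
     (\<forall>p\<in>off_graphs \<Phi>.
        dt h p + v1 p * dx1 h p + v2 p * dx2 h p = - (\<gamma> - 1) * h p * (dx1 v1 p + dx2 v2 p) \<and>
        dt v1 p + v1 p * dx1 v1 p + v2 p * dx2 v1 p = - dx1 h p \<and>
        dt v2 p + v1 p * dx1 v2 p + v2 p * dx2 v2 p = - dx2 h p)"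

text \<open>Entropy solutions in scalar components: mass, both momenta and the energy inequality. The factors \<open>1 / (\<gamma> - 1)\<close> and
  \<open>\<gamma> / (\<gamma> - 1)\<close> turn the pressure into the internal energy density and into density times enthalpy.\<close>

definition entropy_pair ::
  "real \<Rightarrow> real \<Rightarrow> (real \<times> real \<Rightarrow> real) \<Rightarrow> (real \<times> real \<Rightarrow> real) \<Rightarrow> (real \<times> real \<Rightarrow> real) \<Rightarrow>
     (spt \<Rightarrow> real) \<Rightarrow> (spt \<Rightarrow> real) \<Rightarrow> (spt \<Rightarrow> real) \<Rightarrow> bool" where
  "entropy_pair \<gamma> k0 r0 w1 w2 r u1 u2 \<longleftrightarrow>
     bounded_coefficient r \<and> bounded_coefficient u1 \<and> bounded_coefficient u2 \<and> (\<forall>p\<in>slab_cell. 0 \<le> r p) \<and>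
     bounded_datum r0 \<and> bounded_datum w1 \<and> bounded_datum w2 \<and> (\<forall>x\<in>slice_cell. 0 \<le> r0 x) \<and>
     (\<forall>\<zeta>. test_function \<zeta> \<longrightarrow>
        weak_form r (\<lambda>p. r p * u1 p) (\<lambda>p. r p * u2 p) r0 \<zeta> = 0 \<and>
        weak_form (\<lambda>p. r p * u1 p) (\<lambda>p. r p * (u1 p * u1 p) + pressure \<gamma> k0 (r p)) (\<lambda>p. r p * (u1 p * u2 p))
          (\<lambda>x. r0 x * w1 x) \<zeta> = 0 \<and>
        weak_form (\<lambda>p. r p * u2 p) (\<lambda>p. r p * (u1 p * u2 p)) (\<lambda>p. r p * (u2 p * u2 p) + pressure \<gamma> k0 (r p))
          (\<lambda>x. r0 x * w2 x) \<zeta> = 0 \<and>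
        ((\<forall>p. 0 \<le> \<zeta> p) \<longrightarrow>
          0 \<le> weak_form
            (\<lambda>p. r p * (u1 p * u1 p + u2 p * u2 p) * (1/2) + pressure \<gamma> k0 (r p) * (1 / (\<gamma> - 1)))
            (\<lambda>p. (r p * (u1 p * u1 p + u2 p * u2 p) * (1/2) + pressure \<gamma> k0 (r p) * (\<gamma> / (\<gamma> - 1))) * u1 p)
            (\<lambda>p. (r p * (u1 p * u1 p + u2 p * u2 p) * (1/2) + pressure \<gamma> k0 (r p) * (\<gamma> / (\<gamma> - 1))) * u2 p)
            (\<lambda>x. r0 x * (w1 x * w1 x + w2 x * w2 x) * (1/2) + pressure \<gamma> k0 (r0 x) * (1 / (\<gamma> - 1))) \<zeta>))"

text \<open>The production term of the relative entropy identity, quadratic in the difference of the two states.\<close>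

definition source :: "real \<Rightarrow> real \<Rightarrow> (spt \<Rightarrow> real) \<Rightarrow> (spt \<Rightarrow> real) \<Rightarrow> (spt \<Rightarrow> real) \<Rightarrow>
    (spt \<Rightarrow> real) \<Rightarrow> (spt \<Rightarrow> real) \<Rightarrow> (spt \<Rightarrow> real) \<Rightarrow> spt \<Rightarrow> real" where
  "source \<gamma> k0 h v1 v2 r u1 u2 p =
     r p * (dx1 v1 p * (u1 p - v1 p)\<^sup>2 + (dx2 v1 p + dx1 v2 p) * ((u1 p - v1 p) * (u2 p - v2 p))
       + dx2 v2 p * (u2 p - v2 p)\<^sup>2)
     + (\<gamma> - 1) * rel_energy \<gamma> k0 (r p) (h p) * (dx1 v1 p + dx2 v2 p)"

text \<open>Integrates the pointwise identity. The function \<open>J\<close> stands for any integrable upper bound of the resulting integrand: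
  the source contains derivatives of the classical solution, and bounding it pointwise first avoids discussing its
  integrability.\<close>

lemma relative_entropy_inequality:
  assumes \<gamma>: "1 < \<gamma>" "0 < k0"
    and fin: "finite \<Phi>" and \<Phi>: "\<And>\<phi>. \<phi> \<in> \<Phi> \<Longrightarrow> \<phi> differentiable_on ({0..1} \<times> UNIV)"
    and cl: "classical_pair \<gamma> \<Phi> h v1 v2" and en: "entropy_pair \<gamma> k0 r0 w1 w2 r u1 u2"
    and init: "\<And>x. fst x \<noteq> 0 \<Longrightarrow> r0 x = dens \<gamma> k0 (h (0, x)) \<and> w1 x = v1 (0, x) \<and> w2 x = v2 (0, x)"
    and W: "edge_weight T R \<delta> B W W0 W1"
    and J: "integrable cell_measure J"
    and le: "\<And>p. p \<in> off_graphs \<Phi> \<Longrightarrow> p \<in> slab_cell \<Longrightarrow>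
      W0 p * rel_entropy \<gamma> k0 (r p) (u1 p) (u2 p) (h p) (v1 p) (v2 p)
      + W1 p * rel_flux \<gamma> k0 (r p) (u1 p) (u2 p) (h p) (v1 p) (v2 p)
      - W p * source \<gamma> k0 h v1 v2 r u1 u2 p \<le> J p"
  shows "0 \<le> integral\<^sup>L cell_measure J"
proof -
  have th: "tame \<Phi> h" and tv1: "tame \<Phi> v1" and tv2: "tame \<Phi> v2" and hpos: "\<And>p. p \<in> slab - edge \<Longrightarrow> 0 < h p"
    and eqs: "\<And>p. p \<in> off_graphs \<Phi> \<Longrightarrow>
        dt h p + v1 p * dx1 h p + v2 p * dx2 h p = - (\<gamma> - 1) * h p * (dx1 v1 p + dx2 v2 p)"
      "\<And>p. p \<in> off_graphs \<Phi> \<Longrightarrow> dt v1 p + v1 p * dx1 v1 p + v2 p * dx2 v1 p = - dx1 h p"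
      "\<And>p. p \<in> off_graphs \<Phi> \<Longrightarrow> dt v2 p + v1 p * dx1 v2 p + v2 p * dx2 v2 p = - dx2 h p"
    using cl by (simp_all add: classical_pair_def)
  \<comment> \<open>The multiplier of the mass equation.\<close>
  define a where "a p = h p + (-1/2) * (v1 p * v1 p + v2 p * v2 p)" for p
  define P where "P p = press \<gamma> k0 (h p)" for p
  define p' where "p' q = pressure \<gamma> k0 (r q)" for q
  have ta: "tame \<Phi> a" unfolding a_def[abs_def] by (intro tame_add tame_mult tame_const th tv1 tv2)
  have tP: "tame \<Phi> P"
    unfolding P_def[abs_def]
    by (rule tame_compose[OF th hpos press_deriv[OF \<gamma>] press_bounded[OF \<gamma>]])
  have tP1: "tame \<Phi> (\<lambda>p. P p * v1 p)" and tP2: "tame \<Phi> (\<lambda>p. P p * v2 p)"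
    by (intro tame_mult tP tv1 tv2)+
  have ae: "AE p in cell_measure. p \<in> off_graphs \<Phi>" by (rule graphs_negligible[OF fin \<Phi>])
  have lt: "lipschitz_test (weighted W f)" if "tame \<Phi> f" for f
    by (rule weighted_lipschitz_test[OF fin \<Phi> W that])
  have df: "AE p in cell_measure. weighted W f differentiable (at p)" if "tame \<Phi> f" for f
    using ae by eventually_elim (rule weighted_dird(1)[OF W that])
  have bc: "bounded_coefficient r" "bounded_coefficient u1" "bounded_coefficient u2" "bounded_coefficient p'"
    and bd: "bounded_datum r0" "bounded_datum w1" "bounded_datum w2" "bounded_datum (\<lambda>x. pressure \<gamma> k0 (r0 x))"
    using en \<gamma> unfolding entropy_pair_def p'_def[abs_def]
    by (auto intro!: bounded_coefficient_pressure bounded_datum_pressure)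
  note bc' = bounded_coefficient_add bounded_coefficient_mult bounded_coefficient_const bc
  note bd' = bounded_datum_add bounded_datum_mult bounded_datum_const bd
  let ?e0 = "\<lambda>p. r p * (u1 p * u1 p + u2 p * u2 p) * (1/2) + p' p * (1 / (\<gamma> - 1))"
  let ?e1 = "\<lambda>p. (r p * (u1 p * u1 p + u2 p * u2 p) * (1/2) + p' p * (\<gamma> / (\<gamma> - 1))) * u1 p"
  let ?e2 = "\<lambda>p. (r p * (u1 p * u1 p + u2 p * u2 p) * (1/2) + p' p * (\<gamma> / (\<gamma> - 1))) * u2 p"
  let ?ge = "\<lambda>x. r0 x * (w1 x * w1 x + w2 x * w2 x) * (1/2) + pressure \<gamma> k0 (r0 x) * (1 / (\<gamma> - 1))"
  let ?m1 = "\<lambda>p. r p * u1 p" and ?m2 = "\<lambda>p. r p * u2 p"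
  let ?m11 = "\<lambda>p. r p * (u1 p * u1 p) + p' p" and ?m12 = "\<lambda>p. r p * (u1 p * u2 p)"
  let ?m22 = "\<lambda>p. r p * (u2 p * u2 p) + p' p"
  let ?f1 = "weighted W (\<lambda>p. 1)" and ?fa = "weighted W a" and ?fv1 = "weighted W v1" and ?fv2 = "weighted W v2"
  let ?fP = "weighted W P" and ?fP1 = "weighted W (\<lambda>p. P p * v1 p)" and ?fP2 = "weighted W (\<lambda>p. P p * v2 p)"
  have tested: "weak_form F0 F1 F2 G (weighted W f) = 0"
    if "\<And>\<zeta>. test_function \<zeta> \<Longrightarrow> weak_form F0 F1 F2 G \<zeta> = 0" "bounded_coefficient F0" "bounded_coefficient F1"
      "bounded_coefficient F2" "bounded_datum G" "tame \<Phi> f" for F0 F1 F2 G f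
    by (rule weak_form_tested(1)[OF lt[OF that(6)] df[OF that(6)] that(2,3,4,5,1)])
  have E: "0 \<le> weak_form ?e0 ?e1 ?e2 ?ge ?f1"
  proof (rule weak_form_tested(2)[OF lt[OF tame_const] df[OF tame_const]])
    show "\<forall>p. 0 \<le> weighted W (\<lambda>p. 1) p"
    proof
      fix p
      have "clamp_time p \<in> slab" by (simp add: clamp_time_def slab_def)
      then show "0 \<le> weighted W (\<lambda>p. 1) p" using W by (simp add: weighted_def edge_weight_def)
    qed
    show "\<forall>\<zeta>. test_function \<zeta> \<longrightarrow> (\<forall>p. 0 \<le> \<zeta> p) \<longrightarrow> 0 \<le> weak_form ?e0 ?e1 ?e2 ?ge \<zeta>"
      using en by (simp add: entropy_pair_def p'_def)
  qed (intro bc' bd')+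
  have M: "weak_form r ?m1 ?m2 r0 ?fa = 0"
    by (rule tested) (use en in \<open>simp add: entropy_pair_def\<close>, (intro bc' bd' ta)+)
  have M1: "weak_form ?m1 ?m11 ?m12 (\<lambda>x. r0 x * w1 x) ?fv1 = 0"
    by (rule tested) (use en in \<open>simp add: entropy_pair_def p'_def\<close>, (intro bc' bd' tv1)+)
  have M2: "weak_form ?m2 ?m12 ?m22 (\<lambda>x. r0 x * w2 x) ?fv2 = 0"
    by (rule tested) (use en in \<open>simp add: entropy_pair_def p'_def\<close>, (intro bc' bd' tv2)+)
  have D0: "weak_form (\<lambda>_. 1) (\<lambda>_. 0) (\<lambda>_. 0) (\<lambda>_. 1) ?fP = 0"
    by (rule tested) (rule smooth_divergence, assumption, (intro bc' bd' tP)+)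
  have D1: "weak_form (\<lambda>_. 0) (\<lambda>_. 1) (\<lambda>_. 0) (\<lambda>_. 0) ?fP1 = 0"
    by (rule tested) (rule smooth_divergence, assumption, (intro bc' bd' tP1)+)
  have D2: "weak_form (\<lambda>_. 0) (\<lambda>_. 0) (\<lambda>_. 1) (\<lambda>_. 0) ?fP2 = 0"
    by (rule tested) (rule smooth_divergence, assumption, (intro bc' bd' tP2)+)
  have int: "integrable cell_measure (cell_part F0 F1 F2 (weighted W f))"
    if "bounded_coefficient F0" "bounded_coefficient F1" "bounded_coefficient F2" "tame \<Phi> f" for F0 F1 F2 f
    by (rule weak_pairing_integrable(1)[OF lt[OF that(4)] df[OF that(4)] that(1,2,3) bounded_datum_const])
  have ints: "integrable slice_measure (\<lambda>x. G x * weighted W f (0, x))"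
    if "bounded_datum G" "tame \<Phi> f" for G f
    by (rule weak_pairing_integrable(2)[OF lt[OF that(2)] df[OF that(2)] bounded_coefficient_const
          bounded_coefficient_const bounded_coefficient_const that(1)])
  let ?K = "\<lambda>p. cell_part ?e0 ?e1 ?e2 ?f1 p - cell_part r ?m1 ?m2 ?fa p - cell_part ?m1 ?m11 ?m12 ?fv1 p
     - cell_part ?m2 ?m12 ?m22 ?fv2 p + cell_part (\<lambda>_. 1) (\<lambda>_. 0) (\<lambda>_. 0) ?fP p
     + cell_part (\<lambda>_. 0) (\<lambda>_. 1) (\<lambda>_. 0) ?fP1 p + cell_part (\<lambda>_. 0) (\<lambda>_. 0) (\<lambda>_. 1) ?fP2 p"
  let ?S = "\<lambda>x. ?ge x * ?f1 (0, x) - r0 x * ?fa (0, x) - r0 x * w1 x * ?fv1 (0, x) - r0 x * w2 x * ?fv2 (0, x)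
     + 1 * ?fP (0, x) + 0 * ?fP1 (0, x) + 0 * ?fP2 (0, x)"
  note ic = int[OF _ _ _ tame_const] int[OF _ _ _ ta] int[OF _ _ _ tv1] int[OF _ _ _ tv2] int[OF _ _ _ tP] int[OF _ _ _ tP1] int[OF _ _ _ tP2]
  note jc = ints[OF _ tame_const] ints[OF _ ta] ints[OF _ tv1] ints[OF _ tv2] ints[OF _ tP] ints[OF _ tP1] ints[OF _ tP2]
  have i: "integrable cell_measure (cell_part ?e0 ?e1 ?e2 ?f1)" "integrable cell_measure (cell_part r ?m1 ?m2 ?fa)"
    "integrable cell_measure (cell_part ?m1 ?m11 ?m12 ?fv1)" "integrable cell_measure (cell_part ?m2 ?m12 ?m22 ?fv2)"
    "integrable cell_measure (cell_part (\<lambda>_. 1) (\<lambda>_. 0) (\<lambda>_. 0) ?fP)"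
    "integrable cell_measure (cell_part (\<lambda>_. 0) (\<lambda>_. 1) (\<lambda>_. 0) ?fP1)"
    "integrable cell_measure (cell_part (\<lambda>_. 0) (\<lambda>_. 0) (\<lambda>_. 1) ?fP2)"
    by (intro ic bc')+
  have j: "integrable slice_measure (\<lambda>x. ?ge x * ?f1 (0, x))" "integrable slice_measure (\<lambda>x. r0 x * ?fa (0, x))"
    "integrable slice_measure (\<lambda>x. r0 x * w1 x * ?fv1 (0, x))" "integrable slice_measure (\<lambda>x. r0 x * w2 x * ?fv2 (0, x))"
    "integrable slice_measure (\<lambda>x. 1 * ?fP (0, x))" "integrable slice_measure (\<lambda>x. 0 * ?fP1 (0, x))"
    "integrable slice_measure (\<lambda>x. 0 * ?fP2 (0, x))"
    by (intro jc bd')+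
  have iK: "integrable cell_measure ?K"
    by (intro Bochner_Integration.integrable_add Bochner_Integration.integrable_diff i)
  have K: "integral\<^sup>L cell_measure ?K = integral\<^sup>L cell_measure (cell_part ?e0 ?e1 ?e2 ?f1)
     - integral\<^sup>L cell_measure (cell_part r ?m1 ?m2 ?fa) - integral\<^sup>L cell_measure (cell_part ?m1 ?m11 ?m12 ?fv1)
     - integral\<^sup>L cell_measure (cell_part ?m2 ?m12 ?m22 ?fv2) + integral\<^sup>L cell_measure (cell_part (\<lambda>_. 1) (\<lambda>_. 0) (\<lambda>_. 0) ?fP)
     + integral\<^sup>L cell_measure (cell_part (\<lambda>_. 0) (\<lambda>_. 1) (\<lambda>_. 0) ?fP1) + integral\<^sup>L cell_measure (cell_part (\<lambda>_. 0) (\<lambda>_. 0) (\<lambda>_. 1) ?fP2)"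
    by (simp only: Bochner_Integration.integral_add Bochner_Integration.integral_diff
        Bochner_Integration.integrable_add Bochner_Integration.integrable_diff i)
  have S: "integral\<^sup>L slice_measure ?S = (\<integral>x. ?ge x * ?f1 (0, x) \<partial>slice_measure)
     - (\<integral>x. r0 x * ?fa (0, x) \<partial>slice_measure) - (\<integral>x. r0 x * w1 x * ?fv1 (0, x) \<partial>slice_measure)
     - (\<integral>x. r0 x * w2 x * ?fv2 (0, x) \<partial>slice_measure) + (\<integral>x. 1 * ?fP (0, x) \<partial>slice_measure)
     + (\<integral>x. 0 * ?fP1 (0, x) \<partial>slice_measure) + (\<integral>x. 0 * ?fP2 (0, x) \<partial>slice_measure)"
    by (simp only: Bochner_Integration.integral_add Bochner_Integration.integral_diff
        Bochner_Integration.integrable_add Bochner_Integration.integrable_diff j)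
  \<comment> \<open>The initial term is the relative entropy of identical states; on the edge itself the weight vanishes.\<close>
  have "?S x = 0" for x
  proof (cases "fst x = 0")
    case True
    then have "rad (0, x) < \<delta>" using W by (simp add: rad_def edge_weight_def)
    then have "W (0, x) = 0" using W by (simp add: edge_weight_def)
    then show ?thesis by (simp add: weighted_def clamp_time_def)
  next
    case False
    have s: "(0, x) \<in> slab - edge" using False by (cases x) (simp add: slab_def edge_def)
    have hp: "0 < h (0, x)" by (rule hpos[OF s])
    have pr: "pressure \<gamma> k0 (r0 x) = P (0, x)"
      using init[OF False] pressure_dens[OF \<gamma> hp] by (simp add: P_def)
    have r: "r0 x * h (0, x) = \<gamma> / (\<gamma> - 1) * P (0, x)"
      using init[OF False] \<gamma> by (simp add: P_def press_def)
    have g: "\<gamma> / (\<gamma> - 1) * P (0, x) = P (0, x) + P (0, x) * (1 / (\<gamma> - 1))" using \<gamma> by (simp add: field_simps)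
    have "?S x = W (0, x) * (P (0, x) * (1 / (\<gamma> - 1)) - r0 x * h (0, x) + P (0, x))"
      using init[OF False] unfolding pr by (simp add: weighted_def clamp_time_def a_def algebra_simps add_divide_distrib)
    then show ?thesis unfolding r g by simp
  qed
  then have "integral\<^sup>L slice_measure ?S = 0" by (simp only: Bochner_Integration.integral_zero)
  with S K E M M1 M2 D0 D1 D2 have "0 \<le> integral\<^sup>L cell_measure ?K"
    unfolding weak_form_split by linarith
  also have "\<dots> \<le> integral\<^sup>L cell_measure J"
  proof (rule integral_mono_AE[OF iK J])
    have "AE p in cell_measure. p \<in> slab_cell" by (intro AE_I2) simp
    then show "AE p in cell_measure. ?K p \<le> J p" using ae
    proof eventually_elim
      fix p assume p: "p \<in> slab_cell" "p \<in> off_graphs \<Phi>"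
      note dh = tame_differentiable[OF th p(2)] and d1 = tame_differentiable[OF tv1 p(2)] and d2 = tame_differentiable[OF tv2 p(2)]
        and dP = tame_differentiable[OF tP p(2)]
      have hp: "0 < h p" by (rule hpos[OF off_graphs_slab[OF p(2)]])
      have da: "dird b a p = dird b h p - v1 p * dird b v1 p - v2 p * dird b v2 p" for b
      proof -
        have q: "(\<lambda>q. v1 q * v1 q + v2 q * v2 q) differentiable (at p)" using d1 d2 by simp
        have c: "(\<lambda>q. -1/2 :: real) differentiable (at p)" by simp
        have cq: "(\<lambda>q. -1/2 * (v1 q * v1 q + v2 q * v2 q)) differentiable (at p)"
          by (rule differentiable_mult[OF c q])
        show ?thesis
          unfolding a_def[abs_def] dird_add[OF dh cq] dird_mult[OF c q] dird_const
            dird_add[OF differentiable_mult[OF d1 d1] differentiable_mult[OF d2 d2]] dird_mult[OF d1 d1] dird_mult[OF d2 d2]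
          by (simp add: add_divide_distrib)
      qed
      have dPp: "dird b P p = dens \<gamma> k0 (h p) * dird b h p" for b
        unfolding P_def[abs_def] by (rule dird_chain(2)[OF dh press_deriv[OF \<gamma> hp]])
      have dP1: "dird b (\<lambda>p. P p * v1 p) p = dens \<gamma> k0 (h p) * dird b h p * v1 p + P p * dird b v1 p" for b
        unfolding dird_mult[OF dP d1] dPp ..
      have dP2: "dird b (\<lambda>p. P p * v2 p) p = dens \<gamma> k0 (h p) * dird b h p * v2 p + P p * dird b v2 p" for b
        unfolding dird_mult[OF dP d2] dPp ..
      note wd = weighted_dird(4-6)[OF W _ p(2)]
      note id = rel_entropy_identity[OF \<gamma>(1) refl[of "pressure \<gamma> k0 (r p)"] refl[of "press \<gamma> k0 (h p)"] refl[of "dens \<gamma> k0 (h p)"]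
          eqs[OF p(2)], of "u1 p" "u2 p" "W0 p" "W1 p" "W p"]
      have "?K p = W0 p * rel_entropy \<gamma> k0 (r p) (u1 p) (u2 p) (h p) (v1 p) (v2 p)
      + W1 p * rel_flux \<gamma> k0 (r p) (u1 p) (u2 p) (h p) (v1 p) (v2 p)
      - W p * source \<gamma> k0 h v1 v2 r u1 u2 p"
        unfolding source_def id[symmetric] cell_part_def wd[OF tame_const] wd[OF ta] wd[OF tv1] wd[OF tv2] wd[OF tP] wd[OF tP1] wd[OF tP2]
          dird_const da dPp dP1 dP2
        by (simp add: a_def P_def p'_def power2_eq_square)
      also have "\<dots> \<le> J p" by (rule le[OF p(2,1)])
      finally show "?K p \<le> J p" .
    qed
  qed
  finally show ?thesis .
qed

section \<open>Weights supported in cones, cut off near the edge\<close>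

text \<open>Continuously differentiable, which is all the smoothness that the weights need.\<close>

definition pos_square :: "real \<Rightarrow> real" where "pos_square s = (max 0 s)\<^sup>2"

lemma pos_square_nonneg [simp]: "0 \<le> pos_square s"
  by (simp add: pos_square_def)

lemma pos_square_eq_0: "s \<le> 0 \<Longrightarrow> pos_square s = 0"
  by (simp add: pos_square_def)

lemma pos_square_mono: "s \<le> s' \<Longrightarrow> pos_square s \<le> pos_square s'"
  by (simp add: pos_square_def power_mono)

lemma pos_square_deriv: "(pos_square has_real_derivative 2 * max 0 s) (at s)"
proof (cases "s = 0")
  case True
  have "((\<lambda>y. (pos_square y - pos_square 0) / (y - 0)) \<longlongrightarrow> 0) (at 0)"
  proof (rule Lim_null_comparison)
    show "((\<lambda>y::real. \<bar>y\<bar>) \<longlongrightarrow> 0) (at 0)" by (auto intro!: tendsto_eq_intros)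
    show "\<forall>\<^sub>F y in at 0. norm ((pos_square y - pos_square 0) / (y - 0)) \<le> \<bar>y\<bar>"
      by (intro always_eventually allI) (simp add: pos_square_def max_def power2_eq_square)
  qed
  then show ?thesis using True by (simp add: has_field_derivative_iff)
next
  case False
  show ?thesis
  proof (cases "0 < s")
    case True
    have "((\<lambda>s. s\<^sup>2) has_real_derivative 2 * s) (at s)" by (auto intro!: derivative_eq_intros)
    moreover have "\<forall>\<^sub>F y in nhds s. 0 < y" using True by (intro eventually_nhds_in_open[of "{0<..}", simplified]) auto
    then have "\<forall>\<^sub>F y in nhds s. pos_square y = y\<^sup>2" by eventually_elim (simp add: pos_square_def)
    ultimately show ?thesis using True by (subst DERIV_cong_ev[OF refl _ refl]) auto
  next
    case neg: False
    have "((\<lambda>s. 0) has_real_derivative 0) (at s)" by simp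
    moreover have "\<forall>\<^sub>F y in nhds s. y < 0" using False neg by (intro eventually_nhds_in_open[of "{..<0}", simplified]) auto
    then have "\<forall>\<^sub>F y in nhds s. pos_square y = 0" by eventually_elim (simp add: pos_square_def)
    ultimately show ?thesis using neg by (subst DERIV_cong_ev[OF refl _ refl]) auto
  qed
qed

definition planar_deriv :: "(spt \<Rightarrow> real) \<Rightarrow> real \<Rightarrow> real \<Rightarrow> spt \<Rightarrow> bool" where
  "planar_deriv W a b p \<longleftrightarrow> (W has_derivative (\<lambda>h. fst h * a + fst (snd h) * b)) (at p)"

lemma planar_deriv_t: "planar_deriv fst 1 0 p"
  unfolding planar_deriv_def by (auto intro!: bounded_linear_imp_has_derivative bounded_linear_fst)

lemma planar_deriv_x: "planar_deriv (\<lambda>p. fst (snd p)) 0 1 p"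
  unfolding planar_deriv_def by (auto intro!: bounded_linear_imp_has_derivative bounded_linear_fst_comp bounded_linear_snd)

lemma planar_deriv_mult:
  assumes "planar_deriv f a b p" "planar_deriv g c d p"
  shows "planar_deriv (\<lambda>p. f p * g p) (a * g p + f p * c) (b * g p + f p * d) p"
  using has_derivative_mult[OF assms[unfolded planar_deriv_def]] unfolding planar_deriv_def
  by (rule has_derivative_eq_rhs) (auto simp: algebra_simps)

lemma planar_deriv_add:
  assumes "planar_deriv f a b p" "planar_deriv g c d p"
  shows "planar_deriv (\<lambda>p. f p + g p) (a + c) (b + d) p"
  using has_derivative_add[OF assms[unfolded planar_deriv_def]] unfolding planar_deriv_def
  by (rule has_derivative_eq_rhs) (auto simp: algebra_simps)

lemma planar_deriv_chain:
  assumes "planar_deriv f a b p" "(g has_real_derivative d) (at (f p))"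
  shows "planar_deriv (\<lambda>p. g (f p)) (d * a) (d * b) p"
  using has_derivative_compose[OF assms(1)[unfolded planar_deriv_def] assms(2)[unfolded has_field_derivative_def]]
  unfolding planar_deriv_def by (rule has_derivative_eq_rhs) (auto simp: algebra_simps)

text \<open>Positive inside a cone that shrinks at speed \<open>S\<close>. The smooth function \<open>sqrt (1 + x\<^sub>1\<^sup>2)\<close> replaces \<open>\<bar>x\<^sub>1\<bar>\<close>; its slope
  is at most one.\<close>

definition front :: "real \<Rightarrow> real \<Rightarrow> spt \<Rightarrow> real" where
  "front \<rho> S p = (\<rho> - sqrt (1 + (fst (snd p))\<^sup>2)) + - S * fst p"

text \<open>The three factors produce three nonpositive contributions to the time derivative: \<open>- \<kappa>\<close> times the weight, which
  dominates the source; the drop of the cone factor, which dominates the flux since it is \<open>S\<close> times a bound for the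
  \<open>x\<^sub>1\<close>-derivative; and the gain, strictly negative inside the cone before time \<open>T\<close>, which is left over.\<close>

definition cone_weight :: "real \<Rightarrow> real \<Rightarrow> real \<Rightarrow> real \<Rightarrow> spt \<Rightarrow> real" where
  "cone_weight \<kappa> \<rho> S T p = exp (- \<kappa> * fst p) * pos_square (front \<rho> S p) * pos_square (T - fst p)"

definition cone_gain :: "real \<Rightarrow> real \<Rightarrow> real \<Rightarrow> real \<Rightarrow> spt \<Rightarrow> real" where
  "cone_gain \<kappa> \<rho> S T p = exp (- \<kappa> * fst p) * pos_square (front \<rho> S p) * (2 * max 0 (T - fst p))"

definition cone_drop :: "real \<Rightarrow> real \<Rightarrow> real \<Rightarrow> real \<Rightarrow> spt \<Rightarrow> real" where
  "cone_drop \<kappa> \<rho> S T p = exp (- \<kappa> * fst p) * (2 * max 0 (front \<rho> S p)) * pos_square (T - fst p)"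

lemma cone_weight_deriv:
  "planar_deriv (cone_weight \<kappa> \<rho> S T)
     (- \<kappa> * cone_weight \<kappa> \<rho> S T p - S * cone_drop \<kappa> \<rho> S T p - cone_gain \<kappa> \<rho> S T p)
     (- (fst (snd p) / sqrt (1 + (fst (snd p))\<^sup>2)) * cone_drop \<kappa> \<rho> S T p) p"
proof -
  have e: "planar_deriv (\<lambda>p. exp (- \<kappa> * fst p)) (exp (- \<kappa> * fst p) * - \<kappa> * 1) (exp (- \<kappa> * fst p) * - \<kappa> * 0) p"
    by (rule planar_deriv_chain[OF planar_deriv_t]) (auto intro!: derivative_eq_intros)
  have pos: "0 < 1 + x\<^sup>2" for x :: real by (simp add: add_pos_nonneg)
  have 1: "planar_deriv (\<lambda>p. \<rho> - sqrt (1 + (fst (snd p))\<^sup>2)) ((- (fst (snd p) / sqrt (1 + (fst (snd p))\<^sup>2))) * 0)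
     ((- (fst (snd p) / sqrt (1 + (fst (snd p))\<^sup>2))) * 1) p"
    by (rule planar_deriv_chain[OF planar_deriv_x])
       (use pos[of "fst (snd p)"] in \<open>auto intro!: derivative_eq_intros simp: divide_simps\<close>)
  have 2: "planar_deriv (\<lambda>p. - S * fst p) (- S * 1) (- S * 0) p"
    by (rule planar_deriv_chain[OF planar_deriv_t]) (auto intro!: derivative_eq_intros)
  note 3 = planar_deriv_chain[OF planar_deriv_add[OF 1 2] pos_square_deriv, folded front_def]
  have 4: "planar_deriv (\<lambda>p. pos_square (T - fst p)) ((2 * max 0 (T - fst p) * - 1) * 1) ((2 * max 0 (T - fst p) * - 1) * 0) p"
    by (rule planar_deriv_chain[OF planar_deriv_t, where g = "\<lambda>t. pos_square (T - t)"])
       (rule DERIV_chain2[OF pos_square_deriv], auto intro!: derivative_eq_intros)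
  show ?thesis
    using planar_deriv_mult[OF planar_deriv_mult[OF e 3] 4]
    unfolding cone_weight_def[abs_def] cone_drop_def cone_gain_def
    by (simp add: algebra_simps)
qed

text \<open>A continuously differentiable transition from \<open>0\<close> on \<open>s \<le> 1\<close> to \<open>1\<close> on \<open>s \<ge> 2\<close>.\<close>

definition cut_profile :: "real \<Rightarrow> real" where
  "cut_profile s = 1 - pos_square (1 - pos_square (s - 1))"

definition cut_slope :: "real \<Rightarrow> real" where
  "cut_slope s = 2 * max 0 (1 - pos_square (s - 1)) * (2 * max 0 (s - 1))"

lemma cut_profile_deriv: "(cut_profile has_real_derivative cut_slope s) (at s)"
proof -
  have 1: "((\<lambda>s. pos_square (s - 1)) has_real_derivative 2 * max 0 (s - 1) * 1) (at s)"
    by (rule DERIV_chain2[OF pos_square_deriv]) (auto intro!: derivative_eq_intros)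
  have 2: "((\<lambda>s. pos_square (1 - pos_square (s - 1))) has_real_derivative
     2 * max 0 (1 - pos_square (s - 1)) * (0 - 2 * max 0 (s - 1) * 1)) (at s)"
    by (rule DERIV_chain2[OF pos_square_deriv]) (intro DERIV_diff DERIV_const 1)
  show ?thesis
    unfolding cut_profile_def[abs_def]
    by (rule DERIV_cong[OF DERIV_diff[OF DERIV_const 2]]) (simp add: cut_slope_def)
qed

lemma cut_profile_range: "0 \<le> cut_profile s" "cut_profile s \<le> 1"
proof -
  have "pos_square (1 - pos_square (s - 1)) \<le> pos_square 1" by (rule pos_square_mono) simp
  then show "0 \<le> cut_profile s" by (simp add: cut_profile_def pos_square_def)
qed (simp add: cut_profile_def)

lemma cut_profile_low: "s \<le> 1 \<Longrightarrow> cut_profile s = 0"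
  by (simp add: cut_profile_def pos_square_def)

lemma pos_square_ge_1: "1 \<le> s \<Longrightarrow> 1 \<le> pos_square s"
  by (simp add: pos_square_def)

lemma cut_profile_high: "2 \<le> s \<Longrightarrow> cut_profile s = 1"
  using pos_square_ge_1[of "s - 1"] by (simp add: cut_profile_def pos_square_eq_0)

lemma cut_slope_high: "2 \<le> s \<Longrightarrow> cut_slope s = 0"
  using pos_square_ge_1[of "s - 1"] by (simp add: cut_slope_def)

lemma cut_slope_bound: "\<bar>cut_slope s\<bar> \<le> 4"
proof (cases "2 \<le> s")
  case False
  have "2 * max 0 (1 - pos_square (s - 1)) * (2 * max 0 (s - 1)) \<le> 2 * 2"
    using False by (intro mult_mono) auto
  moreover have "0 \<le> cut_slope s" by (simp add: cut_slope_def)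
  ultimately show ?thesis by (simp add: cut_slope_def)
qed (simp add: cut_slope_high)

text \<open>Cuts off the disc of radius \<open>\<delta>\<close> about the edge in the \<open>(t, x\<^sub>1)\<close>-plane. The squared radius is used since it is smooth.\<close>

definition edge_cut :: "real \<Rightarrow> spt \<Rightarrow> real" where
  "edge_cut \<delta> p = cut_profile (((fst p)\<^sup>2 + (fst (snd p))\<^sup>2) / \<delta>\<^sup>2)"

definition edge_slope :: "real \<Rightarrow> spt \<Rightarrow> real" where
  "edge_slope \<delta> p = cut_slope (((fst p)\<^sup>2 + (fst (snd p))\<^sup>2) / \<delta>\<^sup>2)"

lemma edge_cut_deriv:
  assumes "\<delta> > 0"
  shows "planar_deriv (edge_cut \<delta>) (edge_slope \<delta> p * (2 * fst p / \<delta>\<^sup>2)) (edge_slope \<delta> p * (2 * fst (snd p) / \<delta>\<^sup>2)) p"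
proof -
  have 1: "planar_deriv (\<lambda>p. (fst p)\<^sup>2) (2 * fst p * 1) (2 * fst p * 0) p"
    by (rule planar_deriv_chain[OF planar_deriv_t]) (auto intro!: derivative_eq_intros)
  have 2: "planar_deriv (\<lambda>p. (fst (snd p))\<^sup>2) (2 * fst (snd p) * 0) (2 * fst (snd p) * 1) p"
    by (rule planar_deriv_chain[OF planar_deriv_x]) (auto intro!: derivative_eq_intros)
  have 3: "((\<lambda>s. cut_profile (s / \<delta>\<^sup>2)) has_real_derivative cut_slope (s / \<delta>\<^sup>2) * (1 / \<delta>\<^sup>2)) (at s)" for s
    by (rule DERIV_chain2[OF cut_profile_deriv DERIV_cdivide[OF DERIV_ident]])
  show ?thesis
    using planar_deriv_chain[OF planar_deriv_add[OF 1 2] 3]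
    unfolding edge_cut_def[abs_def] edge_slope_def by simp
qed

lemma edge_slope_support:
  assumes "\<delta> > 0" "edge_slope \<delta> p \<noteq> 0" shows "\<bar>fst p\<bar> \<le> 2 * \<delta>" "\<bar>fst (snd p)\<bar> \<le> 2 * \<delta>"
proof -
  have "((fst p)\<^sup>2 + (fst (snd p))\<^sup>2) / \<delta>\<^sup>2 < 2"
    using assms(2) cut_slope_high unfolding edge_slope_def by (meson not_le)
  then have "(fst p)\<^sup>2 + (fst (snd p))\<^sup>2 < 2 * \<delta>\<^sup>2" using assms(1) by (simp add: divide_less_eq)
  moreover have "2 * \<delta>\<^sup>2 \<le> (2 * \<delta>)\<^sup>2" by (simp add: power_mult_distrib)
  moreover have "0 \<le> (fst p)\<^sup>2" "0 \<le> (fst (snd p))\<^sup>2" by simp_all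
  ultimately have "(fst p)\<^sup>2 \<le> (2 * \<delta>)\<^sup>2" "(fst (snd p))\<^sup>2 \<le> (2 * \<delta>)\<^sup>2" by linarith+
  then show "\<bar>fst p\<bar> \<le> 2 * \<delta>" "\<bar>fst (snd p)\<bar> \<le> 2 * \<delta>"
    using assms(1) abs_le_square_iff[of "fst p" "2 * \<delta>"] abs_le_square_iff[of "fst (snd p)" "2 * \<delta>"] by auto
qed

text \<open>The slope is at most \<open>4\<close> and lives where both coordinates are at most \<open>2 \<delta>\<close>.\<close>

lemma edge_gradient_bound:
  assumes d: "\<delta> > 0"
  shows "\<bar>edge_slope \<delta> p * (2 * fst p / \<delta>\<^sup>2)\<bar> \<le> 16 / \<delta>" "\<bar>edge_slope \<delta> p * (2 * fst (snd p) / \<delta>\<^sup>2)\<bar> \<le> 16 / \<delta>"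
proof -
  have *: "\<bar>edge_slope \<delta> p * (2 * x / \<delta>\<^sup>2)\<bar> \<le> 16 / \<delta>" if "\<bar>x\<bar> \<le> 2 * \<delta>" for x
  proof -
    have "\<bar>edge_slope \<delta> p\<bar> * \<bar>2 * x / \<delta>\<^sup>2\<bar> \<le> 4 * (2 * (2 * \<delta>) / \<delta>\<^sup>2)"
      using that d cut_slope_bound unfolding edge_slope_def
      by (intro mult_mono) (auto simp: abs_mult intro!: divide_right_mono)
    also have "\<dots> = 16 / \<delta>" using d by (simp add: power2_eq_square)
    finally show ?thesis by (simp add: abs_mult)
  qed
  show "\<bar>edge_slope \<delta> p * (2 * fst p / \<delta>\<^sup>2)\<bar> \<le> 16 / \<delta>"
    using *[of "fst p"] edge_slope_support(1)[OF d, of p] d by (cases "edge_slope \<delta> p = 0") auto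
  show "\<bar>edge_slope \<delta> p * (2 * fst (snd p) / \<delta>\<^sup>2)\<bar> \<le> 16 / \<delta>"
    using *[of "fst (snd p)"] edge_slope_support(2)[OF d, of p] d by (cases "edge_slope \<delta> p = 0") auto
qed

lemma cone_bounds:
  assumes p: "p \<in> slab" and c: "0 \<le> \<kappa>" "0 \<le> S" "0 \<le> \<rho>" "T \<le> 1"
  shows "0 \<le> cone_weight \<kappa> \<rho> S T p" "cone_weight \<kappa> \<rho> S T p \<le> \<rho>\<^sup>2"
    "0 \<le> cone_gain \<kappa> \<rho> S T p" "cone_gain \<kappa> \<rho> S T p \<le> 2 * \<rho>\<^sup>2"
    "0 \<le> cone_drop \<kappa> \<rho> S T p" "cone_drop \<kappa> \<rho> S T p \<le> 2 * \<rho>"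
proof -
  have t: "0 \<le> fst p" using p by (auto simp: slab_def)
  have e: "exp (- \<kappa> * fst p) \<le> 1" using t c by simp
  have f: "front \<rho> S p \<le> \<rho>" 
  proof -
    have "0 \<le> S * fst p" "0 \<le> sqrt (1 + (fst (snd p))\<^sup>2)" using t c by simp_all
    then show ?thesis unfolding front_def mult_minus_left by linarith
  qed
  have m: "max 0 (front \<rho> S p) \<le> \<rho>" using f c by simp
  have q: "pos_square (front \<rho> S p) \<le> \<rho>\<^sup>2" unfolding pos_square_def using m by (intro power_mono) auto
  have T: "max 0 (T - fst p) \<le> 1" using t c by simp
  have qT: "pos_square (T - fst p) \<le> 1" unfolding pos_square_def using T by (intro power_le_one) auto
  show "0 \<le> cone_weight \<kappa> \<rho> S T p" "0 \<le> cone_gain \<kappa> \<rho> S T p" "0 \<le> cone_drop \<kappa> \<rho> S T p"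
    by (simp_all add: cone_weight_def cone_gain_def cone_drop_def)
  have "cone_weight \<kappa> \<rho> S T p \<le> 1 * \<rho>\<^sup>2 * 1"
    unfolding cone_weight_def using e q qT by (intro mult_mono) auto
  then show "cone_weight \<kappa> \<rho> S T p \<le> \<rho>\<^sup>2" by simp
  have "cone_gain \<kappa> \<rho> S T p \<le> 1 * \<rho>\<^sup>2 * 2"
    unfolding cone_gain_def using e q T by (intro mult_mono) auto
  then show "cone_gain \<kappa> \<rho> S T p \<le> 2 * \<rho>\<^sup>2" by simp
  have "cone_drop \<kappa> \<rho> S T p \<le> 1 * (2 * \<rho>) * 1"
    unfolding cone_drop_def using e m qT c by (intro mult_mono) auto
  then show "cone_drop \<kappa> \<rho> S T p \<le> 2 * \<rho>" by simp
qed

lemma cone_slope_le_1: "\<bar>- (x / sqrt (1 + x\<^sup>2))\<bar> \<le> (1::real)"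
proof -
  have "\<bar>x\<bar> \<le> sqrt (1 + x\<^sup>2)" by (rule real_le_rsqrt) simp
  moreover have "0 < sqrt (1 + x\<^sup>2)" by (simp add: add_pos_nonneg)
  ultimately show ?thesis by (simp add: abs_divide)
qed

text \<open>Product rule for the cone weight and the edge cut-off; the bound grows like \<open>1 / \<delta>\<close>, which is harmless because
  it is used for fixed \<open>\<delta>\<close>.\<close>

lemma cone_edge_weight:
  assumes c: "0 \<le> \<kappa>" "0 \<le> S" "0 \<le> \<rho>" "T < 1" and d: "0 < \<delta>"
  defines "Z \<equiv> cone_weight \<kappa> \<rho> S T" and "D \<equiv> cone_drop \<kappa> \<rho> S T" and "G \<equiv> cone_gain \<kappa> \<rho> S T"
  shows "edge_weight T \<rho> \<delta> (\<kappa> * \<rho>\<^sup>2 + S * (2 * \<rho>) + 2 * \<rho>\<^sup>2 + 2 * \<rho> + \<rho>\<^sup>2 * (16 / \<delta>) + \<rho>\<^sup>2) (\<lambda>p. Z p * edge_cut \<delta> p)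
    (\<lambda>p. (- \<kappa> * Z p - S * D p - G p) * edge_cut \<delta> p + Z p * (edge_slope \<delta> p * (2 * fst p / \<delta>\<^sup>2)))
    (\<lambda>p. (- (fst (snd p) / sqrt (1 + (fst (snd p))\<^sup>2)) * D p) * edge_cut \<delta> p
       + Z p * (edge_slope \<delta> p * (2 * fst (snd p) / \<delta>\<^sup>2)))"
  unfolding edge_weight_def
proof (intro conjI allI ballI impI c d)
  show "periodic (\<lambda>p. Z p * edge_cut \<delta> p)"
    by (simp add: periodic_def Z_def cone_weight_def front_def edge_cut_def)
  show "Z (t, x1, x2) * edge_cut \<delta> (t, x1, x2) = 0" if "0 \<le> t" "t > T \<or> \<bar>x1\<bar> > \<rho>" for t x1 x2
  proof (cases "t > T")
    case True
    then show ?thesis by (simp add: Z_def cone_weight_def pos_square_eq_0)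
  next
    case False
    then have "\<bar>x1\<bar> > \<rho>" using that by simp
    moreover have "\<bar>x1\<bar> \<le> sqrt (1 + x1\<^sup>2)" by (rule real_le_rsqrt) simp
    moreover have "0 \<le> S * t" using c that by simp
    ultimately have "front \<rho> S (t, x1, x2) \<le> 0" by (simp add: front_def)
    then show ?thesis by (simp add: Z_def cone_weight_def pos_square_eq_0)
  qed
  show "Z p * edge_cut \<delta> p = 0" if "rad p < \<delta>" for p
  proof -
    have "(fst p)\<^sup>2 + (fst (snd p))\<^sup>2 \<le> (rad p)\<^sup>2"
      by (simp add: rad_def power2_sum)
    also have "\<dots> \<le> \<delta>\<^sup>2" using that by (intro power_mono) (auto simp: rad_def)
    finally have "edge_cut \<delta> p = 0" unfolding edge_cut_def using d by (intro cut_profile_low) simp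
    then show ?thesis by simp
  qed
  show "((\<lambda>p. Z p * edge_cut \<delta> p) has_derivative (\<lambda>h. fst h * ((- \<kappa> * Z p - S * D p - G p) * edge_cut \<delta> p + Z p * (edge_slope \<delta> p * (2 * fst p / \<delta>\<^sup>2)))
     + fst (snd h) * (- (fst (snd p) / sqrt (1 + (fst (snd p))\<^sup>2)) * D p * edge_cut \<delta> p
       + Z p * (edge_slope \<delta> p * (2 * fst (snd p) / \<delta>\<^sup>2))))) (at p)" for p
    using planar_deriv_mult[OF cone_weight_deriv edge_cut_deriv[OF d]] unfolding planar_deriv_def Z_def D_def G_def .
  fix p assume p: "p \<in> slab"
  have T1: "T \<le> 1" using c by simp
  note cb = cone_bounds[OF p c(1-3) T1, folded Z_def D_def G_def]
  have k: "0 \<le> edge_cut \<delta> p" "edge_cut \<delta> p \<le> 1" by (auto simp: edge_cut_def cut_profile_range)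
  have e16: "0 \<le> \<rho>\<^sup>2 * (16 / \<delta>)" using d by simp
  have nn: "0 \<le> \<kappa> * \<rho>\<^sup>2" "0 \<le> S * (2 * \<rho>)" "0 \<le> \<rho>\<^sup>2" using c by simp_all
  show "0 \<le> Z p * edge_cut \<delta> p" using cb k by simp
  have "Z p * edge_cut \<delta> p \<le> \<rho>\<^sup>2 * 1" using cb k by (intro mult_mono) auto
  then show "Z p * edge_cut \<delta> p \<le> \<kappa> * \<rho>\<^sup>2 + S * (2 * \<rho>) + 2 * \<rho>\<^sup>2 + 2 * \<rho> + \<rho>\<^sup>2 * (16 / \<delta>) + \<rho>\<^sup>2"
    using nn e16 c by linarith
  have z: "\<bar>Z p * y\<bar> \<le> \<rho>\<^sup>2 * (16 / \<delta>)" if "\<bar>y\<bar> \<le> 16 / \<delta>" for y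
    unfolding abs_mult using cb that by (intro mult_mono) auto
  have kk: "\<bar>y * edge_cut \<delta> p\<bar> \<le> \<bar>y\<bar>" for y
    unfolding abs_mult using k by (simp add: mult_left_le)
  have "\<kappa> * Z p \<le> \<kappa> * \<rho>\<^sup>2" "S * D p \<le> S * (2 * \<rho>)" "0 \<le> \<kappa> * Z p" "0 \<le> S * D p"
    using cb c by (auto intro: mult_left_mono)
  then have "\<bar>- \<kappa> * Z p - S * D p - G p\<bar> \<le> \<kappa> * \<rho>\<^sup>2 + S * (2 * \<rho>) + 2 * \<rho>\<^sup>2" using cb by simp
  then show "\<bar>(- \<kappa> * Z p - S * D p - G p) * edge_cut \<delta> p + Z p * (edge_slope \<delta> p * (2 * fst p / \<delta>\<^sup>2))\<bar>
     \<le> \<kappa> * \<rho>\<^sup>2 + S * (2 * \<rho>) + 2 * \<rho>\<^sup>2 + 2 * \<rho> + \<rho>\<^sup>2 * (16 / \<delta>) + \<rho>\<^sup>2"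
    using kk[of "- \<kappa> * Z p - S * D p - G p"] z[OF edge_gradient_bound(1)[OF d, of p]] nn c by linarith
  have "\<bar>- (fst (snd p) / sqrt (1 + (fst (snd p))\<^sup>2)) * D p\<bar> \<le> 1 * (2 * \<rho>)"
    unfolding abs_mult using cone_slope_le_1 cb by (intro mult_mono) auto
  then show "\<bar>- (fst (snd p) / sqrt (1 + (fst (snd p))\<^sup>2)) * D p * edge_cut \<delta> p
       + Z p * (edge_slope \<delta> p * (2 * fst (snd p) / \<delta>\<^sup>2))\<bar>
     \<le> \<kappa> * \<rho>\<^sup>2 + S * (2 * \<rho>) + 2 * \<rho>\<^sup>2 + 2 * \<rho> + \<rho>\<^sup>2 * (16 / \<delta>) + \<rho>\<^sup>2"
    using kk[of "- (fst (snd p) / sqrt (1 + (fst (snd p))\<^sup>2)) * D p"] z[OF edge_gradient_bound(2)[OF d, of p]] nn by linarith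
qed

section \<open>Vanishing of the relative entropy\<close>

lemma slab_cell_subset: "slab_cell \<subseteq> slab - edge"
  by (auto simp: slab_cell_def slab_def edge_def)

lemma tame_measurable: "tame \<Phi> f \<Longrightarrow> f \<in> borel_measurable cell_measure"
  by (intro continuous_imp_measurable_on_sets_lebesgue slab_cell_sets continuous_on_subset[OF _ slab_cell_subset])
     (simp add: tame_def)

text \<open>Only a lower bound for \<open>\<partial>\<^sub>1 v\<^sup>1\<close>, which tends to \<open>+ \<infinity>\<close> in the rarefaction waves as the edge is approached.\<close>

definition source_bounded_below :: "(real \<times> real \<Rightarrow> real) set \<Rightarrow> (spt \<Rightarrow> real) \<Rightarrow> (spt \<Rightarrow> real) \<Rightarrow> bool" where
  "source_bounded_below \<Phi> v1 v2 \<longleftrightarrow> (\<forall>R. \<exists>C. \<forall>p\<in>off_graphs \<Phi>. \<bar>fst (snd p)\<bar> \<le> R \<longrightarrow>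
     - C \<le> dx1 v1 p \<and> \<bar>dx2 v1 p\<bar> \<le> C \<and> \<bar>dx1 v2 p\<bar> \<le> C \<and> \<bar>dx2 v2 p\<bar> \<le> C)"

text \<open>The derivative \<open>\<partial>\<^sub>1 v\<^sup>1\<close> is multiplied by the nonnegative quantities \<open>r (u\<^sup>1 - v\<^sup>1)\<^sup>2\<close> and \<open>(\<gamma> - 1)\<close> times the relative
  energy, so a lower bound suffices. The quadratic form is at least \<open>- 4 C E\<close>, and the compression term is at least
  \<open>- 4 C E\<close> because \<open>\<gamma> - 1 < 2\<close>.\<close>

lemma source_lower:
  assumes A: "1 < \<gamma>" "\<gamma> < 3" "0 < k0" "0 \<le> r p" "0 < h p"
    and C: "- C \<le> dx1 v1 p" "\<bar>dx2 v1 p\<bar> \<le> C" "\<bar>dx1 v2 p\<bar> \<le> C" "\<bar>dx2 v2 p\<bar> \<le> C"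
  shows "- (8 * C) * rel_entropy \<gamma> k0 (r p) (u1 p) (u2 p) (h p) (v1 p) (v2 p) \<le> source \<gamma> k0 h v1 v2 r u1 u2 p"
proof -
  define x y where "x = u1 p - v1 p" and "y = u2 p - v2 p"
  define H where "H = rel_energy \<gamma> k0 (r p) (h p)"
  have C0: "0 \<le> C" using C by linarith
  have H0: "0 \<le> H" unfolding H_def by (rule rel_energy_nonneg[OF A])
  have xy: "2 * \<bar>x * y\<bar> \<le> x\<^sup>2 + y\<^sup>2"
    using sum_squares_bound[of "\<bar>x\<bar>" "\<bar>y\<bar>"] by (simp add: abs_mult mult.assoc)
  have 1: "- C * x\<^sup>2 \<le> dx1 v1 p * x\<^sup>2" using C by (intro mult_right_mono) auto
  have 2: "- C * y\<^sup>2 \<le> dx2 v2 p * y\<^sup>2" using C by (intro mult_right_mono) auto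
  have "\<bar>(dx2 v1 p + dx1 v2 p) * (x * y)\<bar> \<le> (2 * C) * \<bar>x * y\<bar>"
    unfolding abs_mult[of _ "x * y"] using C by (intro mult_right_mono) auto
  also have "\<dots> \<le> C * (x\<^sup>2 + y\<^sup>2)" using mult_left_mono[OF xy C0] by (simp add: mult_ac)
  finally have "- (C * (x\<^sup>2 + y\<^sup>2)) \<le> (dx2 v1 p + dx1 v2 p) * (x * y)" by linarith
  then have "- (2 * C) * (x\<^sup>2 + y\<^sup>2) \<le> dx1 v1 p * x\<^sup>2 + (dx2 v1 p + dx1 v2 p) * (x * y) + dx2 v2 p * y\<^sup>2"
    using 1 2 by (simp add: algebra_simps)
  then have "r p * (- (2 * C) * (x\<^sup>2 + y\<^sup>2)) \<le> r p * (dx1 v1 p * x\<^sup>2 + (dx2 v1 p + dx1 v2 p) * (x * y) + dx2 v2 p * y\<^sup>2)"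
    using A(4) by (rule mult_left_mono)
  moreover have "(\<gamma> - 1) * H * (- (2 * C)) \<le> (\<gamma> - 1) * H * (dx1 v1 p + dx2 v2 p)"
    using C A(1) H0 by (intro mult_left_mono) auto
  moreover have "(\<gamma> - 1) * H * (2 * C) \<le> 2 * H * (2 * C)"
    using A(1,2) H0 C0 by (intro mult_right_mono) auto
  moreover have "0 \<le> H * C" "0 \<le> r p * (C * (x\<^sup>2 + y\<^sup>2))" using H0 C0 A(4) by simp_all
  moreover have "8 * C * rel_entropy \<gamma> k0 (r p) (u1 p) (u2 p) (h p) (v1 p) (v2 p) = 4 * (r p * (C * (x\<^sup>2 + y\<^sup>2))) + 8 * (H * C)"
    by (simp add: rel_entropy_def x_def y_def H_def algebra_simps)
  moreover have "r p * (- (2 * C) * (x\<^sup>2 + y\<^sup>2)) = - 2 * (r p * (C * (x\<^sup>2 + y\<^sup>2)))"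
    "(\<gamma> - 1) * H * (- (2 * C)) = - ((\<gamma> - 1) * H * (2 * C))" "2 * H * (2 * C) = 4 * (H * C)"
    by (simp_all add: algebra_simps)
  ultimately show ?thesis
    unfolding source_def x_def[symmetric] y_def[symmetric] H_def[symmetric] by linarith
qed

text \<open>With the weight chosen as above, flux and source are absorbed and the relative entropy inequality says that the integral
  of the gain times \<open>E\<close> is at most the contribution of the edge cut-off. The latter is of order \<open>1 / \<delta>\<close> times the
  measure of order \<open>\<delta>\<^sup>2\<close> of its support, hence tends to zero with \<open>\<delta>\<close>.\<close>

lemma rel_entropy_vanishes_in_cone:
  assumes \<gamma>: "1 < \<gamma>" "\<gamma> < 3" "0 < k0"
    and fin: "finite \<Phi>" and \<Phi>: "\<And>\<phi>. \<phi> \<in> \<Phi> \<Longrightarrow> \<phi> differentiable_on ({0..1} \<times> UNIV)"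
    and cl: "classical_pair \<gamma> \<Phi> h v1 v2" and en: "entropy_pair \<gamma> k0 r0 w1 w2 r u1 u2"
    and init: "\<And>x. fst x \<noteq> 0 \<Longrightarrow> r0 x = dens \<gamma> k0 (h (0, x)) \<and> w1 x = v1 (0, x) \<and> w2 x = v2 (0, x)"
    and sb: "source_bounded_below \<Phi> v1 v2"
    and M: "\<And>p. p \<in> slab_cell \<Longrightarrow> \<bar>u1 p\<bar> \<le> M \<and> \<bar>u2 p\<bar> \<le> M \<and> \<bar>v1 p\<bar> \<le> M \<and> \<bar>v2 p\<bar> \<le> M \<and> h p \<le> M \<and> r p \<le> M
      \<and> enth \<gamma> k0 (r p) \<le> M"
    and \<rho>: "0 \<le> \<rho>" and T: "T < 1"
  defines "E \<equiv> \<lambda>p. rel_entropy \<gamma> k0 (r p) (u1 p) (u2 p) (h p) (v1 p) (v2 p)"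
  shows "\<exists>\<kappa>. AE p in cell_measure. \<bar>fst (snd p)\<bar> \<le> \<rho> \<longrightarrow> cone_gain \<kappa> \<rho> (7 * M + 1) T p * E p = 0"
proof -
  define S where "S = 7 * M + 1"
  have hpos: "\<And>p. p \<in> slab - edge \<Longrightarrow> 0 < h p" and th: "tame \<Phi> h" "tame \<Phi> v1" "tame \<Phi> v2"
    using cl by (simp_all add: classical_pair_def)
  have r0: "\<And>p. p \<in> slab_cell \<Longrightarrow> 0 \<le> r p" using en by (simp add: entropy_pair_def)
  have hp: "0 < h p" if "p \<in> slab_cell" for p using hpos slab_cell_subset that by blast
  have "(1/2, 0, 0) \<in> slab_cell" by (simp add: slab_cell_def)
  from M[OF this] have M0: "0 \<le> M" by linarith
  have S0: "0 \<le> S" using M0 by (simp add: S_def)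
  obtain C' where C': "\<forall>p\<in>off_graphs \<Phi>. \<bar>fst (snd p)\<bar> \<le> \<rho> \<longrightarrow>
     - C' \<le> dx1 v1 p \<and> \<bar>dx2 v1 p\<bar> \<le> C' \<and> \<bar>dx1 v2 p\<bar> \<le> C' \<and> \<bar>dx2 v2 p\<bar> \<le> C'"
    using sb unfolding source_bounded_below_def by (elim allE[of _ \<rho>] exE) (rule that)
  define C where "C = \<bar>C'\<bar>"
  \<comment> \<open>The rate at which the weight has to decay in order to absorb the source.\<close>
  define \<kappa> where "\<kappa> = 8 * C"
  have \<kappa>0: "0 \<le> \<kappa>" by (simp add: \<kappa>_def C_def)
  define Z G D where "Z = cone_weight \<kappa> \<rho> S T" and "G = cone_gain \<kappa> \<rho> S T" and "D = cone_drop \<kappa> \<rho> S T"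
  have E0: "0 \<le> E p" if "p \<in> slab_cell" for p
    unfolding E_def by (rule rel_entropy_nonneg[OF \<gamma> r0[OF that] hp[OF that]])
  obtain Cp where Cp: "\<forall>y. 0 < y \<and> y \<le> M \<longrightarrow> \<bar>press \<gamma> k0 y\<bar> \<le> Cp \<and> \<bar>dens \<gamma> k0 y\<bar> \<le> Cp"
    using press_bounded[OF \<gamma>(1,3), of M] by (elim exE) (rule that)
  \<comment> \<open>A bound for the relative entropy, needed only in the support of the edge cut-off.\<close>
  define CE where "CE = M * ((2 * M)\<^sup>2 + (2 * M)\<^sup>2) + k0 * M powr \<gamma> / (\<gamma> - 1) + \<bar>Cp\<bar>"
  have EB: "E p \<le> CE" if p: "p \<in> slab_cell" for p
  proof -
    have "(u1 p - v1 p)\<^sup>2 \<le> (2 * M)\<^sup>2" "(u2 p - v2 p)\<^sup>2 \<le> (2 * M)\<^sup>2"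
    proof -
      have "\<bar>u1 p - v1 p\<bar> \<le> \<bar>2 * M\<bar>" "\<bar>u2 p - v2 p\<bar> \<le> \<bar>2 * M\<bar>" using M[OF p] by linarith+
      then show "(u1 p - v1 p)\<^sup>2 \<le> (2 * M)\<^sup>2" "(u2 p - v2 p)\<^sup>2 \<le> (2 * M)\<^sup>2"
        by (simp_all only: abs_le_square_iff)
    qed
    then have "r p * ((u1 p - v1 p)\<^sup>2 + (u2 p - v2 p)\<^sup>2) \<le> M * ((2 * M)\<^sup>2 + (2 * M)\<^sup>2)"
      using M[OF p] r0[OF p] by (intro mult_mono) auto
    moreover have "0 \<le> r p * ((u1 p - v1 p)\<^sup>2 + (u2 p - v2 p)\<^sup>2)" using r0[OF p] by simp
    moreover have "pressure \<gamma> k0 (r p) / (\<gamma> - 1) \<le> k0 * M powr \<gamma> / (\<gamma> - 1)"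
      using pressure_bound[OF \<gamma>(3), of \<gamma> "r p" M] M[OF p] r0[OF p] \<gamma> by (intro divide_right_mono) auto
    moreover have "press \<gamma> k0 (h p) \<le> \<bar>Cp\<bar>" using spec[OF Cp, of "h p"] hp[OF p] M[OF p] by linarith
    moreover have "0 \<le> r p * h p" using r0[OF p] hp[OF p] by simp
    ultimately show ?thesis unfolding E_def rel_entropy_def rel_energy_def CE_def by linarith
  qed
  have CE0: "0 \<le> CE" using EB[OF \<open>(1/2, 0, 0) \<in> slab_cell\<close>] E0[OF \<open>(1/2, 0, 0) \<in> slab_cell\<close>] by linarith
  define E' where "E' p = (if \<bar>fst (snd p)\<bar> \<le> \<rho> then E p else 0)" for p
  have E'0: "0 \<le> E' p" and E'B: "E' p \<le> CE" if "p \<in> slab_cell" for p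
    using E0[OF that] EB[OF that] CE0 by (auto simp: E'_def)
  have Em: "E' \<in> borel_measurable cell_measure"
  proof -
    have tP: "tame \<Phi> (\<lambda>p. press \<gamma> k0 (h p))"
      by (rule tame_compose[OF th(1) hpos press_deriv[OF \<gamma>(1,3)] press_bounded[OF \<gamma>(1,3)]])
    note m = tame_measurable[OF tP] th[THEN tame_measurable]
    have rm: "r \<in> borel_measurable cell_measure" "u1 \<in> borel_measurable cell_measure" "u2 \<in> borel_measurable cell_measure"
      using en by (auto simp: entropy_pair_def bounded_coefficient_def)
    have "E \<in> borel_measurable cell_measure"
      unfolding E_def rel_entropy_def rel_energy_def pressure_def using m rm by measurable
    moreover have "(\<lambda>p::spt. \<bar>fst (snd p)\<bar>) \<in> borel_measurable cell_measure"
      by (intro continuous_measurable_lebesgue_on continuous_intros)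
    ultimately show ?thesis unfolding E'_def by measurable
  qed
  have cont: "continuous_on UNIV Z" "continuous_on UNIV G" "continuous_on UNIV (edge_cut \<delta>)" for \<delta>
  proof -
    have c: "continuous_on UNIV pos_square" unfolding pos_square_def by (intro continuous_intros)
    have f: "continuous_on UNIV (front \<rho> S)" unfolding front_def by (intro continuous_intros)
    have ps: "continuous_on UNIV (\<lambda>p. pos_square (g p))" if "continuous_on UNIV g" for g :: "spt \<Rightarrow> real"
      by (rule continuous_on_compose2[OF c that]) auto
    show "continuous_on UNIV Z" unfolding Z_def cone_weight_def[abs_def] by (intro continuous_intros ps f)
    show "continuous_on UNIV G" unfolding G_def cone_gain_def[abs_def] by (intro continuous_intros ps f)
    show "continuous_on UNIV (edge_cut \<delta>)"
      unfolding edge_cut_def[abs_def] cut_profile_def divide_inverse by (intro continuous_intros ps)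
  qed
  note cm = cont[THEN continuous_measurable_lebesgue_on]
  have cb: "0 \<le> Z p" "Z p \<le> \<rho>\<^sup>2" "0 \<le> G p" "G p \<le> 2 * \<rho>\<^sup>2" "0 \<le> D p" if "p \<in> slab_cell" for p
    using cone_bounds[of p \<kappa> S \<rho> T] slab_cell_subset that \<kappa>0 S0 \<rho> T unfolding Z_def G_def D_def by auto
  have ck: "0 \<le> edge_cut \<delta> p" "edge_cut \<delta> p \<le> 1" for \<delta> p by (auto simp: edge_cut_def cut_profile_range)
  define K where "K = 16 * (1 + S) * \<rho>\<^sup>2 * CE"
  have K0: "0 \<le> K" using S0 CE0 by (simp add: K_def)
  define Box where "Box \<delta> = (cbox (0, -(2 * \<delta>), 0) (2 * \<delta>, 2 * \<delta>, 2 * pi) :: spt set)" for \<delta>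
  have i1: "integrable cell_measure (\<lambda>p. edge_cut \<delta> p * G p * E' p)" for \<delta>
  proof (rule cell_integrable[where B = "1 * (2 * \<rho>\<^sup>2) * CE" and R = \<rho>])
    show "(\<lambda>p. edge_cut \<delta> p * G p * E' p) \<in> borel_measurable cell_measure" using cm Em by measurable
    show "norm (edge_cut \<delta> p * G p * E' p) \<le> 1 * (2 * \<rho>\<^sup>2) * CE" if "p \<in> slab_cell" for p
      unfolding real_norm_def abs_mult using cb[OF that] ck[of \<delta> p] E'0[OF that] E'B[OF that] by (intro mult_mono) auto
  qed (simp add: E'_def)
  have i2: "integrable cell_measure (\<lambda>p. K / \<delta> * indicator (Box \<delta> \<inter> slab_cell) p)"
    and b2: "(\<integral>p. K / \<delta> * indicator (Box \<delta> \<inter> slab_cell) p \<partial>cell_measure) \<le> 16 * pi * K * \<delta>" if d: "0 < \<delta>" for \<delta>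
  proof -
    have Bs: "Box \<delta> \<inter> slab_cell \<in> sets cell_measure"
      using slab_cell_sets unfolding Box_def by (intro sets_restrict_space_iff[THEN iffD2]) auto
    have Bl: "Box \<delta> \<inter> slab_cell \<in> sets lebesgue" using slab_cell_sets unfolding Box_def by auto
    have em: "emeasure cell_measure (Box \<delta> \<inter> slab_cell) = emeasure lebesgue (Box \<delta> \<inter> slab_cell)"
      using slab_cell_sets by (intro emeasure_restrict_space) auto
    have fB: "emeasure lebesgue (Box \<delta>) < \<infinity>"
      using emeasure_compact_finite[of "Box \<delta>"] unfolding Box_def by simp
    have le: "emeasure lebesgue (Box \<delta> \<inter> slab_cell) \<le> emeasure lebesgue (Box \<delta>)"
      by (intro emeasure_mono) (auto simp: Box_def)
    have fin': "emeasure cell_measure (Box \<delta> \<inter> slab_cell) < \<infinity>" using em le fB by (simp add: order_le_less_trans)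
    have "measure cell_measure (Box \<delta> \<inter> slab_cell) \<le> measure lebesgue (Box \<delta>)"
      unfolding measure_def em using le fB by (intro enn2real_mono) auto
    also have "measure lebesgue (Box \<delta>) = 16 * pi * \<delta>\<^sup>2"
      unfolding Box_def using d by (simp add: content_Pair power2_eq_square)
    finally have m: "measure cell_measure (Box \<delta> \<inter> slab_cell) \<le> 16 * pi * \<delta>\<^sup>2" .
    show "integrable cell_measure (\<lambda>p. K / \<delta> * indicator (Box \<delta> \<inter> slab_cell) p)"
      using Bs fin' by (intro integrable_mult_right integrable_real_indicator)
    have "(\<integral>p. K / \<delta> * indicator (Box \<delta> \<inter> slab_cell) p \<partial>cell_measure) = K / \<delta> * measure cell_measure (Box \<delta> \<inter> slab_cell)"
      using Bs by (simp add: Int_absorb1 Int_commute)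
    also have "\<dots> \<le> K / \<delta> * (16 * pi * \<delta>\<^sup>2)" using K0 d by (intro mult_left_mono m) auto
    also have "\<dots> = 16 * pi * K * \<delta>" using d by (simp add: power2_eq_square)
    finally show "(\<integral>p. K / \<delta> * indicator (Box \<delta> \<inter> slab_cell) p \<partial>cell_measure) \<le> 16 * pi * K * \<delta>" .
  qed
  have est: "(\<integral>p. edge_cut \<delta> p * G p * E' p \<partial>cell_measure) \<le> 16 * pi * K * \<delta>" if d: "0 < \<delta>" for \<delta>
  proof -
    have "0 \<le> (\<integral>p. - (edge_cut \<delta> p * G p * E' p) + K / \<delta> * indicator (Box \<delta> \<inter> slab_cell) p \<partial>cell_measure)"
    proof (rule relative_entropy_inequality[OF \<gamma>(1,3) fin \<Phi> cl en init
          cone_edge_weight[OF \<kappa>0 S0 \<rho> T d, folded Z_def G_def D_def]])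
      show "integrable cell_measure (\<lambda>p. - (edge_cut \<delta> p * G p * E' p) + K / \<delta> * indicator (Box \<delta> \<inter> slab_cell) p)"
        by (intro Bochner_Integration.integrable_add Bochner_Integration.integrable_minus i1 i2[OF d])
      fix p assume p: "p \<in> off_graphs \<Phi>" "p \<in> slab_cell"
      let ?Q = "rel_flux \<gamma> k0 (r p) (u1 p) (u2 p) (h p) (v1 p) (v2 p)"
      let ?t = "edge_slope \<delta> p * (2 * fst p / \<delta>\<^sup>2)" and ?x = "edge_slope \<delta> p * (2 * fst (snd p) / \<delta>\<^sup>2)"
      let ?s = "- (fst (snd p) / sqrt (1 + (fst (snd p))\<^sup>2))" and ?src = "source \<gamma> k0 h v1 v2 r u1 u2 p"
      let ?I = "indicator (Box \<delta> \<inter> slab_cell) p :: real"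
      note c = cb[OF p(2)] and k = ck[of \<delta> p] and e0 = E0[OF p(2)] and eB = EB[OF p(2)]
      have I0: "0 \<le> K / \<delta> * ?I" using K0 d by simp
      have "((- \<kappa> * Z p - S * D p - G p) * edge_cut \<delta> p + Z p * ?t) * E p
        + (?s * D p * edge_cut \<delta> p + Z p * ?x) * ?Q - Z p * edge_cut \<delta> p * ?src
        \<le> - (edge_cut \<delta> p * G p * E' p) + K / \<delta> * ?I"
      proof (cases "\<bar>fst (snd p)\<bar> \<le> \<rho>")
        case False
        have "\<bar>fst (snd p)\<bar> \<le> sqrt (1 + (fst (snd p))\<^sup>2)" by (rule real_le_rsqrt) simp
        moreover have "0 \<le> S * fst p" using S0 p(2) by (auto simp: slab_cell_def)
        ultimately have "front \<rho> S p \<le> 0" using False by (simp add: front_def)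
        then have "Z p = 0" "G p = 0" "D p = 0"
          by (simp_all add: Z_def G_def D_def cone_weight_def cone_gain_def cone_drop_def pos_square_eq_0)
        then show ?thesis using I0 by simp
      next
        case True
        have Q: "\<bar>?Q\<bar> \<le> S * E p"
          unfolding S_def E_def using rel_flux_bound[OF \<gamma> r0[OF p(2)] hp[OF p(2)]] M[OF p(2)] by blast
        have src: "- \<kappa> * E p \<le> ?src"
          unfolding \<kappa>_def E_def
          using bspec[OF C' p(1)] True C_def by (intro source_lower \<gamma> r0 hp p(2)) auto
        \<comment> \<open>Source, flux of the cone factor and flux of the edge cut-off are estimated separately.\<close>
        have a1: "Z p * edge_cut \<delta> p * (- \<kappa> * E p) \<le> Z p * edge_cut \<delta> p * ?src"
          using src c k by (intro mult_left_mono) auto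
        have "\<bar>?s * ?Q\<bar> \<le> 1 * (S * E p)" unfolding abs_mult[of ?s] using cone_slope_le_1 Q by (intro mult_mono) auto
        then have "?s * ?Q \<le> S * E p" by linarith
        then have a2: "D p * edge_cut \<delta> p * (?s * ?Q) \<le> D p * edge_cut \<delta> p * (S * E p)"
          using c k by (intro mult_left_mono) auto
        have a3: "Z p * (?t * E p + ?x * ?Q) \<le> K / \<delta> * ?I"
        proof (cases "edge_slope \<delta> p = 0")
          case True
          then show ?thesis using I0 by simp
        next
          case False
          have "p \<in> Box \<delta>"
            using edge_slope_support[OF d False] p(2) unfolding Box_def
            by (cases p) (auto simp: slab_cell_def abs_le_iff)
          then have I1: "?I = 1" using p(2) by simp
          have "\<bar>?t * E p\<bar> \<le> 16 / \<delta> * CE" "\<bar>?x * ?Q\<bar> \<le> 16 / \<delta> * (S * CE)"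
          proof -
            show "\<bar>?t * E p\<bar> \<le> 16 / \<delta> * CE"
              unfolding abs_mult[of ?t] using edge_gradient_bound(1)[OF d, of p] e0 eB d by (intro mult_mono) auto
            have "\<bar>?Q\<bar> \<le> S * CE" using Q mult_left_mono[OF eB S0] by linarith
            then show "\<bar>?x * ?Q\<bar> \<le> 16 / \<delta> * (S * CE)"
              unfolding abs_mult[of ?x] using edge_gradient_bound(2)[OF d, of p] d by (intro mult_mono) auto
          qed
          then have "?t * E p + ?x * ?Q \<le> 16 / \<delta> * CE + 16 / \<delta> * (S * CE)" by linarith
          also have "\<dots> = 16 / \<delta> * ((1 + S) * CE)" by (simp add: algebra_simps add_divide_distrib)
          finally have "Z p * (?t * E p + ?x * ?Q) \<le> \<rho>\<^sup>2 * (16 / \<delta> * ((1 + S) * CE))"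
          proof -
            assume le: "?t * E p + ?x * ?Q \<le> 16 / \<delta> * ((1 + S) * CE)"
            have "Z p * (?t * E p + ?x * ?Q) \<le> Z p * (16 / \<delta> * ((1 + S) * CE))" by (rule mult_left_mono[OF le c(1)])
            also have "\<dots> \<le> \<rho>\<^sup>2 * (16 / \<delta> * ((1 + S) * CE))"
              using d S0 CE0 by (intro mult_right_mono c(2)) simp
            finally show ?thesis .
          qed
          also have "\<dots> = K / \<delta>" by (simp add: K_def)
          finally show ?thesis using I1 by simp
        qed
        have "((- \<kappa> * Z p - S * D p - G p) * edge_cut \<delta> p + Z p * ?t) * E p
          + (?s * D p * edge_cut \<delta> p + Z p * ?x) * ?Q - Z p * edge_cut \<delta> p * ?src
          = - (edge_cut \<delta> p * G p * E p) + Z p * (?t * E p + ?x * ?Q)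
            + (Z p * edge_cut \<delta> p * (- \<kappa> * E p) - Z p * edge_cut \<delta> p * ?src)
            + (D p * edge_cut \<delta> p * (?s * ?Q) - D p * edge_cut \<delta> p * (S * E p))"
          by (simp only: algebra_simps mult_minus_left mult_minus_right)
        also have "\<dots> \<le> - (edge_cut \<delta> p * G p * E p) + K / \<delta> * ?I" using a1 a2 a3 by linarith
        finally show ?thesis using True by (simp add: E'_def)
      qed
      then show "((- \<kappa> * Z p - S * D p - G p) * edge_cut \<delta> p + Z p * ?t) * rel_entropy \<gamma> k0 (r p) (u1 p) (u2 p) (h p) (v1 p) (v2 p)
        + (?s * D p * edge_cut \<delta> p + Z p * ?x) * ?Q - Z p * edge_cut \<delta> p * ?src
        \<le> - (edge_cut \<delta> p * G p * E' p) + K / \<delta> * ?I" unfolding E_def .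
    qed
    also have "\<dots> = - (\<integral>p. edge_cut \<delta> p * G p * E' p \<partial>cell_measure) + (\<integral>p. K / \<delta> * indicator (Box \<delta> \<inter> slab_cell) p \<partial>cell_measure)"
      using i1[of \<delta>] i2[OF d] by (subst Bochner_Integration.integral_add) auto
    finally show ?thesis using b2[OF d] by linarith
  qed
  define \<delta> where "\<delta> n = 1 / real (Suc n)" for n
  have dpos: "0 < \<delta> n" for n by (simp add: \<delta>_def)
  have dlim: "\<delta> \<longlonglongrightarrow> 0" unfolding \<delta>_def by (rule LIMSEQ_Suc[OF lim_const_over_n])
  have i3: "integrable cell_measure (\<lambda>p. G p * E' p)"
  proof (rule cell_integrable[where B = "(2 * \<rho>\<^sup>2) * CE" and R = \<rho>])
    show "(\<lambda>p. G p * E' p) \<in> borel_measurable cell_measure" using cm Em by measurable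
    show "norm (G p * E' p) \<le> (2 * \<rho>\<^sup>2) * CE" if "p \<in> slab_cell" for p
      unfolding real_norm_def abs_mult using cb[OF that] E'0[OF that] E'B[OF that] by (intro mult_mono) auto
  qed (simp add: E'_def)
  have "(\<lambda>n. \<integral>p. edge_cut (\<delta> n) p * G p * E' p \<partial>cell_measure) \<longlonglongrightarrow> (\<integral>p. G p * E' p \<partial>cell_measure)"
  proof (rule integral_dominated_convergence[where w = "\<lambda>p. G p * E' p"])
    show "(\<lambda>p. G p * E' p) \<in> borel_measurable cell_measure" using i3 by auto
    show "(\<lambda>p. edge_cut (\<delta> n) p * G p * E' p) \<in> borel_measurable cell_measure" for n using i1 by auto
    show "integrable cell_measure (\<lambda>p. G p * E' p)" by (rule i3)
    show "AE p in cell_measure. (\<lambda>n. edge_cut (\<delta> n) p * G p * E' p) \<longlonglongrightarrow> G p * E' p"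
    proof (intro AE_I2)
      fix p assume "p \<in> space cell_measure"
      then have t: "0 < fst p" by (auto simp: slab_cell_def)
      have "\<forall>\<^sub>F n in sequentially. \<delta> n < fst p / 2" using order_tendstoD(2)[OF dlim, of "fst p / 2"] t by simp
      then have "\<forall>\<^sub>F n in sequentially. edge_cut (\<delta> n) p * G p * E' p = G p * E' p"
      proof eventually_elim
        fix n assume n: "\<delta> n < fst p / 2"
        have "(2 * \<delta> n)\<^sup>2 \<le> (fst p)\<^sup>2" using n dpos[of n] by (intro power_mono) auto
        then have "2 * (\<delta> n)\<^sup>2 \<le> (fst p)\<^sup>2 + (fst (snd p))\<^sup>2"
          by (simp add: power_mult_distrib) (smt (verit) zero_le_power2)
        then have "2 \<le> ((fst p)\<^sup>2 + (fst (snd p))\<^sup>2) / (\<delta> n)\<^sup>2" using dpos[of n] by (simp add: le_divide_eq)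
        then show "edge_cut (\<delta> n) p * G p * E' p = G p * E' p" by (simp add: edge_cut_def cut_profile_high)
      qed
      then show "(\<lambda>n. edge_cut (\<delta> n) p * G p * E' p) \<longlonglongrightarrow> G p * E' p" by (rule tendsto_eventually)
    qed
    show "AE p in cell_measure. norm (edge_cut (\<delta> n) p * G p * E' p) \<le> G p * E' p" for n
    proof (intro AE_I2)
      fix p assume "p \<in> space cell_measure"
      then have p: "p \<in> slab_cell" by simp
      have "\<bar>edge_cut (\<delta> n) p * (G p * E' p)\<bar> \<le> 1 * (G p * E' p)"
        unfolding abs_mult[of "edge_cut (\<delta> n) p"] using ck[of "\<delta> n" p] cb[OF p] E'0[OF p] by (intro mult_mono) auto
      then show "norm (edge_cut (\<delta> n) p * G p * E' p) \<le> G p * E' p" by (simp add: mult.assoc)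
    qed
  qed
  moreover have "(\<lambda>n. 16 * pi * K * \<delta> n) \<longlonglongrightarrow> 0" using dlim by (auto intro!: tendsto_eq_intros)
  ultimately have "(\<integral>p. G p * E' p \<partial>cell_measure) \<le> 0"
    by (rule LIMSEQ_le) (use est[OF dpos] in blast)
  moreover have nn: "AE p in cell_measure. 0 \<le> G p * E' p"
    using cb E'0 by (intro AE_I2) simp
  then have "0 \<le> (\<integral>p. G p * E' p \<partial>cell_measure)" by (rule integral_nonneg_AE)
  ultimately have "(\<integral>p. G p * E' p \<partial>cell_measure) = 0" by linarith
  then have "AE p in cell_measure. G p * E' p = 0"
    using integral_nonneg_eq_0_iff_AE[OF i3 nn] by simp
  then have "AE p in cell_measure. \<bar>fst (snd p)\<bar> \<le> \<rho> \<longrightarrow> cone_gain \<kappa> \<rho> (7 * M + 1) T p * E p = 0"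
    by eventually_elim (auto simp: G_def E'_def S_def split: if_splits)
  then show ?thesis by blast
qed

text \<open>Countably many cones with growing base and final times tending to one exhaust the strip.\<close>

lemma rel_entropy_vanishes:
  assumes \<gamma>: "1 < \<gamma>" "\<gamma> < 3" "0 < k0"
    and fin: "finite \<Phi>" and \<Phi>: "\<And>\<phi>. \<phi> \<in> \<Phi> \<Longrightarrow> \<phi> differentiable_on ({0..1} \<times> UNIV)"
    and cl: "classical_pair \<gamma> \<Phi> h v1 v2" and en: "entropy_pair \<gamma> k0 r0 w1 w2 r u1 u2"
    and init: "\<And>x. fst x \<noteq> 0 \<Longrightarrow> r0 x = dens \<gamma> k0 (h (0, x)) \<and> w1 x = v1 (0, x) \<and> w2 x = v2 (0, x)"
    and sb: "source_bounded_below \<Phi> v1 v2"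
    and M: "\<And>p. p \<in> slab_cell \<Longrightarrow> \<bar>u1 p\<bar> \<le> M \<and> \<bar>u2 p\<bar> \<le> M \<and> \<bar>v1 p\<bar> \<le> M \<and> \<bar>v2 p\<bar> \<le> M \<and> h p \<le> M \<and> r p \<le> M
      \<and> enth \<gamma> k0 (r p) \<le> M"
  shows "AE p in cell_measure. u1 p = v1 p \<and> u2 p = v2 p \<and> enth \<gamma> k0 (r p) = h p"
proof -
  define S where "S = 7 * M + 1"
  define E where "E p = rel_entropy \<gamma> k0 (r p) (u1 p) (u2 p) (h p) (v1 p) (v2 p)" for p
  \<comment> \<open>Final times increasing to one, all below one since test functions vanish near \<open>t = 1\<close>.\<close>
  define T where "T n = 1 - 1 / real (n + 2)" for n
  have "\<forall>n. \<exists>\<kappa>. AE p in cell_measure. \<bar>fst (snd p)\<bar> \<le> real n \<longrightarrow> cone_gain \<kappa> (real n) S (T n) p * E p = 0"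
    unfolding S_def E_def
    by (intro allI, rule rel_entropy_vanishes_in_cone[OF \<gamma> fin \<Phi> cl en init sb M]) (simp_all add: T_def)
  from choice[OF this] obtain \<kappa> where "\<forall>n. AE p in cell_measure. \<bar>fst (snd p)\<bar> \<le> real n \<longrightarrow> cone_gain (\<kappa> n) (real n) S (T n) p * E p = 0" by (elim exE) (rule that)
  then have "AE p in cell_measure. \<forall>n. \<bar>fst (snd p)\<bar> \<le> real n \<longrightarrow> cone_gain (\<kappa> n) (real n) S (T n) p * E p = 0"
    by (simp add: AE_all_countable)
  moreover have "AE p in cell_measure. p \<in> slab_cell" by (intro AE_I2) simp
  ultimately show ?thesis
  proof eventually_elim
    fix p assume 0: "\<forall>n. \<bar>fst (snd p)\<bar> \<le> real n \<longrightarrow> cone_gain (\<kappa> n) (real n) S (T n) p * E p = 0" and p: "p \<in> slab_cell"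
    have t: "0 < fst p" "fst p < 1" using p by (auto simp: slab_cell_def)
    obtain n where n: "max (sqrt (1 + (fst (snd p))\<^sup>2) + S * fst p) (max \<bar>fst (snd p)\<bar> (1 / (1 - fst p))) < real n"
      using reals_Archimedean2 by blast
    have "0 < front (real n) S p" using n by (simp add: front_def)
    moreover have "fst p < T n"
    proof -
      have "1 / (1 - fst p) < real (n + 2)" using n by simp
      then have "1 / real (n + 2) < 1 - fst p" using t by (simp add: divide_less_eq less_divide_eq mult.commute)
      then show ?thesis by (simp add: T_def)
    qed
    ultimately have "cone_gain (\<kappa> n) (real n) S (T n) p \<noteq> 0" by (simp add: cone_gain_def pos_square_def)
    moreover have "cone_gain (\<kappa> n) (real n) S (T n) p * E p = 0" using 0 n by simp
    ultimately have "E p = 0" by simp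
    moreover have "0 \<le> r p" using en p by (simp add: entropy_pair_def)
    moreover have "0 < h p" using cl subsetD[OF slab_cell_subset p] by (simp add: classical_pair_def)
    ultimately show "u1 p = v1 p \<and> u2 p = v2 p \<and> enth \<gamma> k0 (r p) = h p"
      unfolding E_def by (intro rel_entropy_zero[OF \<gamma>])
  qed
qed

section \<open>Euler equations and gradient bounds at a point\<close>

definition enthalpy :: "real \<Rightarrow> (spt \<Rightarrow> real) \<Rightarrow> spt \<Rightarrow> real" where
  "enthalpy \<gamma> c p = (c p)\<^sup>2 / (\<gamma> - 1)"

definition v1_of :: "(spt \<Rightarrow> vel) \<Rightarrow> spt \<Rightarrow> real" where "v1_of v p = fst (v p)"
definition v2_of :: "(spt \<Rightarrow> vel) \<Rightarrow> spt \<Rightarrow> real" where "v2_of v p = snd (v p)"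

definition euler_jet :: "real \<Rightarrow> (spt \<Rightarrow> real) \<Rightarrow> (spt \<Rightarrow> real) \<Rightarrow> (spt \<Rightarrow> real) \<Rightarrow> spt \<Rightarrow> bool" where
  "euler_jet \<gamma> h v1 v2 p \<longleftrightarrow> h differentiable (at p) \<and> v1 differentiable (at p) \<and> v2 differentiable (at p) \<and>
     dt h p + v1 p * dx1 h p + v2 p * dx2 h p = - (\<gamma> - 1) * h p * (dx1 v1 p + dx2 v2 p) \<and>
     dt v1 p + v1 p * dx1 v1 p + v2 p * dx2 v1 p = - dx1 h p \<and>
     dt v2 p + v1 p * dx1 v2 p + v2 p * dx2 v2 p = - dx2 h p"

text \<open>The bounds at a point that enter tameness and the lower bound for the source.\<close>

definition jet_bound :: "real \<Rightarrow> (spt \<Rightarrow> real) \<Rightarrow> (spt \<Rightarrow> real) \<Rightarrow> (spt \<Rightarrow> real) \<Rightarrow> spt \<Rightarrow> bool" where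
  "jet_bound C h v1 v2 p \<longleftrightarrow>
     (\<forall>b\<in>Basis. \<bar>dird b h p\<bar> * rad p \<le> C \<and> \<bar>dird b v1 p\<bar> * rad p \<le> C \<and> \<bar>dird b v2 p\<bar> * rad p \<le> C) \<and>
     - C \<le> dx1 v1 p \<and> \<bar>dx2 v1 p\<bar> \<le> C \<and> \<bar>dx1 v2 p\<bar> \<le> C \<and> \<bar>dx2 v2 p\<bar> \<le> C"

lemma jet_bound_mono: "jet_bound C h v1 v2 p \<Longrightarrow> C \<le> C' \<Longrightarrow> jet_bound C' h v1 v2 p"
  unfolding jet_bound_def by (intro conjI ballI) (meson order_trans neg_le_iff_le)+

lemma dird_components:
  assumes "v differentiable (at p)"
  shows "v1_of v differentiable (at p)" "v2_of v differentiable (at p)"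
    "dird b (v1_of v) p = fst (dird b v p)" "dird b (v2_of v) p = snd (dird b v p)"
proof -
  have D: "(v has_derivative frechet_derivative v (at p)) (at p)" using assms frechet_derivative_works by blast
  have 1: "(v1_of v has_derivative (\<lambda>h. fst (frechet_derivative v (at p) h))) (at p)"
    unfolding v1_of_def[abs_def] by (rule has_derivative_fst[OF D])
  have 2: "(v2_of v has_derivative (\<lambda>h. snd (frechet_derivative v (at p) h))) (at p)"
    unfolding v2_of_def[abs_def] by (rule has_derivative_snd[OF D])
  show "v1_of v differentiable (at p)" "v2_of v differentiable (at p)" using 1 2 by (auto simp: differentiable_def)
  show "dird b (v1_of v) p = fst (dird b v p)" "dird b (v2_of v) p = snd (dird b v p)"
    unfolding dird_eq[OF 1] dird_eq[OF 2] by (simp_all add: dird_def)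
qed

lemma enth_of_dens:
  assumes "1 < \<gamma>" "0 < k0" "0 < h" shows "enth \<gamma> k0 (dens \<gamma> k0 h) = h"
proof -
  have "dens \<gamma> k0 h powr (\<gamma> - 1) = (\<gamma> - 1) * h / (k0 * \<gamma>)"
    using assms by (simp add: dens_def powr_powr)
  then show ?thesis using assms by (simp add: enth_def)
qed

text \<open>Density and enthalpy are smooth functions of each other away from the vacuum, so the Euler equations can be rewritten in
  the enthalpy.\<close>

lemma euler_at_jet:
  assumes \<gamma>: "1 < \<gamma>" "0 < k0" and e: "euler_at \<gamma> k0 v c p"
    and U: "open U" "p \<in> U" and c: "\<And>q. q \<in> U \<Longrightarrow> 0 < c q"
  shows "euler_jet \<gamma> (enthalpy \<gamma> c) (v1_of v) (v2_of v) p"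
proof -
  define \<rho> where "\<rho> = (\<lambda>q. density_of \<gamma> k0 (c q))"
  let ?h = "enthalpy \<gamma> c"
  have vd: "v differentiable (at p)" and \<rho>d: "\<rho> differentiable (at p)"
    and m: "dt \<rho> p + v p \<bullet> grad \<rho> p = - \<rho> p * dvg v p"
    and mom: "dt v p + fst (v p) *\<^sub>R dx1 v p + snd (v p) *\<^sub>R dx2 v p
        = - (inverse (\<rho> p) *\<^sub>R grad (\<lambda>q. pressure \<gamma> k0 (\<rho> q)) p)"
    using e unfolding euler_at_def \<rho>_def Let_def by blast+
  note vc = dird_components[OF vd]
  have hpos: "0 < ?h q" if "q \<in> U" for q using c[OF that] \<gamma> by (simp add: enthalpy_def)
  have \<rho>h: "\<rho> q = dens \<gamma> k0 (?h q)" for q by (simp add: \<rho>_def density_of_dens[OF \<gamma>(1)] enthalpy_def)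
  have \<rho>p: "0 < \<rho> p" unfolding \<rho>h by (rule dens_pos[OF \<gamma> hpos[OF U(2)]])
  have hp: "?h p = enth \<gamma> k0 (\<rho> p)" unfolding \<rho>h using enth_of_dens[OF \<gamma> hpos[OF U(2)]] by simp
  have p1: "\<rho> p powr (\<gamma> - 1 - 1) = \<rho> p powr (\<gamma> - 1) / \<rho> p"
    using powr_diff[of "\<rho> p" "\<gamma> - 1" 1] powr_one[of "\<rho> p"] \<rho>p by simp
  have "((\<lambda>r. k0 * \<gamma> * r powr (\<gamma> - 1) / (\<gamma> - 1)) has_real_derivative (k0 * \<gamma> * ((\<gamma> - 1) * \<rho> p powr (\<gamma> - 1 - 1)) / (\<gamma> - 1))) (at (\<rho> p))"
    using \<rho>p by (auto intro!: derivative_eq_intros)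
  then have "(enth \<gamma> k0 has_real_derivative ((\<gamma> - 1) * enth \<gamma> k0 (\<rho> p) / \<rho> p)) (at (\<rho> p))"
    unfolding p1 enth_def[abs_def] using \<gamma> by (simp add: field_simps power2_eq_square)
  note hd = dird_chain[OF \<rho>d this]
  have Ueq: "?h q = enth \<gamma> k0 (\<rho> q)" if "q \<in> U" for q unfolding \<rho>h using enth_of_dens[OF \<gamma> hpos[OF that]] by simp
  note hU = dird_cong_open[of U p ?h "\<lambda>q. enth \<gamma> k0 (\<rho> q)", OF U Ueq]
  have hdiff: "?h differentiable (at p)" using hU(1) hd(1) by simp
  have dh: "dird b ?h p = (\<gamma> - 1) * ?h p / \<rho> p * dird b \<rho> p" for b using hU(2)[of b] hd(2)[of b] hp by simp
  have "((\<lambda>r. k0 * r powr \<gamma>) has_real_derivative (k0 * (\<gamma> * \<rho> p powr (\<gamma> - 1)))) (at (\<rho> p))"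
    using \<rho>p by (auto intro!: derivative_eq_intros)
  moreover have "k0 * (\<gamma> * \<rho> p powr (\<gamma> - 1)) = (\<gamma> - 1) * ?h p" unfolding hp enth_def using \<gamma> by simp
  ultimately have "(pressure \<gamma> k0 has_real_derivative ((\<gamma> - 1) * ?h p)) (at (\<rho> p))"
    unfolding pressure_def[abs_def] by simp
  note pd = dird_chain(2)[OF \<rho>d this]
  have pg: "inverse (\<rho> p) * dird b (\<lambda>q. pressure \<gamma> k0 (\<rho> q)) p = dird b ?h p" for b
    unfolding pd dh by (simp add: divide_inverse)
  have m': "dt \<rho> p + (v1_of v p * dx1 \<rho> p + v2_of v p * dx2 \<rho> p) = - \<rho> p * (dx1 (v1_of v) p + dx2 (v2_of v) p)"
    using m unfolding grad_def dvg_def v1_of_def[abs_def] v2_of_def[abs_def] by (cases "v p") simp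
  have "dt ?h p + v1_of v p * dx1 ?h p + v2_of v p * dx2 ?h p
      = (\<gamma> - 1) * ?h p / \<rho> p * (dt \<rho> p + (v1_of v p * dx1 \<rho> p + v2_of v p * dx2 \<rho> p))"
    unfolding dh by (simp add: algebra_simps)
  also have "\<dots> = - (\<gamma> - 1) * ?h p * (dx1 (v1_of v) p + dx2 (v2_of v) p)"
    unfolding m' using \<rho>p by (simp add: field_simps)
  finally have 1: "dt ?h p + v1_of v p * dx1 ?h p + v2_of v p * dx2 ?h p
      = - (\<gamma> - 1) * ?h p * (dx1 (v1_of v) p + dx2 (v2_of v) p)" .
  have "fst (dt v p + fst (v p) *\<^sub>R dx1 v p + snd (v p) *\<^sub>R dx2 v p) = - (inverse (\<rho> p) * dx1 (\<lambda>q. pressure \<gamma> k0 (\<rho> q)) p)"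
    "snd (dt v p + fst (v p) *\<^sub>R dx1 v p + snd (v p) *\<^sub>R dx2 v p) = - (inverse (\<rho> p) * dx2 (\<lambda>q. pressure \<gamma> k0 (\<rho> q)) p)"
    unfolding mom grad_def by simp_all
  then show ?thesis
    unfolding euler_jet_def pg vc(3,4) v1_of_def v2_of_def
    using hdiff vc(1,2) 1[unfolded vc(3,4) v1_of_def v2_of_def] by (simp add: v1_of_def[abs_def] v2_of_def[abs_def])
qed

text \<open>The Euler equations express time derivatives by space derivatives.\<close>

lemma jet_bound_from_space:
  assumes j: "euler_jet \<gamma> h v1 v2 p" and \<gamma>: "1 < \<gamma>" "\<gamma> < 3"
    and M: "\<bar>v1 p\<bar> \<le> M" "\<bar>v2 p\<bar> \<le> M" "\<bar>h p\<bar> \<le> M"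
    and B: "\<And>f. f \<in> {h, v1, v2} \<Longrightarrow> \<bar>dx1 f p\<bar> * rad p \<le> B \<and> \<bar>dx2 f p\<bar> * rad p \<le> B"
    and K: "- K \<le> dx1 v1 p" "\<bar>dx2 v1 p\<bar> \<le> K" "\<bar>dx1 v2 p\<bar> \<le> K" "\<bar>dx2 v2 p\<bar> \<le> K"
  shows "jet_bound (K + B + 6 * M * B) h v1 v2 p"
proof -
  have r: "0 \<le> rad p" by (simp add: rad_def)
  have M0: "0 \<le> M" using M by linarith
  have "0 \<le> \<bar>dx1 h p\<bar> * rad p" using r by simp
  with B[of h] have B0: "0 \<le> B" by simp
  have K0: "0 \<le> K" using K by linarith
  have MB: "0 \<le> M * B" using M0 B0 by simp
  have t: "\<bar>x * y\<bar> * rad p \<le> M * B" if "\<bar>x\<bar> \<le> M" "\<bar>y\<bar> * rad p \<le> B" for x y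
    unfolding abs_mult mult.assoc using that M0 r by (intro mult_mono) auto
  have tri: "\<bar>x + y + z\<bar> * rad p \<le> \<bar>x\<bar> * rad p + \<bar>y\<bar> * rad p + \<bar>z\<bar> * rad p" for x y z
    unfolding distrib_right[symmetric] using r by (intro mult_right_mono) auto
  note Bh = B[of h, simplified] and B1 = B[of v1, simplified] and B2 = B[of v2, simplified]
  have e: "dt v1 p = - (v1 p * dx1 v1 p) + - (v2 p * dx2 v1 p) + - dx1 h p"
    "dt v2 p = - (v1 p * dx1 v2 p) + - (v2 p * dx2 v2 p) + - dx2 h p"
    "dt h p = - (v1 p * dx1 h p) + - (v2 p * dx2 h p) + (- (\<gamma> - 1) * (h p * dx1 v1 p) + - (\<gamma> - 1) * (h p * dx2 v2 p))"
  proof -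
    have "dt h p + v1 p * dx1 h p + v2 p * dx2 h p = - (\<gamma> - 1) * h p * (dx1 v1 p + dx2 v2 p)"
      and "dt v1 p + v1 p * dx1 v1 p + v2 p * dx2 v1 p = - dx1 h p"
      and "dt v2 p + v1 p * dx1 v2 p + v2 p * dx2 v2 p = - dx2 h p"
      using j by (simp_all only: euler_jet_def)
    moreover have "- (\<gamma> - 1) * h p * (dx1 v1 p + dx2 v2 p) = - (\<gamma> - 1) * (h p * dx1 v1 p) + - (\<gamma> - 1) * (h p * dx2 v2 p)"
      by (simp only: distrib_left mult.assoc)
    ultimately show "dt v1 p = - (v1 p * dx1 v1 p) + - (v2 p * dx2 v1 p) + - dx1 h p"
      "dt v2 p = - (v1 p * dx1 v2 p) + - (v2 p * dx2 v2 p) + - dx2 h p"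
      "dt h p = - (v1 p * dx1 h p) + - (v2 p * dx2 h p) + (- (\<gamma> - 1) * (h p * dx1 v1 p) + - (\<gamma> - 1) * (h p * dx2 v2 p))"
      by linarith+
  qed
  have 1: "\<bar>dt v1 p\<bar> * rad p \<le> M * B + M * B + B"
    unfolding e(1) by (rule order_trans[OF tri]) (use t[OF M(1), of "dx1 v1 p"] t[OF M(2), of "dx2 v1 p"] B1 Bh in \<open>simp only: abs_minus_cancel, linarith\<close>)
  have 2: "\<bar>dt v2 p\<bar> * rad p \<le> M * B + M * B + B"
    unfolding e(2) by (rule order_trans[OF tri]) (use t[OF M(1), of "dx1 v2 p"] t[OF M(2), of "dx2 v2 p"] B2 Bh in \<open>simp only: abs_minus_cancel, linarith\<close>)
  have g: "\<bar>- (\<gamma> - 1) * x\<bar> * rad p \<le> 2 * (\<bar>x\<bar> * rad p)" for x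
    unfolding abs_mult mult.assoc using \<gamma> r by (intro mult_right_mono) auto
  have "\<bar>- (\<gamma> - 1) * (h p * dx1 v1 p) + - (\<gamma> - 1) * (h p * dx2 v2 p)\<bar> * rad p
     \<le> \<bar>- (\<gamma> - 1) * (h p * dx1 v1 p)\<bar> * rad p + \<bar>- (\<gamma> - 1) * (h p * dx2 v2 p)\<bar> * rad p"
    unfolding distrib_right[symmetric] using r by (intro mult_right_mono abs_triangle_ineq)
  also have "\<dots> \<le> 2 * (M * B) + 2 * (M * B)"
    using g[of "h p * dx1 v1 p"] g[of "h p * dx2 v2 p"] t[OF M(3), of "dx1 v1 p"] t[OF M(3), of "dx2 v2 p"] B1 B2 by linarith
  finally have 4: "\<bar>- (\<gamma> - 1) * (h p * dx1 v1 p) + - (\<gamma> - 1) * (h p * dx2 v2 p)\<bar> * rad p \<le> 2 * (M * B) + 2 * (M * B)" .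
  have 3: "\<bar>dt h p\<bar> * rad p \<le> M * B + M * B + (2 * (M * B) + 2 * (M * B))"
    unfolding e(3)
    by (rule order_trans[OF tri])
       (use t[OF M(1), of "dx1 h p"] t[OF M(2), of "dx2 h p"] Bh 4 in \<open>simp only: abs_minus_cancel, linarith\<close>)
  have X: "M * B + M * B + B \<le> K + B + 6 * M * B" "M * B + M * B + (2 * (M * B) + 2 * (M * B)) \<le> K + B + 6 * M * B"
    "B \<le> K + B + 6 * M * B" "K \<le> K + B + 6 * M * B"
  proof -
    have "6 * M * B = 6 * (M * B)" by simp
    then show "M * B + M * B + B \<le> K + B + 6 * M * B" "M * B + M * B + (2 * (M * B) + 2 * (M * B)) \<le> K + B + 6 * M * B"
      "B \<le> K + B + 6 * M * B" "K \<le> K + B + 6 * M * B"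
      using K0 B0 MB by linarith+
  qed
  show ?thesis
    unfolding jet_bound_def
  proof (intro conjI ballI)
    fix b :: spt assume "b \<in> Basis"
    then have b: "b = (1,0,0) \<or> b = (0,1,0) \<or> b = (0,0,1)" by (simp add: Basis_spt)
    have "\<bar>dt h p\<bar> * rad p \<le> K + B + 6 * M * B" "\<bar>dx1 h p\<bar> * rad p \<le> K + B + 6 * M * B"
      "\<bar>dx2 h p\<bar> * rad p \<le> K + B + 6 * M * B" using 3 Bh X by linarith+
    then show "\<bar>dird b h p\<bar> * rad p \<le> K + B + 6 * M * B" using b by (elim disjE) (simp_all only:)
    have "\<bar>dt v1 p\<bar> * rad p \<le> K + B + 6 * M * B" "\<bar>dx1 v1 p\<bar> * rad p \<le> K + B + 6 * M * B"
      "\<bar>dx2 v1 p\<bar> * rad p \<le> K + B + 6 * M * B" using 1 B1 X by linarith+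
    then show "\<bar>dird b v1 p\<bar> * rad p \<le> K + B + 6 * M * B" using b by (elim disjE) (simp_all only:)
    have "\<bar>dt v2 p\<bar> * rad p \<le> K + B + 6 * M * B" "\<bar>dx1 v2 p\<bar> * rad p \<le> K + B + 6 * M * B"
      "\<bar>dx2 v2 p\<bar> * rad p \<le> K + B + 6 * M * B" using 2 B2 X by linarith+
    then show "\<bar>dird b v2 p\<bar> * rad p \<le> K + B + 6 * M * B" using b by (elim disjE) (simp_all only:)
  qed (use K X in linarith)+
qed

lemma periodic_shift:
  assumes "periodic f" shows "f (t, x1, x2 + 2 * pi * of_int k) = f (t, x1, x2)"
proof (induction k rule: int_induct[where k = 0])
  case (step1 i)
  have "f (t, x1, (x2 + 2 * pi * of_int i) + 2 * pi) = f (t, x1, x2 + 2 * pi * of_int i)"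
    using assms unfolding periodic_def by blast
  then show ?case using step1 by (simp add: algebra_simps)
next
  case (step2 i)
  have "f (t, x1, (x2 + 2 * pi * of_int (i - 1)) + 2 * pi) = f (t, x1, x2 + 2 * pi * of_int (i - 1))"
    using assms unfolding periodic_def by blast
  then show ?case using step2 by (simp add: algebra_simps)
qed simp

lemma periodic2_shift:
  assumes "periodic2 f" shows "f (t, x2 + 2 * pi * of_int k) = f (t, x2)"
proof -
  have "periodic (\<lambda>(t, x1, x2). f (t, x2))" using assms by (simp add: periodic_def periodic2_def)
  from periodic_shift[OF this, of t 0 x2 k] show ?thesis by simp
qed

lemma dird_shift:
  assumes "periodic f"
  shows "f differentiable (at (t, x1, x2 + 2 * pi * of_int k)) \<longleftrightarrow> f differentiable (at (t, x1, x2))"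
    "dird b f (t, x1, x2 + 2 * pi * of_int k) = dird b f (t, x1, x2)"
proof -
  have s: "f (q + (0, 0, 2 * pi * of_int k)) = f q" for q and k :: int
    using periodic_shift[OF assms] by (cases q) simp
  have *: "(f has_derivative D) (at q)" if "(f has_derivative D) (at (q + (0, 0, 2 * pi * of_int k)))" for D q and k :: int
  proof -
    have "((\<lambda>q. q + (0, 0, 2 * pi * of_int k)) has_derivative (\<lambda>h. h)) (at q)" by (auto intro!: derivative_eq_intros)
    from has_derivative_compose[OF this that] show ?thesis unfolding s .
  qed
  have iff: "(f has_derivative D) (at (t, x1, x2 + 2 * pi * of_int k)) \<longleftrightarrow> (f has_derivative D) (at (t, x1, x2))" for D
  proof
    show "(f has_derivative D) (at (t, x1, x2))" if "(f has_derivative D) (at (t, x1, x2 + 2 * pi * of_int k))"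
      using *[of D "(t, x1, x2)" k] that by simp
    show "(f has_derivative D) (at (t, x1, x2 + 2 * pi * of_int k))" if "(f has_derivative D) (at (t, x1, x2))"
      using *[of D "(t, x1, x2 + 2 * pi * of_int k)" "- k"] that by simp
  qed
  show "f differentiable (at (t, x1, x2 + 2 * pi * of_int k)) \<longleftrightarrow> f differentiable (at (t, x1, x2))"
    by (simp add: differentiable_def iff)
  show "dird b f (t, x1, x2 + 2 * pi * of_int k) = dird b f (t, x1, x2)"
    by (simp add: dird_def frechet_derivative_def iff)
qed

lemma circle_representative: "\<exists>k::int. 0 \<le> x + 2 * pi * of_int k \<and> x + 2 * pi * of_int k < 2 * pi"
proof (intro exI conjI)
  let ?k = "- \<lfloor>x / (2 * pi)\<rfloor>"
  define y where "y = x / (2 * pi) - of_int \<lfloor>x / (2 * pi)\<rfloor>"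
  have "0 \<le> y" "y < 1" unfolding y_def by linarith+
  moreover have "x + 2 * pi * of_int ?k = 2 * pi * y" unfolding y_def right_diff_distrib by simp
  ultimately show "0 \<le> x + 2 * pi * of_int ?k" "x + 2 * pi * of_int ?k < 2 * pi" by simp_all
qed

lemma Ck_on_continuous: "Ck_on k S f \<Longrightarrow> continuous_on S f"
proof (cases k)
  case (Suc n)
  assume "Ck_on k S f"
  then obtain D where "\<forall>x\<in>S. (f has_derivative (\<lambda>h. \<Sum>b\<in>Basis. (h \<bullet> b) *\<^sub>R D b x)) (at x within S)"
    unfolding Suc Ck_on.simps by (elim exE conjE) (rule that)
  then show ?thesis
    unfolding continuous_on_eq_continuous_within by (intro ballI has_derivative_continuous) (erule (1) bspec)
qed simp

text \<open>Periodicity reduces a strip \<open>\<bar>x\<^sub>1\<bar> \<le> R\<close> to a compact set, on which the derivatives up to the boundary are bounded. The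
  smooth representative \<open>f'\<close> may differ from \<open>f\<close> on the edge, where \<open>f\<close> is discontinuous.\<close>

lemma Ck_gradient_bound:
  fixes f f' :: "spt \<Rightarrow> 'b::real_normed_vector"
  assumes S: "closed S" and f': "Ck_on (Suc n) S f'" and eq: "\<And>p. p \<in> S - edge \<Longrightarrow> f' p = f p"
    and per: "periodic f" and Q: "open Q" "Q \<subseteq> S - edge"
    and shift: "\<And>t x1 x2 k. (t, x1, x2) \<in> Q \<Longrightarrow> (t, x1, x2 + 2 * pi * of_int k) \<in> Q"
    and time: "\<And>p. p \<in> Q \<Longrightarrow> 0 \<le> fst p \<and> fst p \<le> 1"
  shows "\<exists>C. \<forall>p\<in>Q. \<bar>fst (snd p)\<bar> \<le> R \<longrightarrow> f differentiable (at p) \<and> (\<forall>b\<in>Basis. norm (dird b f p) \<le> C)"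
proof -
  obtain D where D: "\<forall>b\<in>Basis. Ck_on n S (D b)"
    "\<forall>x\<in>S. (f' has_derivative (\<lambda>h. \<Sum>b\<in>Basis. (h \<bullet> b) *\<^sub>R D b x)) (at x within S)"
    using f' unfolding Ck_on.simps by (elim exE conjE) (rule that)
  let ?K = "S \<inter> cbox (0, -R, 0) (1, R, 2 * pi)"
  have K: "compact ?K" using S by (intro closed_Int_compact) auto
  have "\<exists>C. \<forall>p\<in>?K. norm (D b p) \<le> C" if "b \<in> Basis" for b
  proof -
    have "continuous_on ?K (D b)" using D(1) that Ck_on_continuous continuous_on_subset by blast
    then have "bounded (D b ` ?K)" using K by (intro compact_imp_bounded compact_continuous_image)
    then show ?thesis by (auto simp: bounded_iff)
  qed
  then have "\<forall>b\<in>Basis. \<exists>C. \<forall>p\<in>?K. norm (D b p) \<le> C" by blast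
  from bchoice[OF this] obtain C where C: "\<forall>b\<in>Basis. \<forall>p\<in>?K. norm (D b p) \<le> C b" by (elim exE) (rule that)
  have fD: "(f has_derivative (\<lambda>h. \<Sum>b\<in>Basis. (h \<bullet> b) *\<^sub>R D b p)) (at p)" if p: "p \<in> Q" for p
  proof -
    have pS: "p \<in> S" using p Q by blast
    have "(f' has_derivative (\<lambda>h. \<Sum>b\<in>Basis. (h \<bullet> b) *\<^sub>R D b p)) (at p within Q)"
      by (rule has_derivative_subset[OF bspec[OF D(2) pS]]) (use Q in blast)
    then have "(f' has_derivative (\<lambda>h. \<Sum>b\<in>Basis. (h \<bullet> b) *\<^sub>R D b p)) (at p)"
      using at_within_open[OF p Q(1)] by simp
    then show ?thesis
      by (rule has_derivative_transform_within_open[OF _ Q(1) p]) (use eq Q in blast)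
  qed
  have dD: "dird b f p = D b p" if p: "p \<in> Q" and b: "b \<in> Basis" for p b
  proof -
    have "dird b f p = (\<Sum>c\<in>Basis. (b \<bullet> c) *\<^sub>R D c p)" by (rule dird_eq[OF fD[OF p]])
    also have "\<dots> = (\<Sum>c\<in>Basis. if c = b then D b p else 0)"
      using b by (intro sum.cong) (auto simp: inner_Basis)
    also have "\<dots> = D b p" using b by simp
    finally show ?thesis .
  qed
  define B where "B = (\<Sum>b\<in>Basis. \<bar>C b\<bar>)"
  have "norm (dird b f p) \<le> B" if p: "p \<in> Q" "\<bar>fst (snd p)\<bar> \<le> R" and b: "b \<in> Basis" for p b
  proof -
    obtain t x1 x2 where p': "p = (t, x1, x2)" by (cases p)
    obtain k :: int where k: "0 \<le> x2 + 2 * pi * of_int k" "x2 + 2 * pi * of_int k < 2 * pi"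
      using circle_representative by blast
    let ?q = "(t, x1, x2 + 2 * pi * of_int k)"
    have q: "?q \<in> Q" using shift p unfolding p' by blast
    have "?q \<in> ?K" using q Q time[OF q] k p(2) by (auto simp: p' abs_le_iff)
    then have "norm (D b ?q) \<le> C b" using C b by blast
    also have "C b \<le> B"
    proof -
      have "\<bar>C b\<bar> \<le> B" unfolding B_def using b by (intro member_le_sum) auto
      then show ?thesis by linarith
    qed
    finally have "norm (dird b f ?q) \<le> B" unfolding dD[OF q b] .
    then show ?thesis unfolding p' dird_shift(2)[OF per] .
  qed
  moreover have "f differentiable (at p)" if "p \<in> Q" for p using fD[OF that] by (auto simp: differentiable_def)
  ultimately show ?thesis by (intro exI[of _ B]) blast
qed

section \<open>Gradient bounds in the five regions\<close>

definition jets_bounded_on :: "real \<Rightarrow> spt set \<Rightarrow> (spt \<Rightarrow> vel) \<Rightarrow> (spt \<Rightarrow> real) \<Rightarrow> bool" where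
  "jets_bounded_on \<gamma> Q v c \<longleftrightarrow> (\<forall>R. \<exists>C. \<forall>p\<in>Q. \<bar>fst (snd p)\<bar> \<le> R \<longrightarrow>
     euler_jet \<gamma> (enthalpy \<gamma> c) (v1_of v) (v2_of v) p \<and> jet_bound C (enthalpy \<gamma> c) (v1_of v) (v2_of v) p)"

lemma abs_vel_le: "\<bar>fst w\<bar> \<le> norm w" "\<bar>snd w\<bar> \<le> norm w" for w :: vel
  using norm_fst_le[of "fst w" "snd w"] norm_snd_le[of "snd w" "fst w"] by simp_all

text \<open>In a region where the solution is continuously differentiable up to the boundary, gradients are bounded on
  strips, and so is the distance from the edge.\<close>

lemma jets_classical_region:
  assumes \<gamma>: "1 < \<gamma>" "0 < k0" and cs: "classical_solution_on \<gamma> k0 (Suc n) S v c"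
    and S: "closed S" and Q: "open Q" "Q \<subseteq> S" "Q \<subseteq> {0<..<1} \<times> UNIV"
    and shift: "\<And>t x1 x2 k. (t, x1, x2) \<in> Q \<Longrightarrow> (t, x1, x2 + 2 * pi * of_int k) \<in> Q"
    and per: "periodic v" "periodic c" and c: "\<And>p. p \<in> slab - edge \<Longrightarrow> 0 < c p"
    and M: "\<And>p. p \<in> slab \<Longrightarrow> \<bar>c p\<bar> \<le> M"
  shows "jets_bounded_on \<gamma> Q v c"
  unfolding jets_bounded_on_def
proof
  fix R
  have Qs: "Q \<subseteq> slab - edge" using Q(3) by (auto simp: slab_def edge_def)
  have QS: "Q \<subseteq> S - edge" using Q(2) Qs by blast
  have t01: "0 \<le> fst p \<and> fst p \<le> 1" if "p \<in> Q" for p using Q(3) that by force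
  obtain v' c' where v': "Ck_on (Suc n) S v'" and c': "Ck_on (Suc n) S c'"
    and eq: "\<forall>p\<in>S - edge. v' p = v p \<and> c' p = c p" and eu: "\<forall>p\<in>interior S. euler_at \<gamma> k0 v c p"
    using cs unfolding classical_solution_on_def by (elim exE conjE) (rule that)
  have ex1: "\<exists>A. \<forall>p\<in>Q. \<bar>fst (snd p)\<bar> \<le> R \<longrightarrow> v differentiable (at p) \<and> (\<forall>b\<in>Basis. norm (dird b v p) \<le> A)"
  proof (rule Ck_gradient_bound[OF S v' _ per(1) Q(1) QS])
    show "\<And>p. p \<in> S - edge \<Longrightarrow> v' p = v p" using eq by blast
  qed (rule shift, assumption, rule t01)
  have ex2: "\<exists>A. \<forall>p\<in>Q. \<bar>fst (snd p)\<bar> \<le> R \<longrightarrow> c differentiable (at p) \<and> (\<forall>b\<in>Basis. norm (dird b c p) \<le> A)"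
  proof (rule Ck_gradient_bound[OF S c' _ per(2) Q(1) QS])
    show "\<And>p. p \<in> S - edge \<Longrightarrow> c' p = c p" using eq by blast
  qed (rule shift, assumption, rule t01)
  obtain A where A: "\<forall>p\<in>Q. \<bar>fst (snd p)\<bar> \<le> R \<longrightarrow> v differentiable (at p) \<and> (\<forall>b\<in>Basis. norm (dird b v p) \<le> A)"
    using ex1 by (elim exE) (rule that)
  obtain B where B: "\<forall>p\<in>Q. \<bar>fst (snd p)\<bar> \<le> R \<longrightarrow> c differentiable (at p) \<and> (\<forall>b\<in>Basis. norm (dird b c p) \<le> B)"
    using ex2 by (elim exE) (rule that)
  define K where "K = \<bar>A\<bar> + 2 * \<bar>M\<bar> * \<bar>B\<bar> / (\<gamma> - 1)"
  have K: "0 \<le> 2 * \<bar>M\<bar> * \<bar>B\<bar> / (\<gamma> - 1)" "0 \<le> K" using \<gamma> by (simp_all add: K_def)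
  have "euler_jet \<gamma> (enthalpy \<gamma> c) (v1_of v) (v2_of v) p \<and> jet_bound (K * (1 + \<bar>R\<bar>)) (enthalpy \<gamma> c) (v1_of v) (v2_of v) p"
    if p: "p \<in> Q" "\<bar>fst (snd p)\<bar> \<le> R" for p
  proof
    have "p \<in> interior S" using p Q by (meson interiorI)
    then show "euler_jet \<gamma> (enthalpy \<gamma> c) (v1_of v) (v2_of v) p"
      using eu c Qs by (intro euler_at_jet[OF \<gamma> _ Q(1) p(1)]) auto
    have vd: "v differentiable (at p)" and vb: "\<And>b. b \<in> Basis \<Longrightarrow> norm (dird b v p) \<le> A" using A p by auto
    have cd: "c differentiable (at p)" and cb: "\<And>b. b \<in> Basis \<Longrightarrow> \<bar>dird b c p\<bar> \<le> B" using B p by auto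
    have v: "\<bar>dird b (v1_of v) p\<bar> \<le> K" "\<bar>dird b (v2_of v) p\<bar> \<le> K" if "b \<in> Basis" for b
      unfolding dird_components[OF vd] K_def
      using abs_vel_le[of "dird b v p"] vb[OF that] K(1) by linarith+
    have "((\<lambda>y. y\<^sup>2 / (\<gamma> - 1)) has_real_derivative 2 * c p / (\<gamma> - 1)) (at (c p))"
      using \<gamma> by (auto intro!: derivative_eq_intros)
    from dird_chain(2)[OF cd this] have hd: "dird b (enthalpy \<gamma> c) p = 2 * c p / (\<gamma> - 1) * dird b c p" for b
      by (simp add: enthalpy_def[abs_def])
    have h: "\<bar>dird b (enthalpy \<gamma> c) p\<bar> \<le> K" if "b \<in> Basis" for b
    proof -
      have "p \<in> slab" using Qs p by blast
      then have "\<bar>c p\<bar> * \<bar>dird b c p\<bar> \<le> \<bar>M\<bar> * \<bar>B\<bar>"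
        using M[of p] cb[OF that] by (intro mult_mono) auto
      then have "2 * (\<bar>c p\<bar> * \<bar>dird b c p\<bar>) / (\<gamma> - 1) \<le> 2 * (\<bar>M\<bar> * \<bar>B\<bar>) / (\<gamma> - 1)"
        using \<gamma> by (intro divide_right_mono) auto
      then show ?thesis unfolding hd K_def using \<gamma> by (simp add: abs_mult abs_divide mult.assoc)
    qed
    have r: "0 \<le> rad p" "rad p \<le> 1 + \<bar>R\<bar>" using t01[OF p(1)] p(2) by (auto simp: rad_def)
    have s: "x * rad p \<le> K * (1 + \<bar>R\<bar>)" if "x \<le> K" for x
      using that r K by (intro order_trans[OF mult_right_mono[OF that r(1)]] mult_left_mono) auto
    have K1: "K * 1 \<le> K * (1 + \<bar>R\<bar>)" using K by (intro mult_left_mono) auto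
    have bas: "(0,1,0) \<in> (Basis :: spt set)" "(0,0,1) \<in> (Basis :: spt set)" by (auto simp: Basis_spt)
    show "jet_bound (K * (1 + \<bar>R\<bar>)) (enthalpy \<gamma> c) (v1_of v) (v2_of v) p"
      unfolding jet_bound_def
      using v[OF bas(1)] v[OF bas(2)] K1 by (intro conjI ballI s h v) (assumption | linarith)+
  qed
  then show "\<exists>C. \<forall>p\<in>Q. \<bar>fst (snd p)\<bar> \<le> R \<longrightarrow>
     euler_jet \<gamma> (enthalpy \<gamma> c) (v1_of v) (v2_of v) p \<and> jet_bound C (enthalpy \<gamma> c) (v1_of v) (v2_of v) p" by blast
qed

lemma jet_cong:
  assumes Q: "open Q" "p \<in> Q" and eq: "\<And>q. q \<in> Q \<Longrightarrow> h q = h' q" "\<And>q. q \<in> Q \<Longrightarrow> v1 q = v1' q" "\<And>q. q \<in> Q \<Longrightarrow> v2 q = v2' q"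
  shows "euler_jet \<gamma> h v1 v2 p = euler_jet \<gamma> h' v1' v2' p" "jet_bound C h v1 v2 p = jet_bound C h' v1' v2' p"
  unfolding euler_jet_def jet_bound_def
  by (simp_all only: dird_cong_open[of Q p h h', OF Q eq(1)] dird_cong_open[of Q p v1 v1', OF Q eq(2)]
      dird_cong_open[of Q p v2 v2', OF Q eq(3)] eq[OF Q(2)])

text \<open>In terms of the Riemann invariants, \<open>v\<^sup>1\<close> is \<open>wbar - wup\<close>, and only \<open>\<partial>\<^sub>1 wbar\<close> is singular. It equals
  \<open>2 / ((\<gamma> + 1) t)\<close> up to a bounded error, which is positive up to a bounded error and of order \<open>1 / t\<close>. Inside the fan \<open>t\<close> is
  comparable to the distance from the edge, since the bounding hypersurfaces emanate from the edge with finite speed.\<close>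

lemma jets_front_rarefaction:
  assumes \<gamma>: "1 < \<gamma>" "\<gamma> < 3" "0 < k0" and fr: "front_rarefaction \<gamma> k0 N A \<epsilon> vl cl vr cr \<phi>H \<phi>C v c"
    and Q: "open Q" "\<And>t x1 x2. (t, x1, x2) \<in> Q \<longleftrightarrow> 0 < t \<and> t < 1 \<and> \<phi>H (t, x2) < x1 \<and> x1 < \<phi>C (t, x2)"
    and L: "\<And>t x2. 0 \<le> t \<Longrightarrow> t \<le> 1 \<Longrightarrow> \<bar>\<phi>H (t, x2)\<bar> \<le> L * t \<and> \<bar>\<phi>C (t, x2)\<bar> \<le> L * t"
    and M: "\<And>p. p \<in> slab \<Longrightarrow> norm (v p) \<le> M \<and> \<bar>c p\<bar> \<le> M"
  shows "jets_bounded_on \<gamma> Q v c"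
proof -
  obtain us vF cF X where
    pos: "\<forall>p\<in>foliated_region us X. cF p > 0" and
    eu: "\<forall>p\<in>interior (foliated_region us X). euler_at \<gamma> k0 vF cF p" and
    grads: "\<forall>p\<in>interior (foliated_region us X).
          \<bar>dx2 (\<lambda>p. wbar \<gamma> (cF p) (vF p)) p\<bar> \<le> A * \<epsilon> \<and> \<bar>dx2 (\<lambda>p. wup \<gamma> (cF p) (vF p)) p\<bar> \<le> A * \<epsilon> \<and>
          \<bar>dx2 (\<lambda>p. psi2 (vF p)) p\<bar> \<le> A * \<epsilon> \<and> \<bar>dx1 (\<lambda>p. wup \<gamma> (cF p) (vF p)) p\<bar> \<le> A * \<epsilon> \<and>
          \<bar>dx1 (\<lambda>p. psi2 (vF p)) p\<bar> \<le> A * \<epsilon> \<and>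
          \<bar>- fst p * dx1 (\<lambda>p. wbar \<gamma> (cF p) (vF p)) p + 2 / (\<gamma> + 1)\<bar> \<le> A * \<epsilon> * fst p" and
    reg: "\<forall>t x1 x2. 0 < t \<and> t \<le> 1 \<and> \<phi>H (t, x2) \<le> x1 \<and> x1 \<le> \<phi>C (t, x2) \<longrightarrow>
          (t, x1, x2) \<in> foliated_region us X \<and> v (t, x1, x2) = vF (t, x1, x2) \<and> c (t, x1, x2) = cF (t, x1, x2)"
    using fr unfolding front_rarefaction_def Let_def by (elim exE conjE) (rule that)
  have QR: "p \<in> foliated_region us X \<and> v p = vF p \<and> c p = cF p" if "p \<in> Q" for p
    using that reg Q(2) by (cases p) auto
  have Qi: "p \<in> interior (foliated_region us X)" if "p \<in> Q" for p
    using QR that by (intro interiorI[OF Q(1)]) auto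
  have Qs: "p \<in> slab" if "p \<in> Q" for p using that Q(2) by (cases p) (auto simp: slab_def)
  define e where "e = A * \<epsilon>"
  define B where "B = (1 + \<bar>M\<bar>) * ((1 + \<bar>L\<bar>) * (1 + 2 * \<bar>e\<bar>))"
  define M' where "M' = \<bar>M\<bar> + M\<^sup>2 / (\<gamma> - 1)"
  let ?h = "enthalpy \<gamma> cF" and ?v1 = "v1_of vF" and ?v2 = "v2_of vF"
  have main: "euler_jet \<gamma> ?h ?v1 ?v2 p \<and> jet_bound (2 * \<bar>e\<bar> + B + 6 * M' * B) ?h ?v1 ?v2 p" if p: "p \<in> Q" for p
  proof
    obtain t x1 x2 where p': "p = (t, x1, x2)" by (cases p)
    have t: "0 < t" "t < 1" and x: "\<phi>H (t, x2) < x1" "x1 < \<phi>C (t, x2)" using p Q(2) unfolding p' by auto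
    show j: "euler_jet \<gamma> ?h ?v1 ?v2 p"
      using eu Qi[OF p] pos QR by (intro euler_at_jet[OF \<gamma>(1,3) _ Q(1) p]) auto
    have cpos: "0 < cF q" if "q \<in> Q" for q using pos QR that by blast
    have vd: "?v1 differentiable (at p)" "?v2 differentiable (at p)" and hd: "?h differentiable (at p)"
      using j by (auto simp: euler_jet_def)
    have hp: "0 < ?h p" using cpos[OF p] \<gamma> by (simp add: enthalpy_def)
    have "((\<lambda>y. sqrt ((\<gamma> - 1) * y)) has_real_derivative (\<gamma> - 1) * (inverse (sqrt ((\<gamma> - 1) * ?h p)) / 2)) (at (?h p))"
    proof -
      have "0 < (\<gamma> - 1) * ?h p" using hp \<gamma> by simp
      then show ?thesis by (auto intro!: derivative_eq_intros)
    qed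
    from dird_chain(1)[OF hd this] have "(\<lambda>q. sqrt ((\<gamma> - 1) * ?h q)) differentiable (at p)" .
    moreover have "sqrt ((\<gamma> - 1) * ?h q) = cF q" if "q \<in> Q" for q
      using cpos[OF that] \<gamma> by (simp add: enthalpy_def)
    ultimately have cd: "cF differentiable (at p)"
      using dird_cong_open(1)[OF Q(1) p, of "\<lambda>q. sqrt ((\<gamma> - 1) * ?h q)" cF] by simp
    note cD = cd[unfolded frechet_derivative_works] and v1D = vd(1)[unfolded frechet_derivative_works]
      and v2D = vd(2)[unfolded frechet_derivative_works]
    have wb: "dird b (\<lambda>p. wbar \<gamma> (cF p) (vF p)) p = dird b cF p / (\<gamma> - 1) + dird b ?v1 p / 2" for b
    proof -
      have "((\<lambda>p. cF p * (1 / (\<gamma> - 1)) + ?v1 p * (1/2)) has_derivative (\<lambda>h. frechet_derivative cF (at p) h * (1 / (\<gamma> - 1)) + frechet_derivative ?v1 (at p) h * (1/2))) (at p)"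
        by (intro has_derivative_add has_derivative_mult_left has_derivative_mult_right cD v1D)
      moreover have "(\<lambda>p. cF p * (1 / (\<gamma> - 1)) + ?v1 p * (1/2)) = (\<lambda>p. wbar \<gamma> (cF p) (vF p))"
        using \<gamma> by (simp add: wbar_def v1_of_def fun_eq_iff field_simps)
      ultimately show ?thesis using dird_eq[of "\<lambda>p. wbar \<gamma> (cF p) (vF p)" _ p b] by (simp add: dird_def)
    qed
    have wu: "dird b (\<lambda>p. wup \<gamma> (cF p) (vF p)) p = dird b cF p / (\<gamma> - 1) - dird b ?v1 p / 2" for b
    proof -
      have "((\<lambda>p. cF p * (1 / (\<gamma> - 1)) - ?v1 p * (1/2)) has_derivative (\<lambda>h. frechet_derivative cF (at p) h * (1 / (\<gamma> - 1)) - frechet_derivative ?v1 (at p) h * (1/2))) (at p)"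
        by (intro has_derivative_diff has_derivative_mult_left has_derivative_mult_right cD v1D)
      moreover have "(\<lambda>p. cF p * (1 / (\<gamma> - 1)) - ?v1 p * (1/2)) = (\<lambda>p. wup \<gamma> (cF p) (vF p))"
        using \<gamma> by (simp add: wup_def v1_of_def fun_eq_iff field_simps)
      ultimately show ?thesis using dird_eq[of "\<lambda>p. wup \<gamma> (cF p) (vF p)" _ p b] by (simp add: dird_def)
    qed
    have ps: "dird b (\<lambda>p. psi2 (vF p)) p = - dird b ?v2 p" for b
    proof -
      have "((\<lambda>p. psi2 (vF p)) has_derivative (\<lambda>h. - frechet_derivative ?v2 (at p) h)) (at p)"
        using has_derivative_minus[OF v2D] by (simp add: psi2_def v2_of_def[abs_def])
      from dird_eq[OF this] show ?thesis by (simp add: dird_def)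
    qed
    have "((\<lambda>y. y\<^sup>2 / (\<gamma> - 1)) has_real_derivative 2 * cF p / (\<gamma> - 1)) (at (cF p))"
      using \<gamma> by (auto intro!: derivative_eq_intros)
    from dird_chain(2)[OF cd this] have hD: "dird b ?h p = cF p * (2 * (dird b cF p / (\<gamma> - 1)))" for b
      by (simp add: enthalpy_def[abs_def])
    note g = bspec[OF grads Qi[OF p]]
    \<comment> \<open>The derivatives of the two Riemann invariants; \<open>v\<^sup>1\<close> and \<open>h\<close> have the derivatives \<open>X - Y\<close> and \<open>c (X + Y)\<close>.\<close>
    define X Y where "X b = dird b cF p / (\<gamma> - 1) + dird b ?v1 p / 2" and "Y b = dird b cF p / (\<gamma> - 1) - dird b ?v1 p / 2" for b
    have v1XY: "dird b ?v1 p = X b - Y b" and hXY: "dird b ?h p = cF p * (X b + Y b)" for b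
      unfolding hD by (simp_all add: X_def Y_def)
    let ?e1 = "(0,1,0) :: spt" and ?e2 = "(0,0,1) :: spt"
    have G: "\<bar>X ?e2\<bar> \<le> \<bar>e\<bar>" "\<bar>Y ?e2\<bar> \<le> \<bar>e\<bar>" "\<bar>dx2 ?v2 p\<bar> \<le> \<bar>e\<bar>" "\<bar>Y ?e1\<bar> \<le> \<bar>e\<bar>" "\<bar>dx1 ?v2 p\<bar> \<le> \<bar>e\<bar>"
      and G1: "\<bar>- t * X ?e1 + 2 / (\<gamma> + 1)\<bar> \<le> e * t"
    proof -
      note g' = g[unfolded wb wu ps, folded X_def Y_def e_def]
      show "\<bar>X ?e2\<bar> \<le> \<bar>e\<bar>" "\<bar>Y ?e2\<bar> \<le> \<bar>e\<bar>" "\<bar>dx2 ?v2 p\<bar> \<le> \<bar>e\<bar>" "\<bar>Y ?e1\<bar> \<le> \<bar>e\<bar>" "\<bar>dx1 ?v2 p\<bar> \<le> \<bar>e\<bar>"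
        using g' by linarith+
      have "fst p = t" by (simp add: p')
      then show "\<bar>- t * X ?e1 + 2 / (\<gamma> + 1)\<bar> \<le> e * t" using g' by simp
    qed
    have g1: "0 \<le> 2 / (\<gamma> + 1)" "2 / (\<gamma> + 1) \<le> 1" using \<gamma> by auto
    have et: "e * t \<le> \<bar>e\<bar> * t" using t by (intro mult_right_mono) auto
    have et1: "\<bar>e\<bar> * t \<le> \<bar>e\<bar>" using t by (simp add: mult_left_le)
    \<comment> \<open>The main term of \<open>X\<close> in the \<open>x\<^sub>1\<close>-direction is positive and is dropped.\<close>
    have Xlow: "- \<bar>e\<bar> \<le> X ?e1"
    proof (rule ccontr)
      assume "\<not> - \<bar>e\<bar> \<le> X ?e1"
      then have "X ?e1 * t < - \<bar>e\<bar> * t" using t by (intro mult_strict_right_mono) auto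
      moreover have "- t * X ?e1 + 2 / (\<gamma> + 1) \<le> e * t" using G1 by (rule abs_le_D1)
      moreover have "- t * X ?e1 = - (X ?e1 * t)" "- \<bar>e\<bar> * t = - (\<bar>e\<bar> * t)" by simp_all
      ultimately show False using g1 et by linarith
    qed
    have Xt: "\<bar>X ?e1\<bar> * t \<le> 1 + \<bar>e\<bar>"
    proof -
      define q where "q = 2 / (\<gamma> + 1)"
      have "\<bar>- (t * X ?e1) + q\<bar> \<le> e * t" using G1 by (simp add: q_def)
      then have "\<bar>t * X ?e1\<bar> \<le> 1 + \<bar>e\<bar>" using g1[folded q_def] et et1 by linarith
      then show ?thesis using t by (simp add: abs_mult mult.commute)
    qed
    have rad: "rad p \<le> (1 + \<bar>L\<bar>) * t" "0 \<le> rad p"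
    proof -
      have "\<bar>x1\<bar> \<le> L * t" using x L[of t x2] t by auto
      also have "L * t \<le> \<bar>L\<bar> * t" using t by (intro mult_right_mono) auto
      finally show "rad p \<le> (1 + \<bar>L\<bar>) * t" using t by (simp add: rad_def p' algebra_simps)
    qed (simp add: rad_def)
    define W where "W = (1 + \<bar>L\<bar>) * (1 + 2 * \<bar>e\<bar>)"
    have W0: "0 \<le> W" by (simp add: W_def)
    have small: "\<bar>y\<bar> * rad p \<le> W" if "\<bar>y\<bar> * t \<le> 1 + 2 * \<bar>e\<bar>" for y
    proof -
      have "\<bar>y\<bar> * rad p \<le> \<bar>y\<bar> * ((1 + \<bar>L\<bar>) * t)" using rad by (intro mult_left_mono) auto
      also have "\<dots> = (1 + \<bar>L\<bar>) * (\<bar>y\<bar> * t)" by simp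
      also have "\<dots> \<le> W" unfolding W_def using that by (intro mult_left_mono) auto
      finally show ?thesis .
    qed
    have yt: "\<bar>y\<bar> * t \<le> k" if "\<bar>y\<bar> \<le> k" for y k
      using that t by (meson abs_ge_zero less_imp_le mult_left_le order_trans)
    have tri: "\<bar>a + b\<bar> * t \<le> \<bar>a\<bar> * t + \<bar>b\<bar> * t" for a b
      unfolding distrib_right[symmetric] using t by (intro mult_right_mono abs_triangle_ineq) auto
    have XY: "\<bar>X b - Y b\<bar> * rad p \<le> W" "\<bar>X b + Y b\<bar> * rad p \<le> W" if "b \<in> {?e1, ?e2}" for b
    proof -
      have "\<bar>X b\<bar> * t \<le> 1 + \<bar>e\<bar>" "\<bar>Y b\<bar> * t \<le> \<bar>e\<bar>"
        using that Xt yt[OF G(1)] yt[OF G(2)] yt[OF G(4)] by auto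
      then show "\<bar>X b - Y b\<bar> * rad p \<le> W" "\<bar>X b + Y b\<bar> * rad p \<le> W"
        using tri[of "X b" "Y b"] tri[of "X b" "- Y b"] by (intro small; simp)+
    qed
    have cM: "\<bar>cF p\<bar> \<le> \<bar>M\<bar>" and vM: "norm (vF p) \<le> \<bar>M\<bar>" using M[OF Qs[OF p]] QR[OF p] by auto
    have WB: "W \<le> B" "\<bar>M\<bar> * W \<le> B" 
    proof -
      have "B = W + \<bar>M\<bar> * W" unfolding B_def W_def[symmetric] by (simp only: distrib_right mult_1_left)
      moreover have "0 \<le> \<bar>M\<bar> * W" using W0 by simp
      ultimately show "W \<le> B" "\<bar>M\<bar> * W \<le> B" using W0 by linarith+
    qed
    show "jet_bound (2 * \<bar>e\<bar> + B + 6 * M' * B) ?h ?v1 ?v2 p"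
    proof (rule jet_bound_from_space[OF j \<gamma>(1,2)])
      have "\<bar>M\<bar> \<le> M'" using \<gamma> by (simp add: M'_def)
      then show "\<bar>?v1 p\<bar> \<le> M'" "\<bar>?v2 p\<bar> \<le> M'"
        using abs_vel_le[of "vF p"] vM by (simp_all add: v1_of_def v2_of_def)
      have "(cF p)\<^sup>2 \<le> M\<^sup>2" using cM by (simp add: abs_le_square_iff)
      then have "(cF p)\<^sup>2 / (\<gamma> - 1) \<le> M\<^sup>2 / (\<gamma> - 1)" using \<gamma> by (intro divide_right_mono) auto
      then show "\<bar>?h p\<bar> \<le> M'" using \<gamma> by (simp add: enthalpy_def M'_def)
      have hb: "\<bar>dird b ?h p\<bar> * rad p \<le> B" if "b \<in> {?e1, ?e2}" for b
      proof -
        have "\<bar>dird b ?h p\<bar> * rad p = \<bar>cF p\<bar> * (\<bar>X b + Y b\<bar> * rad p)" by (simp add: hXY abs_mult)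
        also have "\<dots> \<le> \<bar>M\<bar> * W" using cM XY(2)[OF that] rad by (intro mult_mono) auto
        finally show ?thesis using WB by linarith
      qed
      have vb: "\<bar>dird b ?v1 p\<bar> * rad p \<le> B" if "b \<in> {?e1, ?e2}" for b
        unfolding v1XY using XY(1)[OF that] WB by linarith
      have v2b: "\<bar>dird b ?v2 p\<bar> * rad p \<le> B" if "b \<in> {?e1, ?e2}" for b
      proof -
        have "\<bar>dird b ?v2 p\<bar> * t \<le> \<bar>e\<bar>" using that yt[OF G(3)] yt[OF G(5)] by auto
        then have "\<bar>dird b ?v2 p\<bar> * rad p \<le> W" by (intro small) simp
        then show ?thesis using WB by linarith
      qed
      show "\<bar>dx1 f p\<bar> * rad p \<le> B \<and> \<bar>dx2 f p\<bar> * rad p \<le> B" if "f \<in> {?h, ?v1, ?v2}" for f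
        using that hb vb v2b by blast
      show "- (2 * \<bar>e\<bar>) \<le> dx1 ?v1 p" unfolding v1XY using Xlow G(4) by linarith
      show "\<bar>dx2 ?v1 p\<bar> \<le> 2 * \<bar>e\<bar>" unfolding v1XY using G(1,2) by linarith
      show "\<bar>dx1 ?v2 p\<bar> \<le> 2 * \<bar>e\<bar>" "\<bar>dx2 ?v2 p\<bar> \<le> 2 * \<bar>e\<bar>" using G(3,5) by linarith+
    qed
  qed
  have "euler_jet \<gamma> (enthalpy \<gamma> c) (v1_of v) (v2_of v) p \<and> jet_bound (2 * \<bar>e\<bar> + B + 6 * M' * B) (enthalpy \<gamma> c) (v1_of v) (v2_of v) p"
    if p: "p \<in> Q" for p
    using main[OF p] jet_cong[OF Q(1) p, of "enthalpy \<gamma> c" ?h "v1_of v" ?v1 "v2_of v" ?v2] QR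
    by (simp add: enthalpy_def v1_of_def v2_of_def)
  then show ?thesis unfolding jets_bounded_on_def by blast
qed

lemma reflect_reflect [simp]: "reflect (reflect p) = p"
  by (cases p) (simp add: reflect_def flip_def)

lemma dird_reflect:
  fixes f :: "spt \<Rightarrow> real"
  assumes "f differentiable (at (reflect p))"
  shows "(\<lambda>q. f (reflect q)) differentiable (at p)" "dt (\<lambda>q. f (reflect q)) p = dt f (reflect p)"
    "dx1 (\<lambda>q. f (reflect q)) p = - dx1 f (reflect p)" "dx2 (\<lambda>q. f (reflect q)) p = dx2 f (reflect p)"
proof -
  let ?D = "frechet_derivative f (at (reflect p))"
  have D: "(f has_derivative ?D) (at (reflect p))" using assms frechet_derivative_works by blast
  have r: "reflect = (\<lambda>q. (fst q, - fst (snd q), snd (snd q)))" by (simp add: fun_eq_iff reflect_def flip_def)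
  have R: "(reflect has_derivative reflect) (at p)"
    unfolding r by (intro has_derivative_Pair has_derivative_minus bounded_linear_imp_has_derivative
        bounded_linear_fst bounded_linear_fst_comp bounded_linear_snd_comp bounded_linear_snd)
  have C: "((\<lambda>q. f (reflect q)) has_derivative (\<lambda>h. ?D (reflect h))) (at p)"
    by (rule has_derivative_compose[OF R D])
  show "(\<lambda>q. f (reflect q)) differentiable (at p)" using C by (auto simp: differentiable_def)
  have "?D (0, -1, 0) = - ?D (0, 1, 0)"
    using linear_neg[OF linear_frechet_derivative[OF assms], of "(0, 1, 0)"] by simp
  then show "dt (\<lambda>q. f (reflect q)) p = dt f (reflect p)"
    "dx1 (\<lambda>q. f (reflect q)) p = - dx1 f (reflect p)" "dx2 (\<lambda>q. f (reflect q)) p = dx2 f (reflect p)"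
    unfolding dird_eq[OF C] by (simp_all add: dird_def r)
qed

text \<open>The Euler equations and the bounds are invariant under the reflection \<open>x\<^sub>1 \<mapsto> - x\<^sub>1\<close>, which reverses \<open>v\<^sup>1\<close> and hence
  preserves \<open>\<partial>\<^sub>1 v\<^sup>1\<close>.\<close>

lemma jet_reflect:
  assumes j: "euler_jet \<gamma> h v1 v2 (reflect p)"
  shows "euler_jet \<gamma> (\<lambda>q. h (reflect q)) (\<lambda>q. - v1 (reflect q)) (\<lambda>q. v2 (reflect q)) p"
    "jet_bound C h v1 v2 (reflect p) \<Longrightarrow> jet_bound C (\<lambda>q. h (reflect q)) (\<lambda>q. - v1 (reflect q)) (\<lambda>q. v2 (reflect q)) p"
proof -
  have d: "h differentiable (at (reflect p))" "v1 differentiable (at (reflect p))" "v2 differentiable (at (reflect p))"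
    using j by (auto simp: euler_jet_def)
  note r = dird_reflect[OF d(1)] dird_reflect[OF d(3)]
  have n: "(\<lambda>q. - v1 (reflect q)) differentiable (at p)" using dird_reflect(1)[OF d(2)] by simp
  have nd: "dird b (\<lambda>q. - v1 (reflect q)) p = - dird b (\<lambda>q. v1 (reflect q)) p" for b
  proof -
    have "((\<lambda>q. v1 (reflect q)) has_derivative frechet_derivative (\<lambda>q. v1 (reflect q)) (at p)) (at p)"
      using dird_reflect(1)[OF d(2)] frechet_derivative_works by blast
    from dird_eq[OF has_derivative_minus[OF this]] show ?thesis by (simp add: dird_def)
  qed
  show "euler_jet \<gamma> (\<lambda>q. h (reflect q)) (\<lambda>q. - v1 (reflect q)) (\<lambda>q. v2 (reflect q)) p"
    using j r(1,5) n unfolding euler_jet_def nd dird_reflect[OF d(1)] dird_reflect[OF d(2)] dird_reflect[OF d(3)]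
    by (simp add: algebra_simps)
  have rr: "rad (reflect p) = rad p" by (simp add: rad_def reflect_def flip_def)
  show "jet_bound C h v1 v2 (reflect p) \<Longrightarrow> jet_bound C (\<lambda>q. h (reflect q)) (\<lambda>q. - v1 (reflect q)) (\<lambda>q. v2 (reflect q)) p"
    unfolding jet_bound_def Basis_spt nd by (simp add: dird_reflect[OF d(1)] dird_reflect[OF d(2)] dird_reflect[OF d(3)] rr)
qed

text \<open>Reduced to the front wave by the reflection.\<close>

lemma jets_back_rarefaction:
  assumes \<gamma>: "1 < \<gamma>" "\<gamma> < 3" "0 < k0" and br: "back_rarefaction \<gamma> k0 N A \<epsilon> vl cl vr cr \<phi>C \<phi>H v c"
    and Q: "open Q" "\<And>t x1 x2. (t, x1, x2) \<in> Q \<longleftrightarrow> 0 < t \<and> t < 1 \<and> \<phi>C (t, x2) < x1 \<and> x1 < \<phi>H (t, x2)"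
    and L: "\<And>t x2. 0 \<le> t \<Longrightarrow> t \<le> 1 \<Longrightarrow> \<bar>\<phi>C (t, x2)\<bar> \<le> L * t \<and> \<bar>\<phi>H (t, x2)\<bar> \<le> L * t"
    and M: "\<And>p. p \<in> slab \<Longrightarrow> norm (v p) \<le> M \<and> \<bar>c p\<bar> \<le> M"
  shows "jets_bounded_on \<gamma> Q v c"
proof -
  let ?v = "flip \<circ> v \<circ> reflect" and ?c = "c \<circ> reflect"
  let ?Q = "reflect -` Q"
  have rc: "continuous_on UNIV reflect" unfolding reflect_def flip_def by (intro continuous_intros)
  have "jets_bounded_on \<gamma> ?Q ?v ?c"
  proof (rule jets_front_rarefaction[OF \<gamma> br[unfolded back_rarefaction_def]])
    show "open ?Q" using rc Q(1) by (simp add: open_vimage)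
    show "(t, x1, x2) \<in> ?Q \<longleftrightarrow> 0 < t \<and> t < 1 \<and> - \<phi>H (t, x2) < x1 \<and> x1 < - \<phi>C (t, x2)" for t x1 x2
      using Q(2)[of t "- x1" x2] by (auto simp: reflect_def flip_def)
    show "\<bar>- \<phi>H (t, x2)\<bar> \<le> L * t \<and> \<bar>- \<phi>C (t, x2)\<bar> \<le> L * t" if "0 \<le> t" "t \<le> 1" for t x2 using L[OF that] by simp
    show "norm (?v p) \<le> M \<and> \<bar>?c p\<bar> \<le> M" if "p \<in> slab" for p
    proof -
      have "reflect p \<in> slab" using that by (auto simp: slab_def reflect_def)
      moreover have "norm (flip w) = norm w" for w by (cases w) (simp add: flip_def norm_Pair)
      ultimately show ?thesis using M[of "reflect p"] by simp
    qed
  qed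
  then have "\<exists>C. \<forall>p\<in>?Q. \<bar>fst (snd p)\<bar> \<le> R \<longrightarrow> euler_jet \<gamma> (enthalpy \<gamma> ?c) (v1_of ?v) (v2_of ?v) p \<and> jet_bound C (enthalpy \<gamma> ?c) (v1_of ?v) (v2_of ?v) p" for R
    unfolding jets_bounded_on_def by blast
  moreover have "enthalpy \<gamma> c = (\<lambda>q. enthalpy \<gamma> ?c (reflect q))" "v1_of v = (\<lambda>q. - v1_of ?v (reflect q))"
    "v2_of v = (\<lambda>q. v2_of ?v (reflect q))"
    by (simp_all add: fun_eq_iff enthalpy_def v1_of_def v2_of_def flip_def)
  moreover have "reflect p \<in> ?Q \<and> \<bar>fst (snd (reflect p))\<bar> = \<bar>fst (snd p)\<bar>" if "p \<in> Q" for p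
    using that by (simp add: reflect_def[of p] flip_def) (simp add: reflect_def flip_def)
  ultimately show ?thesis
    unfolding jets_bounded_on_def by (metis jet_reflect)
qed

section \<open>The two-rarefaction solution as a piecewise classical solution\<close>

text \<open>The hypersurfaces are graphs \<open>x\<^sub>1 = \<phi> (t, x\<^sub>2)\<close> that start at \<open>x\<^sub>1 = 0\<close>; the mean value theorem in \<open>t\<close> and compactness of the
  circle bound their speed.\<close>

lemma null_graph_facts:
  assumes "null_from_edge (Suc n) v c \<phi>"
  shows "\<phi> differentiable_on ({0..1} \<times> UNIV)" "continuous_on ({0..1} \<times> UNIV) \<phi>" "periodic2 \<phi>"
    "\<exists>L. \<forall>t x2. 0 \<le> t \<longrightarrow> t \<le> 1 \<longrightarrow> \<bar>\<phi> (t, x2)\<bar> \<le> L * t"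
proof -
  have ck: "Ck_on (Suc n) ({0..1} \<times> UNIV) \<phi>" and per: "periodic2 \<phi>" and zero: "\<phi> (0, x2) = 0" for x2
    using assms by (auto simp: null_from_edge_def simp del: Ck_on.simps)
  obtain D where D: "\<forall>b\<in>Basis. Ck_on n ({0..1} \<times> UNIV) (D b)"
    "\<forall>x\<in>{0..1} \<times> UNIV. (\<phi> has_derivative (\<lambda>h. \<Sum>b\<in>Basis. (h \<bullet> b) *\<^sub>R D b x)) (at x within {0..1} \<times> UNIV)"
    using ck unfolding Ck_on.simps by (elim exE conjE) (rule that)
  show "\<phi> differentiable_on ({0..1} \<times> UNIV)"
    using D(2) unfolding differentiable_on_def differentiable_def by blast
  show "continuous_on ({0..1} \<times> UNIV) \<phi>" by (rule Ck_on_continuous[OF ck])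
  show "periodic2 \<phi>" by (rule per)
  let ?K = "cbox (0, 0) (1, 2 * pi) :: (real \<times> real) set"
  have bas: "(1, 0) \<in> (Basis :: (real \<times> real) set)" by (simp add: Basis_prod_def)
  have "continuous_on ({0..1} \<times> UNIV) (D (1, 0))" using D(1) bas Ck_on_continuous by blast
  then have "continuous_on ?K (D (1, 0))" by (rule continuous_on_subset) auto
  then have "bounded (D (1, 0) ` ?K)" by (intro compact_imp_bounded compact_continuous_image) auto
  then obtain L where L: "\<forall>x\<in>?K. \<bar>D (1, 0) x\<bar> \<le> L" by (auto simp: bounded_iff)
  have *: "\<bar>\<phi> (t, x2)\<bar> \<le> L * t" if t: "0 \<le> t" "t \<le> 1" and x2: "0 \<le> x2" "x2 \<le> 2 * pi" for t x2
  proof -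
    have "norm (\<phi> (t, x2) - \<phi> (0, x2)) \<le> L * norm (t - 0)"
    proof (rule field_differentiable_bound[of "{0..1}" "\<lambda>s. \<phi> (s, x2)" "\<lambda>s. D (1, 0) (s, x2)"])
      fix s :: real assume s: "s \<in> {0..1}"
      have "(s, x2) \<in> {0..1} \<times> UNIV" using s by simp
      from bspec[OF D(2) this] have "(\<phi> has_derivative (\<lambda>h. \<Sum>b\<in>Basis. (h \<bullet> b) *\<^sub>R D b (s, x2))) (at (s, x2) within (\<lambda>s. (s, x2)) ` {0..1})"
        by (rule has_derivative_subset) auto
      moreover have "((\<lambda>s. (s, x2)) has_vector_derivative (1, 0)) (at s within {0..1})"
        by (auto intro!: derivative_eq_intros has_vector_derivative_Pair)
      ultimately have "((\<lambda>s. \<phi> (s, x2)) has_vector_derivative (\<Sum>b\<in>Basis. ((1::real, 0::real) \<bullet> b) *\<^sub>R D b (s, x2))) (at s within {0..1})"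
        using vector_derivative_diff_chain_within by (force simp: o_def)
      moreover have "(\<Sum>b\<in>Basis. ((1::real, 0::real) \<bullet> b) *\<^sub>R D b (s, x2)) = D (1, 0) (s, x2)"
      proof -
        have "(\<Sum>b\<in>Basis. ((1::real, 0::real) \<bullet> b) *\<^sub>R D b (s, x2)) = (\<Sum>b\<in>Basis. if b = (1::real, 0::real) then D (1, 0) (s, x2) else 0)"
          using bas by (intro sum.cong) (auto simp: inner_Basis)
        then show ?thesis using bas by simp
      qed
      ultimately show "((\<lambda>s. \<phi> (s, x2)) has_field_derivative D (1, 0) (s, x2)) (at s within {0..1})"
        by (simp add: has_real_derivative_iff_has_vector_derivative)
      show "norm (D (1, 0) (s, x2)) \<le> L" using L s x2 by simp
    qed (use t in auto)
    then show ?thesis using zero t by simp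
  qed
  have "\<bar>\<phi> (t, x2)\<bar> \<le> L * t" if t: "0 \<le> t" "t \<le> 1" for t x2
  proof -
    obtain k :: int where k: "0 \<le> x2 + 2 * pi * of_int k" "x2 + 2 * pi * of_int k < 2 * pi"
      using circle_representative by blast
    have "\<bar>\<phi> (t, x2 + 2 * pi * of_int k)\<bar> \<le> L * t" by (rule *[OF t]) (use k in auto)
    then show ?thesis by (simp only: periodic2_shift[OF per])
  qed
  then show "\<exists>L. \<forall>t x2. 0 \<le> t \<longrightarrow> t \<le> 1 \<longrightarrow> \<bar>\<phi> (t, x2)\<bar> \<le> L * t" by blast
qed

lemma closed_between:
  assumes "continuous_on slab f" "continuous_on slab g"
  shows "closed {p \<in> slab. f p \<le> (g p :: real)}"
proof -
  have "closed slab" unfolding slab_def by (intro closed_Times) auto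
  then show ?thesis using assms by (intro continuous_on_closed_Collect_le)
qed

lemma open_between:
  assumes "continuous_on slab f" "continuous_on slab g"
  shows "open {p. 0 < fst p \<and> fst p < 1 \<and> f p < (g p :: real)}"
proof -
  let ?V = "{p::spt. 0 < fst p \<and> fst p < 1}"
  have V: "open ?V" by (intro open_Collect_conj open_Collect_less continuous_intros)
  have "continuous_on ?V (\<lambda>p. g p - f p)"
    using assms by (intro continuous_on_diff) (auto elim!: continuous_on_subset simp: slab_def)
  from continuous_open_preimage[OF this V, of "{0<..}"] have "open (?V \<inter> (\<lambda>p. g p - f p) -` {0<..})" by simp
  moreover have "?V \<inter> (\<lambda>p. g p - f p) -` {0<..} = {p. 0 < fst p \<and> fst p < 1 \<and> f p < g p}" by auto
  ultimately show ?thesis by simp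
qed

text \<open>Off the four hypersurfaces a point lies in one of five open regions, in which the bounds have been established
  separately. Across the hypersurfaces the solution is merely continuous, which the notion of tameness allows for.\<close>

lemma two_rarefaction_classical_pair:
  assumes \<gamma>: "1 < \<gamma>" "\<gamma> < 3" "0 < k0"
    and tr: "two_rarefaction_solution \<gamma> k0 (Suc n) A \<epsilon> vl cl vr cr v c"
  shows "\<exists>\<Phi>. finite \<Phi> \<and> (\<forall>\<phi>\<in>\<Phi>. \<phi> differentiable_on ({0..1} \<times> UNIV)) \<and>
     classical_pair \<gamma> \<Phi> (enthalpy \<gamma> c) (v1_of v) (v2_of v) \<and> source_bounded_below \<Phi> (v1_of v) (v2_of v)"
proof -
  obtain \<phi>1 \<phi>2 \<phi>3 \<phi>4 where per: "periodic v" "periodic c" and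
    bd: "bounded (v ` slab)" "bounded (c ` slab)" and pos: "\<forall>p\<in>slab - edge. c p > 0" and
    cont: "continuous_on (slab - edge) v" "continuous_on (slab - edge) c" and
    n1: "null_from_edge (Suc n) v c \<phi>1" and n2: "null_from_edge (Suc n) v c \<phi>2" and
    n3: "null_from_edge (Suc n) v c \<phi>3" and n4: "null_from_edge (Suc n) v c \<phi>4" and
    c1: "classical_solution_on \<gamma> k0 (Suc n) {(t, x1, x2). 0 \<le> t \<and> t \<le> 1 \<and> x1 \<le> \<phi>1 (t, x2)} v c" and
    c2: "back_rarefaction \<gamma> k0 (Suc n) A \<epsilon> vl cl vr cr \<phi>1 \<phi>2 v c" and
    c3: "classical_solution_on \<gamma> k0 (Suc n) {(t, x1, x2). 0 \<le> t \<and> t \<le> 1 \<and> \<phi>2 (t, x2) \<le> x1 \<and> x1 \<le> \<phi>3 (t, x2)} v c" and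
    c4: "front_rarefaction \<gamma> k0 (Suc n) A \<epsilon> vl cl vr cr \<phi>3 \<phi>4 v c" and
    c5: "classical_solution_on \<gamma> k0 (Suc n) {(t, x1, x2). 0 \<le> t \<and> t \<le> 1 \<and> \<phi>4 (t, x2) \<le> x1} v c"
    using tr unfolding two_rarefaction_solution_def by (elim conjE exE) (rule that)
  obtain Mv Mc where "\<And>p. p \<in> slab \<Longrightarrow> norm (v p) \<le> Mv" "\<And>p. p \<in> slab \<Longrightarrow> \<bar>c p\<bar> \<le> Mc"
    using bd unfolding bounded_iff by auto
  then have M: "norm (v p) \<le> max Mv Mc \<and> \<bar>c p\<bar> \<le> max Mv Mc" if "p \<in> slab" for p
    using that by (meson max.coboundedI1 max.coboundedI2)
  define M where "M = max Mv Mc"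
  note M = M[folded M_def]
  define g where "g \<phi> p = \<phi> (fst p, snd (snd p))" for \<phi> :: "real \<times> real \<Rightarrow> real" and p :: spt
  have gc: "continuous_on slab (g \<phi>)" if "continuous_on ({0..1} \<times> UNIV) \<phi>" for \<phi>
    unfolding g_def[abs_def]
    by (rule continuous_on_compose2[OF that]) (auto intro!: continuous_intros simp: slab_def)
  have xc: "continuous_on slab (\<lambda>p. fst (snd p))" by (intro continuous_intros)
  note f1 = null_graph_facts[OF n1] and f2 = null_graph_facts[OF n2] and f3 = null_graph_facts[OF n3] and f4 = null_graph_facts[OF n4]
  note g1 = gc[OF f1(2)] and g2 = gc[OF f2(2)] and g3 = gc[OF f3(2)] and g4 = gc[OF f4(2)]
  note sh = periodic2_shift[OF f1(3)] periodic2_shift[OF f2(3)] periodic2_shift[OF f3(3)] periodic2_shift[OF f4(3)]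
  obtain L1 where L1: "\<And>t x2. 0 \<le> t \<Longrightarrow> t \<le> 1 \<Longrightarrow> \<bar>\<phi>1 (t, x2)\<bar> \<le> L1 * t" using f1(4) by auto
  obtain L2 where L2: "\<And>t x2. 0 \<le> t \<Longrightarrow> t \<le> 1 \<Longrightarrow> \<bar>\<phi>2 (t, x2)\<bar> \<le> L2 * t" using f2(4) by auto
  obtain L3 where L3: "\<And>t x2. 0 \<le> t \<Longrightarrow> t \<le> 1 \<Longrightarrow> \<bar>\<phi>3 (t, x2)\<bar> \<le> L3 * t" using f3(4) by auto
  obtain L4 where L4: "\<And>t x2. 0 \<le> t \<Longrightarrow> t \<le> 1 \<Longrightarrow> \<bar>\<phi>4 (t, x2)\<bar> \<le> L4 * t" using f4(4) by auto
  define L where "L = \<bar>L1\<bar> + \<bar>L2\<bar> + \<bar>L3\<bar> + \<bar>L4\<bar>"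
  have LL: "L1 * t \<le> L * t" "L2 * t \<le> L * t" "L3 * t \<le> L * t" "L4 * t \<le> L * t" if "0 \<le> t" for t
    using that unfolding L_def by (intro mult_right_mono; simp)+
  \<comment> \<open>The five open regions between consecutive hypersurfaces.\<close>
  define Q1 where "Q1 = {p. 0 < fst p \<and> fst p < 1 \<and> fst (snd p) < g \<phi>1 p}"
  define Q2 where "Q2 = {p. 0 < fst p \<and> fst p < 1 \<and> g \<phi>1 p < fst (snd p)} \<inter> {p. 0 < fst p \<and> fst p < 1 \<and> fst (snd p) < g \<phi>2 p}"
  define Q3 where "Q3 = {p. 0 < fst p \<and> fst p < 1 \<and> g \<phi>2 p < fst (snd p)} \<inter> {p. 0 < fst p \<and> fst p < 1 \<and> fst (snd p) < g \<phi>3 p}"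
  define Q4 where "Q4 = {p. 0 < fst p \<and> fst p < 1 \<and> g \<phi>3 p < fst (snd p)} \<inter> {p. 0 < fst p \<and> fst p < 1 \<and> fst (snd p) < g \<phi>4 p}"
  define Q5 where "Q5 = {p. 0 < fst p \<and> fst p < 1 \<and> g \<phi>4 p < fst (snd p)}"
  have op: "open Q1" "open Q2" "open Q3" "open Q4" "open Q5"
    unfolding Q1_def Q2_def Q3_def Q4_def Q5_def by (intro open_Int open_between g1 g2 g3 g4 xc)+
  have cpos: "\<And>p. p \<in> slab - edge \<Longrightarrow> 0 < c p" using pos by blast
  have Mc: "\<And>p. p \<in> slab \<Longrightarrow> \<bar>c p\<bar> \<le> M" using M by blast
  have j1: "jets_bounded_on \<gamma> Q1 v c"
  proof (rule jets_classical_region[OF \<gamma>(1,3) c1 _ op(1) _ _ _ per cpos Mc])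
    have "{(t, x1, x2). 0 \<le> t \<and> t \<le> 1 \<and> x1 \<le> \<phi>1 (t, x2)} = {p \<in> slab. fst (snd p) \<le> g \<phi>1 p}"
      by (auto simp: slab_def g_def)
    then show "closed {(t, x1, x2). 0 \<le> t \<and> t \<le> 1 \<and> x1 \<le> \<phi>1 (t, x2)}" using closed_between[OF xc g1] by simp
  qed (auto simp: Q1_def g_def sh)
  have j3: "jets_bounded_on \<gamma> Q3 v c"
  proof (rule jets_classical_region[OF \<gamma>(1,3) c3 _ op(3) _ _ _ per cpos Mc])
    have "{(t, x1, x2). 0 \<le> t \<and> t \<le> 1 \<and> \<phi>2 (t, x2) \<le> x1 \<and> x1 \<le> \<phi>3 (t, x2)}
      = {p \<in> slab. g \<phi>2 p \<le> fst (snd p)} \<inter> {p \<in> slab. fst (snd p) \<le> g \<phi>3 p}"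
      by (auto simp: slab_def g_def)
    then show "closed {(t, x1, x2). 0 \<le> t \<and> t \<le> 1 \<and> \<phi>2 (t, x2) \<le> x1 \<and> x1 \<le> \<phi>3 (t, x2)}"
      using closed_Int[OF closed_between[OF g2 xc] closed_between[OF xc g3]] by simp
  qed (auto simp: Q3_def g_def sh)
  have j5: "jets_bounded_on \<gamma> Q5 v c"
  proof (rule jets_classical_region[OF \<gamma>(1,3) c5 _ op(5) _ _ _ per cpos Mc])
    have "{(t, x1, x2). 0 \<le> t \<and> t \<le> 1 \<and> \<phi>4 (t, x2) \<le> x1} = {p \<in> slab. g \<phi>4 p \<le> fst (snd p)}"
      by (auto simp: slab_def g_def)
    then show "closed {(t, x1, x2). 0 \<le> t \<and> t \<le> 1 \<and> \<phi>4 (t, x2) \<le> x1}" using closed_between[OF g4 xc] by simp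
  qed (auto simp: Q5_def g_def sh)
  have j2: "jets_bounded_on \<gamma> Q2 v c"
  proof (rule jets_back_rarefaction[OF \<gamma> c2 op(2) _ _ M])
    show "\<bar>\<phi>1 (t, x2)\<bar> \<le> L * t \<and> \<bar>\<phi>2 (t, x2)\<bar> \<le> L * t" if "0 \<le> t" "t \<le> 1" for t x2
      using L1[OF that, of x2] L2[OF that, of x2] LL[OF that(1)] by linarith
  qed (auto simp: Q2_def g_def)
  have j4: "jets_bounded_on \<gamma> Q4 v c"
  proof (rule jets_front_rarefaction[OF \<gamma> c4 op(4) _ _ M])
    show "\<bar>\<phi>3 (t, x2)\<bar> \<le> L * t \<and> \<bar>\<phi>4 (t, x2)\<bar> \<le> L * t" if "0 \<le> t" "t \<le> 1" for t x2
      using L3[OF that, of x2] L4[OF that, of x2] LL[OF that(1)] by linarith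
  qed (auto simp: Q4_def g_def)
  let ?\<Phi> = "{\<phi>1, \<phi>2, \<phi>3, \<phi>4}"
  have cover: "p \<in> Q1 \<or> p \<in> Q2 \<or> p \<in> Q3 \<or> p \<in> Q4 \<or> p \<in> Q5" if "p \<in> off_graphs ?\<Phi>" for p
    using that by (cases p) (auto simp: off_graphs_def Q1_def Q2_def Q3_def Q4_def Q5_def g_def)
  have jets: "\<exists>C. \<forall>p\<in>off_graphs ?\<Phi>. \<bar>fst (snd p)\<bar> \<le> R \<longrightarrow>
     euler_jet \<gamma> (enthalpy \<gamma> c) (v1_of v) (v2_of v) p \<and> jet_bound C (enthalpy \<gamma> c) (v1_of v) (v2_of v) p" for R
  proof -
    let ?P = "\<lambda>C p. euler_jet \<gamma> (enthalpy \<gamma> c) (v1_of v) (v2_of v) p \<and> jet_bound C (enthalpy \<gamma> c) (v1_of v) (v2_of v) p"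
    obtain C1 where C1: "\<forall>p\<in>Q1. \<bar>fst (snd p)\<bar> \<le> R \<longrightarrow> ?P C1 p" using spec[OF j1[unfolded jets_bounded_on_def], of R] by (elim exE) (rule that)
    obtain C2 where C2: "\<forall>p\<in>Q2. \<bar>fst (snd p)\<bar> \<le> R \<longrightarrow> ?P C2 p" using spec[OF j2[unfolded jets_bounded_on_def], of R] by (elim exE) (rule that)
    obtain C3 where C3: "\<forall>p\<in>Q3. \<bar>fst (snd p)\<bar> \<le> R \<longrightarrow> ?P C3 p" using spec[OF j3[unfolded jets_bounded_on_def], of R] by (elim exE) (rule that)
    obtain C4 where C4: "\<forall>p\<in>Q4. \<bar>fst (snd p)\<bar> \<le> R \<longrightarrow> ?P C4 p" using spec[OF j4[unfolded jets_bounded_on_def], of R] by (elim exE) (rule that)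
    obtain C5 where C5: "\<forall>p\<in>Q5. \<bar>fst (snd p)\<bar> \<le> R \<longrightarrow> ?P C5 p" using spec[OF j5[unfolded jets_bounded_on_def], of R] by (elim exE) (rule that)
    define C where "C = \<bar>C1\<bar> + \<bar>C2\<bar> + \<bar>C3\<bar> + \<bar>C4\<bar> + \<bar>C5\<bar>"
    have le: "C1 \<le> C" "C2 \<le> C" "C3 \<le> C" "C4 \<le> C" "C5 \<le> C" unfolding C_def by linarith+
    have mono: "?P C p" if "?P C' p" "C' \<le> C" for C' p using that jet_bound_mono by blast
    have "?P C p" if p: "p \<in> off_graphs ?\<Phi>" "\<bar>fst (snd p)\<bar> \<le> R" for p
      using cover[OF p(1)]
    proof (elim disjE)
      assume "p \<in> Q1" then show ?thesis using C1 p(2) le(1) mono by blast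
    next
      assume "p \<in> Q2" then show ?thesis using C2 p(2) le(2) mono by blast
    next
      assume "p \<in> Q3" then show ?thesis using C3 p(2) le(3) mono by blast
    next
      assume "p \<in> Q4" then show ?thesis using C4 p(2) le(4) mono by blast
    next
      assume "p \<in> Q5" then show ?thesis using C5 p(2) le(5) mono by blast
    qed
    then show ?thesis by blast
  qed
  have ej: "euler_jet \<gamma> (enthalpy \<gamma> c) (v1_of v) (v2_of v) p" if "p \<in> off_graphs ?\<Phi>" for p
    using jets[of "\<bar>fst (snd p)\<bar>"] that by auto
  have grads: "\<exists>C. \<forall>p\<in>off_graphs ?\<Phi>. \<bar>fst (snd p)\<bar> \<le> R \<longrightarrow> (\<forall>b\<in>Basis. \<bar>dird b f p\<bar> * rad p \<le> C)"
    if "f \<in> {enthalpy \<gamma> c, v1_of v, v2_of v}" for f R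
  proof -
    obtain C where C: "\<forall>p\<in>off_graphs ?\<Phi>. \<bar>fst (snd p)\<bar> \<le> R \<longrightarrow>
     euler_jet \<gamma> (enthalpy \<gamma> c) (v1_of v) (v2_of v) p \<and> jet_bound C (enthalpy \<gamma> c) (v1_of v) (v2_of v) p"
      using jets[of R] by (elim exE) (rule that)
    show ?thesis
    proof (intro exI[of _ C] ballI impI)
      fix p b :: spt assume p: "p \<in> off_graphs ?\<Phi>" "\<bar>fst (snd p)\<bar> \<le> R" and b: "b \<in> Basis"
      have "jet_bound C (enthalpy \<gamma> c) (v1_of v) (v2_of v) p" using bspec[OF C p(1)] p(2) by simp
      then show "\<bar>dird b f p\<bar> * rad p \<le> C" using that b unfolding jet_bound_def by auto
    qed
  qed
  have M2: "\<bar>enthalpy \<gamma> c p\<bar> \<le> M\<^sup>2 / (\<gamma> - 1)" if "p \<in> slab" for p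
  proof -
    have "\<bar>c p\<bar> \<le> \<bar>M\<bar>" using Mc[OF that] by simp
    then have "(c p)\<^sup>2 \<le> M\<^sup>2" by (simp add: abs_le_square_iff)
    then show ?thesis using \<gamma> by (simp add: enthalpy_def divide_right_mono)
  qed
  have th: "tame ?\<Phi> (enthalpy \<gamma> c)"
  proof (rule tameI)
    show "periodic (enthalpy \<gamma> c)" using per by (simp add: periodic_def enthalpy_def)
    show "continuous_on (slab - edge) (enthalpy \<gamma> c)"
      unfolding enthalpy_def[abs_def] divide_inverse by (intro continuous_intros cont)
    show "\<exists>C. \<forall>p\<in>slab - edge. \<bar>fst (snd p)\<bar> \<le> R \<longrightarrow> \<bar>enthalpy \<gamma> c p\<bar> \<le> C" for R using M2 by blast
  qed (use ej grads in \<open>auto simp: euler_jet_def\<close>)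
  have tv1: "tame ?\<Phi> (v1_of v)"
  proof (rule tameI)
    show "periodic (v1_of v)" using per by (simp add: periodic_def v1_of_def)
    show "continuous_on (slab - edge) (v1_of v)" unfolding v1_of_def[abs_def] by (intro continuous_intros cont)
    have "\<bar>v1_of v p\<bar> \<le> M" if "p \<in> slab" for p using abs_vel_le(1)[of "v p"] M[OF that] by (simp add: v1_of_def)
    then show "\<exists>C. \<forall>p\<in>slab - edge. \<bar>fst (snd p)\<bar> \<le> R \<longrightarrow> \<bar>v1_of v p\<bar> \<le> C" for R by blast
  qed (use ej grads in \<open>auto simp: euler_jet_def\<close>)
  have tv2: "tame ?\<Phi> (v2_of v)"
  proof (rule tameI)
    show "periodic (v2_of v)" using per by (simp add: periodic_def v2_of_def)
    show "continuous_on (slab - edge) (v2_of v)" unfolding v2_of_def[abs_def] by (intro continuous_intros cont)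
    have "\<bar>v2_of v p\<bar> \<le> M" if "p \<in> slab" for p using abs_vel_le(2)[of "v p"] M[OF that] by (simp add: v2_of_def)
    then show "\<exists>C. \<forall>p\<in>slab - edge. \<bar>fst (snd p)\<bar> \<le> R \<longrightarrow> \<bar>v2_of v p\<bar> \<le> C" for R by blast
  qed (use ej grads in \<open>auto simp: euler_jet_def\<close>)
  have "classical_pair \<gamma> ?\<Phi> (enthalpy \<gamma> c) (v1_of v) (v2_of v)"
    unfolding classical_pair_def
  proof (intro conjI th tv1 tv2 ballI)
    show "0 < enthalpy \<gamma> c p" if "p \<in> slab - edge" for p using cpos[OF that] \<gamma> by (simp add: enthalpy_def)
  qed (use ej in \<open>simp_all only: euler_jet_def\<close>)
  moreover have "source_bounded_below ?\<Phi> (v1_of v) (v2_of v)"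
    unfolding source_bounded_below_def
  proof
    fix R
    obtain C where C: "\<forall>p\<in>off_graphs ?\<Phi>. \<bar>fst (snd p)\<bar> \<le> R \<longrightarrow>
     euler_jet \<gamma> (enthalpy \<gamma> c) (v1_of v) (v2_of v) p \<and> jet_bound C (enthalpy \<gamma> c) (v1_of v) (v2_of v) p"
      using jets[of R] by (elim exE) (rule that)
    then show "\<exists>C. \<forall>p\<in>off_graphs ?\<Phi>. \<bar>fst (snd p)\<bar> \<le> R \<longrightarrow>
     - C \<le> dx1 (v1_of v) p \<and> \<bar>dx2 (v1_of v) p\<bar> \<le> C \<and> \<bar>dx1 (v2_of v) p\<bar> \<le> C \<and> \<bar>dx2 (v2_of v) p\<bar> \<le> C"
      unfolding jet_bound_def by (intro exI[of _ C]) blast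
  qed
  moreover have "\<forall>\<phi>\<in>?\<Phi>. \<phi> differentiable_on ({0..1} \<times> UNIV)" using f1(1) f2(1) f3(1) f4(1) by blast
  ultimately show ?thesis by (intro exI[of _ ?\<Phi>]) blast
qed

section \<open>Entropy solutions and uniqueness\<close>

lemma smooth_pairing_integrable:
  assumes t: "test_function \<zeta>" and F: "bounded_coefficient F" and b: "b \<in> Basis"
  shows "integrable cell_measure (\<lambda>p. F p * dird b \<zeta> p)"
proof -
  obtain T R where sm: "smooth_on UNIV \<zeta>" and supp: "\<And>t x1 x2. t > T \<or> \<bar>x1\<bar> > R \<Longrightarrow> \<zeta> (t, x1, x2) = 0"
    using t unfolding test_function_def by blast
  have dc: "continuous_on UNIV (dird b \<zeta>)" by (rule smooth_dird_continuous[OF sm b])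
  have d0: "dird b \<zeta> (t, x1, x2) = 0" if x: "\<bar>x1\<bar> > R" for t x1 x2
  proof -
    have "open {p::spt. \<bar>fst (snd p)\<bar> > R}" by (intro open_Collect_less continuous_intros)
    from dird_cong_open(2)[OF this, of "(t, x1, x2)" \<zeta> "\<lambda>_. 0" b] show ?thesis
      using x supp by (auto simp: dird_const)
  qed
  let ?K = "cbox (0, -R, 0) (1, R, 2 * pi) :: spt set"
  have "bounded (dird b \<zeta> ` ?K)"
    by (intro compact_imp_bounded compact_continuous_image continuous_on_subset[OF dc]) auto
  then obtain B where B: "\<And>p. p \<in> ?K \<Longrightarrow> \<bar>dird b \<zeta> p\<bar> \<le> B" unfolding bounded_iff by auto
  obtain M where M: "\<forall>p\<in>slab_cell. \<bar>F p\<bar> \<le> M" using F by (auto simp: bounded_coefficient_def)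
  show ?thesis
  proof (rule cell_integrable[where B = "\<bar>M\<bar> * \<bar>B\<bar>" and R = R])
    show "(\<lambda>p. F p * dird b \<zeta> p) \<in> borel_measurable cell_measure"
      using F continuous_measurable_lebesgue_on[OF dc] by (simp add: bounded_coefficient_def borel_measurable_times)
    show "norm (F p * dird b \<zeta> p) \<le> \<bar>M\<bar> * \<bar>B\<bar>" if p: "p \<in> slab_cell" for p
    proof -
      obtain t x1 x2 where p': "p = (t, x1, x2)" by (cases p)
      have "\<bar>dird b \<zeta> p\<bar> \<le> \<bar>B\<bar>"
      proof (cases "\<bar>x1\<bar> > R")
        case False
        then have "p \<in> ?K" using p by (auto simp: p' slab_cell_def abs_le_iff)
        then show ?thesis using B[of p] by simp
      qed (simp add: p' d0)
      then show ?thesis unfolding real_norm_def abs_mult using bspec[OF M p] by (intro mult_mono) auto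
    qed
  qed (simp add: d0)
qed

lemma smooth_initial_integrable:
  assumes t: "test_function \<zeta>" and G: "bounded_datum G"
  shows "integrable slice_measure (\<lambda>x. G x * \<zeta> (0, x))"
proof -
  obtain T R where sm: "smooth_on UNIV \<zeta>" and supp: "\<And>t x1 x2. t > T \<or> \<bar>x1\<bar> > R \<Longrightarrow> \<zeta> (t, x1, x2) = 0"
    using t unfolding test_function_def by blast
  have "Ck_on 0 UNIV \<zeta>" using sm unfolding smooth_on_def by blast
  then have c: "continuous_on UNIV \<zeta>" by simp
  have c0: "continuous_on UNIV (\<lambda>x. \<zeta> (0, x))"
    by (rule continuous_on_compose2[OF c]) (auto intro!: continuous_intros)
  let ?K = "cbox (-R, 0) (R, 2 * pi) :: (real \<times> real) set"
  have "bounded ((\<lambda>x. \<zeta> (0, x)) ` ?K)"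
    by (intro compact_imp_bounded compact_continuous_image continuous_on_subset[OF c0]) auto
  then obtain B where B: "\<And>x. x \<in> ?K \<Longrightarrow> \<bar>\<zeta> (0, x)\<bar> \<le> B" unfolding bounded_iff by auto
  obtain M where M: "\<forall>x\<in>slice_cell. \<bar>G x\<bar> \<le> M" using G by (auto simp: bounded_datum_def)
  show ?thesis
  proof (rule slice_integrable[where B = "\<bar>M\<bar> * \<bar>B\<bar>" and R = R])
    show "(\<lambda>x. G x * \<zeta> (0, x)) \<in> borel_measurable slice_measure"
      using G continuous_measurable_lebesgue_on[OF c0] by (simp add: bounded_datum_def borel_measurable_times)
    show "norm (G x * \<zeta> (0, x)) \<le> \<bar>M\<bar> * \<bar>B\<bar>" if x: "x \<in> slice_cell" for x
    proof -
      obtain x1 x2 where x': "x = (x1, x2)" by (cases x)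
      have "\<bar>\<zeta> (0, x)\<bar> \<le> \<bar>B\<bar>"
      proof (cases "\<bar>x1\<bar> > R")
        case False
        then have "x \<in> ?K" using x by (auto simp: x' slice_cell_def abs_le_iff)
        then show ?thesis using B[of x] by simp
      qed (simp add: x' supp)
      then show ?thesis unfolding real_norm_def abs_mult using bspec[OF M x] by (intro mult_mono) auto
    qed
  qed (simp add: supp)
qed

text \<open>Splits the vectorial momentum equation into components and inserts the equation of state into energy and energy flux.\<close>

lemma entropy_solution_pair:
  assumes \<gamma>: "1 < \<gamma>" "0 < k0" and es: "entropy_solution \<gamma> k0 r0 w r u"
    and r0: "bounded_datum r0" "\<And>x. 0 \<le> r0 x" and w: "bounded_datum (\<lambda>x. fst (w x))" "bounded_datum (\<lambda>x. snd (w x))"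
  shows "entropy_pair \<gamma> k0 r0 (\<lambda>x. fst (w x)) (\<lambda>x. snd (w x)) r (v1_of u) (v2_of u)"
proof -
  let ?u1 = "v1_of u" and ?u2 = "v2_of u"
  have sub: "slab_cell \<subseteq> slab" using slab_cell_subset by blast
  have rm: "r \<in> borel_measurable (lebesgue_on slab)" and um: "u \<in> borel_measurable (lebesgue_on slab)"
    and rb: "bounded (r ` slab)" and ub: "bounded (u ` slab)" and rpos: "\<forall>p\<in>slab. r p \<ge> 0"
    and weak: "\<forall>\<zeta>. test_function \<zeta> \<longrightarrow>
        (LINT p:slab_cell|lebesgue. r p * dt \<zeta> p + r p * (u p \<bullet> grad \<zeta> p))
          + (LINT x:slice_cell|lebesgue. r0 x * \<zeta> (0, x)) = 0 \<and>
        (LINT p:slab_cell|lebesgue.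
            (r p * dt \<zeta> p) *\<^sub>R u p + (r p * (u p \<bullet> grad \<zeta> p)) *\<^sub>R u p
              + pressure \<gamma> k0 (r p) *\<^sub>R grad \<zeta> p)
          + (LINT x:slice_cell|lebesgue. (r0 x * \<zeta> (0, x)) *\<^sub>R w x) = 0 \<and>
        ((\<forall>p. \<zeta> p \<ge> 0) \<longrightarrow>
          (LINT p:slab_cell|lebesgue.
              phys_entropy \<gamma> k0 (r p) (u p) * dt \<zeta> p
                + entropy_flux \<gamma> k0 (r p) (u p) \<bullet> grad \<zeta> p)
            + (LINT x:slice_cell|lebesgue. phys_entropy \<gamma> k0 (r0 x) (w x) * \<zeta> (0, x)) \<ge> 0)"
    using es unfolding entropy_solution_def by - (elim conjE, assumption)+
  have um': "u \<in> borel_measurable cell_measure" by (rule measurable_restrict_mono[OF um sub])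
  obtain Mr Mu where Mr: "\<And>p. p \<in> slab \<Longrightarrow> \<bar>r p\<bar> \<le> Mr" and Mu: "\<And>p. p \<in> slab \<Longrightarrow> norm (u p) \<le> Mu"
    using rb ub unfolding bounded_iff by auto
  have fm: "(fst :: vel \<Rightarrow> real) \<in> borel_measurable borel" "(snd :: vel \<Rightarrow> real) \<in> borel_measurable borel"
    by (intro borel_measurable_continuous_onI continuous_intros)+
  have bc: "bounded_coefficient r" "bounded_coefficient ?u1" "bounded_coefficient ?u2"
  proof -
    show "bounded_coefficient r"
      unfolding bounded_coefficient_def using measurable_restrict_mono[OF rm sub] Mr sub by blast
    have "\<bar>?u1 p\<bar> \<le> Mu" "\<bar>?u2 p\<bar> \<le> Mu" if "p \<in> slab_cell" for p
      using abs_vel_le[of "u p"] Mu[OF subsetD[OF sub that]] by (auto simp: v1_of_def v2_of_def)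
    moreover have "?u1 \<in> borel_measurable cell_measure" "?u2 \<in> borel_measurable cell_measure"
      unfolding v1_of_def[abs_def] v2_of_def[abs_def] using measurable_compose[OF um' fm(1)] measurable_compose[OF um' fm(2)] by auto
    ultimately show "bounded_coefficient ?u1" "bounded_coefficient ?u2" unfolding bounded_coefficient_def by blast+
  qed
  have rn: "0 \<le> r p" if "p \<in> slab_cell" for p using rpos sub that by blast
  have bp: "bounded_coefficient (\<lambda>p. pressure \<gamma> k0 (r p))"
    by (rule bounded_coefficient_pressure[OF bc(1) rn \<gamma>(2)]) (use \<gamma> in auto)
  have bas: "(1,0,0) \<in> (Basis :: spt set)" "(0,1,0) \<in> (Basis :: spt set)" "(0,0,1) \<in> (Basis :: spt set)"
    by (auto simp: Basis_spt)
  have ug: "u p \<bullet> grad \<zeta> p = ?u1 p * dx1 \<zeta> p + ?u2 p * dx2 \<zeta> p" for p \<zeta>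
    by (cases "u p") (simp add: grad_def v1_of_def v2_of_def)
  have eng: "phys_entropy \<gamma> k0 s y = s * (fst y * fst y + snd y * snd y) * (1/2) + pressure \<gamma> k0 s * (1 / (\<gamma> - 1))" for s y
    by (cases y; cases "s = 0") (auto simp: phys_entropy_def pressure_def)
  have ss: "(sound_speed \<gamma> k0 s)\<^sup>2 = k0 * \<gamma> * s powr (\<gamma> - 1)" for s
    using \<gamma> by (simp add: sound_speed_def dpressure_def)
  have pw: "s * s powr (\<gamma> - 1) = s powr \<gamma>" if "0 \<le> s" for s
    using powr_add[of s 1 "\<gamma> - 1"] that \<gamma> by (cases "s = 0") auto
  have flux: "entropy_flux \<gamma> k0 s y = (s * (fst y * fst y + snd y * snd y) * (1/2) + pressure \<gamma> k0 s * (\<gamma> / (\<gamma> - 1))) *\<^sub>R y"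
    if "0 \<le> s" for s y
  proof -
    have "s * ((y \<bullet> y) / 2 + (sound_speed \<gamma> k0 s)\<^sup>2 / (\<gamma> - 1)) = s * (y \<bullet> y) * (1/2) + k0 * (s * s powr (\<gamma> - 1)) * (\<gamma> / (\<gamma> - 1))"
      unfolding ss by (simp add: distrib_left)
    then show ?thesis unfolding entropy_flux_def pw[OF that] pressure_def by (cases y) simp
  qed
  have "weak_form r (\<lambda>p. r p * ?u1 p) (\<lambda>p. r p * ?u2 p) r0 \<zeta> = 0 \<and>
        weak_form (\<lambda>p. r p * ?u1 p) (\<lambda>p. r p * (?u1 p * ?u1 p) + pressure \<gamma> k0 (r p)) (\<lambda>p. r p * (?u1 p * ?u2 p))
          (\<lambda>x. r0 x * fst (w x)) \<zeta> = 0 \<and>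
        weak_form (\<lambda>p. r p * ?u2 p) (\<lambda>p. r p * (?u1 p * ?u2 p)) (\<lambda>p. r p * (?u2 p * ?u2 p) + pressure \<gamma> k0 (r p))
          (\<lambda>x. r0 x * snd (w x)) \<zeta> = 0 \<and>
        ((\<forall>p. 0 \<le> \<zeta> p) \<longrightarrow>
          0 \<le> weak_form
            (\<lambda>p. r p * (?u1 p * ?u1 p + ?u2 p * ?u2 p) * (1/2) + pressure \<gamma> k0 (r p) * (1 / (\<gamma> - 1)))
            (\<lambda>p. (r p * (?u1 p * ?u1 p + ?u2 p * ?u2 p) * (1/2) + pressure \<gamma> k0 (r p) * (\<gamma> / (\<gamma> - 1))) * ?u1 p)
            (\<lambda>p. (r p * (?u1 p * ?u1 p + ?u2 p * ?u2 p) * (1/2) + pressure \<gamma> k0 (r p) * (\<gamma> / (\<gamma> - 1))) * ?u2 p)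
            (\<lambda>x. r0 x * (fst (w x) * fst (w x) + snd (w x) * snd (w x)) * (1/2) + pressure \<gamma> k0 (r0 x) * (1 / (\<gamma> - 1))) \<zeta>)"
    if t: "test_function \<zeta>" for \<zeta>
  proof (intro conjI impI)
    note wk = weak[rule_format, OF t]
    have mass: "(LINT p:slab_cell|lebesgue. r p * dt \<zeta> p + r p * (u p \<bullet> grad \<zeta> p)) + (LINT x:slice_cell|lebesgue. r0 x * \<zeta> (0, x)) = 0"
      using wk by blast
    show "weak_form r (\<lambda>p. r p * ?u1 p) (\<lambda>p. r p * ?u2 p) r0 \<zeta> = 0"
      using mass unfolding weak_form_def ug by (simp only: distrib_left mult.assoc add.assoc)
    define K1 where "K1 = cell_part (\<lambda>p. r p * ?u1 p) (\<lambda>p. r p * (?u1 p * ?u1 p) + pressure \<gamma> k0 (r p)) (\<lambda>p. r p * (?u1 p * ?u2 p)) \<zeta>"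
    define K2 where "K2 = cell_part (\<lambda>p. r p * ?u2 p) (\<lambda>p. r p * (?u1 p * ?u2 p)) (\<lambda>p. r p * (?u2 p * ?u2 p) + pressure \<gamma> k0 (r p)) \<zeta>"
    have iK: "integrable cell_measure K1" "integrable cell_measure K2"
      unfolding K1_def K2_def cell_part_def[abs_def]
      by (intro Bochner_Integration.integrable_add smooth_pairing_integrable t bas bounded_coefficient_add bounded_coefficient_mult bc bp)+
    define S1 where "S1 x = r0 x * fst (w x) * \<zeta> (0, x)" for x
    define S2 where "S2 x = r0 x * snd (w x) * \<zeta> (0, x)" for x
    have iS: "integrable slice_measure S1" "integrable slice_measure S2"
      unfolding S1_def[abs_def] S2_def[abs_def] by (intro smooth_initial_integrable t bounded_datum_mult r0 w)+
    have "(LINT p:slab_cell|lebesgue. (r p * dt \<zeta> p) *\<^sub>R u p + (r p * (u p \<bullet> grad \<zeta> p)) *\<^sub>R u p + pressure \<gamma> k0 (r p) *\<^sub>R grad \<zeta> p)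
          + (LINT x:slice_cell|lebesgue. (r0 x * \<zeta> (0, x)) *\<^sub>R w x) = 0"
      using wk by blast
    moreover have "(r p * dt \<zeta> p) *\<^sub>R u p + (r p * (u p \<bullet> grad \<zeta> p)) *\<^sub>R u p + pressure \<gamma> k0 (r p) *\<^sub>R grad \<zeta> p
        = K1 p *\<^sub>R (1, 0) + K2 p *\<^sub>R (0, 1)" for p
    proof -
      obtain a b where ab: "u p = (a, b)" by (cases "u p")
      then have "?u1 p = a" "?u2 p = b" by (simp_all add: v1_of_def v2_of_def)
      then show ?thesis unfolding ug K1_def K2_def cell_part_def ab by (simp add: grad_def algebra_simps)
    qed
    moreover have "(r0 x * \<zeta> (0, x)) *\<^sub>R w x = S1 x *\<^sub>R (1, 0) + S2 x *\<^sub>R (0, 1)" for x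
      unfolding S1_def S2_def by (cases "w x") (simp add: algebra_simps)
    ultimately have mom: "(\<integral>p. K1 p *\<^sub>R (1, 0) + K2 p *\<^sub>R (0, 1) \<partial>cell_measure) + (\<integral>x. S1 x *\<^sub>R (1, 0) + S2 x *\<^sub>R (0, 1) \<partial>slice_measure) = (0 :: vel)"
      unfolding cell_set_integral slice_set_integral by simp
    have "(\<integral>p. K1 p *\<^sub>R (1, 0) + K2 p *\<^sub>R (0, 1 :: real) \<partial>cell_measure) = (integral\<^sup>L cell_measure K1 *\<^sub>R (1, 0) + integral\<^sup>L cell_measure K2 *\<^sub>R (0, 1) :: vel)"
      by (simp only: Bochner_Integration.integral_add integrable_scaleR_left integral_scaleR_left iK)
    moreover have "(\<integral>x. S1 x *\<^sub>R (1, 0) + S2 x *\<^sub>R (0, 1 :: real) \<partial>slice_measure) = (integral\<^sup>L slice_measure S1 *\<^sub>R (1, 0) + integral\<^sup>L slice_measure S2 *\<^sub>R (0, 1) :: vel)"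
      by (simp only: Bochner_Integration.integral_add integrable_scaleR_left integral_scaleR_left iS)
    ultimately have two: "integral\<^sup>L cell_measure K1 + integral\<^sup>L slice_measure S1 = 0" "integral\<^sup>L cell_measure K2 + integral\<^sup>L slice_measure S2 = 0"
      using mom by (simp_all add: zero_prod_def)
    show "weak_form (\<lambda>p. r p * ?u1 p) (\<lambda>p. r p * (?u1 p * ?u1 p) + pressure \<gamma> k0 (r p)) (\<lambda>p. r p * (?u1 p * ?u2 p))
          (\<lambda>x. r0 x * fst (w x)) \<zeta> = 0"
      using two(1) unfolding weak_form_split K1_def S1_def[abs_def] .
    show "weak_form (\<lambda>p. r p * ?u2 p) (\<lambda>p. r p * (?u1 p * ?u2 p)) (\<lambda>p. r p * (?u2 p * ?u2 p) + pressure \<gamma> k0 (r p))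
          (\<lambda>x. r0 x * snd (w x)) \<zeta> = 0"
      using two(2) unfolding weak_form_split K2_def S2_def[abs_def] .
    assume "\<forall>p. 0 \<le> \<zeta> p"
    then have "0 \<le> (LINT p:slab_cell|lebesgue. phys_entropy \<gamma> k0 (r p) (u p) * dt \<zeta> p + entropy_flux \<gamma> k0 (r p) (u p) \<bullet> grad \<zeta> p)
            + (LINT x:slice_cell|lebesgue. phys_entropy \<gamma> k0 (r0 x) (w x) * \<zeta> (0, x))"
      using wk by blast
    moreover have "(LINT p:slab_cell|lebesgue. phys_entropy \<gamma> k0 (r p) (u p) * dt \<zeta> p + entropy_flux \<gamma> k0 (r p) (u p) \<bullet> grad \<zeta> p)
      = (LINT p:slab_cell|lebesgue. (r p * (?u1 p * ?u1 p + ?u2 p * ?u2 p) * (1/2) + pressure \<gamma> k0 (r p) * (1 / (\<gamma> - 1))) * dt \<zeta> p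
        + ((r p * (?u1 p * ?u1 p + ?u2 p * ?u2 p) * (1/2) + pressure \<gamma> k0 (r p) * (\<gamma> / (\<gamma> - 1))) * ?u1 p) * dx1 \<zeta> p
        + ((r p * (?u1 p * ?u1 p + ?u2 p * ?u2 p) * (1/2) + pressure \<gamma> k0 (r p) * (\<gamma> / (\<gamma> - 1))) * ?u2 p) * dx2 \<zeta> p)"
      unfolding cell_set_integral
    proof (intro Bochner_Integration.integral_cong refl)
      fix p assume "p \<in> space cell_measure"
      then have r: "0 \<le> r p" using rn by simp
      show "phys_entropy \<gamma> k0 (r p) (u p) * dt \<zeta> p + entropy_flux \<gamma> k0 (r p) (u p) \<bullet> grad \<zeta> p
        = (r p * (?u1 p * ?u1 p + ?u2 p * ?u2 p) * (1/2) + pressure \<gamma> k0 (r p) * (1 / (\<gamma> - 1))) * dt \<zeta> p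
        + ((r p * (?u1 p * ?u1 p + ?u2 p * ?u2 p) * (1/2) + pressure \<gamma> k0 (r p) * (\<gamma> / (\<gamma> - 1))) * ?u1 p) * dx1 \<zeta> p
        + ((r p * (?u1 p * ?u1 p + ?u2 p * ?u2 p) * (1/2) + pressure \<gamma> k0 (r p) * (\<gamma> / (\<gamma> - 1))) * ?u2 p) * dx2 \<zeta> p"
        unfolding flux[OF r] eng inner_scaleR_left ug v1_of_def v2_of_def
        by (simp only: distrib_left[of _ "fst (u p) * dx1 \<zeta> p"] mult.assoc add.assoc)
    qed
    ultimately show "0 \<le> weak_form
            (\<lambda>p. r p * (?u1 p * ?u1 p + ?u2 p * ?u2 p) * (1/2) + pressure \<gamma> k0 (r p) * (1 / (\<gamma> - 1)))
            (\<lambda>p. (r p * (?u1 p * ?u1 p + ?u2 p * ?u2 p) * (1/2) + pressure \<gamma> k0 (r p) * (\<gamma> / (\<gamma> - 1))) * ?u1 p)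
            (\<lambda>p. (r p * (?u1 p * ?u1 p + ?u2 p * ?u2 p) * (1/2) + pressure \<gamma> k0 (r p) * (\<gamma> / (\<gamma> - 1))) * ?u2 p)
            (\<lambda>x. r0 x * (fst (w x) * fst (w x) + snd (w x) * snd (w x)) * (1/2) + pressure \<gamma> k0 (r0 x) * (1 / (\<gamma> - 1))) \<zeta>"
      unfolding weak_form_def eng by simp
  qed
  then show ?thesis
    unfolding entropy_pair_def using bc rn r0 w by blast
qed

lemma glue_bounded_datum:
  fixes fl fr :: "real \<times> real \<Rightarrow> real"
  assumes l: "continuous_on {x. fst x \<le> 0} fl" and r: "continuous_on {x. fst x \<ge> 0} fr"
    and b: "\<And>x. fst x \<noteq> 0 \<Longrightarrow> \<bar>glue fl fr x\<bar> \<le> M"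
  shows "glue fl fr \<in> borel_measurable slice_measure" "\<bar>glue fl fr x\<bar> \<le> M"
proof -
  let ?A = "{x::real \<times> real. fst x \<le> 0}" and ?B = "{x::real \<times> real. fst x > 0}"
  have "closed ?A" "open ?B" by (intro closed_Collect_le open_Collect_less continuous_intros)+
  then have AB: "?A \<in> sets lebesgue" "?B \<in> sets lebesgue" by auto
  have "continuous_on ?B fr" by (rule continuous_on_subset[OF r]) auto
  with l AB have "(\<lambda>x. if x \<in> ?A then fl x else 0) \<in> borel_measurable lebesgue" "(\<lambda>x. if x \<in> ?B then fr x else 0) \<in> borel_measurable lebesgue"
    by (simp_all only: borel_measurable_if continuous_imp_measurable_on_sets_lebesgue)
  then have "(\<lambda>x. (if x \<in> ?A then fl x else 0) + (if x \<in> ?B then fr x else 0)) \<in> borel_measurable lebesgue"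
    by (rule borel_measurable_add)
  moreover have "(\<lambda>x. (if x \<in> ?A then fl x else 0) + (if x \<in> ?B then fr x else 0)) = glue fl fr"
    by (auto simp: glue_def fun_eq_iff)
  ultimately show "glue fl fr \<in> borel_measurable slice_measure" by (simp add: measurable_restrict_space1)
  show "\<bar>glue fl fr x\<bar> \<le> M"
  proof (cases "fst x = 0")
    case True
    obtain x2 where x: "x = (0, x2)" using True by (cases x) auto
    \<comment> \<open>At \<open>x\<^sub>1 = 0\<close> the glued function is the left trace, a limit of values with \<open>x\<^sub>1 < 0\<close>.\<close>
    define y where "y n = (- 1 / real (Suc n), x2)" for n
    have "(\<lambda>n. - (1 / real (Suc n))) \<longlonglongrightarrow> - 0" by (intro tendsto_minus LIMSEQ_Suc[OF lim_const_over_n])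
    then have "y \<longlonglongrightarrow> x" unfolding y_def x by (intro tendsto_Pair tendsto_const) simp
    then have "(\<lambda>n. fl (y n)) \<longlonglongrightarrow> fl x"
      by (rule continuous_on_tendsto_compose[OF l]) (auto simp: x y_def)
    then have "(\<lambda>n. \<bar>fl (y n)\<bar>) \<longlonglongrightarrow> \<bar>fl x\<bar>" by (rule tendsto_rabs)
    moreover have "\<bar>fl (y n)\<bar> \<le> M" for n using b[of "y n"] by (simp add: y_def glue_def)
    ultimately have "\<bar>fl x\<bar> \<le> M" by (intro LIMSEQ_le_const2) auto
    then show ?thesis using True by (simp add: glue_def)
  qed (rule b)
qed

text \<open>The translates of one period cover the slab up to the two hyperplanes \<open>t = 0\<close> and \<open>t = 1\<close>.\<close>

lemma AE_slab_from_cell: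
  assumes ae: "AE p in cell_measure. P p" and per: "\<And>t x1 x2 k. P (t, x1, x2 + 2 * pi * of_int k) \<longleftrightarrow> P (t, x1, x2)"
  shows "AE p in lebesgue_on slab. P p"
proof -
  have "AE p in lebesgue. p \<in> slab_cell \<longrightarrow> P p" using ae by (simp add: AE_cell_iff)
  then have "{p \<in> space lebesgue. \<not> (p \<in> slab_cell \<longrightarrow> P p)} \<in> null_sets lebesgue"
    by (simp only: completion.AE_iff_null_sets)
  then have N: "negligible {p \<in> slab_cell. \<not> P p}" (is "negligible ?N")
    by (simp add: negligible_iff_null_sets)
  \<comment> \<open>The initial and the final time do not belong to the cell.\<close>
  define H where "H = {p::spt. p \<bullet> (1,0,0) = 0} \<union> {p. p \<bullet> (1,0,0) = 1}"
  have H: "negligible H" unfolding H_def by (intro negligible_Un negligible_standard_hyperplane) (auto simp: Basis_spt)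
  have T: "negligible ((+) (0, 0, 2 * pi * of_int k) ` ?N)" for k :: int by (rule negligible_translation[OF N])
  have "negligible (\<Union>k::int. (+) (0, 0, 2 * pi * of_int k) ` ?N)"
    by (rule negligible_countable_Union) (use T in auto)
  then have neg: "negligible (H \<union> (\<Union>k::int. (+) (0, 0, 2 * pi * of_int k) ` ?N))" using H by (intro negligible_Un)
  have "p \<in> H \<union> (\<Union>k::int. (+) (0, 0, 2 * pi * of_int k) ` ?N)" if p: "p \<in> slab" "\<not> P p" for p
  proof (cases "p \<in> H")
    case False
    obtain t x1 x2 where p': "p = (t, x1, x2)" by (cases p)
    have t: "0 < t" "t < 1" using p(1) False by (auto simp: p' slab_def H_def)
    obtain k :: int where k: "0 \<le> x2 + 2 * pi * of_int k" "x2 + 2 * pi * of_int k < 2 * pi"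
      using circle_representative by blast
    let ?q = "(t, x1, x2 + 2 * pi * of_int k)"
    have "?q \<in> ?N" using t k p(2) per[of t x1 x2 k] by (simp add: p' slab_cell_def)
    moreover have "p = (+) (0, 0, 2 * pi * of_int (- k)) ?q" by (simp add: p')
    ultimately show ?thesis by blast
  qed simp
  moreover have "AE p in lebesgue. p \<notin> H \<union> (\<Union>k::int. (+) (0, 0, 2 * pi * of_int k) ` ?N)"
    using neg by (intro AE_not_in) (simp add: negligible_iff_null_sets)
  ultimately have "AE p in lebesgue. p \<in> slab \<longrightarrow> P p" by (elim eventually_mono) blast
  moreover have "slab \<in> sets lebesgue"
  proof -
    have "closed slab" unfolding slab_def by (intro closed_Times) auto
    then show ?thesis by auto
  qed
  ultimately show ?thesis by (subst AE_restrict_space_iff) auto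
qed

theorem proposition2p12:
  fixes \<gamma> k0 vl0 cl0 vr0 cr0 :: real
  assumes "1 < \<gamma>" "\<gamma> < 3" "k0 > 0"
    and "cl0 > 0" "cr0 > 0"
    and "wbar \<gamma> cr0 (vr0, 0) > wbar \<gamma> cl0 (vl0, 0)"
    and "wup \<gamma> cl0 (vl0, 0) > wup \<gamma> cr0 (vr0, 0)"
    and "wbar \<gamma> cl0 (vl0, 0) + wup \<gamma> cr0 (vr0, 0) > 0"
  shows "\<exists>N1. \<forall>N0\<ge>N1. \<forall>N\<ge>N1. \<forall>A>0. \<exists>\<epsilon>0>0. \<forall>\<epsilon>. 0 < \<epsilon> \<and> \<epsilon> < \<epsilon>0 \<longrightarrow>
    (\<forall>vl cl vr cr v c \<rho>' v'.
       riemann_data N0 \<epsilon> vl0 cl0 vr0 cr0 vl cl vr cr \<longrightarrow>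
       two_rarefaction_solution \<gamma> k0 N A \<epsilon> vl cl vr cr v c \<longrightarrow>
       entropy_solution \<gamma> k0 (\<lambda>x. density_of \<gamma> k0 (glue cl cr x)) (glue vl vr) \<rho>' v' \<longrightarrow>
       (AE p in lebesgue_on slab. v' p = v p \<and> sound_speed \<gamma> k0 (\<rho>' p) = c p))"
proof -
  note \<gamma> = assms(1-3)
  have main: "AE p in lebesgue_on slab. v' p = v p \<and> sound_speed \<gamma> k0 (\<rho>' p) = c p"
    if N: "1 \<le> N" and rd: "riemann_data N0 \<epsilon> vl0 cl0 vr0 cr0 vl cl vr cr"
      and tr: "two_rarefaction_solution \<gamma> k0 N A \<epsilon> vl cl vr cr v c"
      and es: "entropy_solution \<gamma> k0 (\<lambda>x. density_of \<gamma> k0 (glue cl cr x)) (glue vl vr) \<rho>' v'"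
    for N0 N A \<epsilon> vl cl vr cr v c \<rho>' v'
  proof -
    obtain n where n: "N = Suc n" using N by (cases N) auto
    obtain \<Phi> where fin: "finite \<Phi>" and \<Phi>: "\<forall>\<phi>\<in>\<Phi>. \<phi> differentiable_on ({0..1} \<times> UNIV)"
      and cl: "classical_pair \<gamma> \<Phi> (enthalpy \<gamma> c) (v1_of v) (v2_of v)" and sb: "source_bounded_below \<Phi> (v1_of v) (v2_of v)"
      using two_rarefaction_classical_pair[OF \<gamma> tr[unfolded n]] by blast
    have perv: "periodic v" "periodic c" and bd: "bounded (v ` slab)" "bounded (c ` slab)" and pos: "\<And>p. p \<in> slab - edge \<Longrightarrow> c p > 0"
      and ini: "\<And>x. fst x \<noteq> 0 \<Longrightarrow> v (0, x) = glue vl vr x \<and> c (0, x) = glue cl cr x"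
      using tr by (auto simp: two_rarefaction_solution_def)
    have per': "periodic \<rho>'" "periodic v'" and bd': "bounded (\<rho>' ` slab)" "bounded (v' ` slab)" and rpos: "\<And>p. p \<in> slab \<Longrightarrow> 0 \<le> \<rho>' p"
      using es by (auto simp: entropy_solution_def)
    obtain Mv Mc Mr Mu where Mv: "\<And>p. p \<in> slab \<Longrightarrow> norm (v p) \<le> Mv" and Mc: "\<And>p. p \<in> slab \<Longrightarrow> \<bar>c p\<bar> \<le> Mc"
      and Mr: "\<And>p. p \<in> slab \<Longrightarrow> \<bar>\<rho>' p\<bar> \<le> Mr" and Mu: "\<And>p. p \<in> slab \<Longrightarrow> norm (v' p) \<le> Mu"
    proof -
      obtain Mv Mc Mr Mu where "\<forall>y\<in>v ` slab. norm y \<le> Mv" "\<forall>y\<in>c ` slab. norm y \<le> Mc"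
        "\<forall>y\<in>\<rho>' ` slab. norm y \<le> Mr" "\<forall>y\<in>v' ` slab. norm y \<le> Mu"
        using bd bd' unfolding bounded_iff by (elim exE) (rule that)
      then show thesis by (intro that[of Mv Mc Mr Mu]) (simp_all only: ball_simps real_norm_def)
    qed
    have sm: "continuous_on {x. fst x \<le> 0} vl" "continuous_on {x. fst x \<le> 0} cl"
      "continuous_on {x. fst x \<ge> 0} vr" "continuous_on {x. fst x \<ge> 0} cr"
    proof -
      have "Ck_on 0 {x. fst x \<le> 0} vl" "Ck_on 0 {x. fst x \<le> 0} cl" "Ck_on 0 {x. fst x \<ge> 0} vr" "Ck_on 0 {x. fst x \<ge> 0} cr"
        using rd unfolding riemann_data_def smooth_on_def by blast+
      then show "continuous_on {x. fst x \<le> 0} vl" "continuous_on {x. fst x \<le> 0} cl"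
        "continuous_on {x. fst x \<ge> 0} vr" "continuous_on {x. fst x \<ge> 0} cr" by simp_all
    qed
    have slab0: "(0, x) \<in> slab" for x by (simp add: slab_def)
    have cb: "\<bar>glue cl cr x\<bar> \<le> Mc" if "fst x \<noteq> 0" for x using Mc[OF slab0[of x]] ini[OF that] by simp
    have vb: "norm (glue vl vr x) \<le> Mv" if "fst x \<noteq> 0" for x using Mv[OF slab0[of x]] ini[OF that] by simp
    have gv: "fst (glue vl vr x) = glue (\<lambda>x. fst (vl x)) (\<lambda>x. fst (vr x)) x" "snd (glue vl vr x) = glue (\<lambda>x. snd (vl x)) (\<lambda>x. snd (vr x)) x" for x
      by (auto simp: glue_def)
    have w1: "bounded_datum (\<lambda>x. fst (glue vl vr x))"
    proof -
      have c: "continuous_on {x. fst x \<le> 0} (\<lambda>x. fst (vl x))" "continuous_on {x. fst x \<ge> 0} (\<lambda>x. fst (vr x))"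
        by (intro continuous_intros sm)+
      have b: "\<bar>glue (\<lambda>x. fst (vl x)) (\<lambda>x. fst (vr x)) x\<bar> \<le> Mv" if "fst x \<noteq> 0" for x
        using vb[OF that] abs_vel_le(1)[of "glue vl vr x"] unfolding gv by linarith
      show ?thesis unfolding gv bounded_datum_def using glue_bounded_datum[OF c b] by blast
    qed
    have w2: "bounded_datum (\<lambda>x. snd (glue vl vr x))"
    proof -
      have c: "continuous_on {x. fst x \<le> 0} (\<lambda>x. snd (vl x))" "continuous_on {x. fst x \<ge> 0} (\<lambda>x. snd (vr x))"
        by (intro continuous_intros sm)+
      have b: "\<bar>glue (\<lambda>x. snd (vl x)) (\<lambda>x. snd (vr x)) x\<bar> \<le> Mv" if "fst x \<noteq> 0" for x
        using vb[OF that] abs_vel_le(2)[of "glue vl vr x"] unfolding gv by linarith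
      show ?thesis unfolding gv bounded_datum_def using glue_bounded_datum[OF c b] by blast
    qed
    have r0: "bounded_datum (\<lambda>x. density_of \<gamma> k0 (glue cl cr x))" and r0n: "0 \<le> density_of \<gamma> k0 (glue cl cr x)" for x
    proof -
      show "0 \<le> density_of \<gamma> k0 (glue cl cr x)" for x by (simp add: density_of_def)
      note g = glue_bounded_datum[OF sm(2,4) cb]
      have "(\<lambda>x. density_of \<gamma> k0 (glue cl cr x)) \<in> borel_measurable slice_measure"
        unfolding density_of_def using g(1) by measurable
      moreover have "\<bar>density_of \<gamma> k0 (glue cl cr x)\<bar> \<le> density_of \<gamma> k0 Mc" for x
      proof -
        have "(glue cl cr x)\<^sup>2 \<le> Mc\<^sup>2" using g(2)[of x] by (simp add: abs_le_square_iff[symmetric] abs_le_iff)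
        then show ?thesis unfolding density_of_def using \<gamma> by (simp add: powr_mono2 divide_right_mono)
      qed
      ultimately show "bounded_datum (\<lambda>x. density_of \<gamma> k0 (glue cl cr x))" unfolding bounded_datum_def by blast
    qed
    have en: "entropy_pair \<gamma> k0 (\<lambda>x. density_of \<gamma> k0 (glue cl cr x)) (\<lambda>x. fst (glue vl vr x)) (\<lambda>x. snd (glue vl vr x)) \<rho>' (v1_of v') (v2_of v')"
      by (rule entropy_solution_pair[OF \<gamma>(1,3) es r0 r0n w1 w2])
    define M where "M = \<bar>Mv\<bar> + \<bar>Mu\<bar> + \<bar>Mr\<bar> + Mc\<^sup>2 / (\<gamma> - 1) + enth \<gamma> k0 \<bar>Mr\<bar>"
    have "AE p in cell_measure. v1_of v' p = v1_of v p \<and> v2_of v' p = v2_of v p \<and> enth \<gamma> k0 (\<rho>' p) = enthalpy \<gamma> c p"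
    proof (rule rel_entropy_vanishes[OF \<gamma> fin _ cl en _ sb])
      show "\<phi> differentiable_on ({0..1} \<times> UNIV)" if "\<phi> \<in> \<Phi>" for \<phi> using \<Phi> that by blast
      show "density_of \<gamma> k0 (glue cl cr x) = dens \<gamma> k0 (enthalpy \<gamma> c (0, x)) \<and> fst (glue vl vr x) = v1_of v (0, x) \<and> snd (glue vl vr x) = v2_of v (0, x)"
        if "fst x \<noteq> 0" for x
        using ini[OF that] by (simp add: density_of_dens[OF \<gamma>(1)] enthalpy_def v1_of_def v2_of_def)
      show "\<bar>v1_of v' p\<bar> \<le> M \<and> \<bar>v2_of v' p\<bar> \<le> M \<and> \<bar>v1_of v p\<bar> \<le> M \<and> \<bar>v2_of v p\<bar> \<le> M \<and> enthalpy \<gamma> c p \<le> M \<and> \<rho>' p \<le> M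
        \<and> enth \<gamma> k0 (\<rho>' p) \<le> M" if "p \<in> slab_cell" for p
      proof -
        have p: "p \<in> slab" using that slab_cell_subset by blast
        have "\<bar>c p\<bar> \<le> \<bar>Mc\<bar>" using Mc[OF p] by simp
        then have "(c p)\<^sup>2 \<le> Mc\<^sup>2" by (simp add: abs_le_square_iff)
        then have h: "enthalpy \<gamma> c p \<le> Mc\<^sup>2 / (\<gamma> - 1)" using \<gamma> by (simp add: enthalpy_def divide_right_mono)
        have e: "enth \<gamma> k0 (\<rho>' p) \<le> enth \<gamma> k0 \<bar>Mr\<bar>"
          unfolding enth_def using \<gamma> rpos[OF p] Mr[OF p] by (intro divide_right_mono mult_left_mono powr_mono2) auto
        have nn: "0 \<le> Mc\<^sup>2 / (\<gamma> - 1)" "0 \<le> enth \<gamma> k0 \<bar>Mr\<bar>" using \<gamma> by (auto intro: enth_nonneg)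
        show ?thesis
          using abs_vel_le[of "v p"] abs_vel_le[of "v' p"] Mv[OF p] Mu[OF p] Mr[OF p] h e nn
          unfolding M_def v1_of_def v2_of_def by linarith
      qed
    qed
    moreover have "AE p in cell_measure. p \<in> slab_cell" by (intro AE_I2) simp
    ultimately have "AE p in cell_measure. v' p = v p \<and> sound_speed \<gamma> k0 (\<rho>' p) = c p"
    proof eventually_elim
      fix p assume *: "v1_of v' p = v1_of v p \<and> v2_of v' p = v2_of v p \<and> enth \<gamma> k0 (\<rho>' p) = enthalpy \<gamma> c p" and p: "p \<in> slab_cell"
      have "sound_speed \<gamma> k0 (\<rho>' p) = sqrt ((\<gamma> - 1) * enth \<gamma> k0 (\<rho>' p))"
        using \<gamma> by (simp add: sound_speed_def dpressure_def enth_def)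
      also have "\<dots> = sqrt ((c p)\<^sup>2)" using * \<gamma> by (simp add: enthalpy_def)
      also have "\<dots> = c p" using pos[OF subsetD[OF slab_cell_subset p]] by simp
      finally show "v' p = v p \<and> sound_speed \<gamma> k0 (\<rho>' p) = c p"
        using * by (simp add: v1_of_def v2_of_def prod_eq_iff)
    qed
    then show ?thesis
      by (rule AE_slab_from_cell)
         (simp only: periodic_shift[OF perv(1)] periodic_shift[OF perv(2)] periodic_shift[OF per'(1)] periodic_shift[OF per'(2)])
  qed
  show ?thesis
  proof (rule exI[of _ 1], intro allI impI)
    fix N0 N A assume N: "1 \<le> (N::nat)"
    show "\<exists>\<epsilon>0>0. \<forall>\<epsilon>. 0 < \<epsilon> \<and> \<epsilon> < \<epsilon>0 \<longrightarrow>
      (\<forall>vl cl vr cr v c \<rho>' v'.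
         riemann_data N0 \<epsilon> vl0 cl0 vr0 cr0 vl cl vr cr \<longrightarrow>
         two_rarefaction_solution \<gamma> k0 N A \<epsilon> vl cl vr cr v c \<longrightarrow>
         entropy_solution \<gamma> k0 (\<lambda>x. density_of \<gamma> k0 (glue cl cr x)) (glue vl vr) \<rho>' v' \<longrightarrow>
         (AE p in lebesgue_on slab. v' p = v p \<and> sound_speed \<gamma> k0 (\<rho>' p) = c p))"
      by (rule exI[of _ 1], rule conjI, rule zero_less_one, intro allI impI, rule main[OF N])
  qed
qed

end
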